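(* Let $G$ and $H$ be countable sofic groups each of which either (1) contains a w-normal amenable subgroup which is neither locally finite nor virtually cyclic, or (2) is a product of two countably infinite sofic groups at least one of which is not locally finite. Let $G\curvearrowright (X,\mu)$ and $H\curvearrowright (Y,\nu)$ be free p.m.p. actions which are uniquely ergodic and entropy regular, and suppose that they are boundedly orbit equivalent. Then $$h_\nu(H\curvearrowright Y)=h_\mu(G\curvearrowright X),$$ where $h_\nu,h_\mu$ denote maximum sofic measure entropy.
   Context: All groups are countable and discrete. A group is locally finite if each of its finitely generated subgroups is finite, and virtually cyclic if it has a cyclic subgroup of finite index. w-normality. A subgroup $G_0$ of $G$ is w-normal in $G$ if there are a countable ordinal $\gamma$ and subgroups $G_\lambda$ of $G$ for ordinals $0\le\lambda\le\gamma$ (the subgroup at $\lambda=0$ being $G_0$) such that $G_\lambda\subseteq G_{\lambda'}$ for $\lambda<\lambda'\le\gamma$; $G=G_\gamma$; $G_\lambda$ is normal in $G_{\lambda+1}$ for each $\lambda<\gamma$; and $G_{\lambda'}=\bigcup_{\lambda<\lambda'}G_\lambda$ for each limit ordinal $\lambda'\le\gamma$. P.m.p. actions. A p.m.p. action $G\curvearrowright (X,\mu)$ is an action by measure-preserving transformations on a standard probability space (a standard Borel space with a probability measure). It is free if the set of $x\in X$ with $sx\neq x$ for all $s\in G\setminus\{e_G\}$ has measure one. It is uniquely ergodic if there is a unique state (mean, i.e. unital positive linear functional) on $L^\infty(X,\mu)$ invariant under the $G$-action $(gf)(x)=f(g^{-1}x)$. Partitions are Borel. Bounded orbit equivalence.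 Two free p.m.p. actions $G\curvearrowright (X,\mu)$ and $H\curvearrowright (Y,\nu)$ are orbit equivalent if there are a $G$-invariant conull set $X_0\subseteq X$, an $H$-invariant conull set $Y_0\subseteq Y$, and a measure isomorphism $\Psi:X_0\to Y_0$ with $\Psi(Gx)=H\Psi(x)$ for all $x\in X_0$. Associated to $\Psi$ are cocycles $\kappa:G\times X_0\to H$ and $\lambda:H\times Y_0\to G$, determined up to null sets by $\Psi(gx)=\kappa(g,x)\Psi(x)$ and $\Psi^{-1}(ty)=\lambda(t,y)\Psi^{-1}(y)$. The actions are boundedly orbit equivalent if $X_0,Y_0,\Psi$ can be chosen so that $\kappa(g,X_0)$ is finite for every $g\in G$ and $\lambda(t,Y_0)$ is finite for every $t\in H$. Sofic approximations. For a nonempty finite set $V$, $\mathrm{Sym}(V)$ is its permutation group, $\mathbb{P}_V$ is the algebra of all subsets of $V$, $\mathrm{m}$ is the uniform probability measure on $V$, and $\rho_{\mathrm{Hamm}}(T,S)=|\{v\in V:Tv\ne Sv\}|/|V|$ for $T,S\in V^V$. A sofic approximation for $G$ is a (not necessarily multiplicative) map $\sigma:G\to\mathrm{Sym}(V)$ for some nonempty finite set $V$. It is an $(F,\delta)$-approximation ($F\subseteq G$ finite, $\delta>0$) if $\rho_{\mathrm{Hamm}}(\sigma_{st},\sigma_s\sigma_t)\le\delta$ for all $s,t\in F$ and $\rho_{\mathrm{Hamm}}(\sigma_s,\sigma_t)\ge 1-\delta$ for all distinct $s,t\in F$. A sofic approximation sequence for $G$ is a sequence $\Sigma=\{\sigma_k:G\to\mathrm{Sym}(V_k)\}_{k=1}^\infty$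 such that for every finite $F\subseteq G$ and $\delta>0$, $\sigma_k$ is an $(F,\delta)$-approximation for all sufficiently large $k$. $G$ is sofic if it admits a sofic approximation sequence. Sofic measure entropy. Let $G\curvearrowright (X,\mu)$ be a p.m.p. action, $\mathscr{C}$ a finite partition of $X$, $F\subseteq G$ finite with $e_G\in F$, $\delta>0$, and $\sigma:G\to\mathrm{Sym}(V)$ a sofic approximation. Let $\mathrm{alg}(\cdot)$ denote the (finite) algebra of sets generated by a partition and $\mathscr{C}_F=\bigvee_{s\in F}s\mathscr{C}$. Let $\mathrm{Hom}_\mu(\mathscr{C},F,\delta,\sigma)$ be the set of all (Boolean algebra) homomorphisms $\varphi:\mathrm{alg}(\mathscr{C}_F)\to\mathbb{P}_V$ with $\sum_{A\in\mathscr{C}}\mathrm{m}(\sigma_g\varphi(A)\,\Delta\,\varphi(gA))<\delta$ for all $g\in F$ and $\sum_{A\in\mathscr{C}_F}|\mathrm{m}(\varphi(A))-\mu(A)|<\delta$. For a partition $\mathscr{P}\le\mathscr{C}$ (i.e. $\mathscr{C}$ refines $\mathscr{P}$), $|\mathrm{Hom}_\mu(\mathscr{C},F,\delta,\sigma)|_{\mathscr{P}}$ is the number of distinct restrictions of its elements to $\mathscr{P}$. Then $$h_{\Sigma,\mu}(G\curvearrowright X)=\sup_{\mathscr{P}}\inf_{\mathscr{C}\ge\mathscr{P}}\inf_F\inf_{\delta>0}\limsup_{k\to\infty}\frac{1}{|V_k|}\log|\mathrm{Hom}_\mu(\mathscr{C},F,\delta,\sigma_k)|_{\mathscr{P}},$$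 with $\mathscr{P},\mathscr{C}$ ranging over finite partitions, $F$ over finite subsets of $G$ containing $e_G$, and $\log 0=-\infty$. The maximum and infimum sofic measure entropies are $h_\mu(G\curvearrowright X)=\max_\Sigma h_{\Sigma,\mu}(G\curvearrowright X)$ (the maximum exists) and $\underline{h}_\mu(G\curvearrowright X)=\inf_\Sigma h_{\Sigma,\mu}(G\curvearrowright X)$, over all sofic approximation sequences $\Sigma$ for $G$. The action is entropy regular if its maximum and infimum sofic measure entropies are equal. *)

theory Defs
  imports
    "HOL-Algebra.Group_Action"
    "HOL-Algebra.Generated_Groups"
    "HOL-Combinatorics.Permutations"
    "HOL-Library.Nonpos_Ints"
    "HOL-Probability.Probability"
begin

section \<open>Group theory\<close>

definition locally_finite_group :: "('g, 'c) monoid_scheme \<Rightarrow> bool" where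
  "locally_finite_group G \<longleftrightarrow>
     (\<forall>S. S \<subseteq> carrier G \<and> finite S \<longrightarrow> finite (generate G S))"

definition virtually_cyclic :: "('g, 'c) monoid_scheme \<Rightarrow> bool" where
  "virtually_cyclic G \<longleftrightarrow>
     (\<exists>a\<in>carrier G. finite (rcosets\<^bsub>G\<^esub> (generate G {a})))"

text \<open>
  An interval \<open>[0, \<gamma>]\<close> with \<open>\<gamma>\<close> a countable ordinal is, up to isomorphism, the same thing as a
  well-order on a set of natural numbers that has a least and a greatest element.
  \<open>imm_succ r i j\<close> says that \<open>j\<close> is the ordinal successor of \<open>i\<close>; an element other than the
  least one that is not a successor is a limit.
\<close>

definition imm_succ :: "'i rel \<Rightarrow> 'i \<Rightarrow> 'i \<Rightarrow> bool" where
  "imm_succ r i j \<longleftrightarrow> i \<in> Field r \<and> underS r j = under r i"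

definition w_normal :: "'g set \<Rightarrow> ('g, 'c) monoid_scheme \<Rightarrow> bool" where
  "w_normal N G \<longleftrightarrow>
     (\<exists>(r :: nat rel) (S :: nat \<Rightarrow> 'g set) z c.
        Well_order r \<and> z \<in> Field r \<and> c \<in> Field r \<and>
        (\<forall>i\<in>Field r. (z, i) \<in> r \<and> (i, c) \<in> r) \<and>
        (\<forall>i\<in>Field r. subgroup (S i) G) \<and>
        S z = N \<and> S c = carrier G \<and>
        (\<forall>i j. (i, j) \<in> r \<longrightarrow> S i \<subseteq> S j) \<and>
        (\<forall>i j. imm_succ r i j \<longrightarrow> S i \<lhd> G\<lparr>carrier := S j\<rparr>) \<and>
        (\<forall>j\<in>Field r. j \<noteq> z \<and> (\<nexists>i. imm_succ r i j) \<longrightarrow> S j = (\<Union>i\<in>underS r j. S i)))"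


section \<open>Means on bounded functions\<close>

text \<open>
  Elements of \<open>L\<^sup>\<infinity>\<close> are represented by functions rather than by classes of functions, so a
  functional on \<open>L\<^sup>\<infinity>\<close> is a functional on \<open>Linfty M\<close> that respects equality almost everywhere.
\<close>

definition Linfty :: "'x measure \<Rightarrow> ('x \<Rightarrow> complex) set" where
  "Linfty M = {f \<in> borel_measurable M. \<exists>B. AE x in M. norm (f x) \<le> B}"

definition mean_on :: "'x measure \<Rightarrow> (('x \<Rightarrow> complex) \<Rightarrow> complex) \<Rightarrow> bool" where
  "mean_on M m \<longleftrightarrow>
     (\<forall>f\<in>Linfty M. \<forall>g\<in>Linfty M. (AE x in M. f x = g x) \<longrightarrow> m f = m g) \<and>
     (\<forall>f\<in>Linfty M. \<forall>g\<in>Linfty M. m (\<lambda>x. f x + g x) = m f + m g) \<and>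
     (\<forall>a. \<forall>f\<in>Linfty M. m (\<lambda>x. a * f x) = a * m f) \<and>
     (\<forall>f\<in>Linfty M. (AE x in M. f x \<in> \<real>\<^sub>\<ge>\<^sub>0) \<longrightarrow> m f \<in> \<real>\<^sub>\<ge>\<^sub>0) \<and>
     m (\<lambda>_. 1) = 1"

definition invariant_mean_on ::
    "('g, 'c) monoid_scheme \<Rightarrow> 'x measure \<Rightarrow> ('g \<Rightarrow> 'x \<Rightarrow> 'x)
      \<Rightarrow> (('x \<Rightarrow> complex) \<Rightarrow> complex) \<Rightarrow> bool" where
  "invariant_mean_on G M \<alpha> m \<longleftrightarrow>
     mean_on M m \<and>
     (\<forall>g\<in>carrier G. \<forall>f\<in>Linfty M. m (\<lambda>x. f (\<alpha> (inv\<^bsub>G\<^esub> g) x)) = m f)"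

text \<open>A left invariant mean on \<open>\<ell>\<^sup>\<infinity>(G)\<close>.\<close>

definition amenable :: "('g, 'c) monoid_scheme \<Rightarrow> bool" where
  "amenable G \<longleftrightarrow>
     (\<exists>m. invariant_mean_on G (count_space (carrier G)) (\<lambda>g h. g \<otimes>\<^bsub>G\<^esub> h) m)"


section \<open>Probability measure preserving actions\<close>

definition standard_borel :: "'x measure \<Rightarrow> bool" where
  "standard_borel M \<longleftrightarrow>
     (\<exists>T. topspace T = space M \<and> completely_metrizable_space T \<and> second_countable T \<and>
          sets M = sigma_sets (space M) {U. openin T U})"

definition pmp_action :: "('g, 'c) monoid_scheme \<Rightarrow> 'x measure \<Rightarrow> ('g \<Rightarrow> 'x \<Rightarrow> 'x) \<Rightarrow> bool" where
  "pmp_action G M \<alpha> \<longleftrightarrow>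
     standard_borel M \<and> prob_space M \<and> group_action G (space M) \<alpha> \<and>
     (\<forall>g\<in>carrier G. \<alpha> g \<in> M \<rightarrow>\<^sub>M M \<and> distr M M (\<alpha> g) = M)"

definition free_action :: "('g, 'c) monoid_scheme \<Rightarrow> 'x measure \<Rightarrow> ('g \<Rightarrow> 'x \<Rightarrow> 'x) \<Rightarrow> bool" where
  "free_action G M \<alpha> \<longleftrightarrow> (AE x in M. \<forall>s\<in>carrier G - {\<one>\<^bsub>G\<^esub>}. \<alpha> s x \<noteq> x)"

text \<open>Extensionality makes a functional on \<open>Linfty M\<close> a unique HOL function.\<close>

definition uniquely_ergodic ::
    "('g, 'c) monoid_scheme \<Rightarrow> 'x measure \<Rightarrow> ('g \<Rightarrow> 'x \<Rightarrow> 'x) \<Rightarrow> bool" where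
  "uniquely_ergodic G M \<alpha> \<longleftrightarrow>
     (\<exists>!m. m \<in> extensional (Linfty M) \<and> invariant_mean_on G M \<alpha> m)"

definition invariant_conull ::
    "('g, 'c) monoid_scheme \<Rightarrow> 'x measure \<Rightarrow> ('g \<Rightarrow> 'x \<Rightarrow> 'x) \<Rightarrow> 'x set \<Rightarrow> bool" where
  "invariant_conull G M \<alpha> X0 \<longleftrightarrow>
     X0 \<in> sets M \<and> (AE x in M. x \<in> X0) \<and> (\<forall>g\<in>carrier G. \<alpha> g ` X0 = X0)"

definition measure_isomorphism :: "'x measure \<Rightarrow> 'y measure \<Rightarrow> ('x \<Rightarrow> 'y) \<Rightarrow> bool" where
  "measure_isomorphism M N \<Psi> \<longleftrightarrow>
     bij_betw \<Psi> (space M) (space N) \<and> \<Psi> \<in> M \<rightarrow>\<^sub>M N \<and>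
     inv_into (space M) \<Psi> \<in> N \<rightarrow>\<^sub>M M \<and> distr M N \<Psi> = N"

definition orbit_equivalence ::
    "('g, 'c) monoid_scheme \<Rightarrow> 'x measure \<Rightarrow> ('g \<Rightarrow> 'x \<Rightarrow> 'x) \<Rightarrow>
     ('h, 'd) monoid_scheme \<Rightarrow> 'y measure \<Rightarrow> ('h \<Rightarrow> 'y \<Rightarrow> 'y) \<Rightarrow>
     'x set \<Rightarrow> 'y set \<Rightarrow> ('x \<Rightarrow> 'y) \<Rightarrow> bool" where
  "orbit_equivalence G M \<alpha> H N \<beta> X0 Y0 \<Psi> \<longleftrightarrow>
     invariant_conull G M \<alpha> X0 \<and> invariant_conull H N \<beta> Y0 \<and>
     measure_isomorphism (restrict_space M X0) (restrict_space N Y0) \<Psi> \<and>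
     (\<forall>x\<in>X0. \<Psi> ` orbit G \<alpha> x = orbit H \<beta> (\<Psi> x))"

definition cocycle_of ::
    "('g, 'c) monoid_scheme \<Rightarrow> ('g \<Rightarrow> 'x \<Rightarrow> 'x) \<Rightarrow> ('h, 'd) monoid_scheme \<Rightarrow> ('h \<Rightarrow> 'y \<Rightarrow> 'y) \<Rightarrow>
     'x set \<Rightarrow> ('x \<Rightarrow> 'y) \<Rightarrow> ('g \<Rightarrow> 'x \<Rightarrow> 'h) \<Rightarrow> bool" where
  "cocycle_of G \<alpha> H \<beta> X0 \<Psi> \<kappa> \<longleftrightarrow>
     (\<forall>g\<in>carrier G. \<forall>x\<in>X0. \<kappa> g x \<in> carrier H \<and> \<Psi> (\<alpha> g x) = \<beta> (\<kappa> g x) (\<Psi> x))"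

definition boundedly_orbit_equivalent ::
    "('g, 'c) monoid_scheme \<Rightarrow> 'x measure \<Rightarrow> ('g \<Rightarrow> 'x \<Rightarrow> 'x) \<Rightarrow>
     ('h, 'd) monoid_scheme \<Rightarrow> 'y measure \<Rightarrow> ('h \<Rightarrow> 'y \<Rightarrow> 'y) \<Rightarrow> bool" where
  "boundedly_orbit_equivalent G M \<alpha> H N \<beta> \<longleftrightarrow>
     (\<exists>X0 Y0 \<Psi> \<kappa> \<kappa>'.
        orbit_equivalence G M \<alpha> H N \<beta> X0 Y0 \<Psi> \<and>
        cocycle_of G \<alpha> H \<beta> X0 \<Psi> \<kappa> \<and>
        cocycle_of H \<beta> G \<alpha> Y0 (inv_into X0 \<Psi>) \<kappa>' \<and>
        (\<forall>g\<in>carrier G. finite (\<kappa> g ` X0)) \<and>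
        (\<forall>t\<in>carrier H. finite (\<kappa>' t ` Y0)))"


section \<open>Sofic approximations\<close>

definition hamming_dist :: "'v set \<Rightarrow> ('v \<Rightarrow> 'v) \<Rightarrow> ('v \<Rightarrow> 'v) \<Rightarrow> real" where
  "hamming_dist V T S = real (card {v \<in> V. T v \<noteq> S v}) / real (card V)"

definition sofic_approx ::
    "('g, 'c) monoid_scheme \<Rightarrow> 'v set \<Rightarrow> ('g \<Rightarrow> 'v \<Rightarrow> 'v) \<Rightarrow> bool" where
  "sofic_approx G V \<sigma> \<longleftrightarrow> finite V \<and> V \<noteq> {} \<and> (\<forall>g\<in>carrier G. \<sigma> g permutes V)"

definition good_approx ::
    "('g, 'c) monoid_scheme \<Rightarrow> 'g set \<Rightarrow> real \<Rightarrow> 'v set \<Rightarrow> ('g \<Rightarrow> 'v \<Rightarrow> 'v) \<Rightarrow> bool" where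
  "good_approx G F \<delta> V \<sigma> \<longleftrightarrow>
     (\<forall>s\<in>F. \<forall>t\<in>F. hamming_dist V (\<sigma> (s \<otimes>\<^bsub>G\<^esub> t)) (\<sigma> s \<circ> \<sigma> t) \<le> \<delta>) \<and>
     (\<forall>s\<in>F. \<forall>t\<in>F. s \<noteq> t \<longrightarrow> hamming_dist V (\<sigma> s) (\<sigma> t) \<ge> 1 - \<delta>)"

text \<open>
  The finite sets \<open>V k\<close> are taken among the finite sets of natural numbers, so that sequences
  can be quantified over; up to relabelling these are all nonempty finite sets.
\<close>

definition sofic_approx_seq ::
    "('g, 'c) monoid_scheme \<Rightarrow> (nat \<Rightarrow> nat set) \<Rightarrow> (nat \<Rightarrow> 'g \<Rightarrow> nat \<Rightarrow> nat) \<Rightarrow> bool" where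
  "sofic_approx_seq G V \<sigma> \<longleftrightarrow>
     (\<forall>k. sofic_approx G (V k) (\<sigma> k)) \<and>
     (\<forall>F \<delta>. finite F \<and> F \<subseteq> carrier G \<and> \<delta> > 0 \<longrightarrow>
        (\<forall>\<^sub>F k in sequentially. good_approx G F \<delta> (V k) (\<sigma> k)))"

definition sofic :: "('g, 'c) monoid_scheme \<Rightarrow> bool" where
  "sofic G \<longleftrightarrow> (\<exists>V \<sigma>. sofic_approx_seq G V \<sigma>)"


section \<open>Sofic measure entropy\<close>

definition finite_partition :: "'x measure \<Rightarrow> 'x set set \<Rightarrow> bool" where
  "finite_partition M P \<longleftrightarrow> finite P \<and> partition_on (space M) P \<and> P \<subseteq> sets M"

definition alg :: "'x measure \<Rightarrow> 'x set set \<Rightarrow> 'x set set" where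
  "alg M P = algebra (space M) hull P"

definition translated_join :: "('g \<Rightarrow> 'x \<Rightarrow> 'x) \<Rightarrow> 'g set \<Rightarrow> 'x set set \<Rightarrow> 'x set set" where
  "translated_join \<alpha> F C = common_refinement ((\<lambda>s. (`) (\<alpha> s) ` C) ` F)"

definition boolean_hom ::
    "'x set \<Rightarrow> 'x set set \<Rightarrow> 'v set \<Rightarrow> ('x set \<Rightarrow> 'v set) \<Rightarrow> bool" where
  "boolean_hom \<Omega> \<A> V \<phi> \<longleftrightarrow>
     \<phi> \<in> \<A> \<rightarrow>\<^sub>E Pow V \<and> \<phi> {} = {} \<and> \<phi> \<Omega> = V \<and>
     (\<forall>A\<in>\<A>. \<phi> (\<Omega> - A) = V - \<phi> A) \<and>
     (\<forall>A\<in>\<A>. \<forall>B\<in>\<A>. \<phi> (A \<union> B) = \<phi> A \<union> \<phi> B \<and> \<phi> (A \<inter> B) = \<phi> A \<inter> \<phi> B)"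

definition Hom_mu ::
    "'x measure \<Rightarrow> ('g \<Rightarrow> 'x \<Rightarrow> 'x) \<Rightarrow> 'x set set \<Rightarrow> 'g set \<Rightarrow> real \<Rightarrow>
     'v set \<Rightarrow> ('g \<Rightarrow> 'v \<Rightarrow> 'v) \<Rightarrow> ('x set \<Rightarrow> 'v set) set" where
  "Hom_mu M \<alpha> C F \<delta> V \<sigma> =
     {\<phi>. boolean_hom (space M) (alg M (translated_join \<alpha> F C)) V \<phi> \<and>
         (\<forall>g\<in>F. (\<Sum>A\<in>C. measure (uniform_count_measure V)
                          (sym_diff (\<sigma> g ` \<phi> A) (\<phi> (\<alpha> g ` A)))) < \<delta>) \<and>
         (\<Sum>A\<in>translated_join \<alpha> F C.
            \<bar>measure (uniform_count_measure V) (\<phi> A) - measure M A\<bar>) < \<delta>}"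

definition num_restrictions :: "('x set \<Rightarrow> 'v set) set \<Rightarrow> 'x set set \<Rightarrow> nat" where
  "num_restrictions \<Phi> P = card ((\<lambda>\<phi>. restrict \<phi> P) ` \<Phi>)"

definition log_count :: "nat \<Rightarrow> ereal" where
  "log_count n = (if n = 0 then -\<infinity> else ereal (ln (real n)))"

definition sofic_entropy ::
    "('g, 'c) monoid_scheme \<Rightarrow> 'x measure \<Rightarrow> ('g \<Rightarrow> 'x \<Rightarrow> 'x) \<Rightarrow>
     (nat \<Rightarrow> nat set) \<Rightarrow> (nat \<Rightarrow> 'g \<Rightarrow> nat \<Rightarrow> nat) \<Rightarrow> ereal" where
  "sofic_entropy G M \<alpha> V \<sigma> =
     (SUP P\<in>{P. finite_partition M P}.
      INF C\<in>{C. finite_partition M C \<and> refines (space M) C P}.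
      INF F\<in>{F. finite F \<and> F \<subseteq> carrier G \<and> \<one>\<^bsub>G\<^esub> \<in> F}.
      INF \<delta>\<in>{0<..}.
        limsup (\<lambda>k. log_count (num_restrictions (Hom_mu M \<alpha> C F \<delta> (V k) (\<sigma> k)) P)
                      / ereal (real (card (V k)))))"

text \<open>The supremum over all sofic approximation sequences is attained.\<close>

definition max_sofic_entropy ::
    "('g, 'c) monoid_scheme \<Rightarrow> 'x measure \<Rightarrow> ('g \<Rightarrow> 'x \<Rightarrow> 'x) \<Rightarrow> ereal" where
  "max_sofic_entropy G M \<alpha> =
     (SUP (V, \<sigma>)\<in>{(V, \<sigma>). sofic_approx_seq G V \<sigma>}. sofic_entropy G M \<alpha> V \<sigma>)"

definition inf_sofic_entropy ::
    "('g, 'c) monoid_scheme \<Rightarrow> 'x measure \<Rightarrow> ('g \<Rightarrow> 'x \<Rightarrow> 'x) \<Rightarrow> ereal" where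
  "inf_sofic_entropy G M \<alpha> =
     (INF (V, \<sigma>)\<in>{(V, \<sigma>). sofic_approx_seq G V \<sigma>}. sofic_entropy G M \<alpha> V \<sigma>)"

definition entropy_regular ::
    "('g, 'c) monoid_scheme \<Rightarrow> 'x measure \<Rightarrow> ('g \<Rightarrow> 'x \<Rightarrow> 'x) \<Rightarrow> bool" where
  "entropy_regular G M \<alpha> \<longleftrightarrow> max_sofic_entropy G M \<alpha> = inf_sofic_entropy G M \<alpha>"


section \<open>The two classes of groups\<close>

definition has_w_normal_amenable_subgroup :: "('g, 'c) monoid_scheme \<Rightarrow> bool" where
  "has_w_normal_amenable_subgroup G \<longleftrightarrow>
     (\<exists>N. subgroup N G \<and> w_normal N G \<and> amenable (G\<lparr>carrier := N\<rparr>) \<and>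
          \<not> locally_finite_group (G\<lparr>carrier := N\<rparr>) \<and> \<not> virtually_cyclic (G\<lparr>carrier := N\<rparr>))"

text \<open>The factors are countably infinite, so up to isomorphism their carriers are sets of
  natural numbers.\<close>

definition product_of_infinite_sofic_groups :: "('g, 'c) monoid_scheme \<Rightarrow> bool" where
  "product_of_infinite_sofic_groups G \<longleftrightarrow>
     (\<exists>(A :: nat monoid) (B :: nat monoid).
        group A \<and> group B \<and> infinite (carrier A) \<and> infinite (carrier B) \<and>
        sofic A \<and> sofic B \<and> (\<not> locally_finite_group A \<or> \<not> locally_finite_group B) \<and>
        G \<cong> A \<times>\<times> B)"

end

theory Submission
 imports Defs
begin

text \<open>The orbit equivalence identifies the two actions with actions of \<open>G\<close> and \<open>H\<close> on one space which have the same
 orbits, and by symmetry it suffices to bound the entropy of \<open>G\<close> from above by that of \<open>H\<close>. A group in either class has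
 a sofic approximation sequence with a sparse set \<open>D\<close> of edges which connects the points of a set \<open>W\<close> whose translates by
 a fixed finite set cover almost everything. There are few ways to prescribe the values of the cocycle along \<open>D\<close>, so by
 the pigeonhole principle most of the entropy of \<open>G\<close> is carried by microstates with common values there, and these agree
 on all cocycle values between points of \<open>W\<close>. One of them turns the sofic approximation of \<open>G\<close> into
 one of \<open>H\<close>, and the others are transported to microstates for \<open>H\<close> on it, with little loss in their number. A diagonal
 argument over a generating sequence of sets gives one sofic approximation sequence of \<open>H\<close>. Entropy regularity of
 the action of \<open>G\<close> allows the special sequence for \<open>G\<close> to compute its maximal entropy.\<close>

section \<open>Amenability\<close>

text \<open>The partition that carries the entropy on the side of H must be fixed before the finer
  labels and the finite subsets of H against which it is tested. Besides a partition for G it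
  records the cocycle values on a finite set \<open>S\<close>, which are needed to undo the
  transport; so \<open>S\<close> comes first. The set \<open>T\<close> on which two microstates must
  agree depends on \<open>S\<close> and on the test set in H, so it comes later. This order of
  choices shapes the notion of sparse connectivity. Boundedness of the orbit equivalence makes the
  cost of an edge, the logarithm of the number of possible cocycle values, finite, and the tolerated
  loss of entropy is built into the cost function. The total cost may then be any multiple above 1
  of the number of points, so nothing accumulates along a transfinite chain of subgroups. Sparse
  connecting sets have three origins: with superlinear growth a net of balls joined by short paths,
  with linear growth the cosets of a cyclic subgroup of large finite index, and in a product one
  factor as a corridor for the other.\<close>

abbreviation rcard :: "'a set => real" where "rcard A \<equiv> real (card A)"

abbreviation "bdry G S X \<equiv> {x \<in> X. \<exists>s\<in>S. s \<otimes>\<^bsub>G\<^esub> x \<notin> X}"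

abbreviation "core G S X \<equiv> {x \<in> X. \<forall>s\<in>S. s \<otimes>\<^bsub>G\<^esub> x \<in> X}"

abbreviation "hits K sm U v \<equiv> {k \<in> K. sm k v \<in> U}"

abbreviation "cover S sm W \<equiv> (\<Union>s\<in>S. sm s ` W)"

text \<open>Pairs are deleted as long as Hall's condition survives. A maximal set of deletions
  exists by Zorn: for a finite \<open>J\<close> only finitely many pairs matter, and those deleted
  in the union of a chain are deleted in one of its members. After a maximal deletion every set is a
  singleton, and this is the selection.\<close>

lemma Hall_selection:
 fixes A :: "'i => 'a set"
 assumes fin: "\<And>i. i \<in> I ==> finite (A i)"
  and hall: "\<And>J. J \<subseteq> I ==> finite J ==> card J \<le> card (\<Union>j\<in>J. A j)"
 shows "\<exists>f. inj_on f I \<and> (\<forall>i\<in>I. f i \<in> A i)"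
proof -
 define B where "B = (\<lambda>U i. {x \<in> A i. (i, x) \<notin> U})"
 define \<U> where "\<U> = {U. U \<subseteq> Sigma I A \<and> (\<forall>J\<subseteq>I. finite J --> card J \<le> card (\<Union>j\<in>J. B U j))}"
 have finB: "finite (\<Union>j\<in>J. B U j)" if "J \<subseteq> I" "finite J" for J U
  using that fin unfolding B_def by auto
 have "{} \<in> \<U>"
  unfolding \<U>_def B_def using hall by auto
 have "\<exists>U\<in>\<U>. \<forall>X\<in>\<C>. X \<subseteq> U" if C: "\<C> \<in> chains \<U>" for \<C>
 proof (cases "\<C> = {}")
  case True
  then show ?thesis using \<open>{} \<in> \<U>\<close> by blast
 next
  case False
  have "\<Union>\<C> \<in> \<U>"
  proof -
   have sub: "\<Union>\<C> \<subseteq> Sigma I A"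
    using C unfolding chains_def \<U>_def by blast
   have "card J \<le> card (\<Union>j\<in>J. B (\<Union>\<C>) j)" if J: "J \<subseteq> I" "finite J" for J
   proof -
    have fs: "finite (\<Union>\<C> \<inter> Sigma J A)"
     using J fin by (intro finite_Int disjI2 finite_SigmaI) auto
    have "\<exists>X\<in>\<C>. \<Union>\<C> \<inter> Sigma J A \<subseteq> X"
     using finite_subset_Union_chain[OF fs, of \<C>] False C
     unfolding chains_def by (metis (no_types, lifting) CollectD inf_le1 subset_chain_def chain_subset_def chains_extend order_refl)
    then obtain X where X: "X \<in> \<C>" "\<Union>\<C> \<inter> Sigma J A \<subseteq> X" by blast
    have "B X j = B (\<Union>\<C>) j" if "j \<in> J" for j
     using X that unfolding B_def by blast
    then have "(\<Union>j\<in>J. B X j) = (\<Union>j\<in>J. B (\<Union>\<C>) j)" by auto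
    moreover have "X \<in> \<U>" using C X(1) unfolding chains_def by blast
    ultimately show ?thesis using J unfolding \<U>_def by auto
   qed
   then show ?thesis using sub unfolding \<U>_def by blast
  qed
  then show ?thesis by blast
 qed
 then have "\<exists>U\<in>\<U>. \<forall>X\<in>\<U>. U \<subseteq> X --> X = U"
  by (intro Zorn_Lemma2 ballI)
 then obtain U where U: "U \<in> \<U>" and mx: "\<And>X. X \<in> \<U> ==> U \<subseteq> X ==> X = U"
  by auto
 have H: "card J \<le> card (\<Union>j\<in>J. B U j)" if "J \<subseteq> I" "finite J" for J
  using U that unfolding \<U>_def by blast
 have drop: "\<exists>J\<subseteq>I. finite J \<and> i \<notin> J \<and> card ((\<Union>j\<in>J. B U j) \<union> (B U i - {x})) \<le> card J"
  if i: "i \<in> I" and x: "x \<in> B U i" for i x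
 proof -
  define U' where "U' = insert (i, x) U"
  have "U' \<notin> \<U>" using mx[of U'] x unfolding U'_def B_def by blast
  moreover have "U' \<subseteq> Sigma I A" using U i x unfolding U'_def \<U>_def B_def by blast
  ultimately obtain J where J: "J \<subseteq> I" "finite J" "card (\<Union>j\<in>J. B U' j) < card J"
   unfolding \<U>_def by (auto simp: not_le)
  have iJ: "i \<in> J"
  proof (rule ccontr)
   assume "i \<notin> J"
   then have "(\<Union>j\<in>J. B U' j) = (\<Union>j\<in>J. B U j)" unfolding U'_def B_def by auto
   then show False using J H[of J] by auto
  qed
  have e: "(\<Union>j\<in>J. B U' j) = (\<Union>j\<in>J-{i}. B U j) \<union> (B U i - {x})"
   using iJ unfolding U'_def B_def by auto
  have "card (J - {i}) = card J - 1" using iJ J(2) by simp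
  then have "card ((\<Union>j\<in>J-{i}. B U j) \<union> (B U i - {x})) \<le> card (J - {i})"
   using J(3) e by simp
  then show ?thesis using J by (intro exI[of _ "J - {i}"]) auto
 qed
 \<comment> \<open>If x and y were both left at i, deleting either of them would break Hall's
   condition, with witnesses \<open>J\<close> and \<open>K\<close>. Hall's condition for the union
   (with i added) and for the intersection of the witnesses then makes the sizes of
   \<open>?P\<close> and \<open>?Q\<close> add up to at least one more than the witnesses
   allow.\<close>
 have single: "\<exists>x. B U i = {x}" if i: "i \<in> I" for i
 proof -
  have fi: "finite (B U i)" using fin[OF i] unfolding B_def by auto
  have "1 \<le> card (B U i)" using H[of "{i}"] i by simp
  then obtain x where x: "x \<in> B U i" using fi by (metis card_eq_0_iff equals0I not_one_le_zero)
  have "y = x" if y: "y \<in> B U i" for y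
  proof (rule ccontr)
   assume ne: "y \<noteq> x"
   obtain J where J: "J \<subseteq> I" "finite J" "i \<notin> J" "card ((\<Union>j\<in>J. B U j) \<union> (B U i - {x})) \<le> card J"
    using drop[OF i x] by blast
   obtain K where K: "K \<subseteq> I" "finite K" "i \<notin> K" "card ((\<Union>j\<in>K. B U j) \<union> (B U i - {y})) \<le> card K"
    using drop[OF i y] by blast
   let ?P = "(\<Union>j\<in>J. B U j) \<union> (B U i - {x})" and ?Q = "(\<Union>j\<in>K. B U j) \<union> (B U i - {y})"
   have fP: "finite ?P" "finite ?Q" using finB J K fi by auto
   have 1: "card (insert i (J \<union> K)) \<le> card (?P \<union> ?Q)"
   proof -
    have "(\<Union>j\<in>insert i (J \<union> K). B U j) \<subseteq> ?P \<union> ?Q" using ne by auto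
    moreover have "card (insert i (J \<union> K)) \<le> card (\<Union>j\<in>insert i (J \<union> K). B U j)"
     using H[of "insert i (J \<union> K)"] i J K by auto
    ultimately show ?thesis using fP by (meson card_mono finite_UnI order_trans)
   qed
   have 2: "card (J \<inter> K) \<le> card (?P \<inter> ?Q)"
   proof -
    have "(\<Union>j\<in>J \<inter> K. B U j) \<subseteq> ?P \<inter> ?Q" by auto
    moreover have "card (J \<inter> K) \<le> card (\<Union>j\<in>J \<inter> K. B U j)"
     using H[of "J \<inter> K"] J by auto
    ultimately show ?thesis using fP by (meson card_mono finite_Int order_trans)
   qed
   have "card (insert i (J \<union> K)) = card (J \<union> K) + 1" using J K by simp
   then show False
    using 1 2 J K card_Un_Int[OF fP] card_Un_Int[OF J(2) K(2)] by linarith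
  qed
  then show ?thesis using x by blast
 qed
 define f where "f = (\<lambda>i. THE x. B U i = {x})"
 have f: "B U i = {f i}" if "i \<in> I" for i
  unfolding f_def using single[OF that] by (metis (mono_tags, lifting) singleton_inject the_equality)
 have "inj_on f I"
 proof (rule inj_onI)
  fix i j assume ij: "i \<in> I" "j \<in> I" "f i = f j"
  then have "card {i, j} \<le> card (\<Union>k\<in>{i,j}. B U k)" by (intro H) auto
  also have "\<dots> \<le> 1" using f ij by simp
  finally show "i = j" by (cases "i = j") auto
 qed
 moreover have "f i \<in> A i" if "i \<in> I" for i
  using f[OF that] unfolding B_def by blast
 ultimately show ?thesis by blast
qed

section \<open>Calculus with means on bounded functions\<close>

lemma mean_on_add:
 assumes "mean_on M m" and "f \<in> Linfty M" and "g \<in> Linfty M"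
 shows "m (\<lambda>x. f x + g x) = m f + m g"
proof -
 have *: "\<forall>f\<in>Linfty M. \<forall>g\<in>Linfty M. m (\<lambda>x. f x + g x) = m f + m g"
  using assms(1) unfolding mean_on_def by (elim conjE)
 show ?thesis
  by (rule *[rule_format, OF assms(2,3)])
qed

lemma mean_on_cmult:
 assumes "mean_on M m" and "f \<in> Linfty M"
 shows "m (\<lambda>x. a * f x) = a * m f"
proof -
 have *: "\<forall>a. \<forall>f\<in>Linfty M. m (\<lambda>x. a * f x) = a * m f"
  using assms(1) unfolding mean_on_def by (elim conjE)
 show ?thesis
  by (rule *[rule_format, OF assms(2)])
qed

lemma mean_on_cong:
 assumes "mean_on M m" and "f \<in> Linfty M" and "g \<in> Linfty M" and "AE x in M. f x = g x"
 shows "m f = m g"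
proof -
 have *: "\<forall>f\<in>Linfty M. \<forall>g\<in>Linfty M. (AE x in M. f x = g x) --> m f = m g"
  using assms(1) unfolding mean_on_def by (elim conjE)
 show ?thesis
  by (rule *[rule_format, OF assms(2-4)])
qed

lemma mean_on_nonneg:
 assumes "mean_on M m" and "f \<in> Linfty M" and "AE x in M. f x \<in> \<real>\<^sub>\<ge>\<^sub>0"
 shows "m f \<in> \<real>\<^sub>\<ge>\<^sub>0"
proof -
 have *: "\<forall>f\<in>Linfty M. (AE x in M. f x \<in> \<real>\<^sub>\<ge>\<^sub>0) --> m f \<in> \<real>\<^sub>\<ge>\<^sub>0"
  using assms(1) unfolding mean_on_def by (elim conjE)
 show ?thesis
  by (rule *[rule_format, OF assms(2,3)])
qed

lemma mean_on_one: "mean_on M m ==> m (\<lambda>_. 1) = 1"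
 unfolding mean_on_def by (elim conjE)

lemma Linfty_count_space_bounded:
 assumes "\<And>x. x \<in> X ==> norm (f x) \<le> B"
 shows "f \<in> Linfty (count_space X)"
 unfolding Linfty_def using assms by (auto simp: AE_count_space)

lemma mean_on_count_space_sum:
 assumes m: "mean_on (count_space X) m" and "finite I"
  and bd: "\<And>i x. i \<in> I ==> x \<in> X ==> norm (f i x) \<le> 1"
 shows "m (\<lambda>x. \<Sum>i\<in>I. f i x) = (\<Sum>i\<in>I. m (f i))"
 using assms(2) bd
proof (induction I rule: finite_induct)
 case empty
 have "m (\<lambda>x. 0 * 1) = 0 * m (\<lambda>x. 1)"
  by (rule mean_on_cmult[OF m], rule Linfty_count_space_bounded[of _ _ 1]) simp
 then show ?case by simp
next
 case (insert i J)
 have "(\<lambda>x. \<Sum>i\<in>J. f i x) \<in> Linfty (count_space X)"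
  by (rule Linfty_count_space_bounded[of _ _ "\<Sum>i\<in>J. 1"], rule order_trans[OF norm_sum], rule sum_mono)
   (use insert in auto)
 moreover have "f i \<in> Linfty (count_space X)"
  by (rule Linfty_count_space_bounded[of _ _ 1]) (use insert in auto)
 ultimately have "m (\<lambda>x. f i x + (\<Sum>i\<in>J. f i x)) = m (f i) + m (\<lambda>x. \<Sum>i\<in>J. f i x)"
  by (intro mean_on_add[OF m])
 then show ?case using insert by simp
qed

text \<open>If every finite set grew by a definite factor under \<open>E\<close>, Hall's theorem would give a paradoxical
 decomposition of the group, on which an invariant mean takes the values \<open>2\<close> and at most \<open>1\<close>.\<close>

lemma (in group) amenable_not_doubling:
 assumes "amenable G" and E: "finite E" "E \<subseteq> carrier G"
 shows "\<exists>F. finite F \<and> F \<subseteq> carrier G \<and> card (\<Union>g\<in>F. (\<lambda>e. e \<otimes> g) ` E) < 2 * card F"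
proof (rule ccontr)
 assume neg: "\<not> ?thesis"
 have dbl: "2 * card F \<le> card (\<Union>g\<in>F. (\<lambda>e. e \<otimes> g) ` E)" if F: "finite F" "F \<subseteq> carrier G" for F
 proof (rule ccontr)
  assume "\<not> ?thesis"
  then have "card (\<Union>g\<in>F. (\<lambda>e. e \<otimes> g) ` E) < 2 * card F" by (rule not_le_imp_less)
  with F neg show False by (metis (no_types, lifting))
 qed
 \<comment> \<open>The boolean doubles every g, so Hall's condition for this family is the assumed
   growth by the factor 2.\<close>
 define A where "A = (\<lambda>(g, b::bool). (\<lambda>e. e \<otimes> g) ` E)"
 have "\<exists>f. inj_on f (carrier G \<times> UNIV) \<and> (\<forall>i\<in>carrier G \<times> UNIV. f i \<in> A i)"
 proof (rule Hall_selection)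
  show "finite (A i)" for i using E unfolding A_def by (auto split: prod.split)
  fix J assume J: "J \<subseteq> carrier G \<times> (UNIV::bool set)" "finite J"
  have "J \<subseteq> fst ` J \<times> UNIV" by force
  then have "card J \<le> card (fst ` J \<times> (UNIV::bool set))" using J by (intro card_mono) auto
  also have "\<dots> = 2 * card (fst ` J)" by (simp add: card_cartesian_product)
  also have "\<dots> \<le> card (\<Union>g\<in>fst ` J. (\<lambda>e. e \<otimes> g) ` E)" using J by (intro dbl) auto
  also have "(\<Union>g\<in>fst ` J. (\<lambda>e. e \<otimes> g) ` E) = (\<Union>j\<in>J. A j)" unfolding A_def by force
  finally show "card J \<le> card (\<Union>j\<in>J. A j)" .
 qed
 then obtain f where inj: "inj_on f (carrier G \<times> UNIV)"
  and f': "\<forall>i\<in>carrier G \<times> UNIV. f i \<in> A i"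
  by (elim exE conjE)
 have f: "f (g, b) \<in> (\<lambda>e. e \<otimes> g) ` E" if "g \<in> carrier G" for g b
  using bspec[OF f', of "(g, b)"] that by (simp add: A_def)
 obtain m where m: "invariant_mean_on G (count_space (carrier G)) (\<lambda>g h. g \<otimes> h) m"
  using assms(1) unfolding amenable_def by (elim exE)
 then have mean: "mean_on (count_space (carrier G)) m" unfolding invariant_mean_on_def by (elim conjE)
 define u where "u = (\<lambda>(e, b) x. if f (x, b) = e \<otimes> x then 1 else (0::complex))"
 define I where "I = E \<times> (UNIV::bool set)"
 have fI: "finite I" using E unfolding I_def by simp
 have bd: "norm (u i x) \<le> 1" for i x unfolding u_def by (auto split: prod.split)
 have Lf: "u i \<in> Linfty (count_space (carrier G))" for i
  using Linfty_count_space_bounded[of "carrier G" "u i" 1] bd by blast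
 have "m (\<lambda>x. \<Sum>i\<in>I. u i x) = m (\<lambda>x. 2 * 1)"
 proof (rule mean_on_cong[OF mean])
  show "(\<lambda>x. \<Sum>i\<in>I. u i x) \<in> Linfty (count_space (carrier G))"
   by (rule Linfty_count_space_bounded[of _ _ "\<Sum>i\<in>I. 1"], rule order_trans[OF norm_sum], rule sum_mono)
    (use bd in auto)
  show "(\<lambda>x. 2 * 1) \<in> Linfty (count_space (carrier G))"
   by (rule Linfty_count_space_bounded[of _ _ 2]) auto
  have "(\<Sum>i\<in>I. u i x) = 2" if x: "x \<in> carrier G" for x
  proof -
   have 1: "(\<Sum>e\<in>E. u (e, b) x) = 1" for b
   proof -
    obtain e0 where e0: "e0 \<in> E" "f (x, b) = e0 \<otimes> x" using f[OF x, of b] by blast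
    have "(\<Sum>e\<in>E. u (e, b) x) = (\<Sum>e\<in>E. if e = e0 then 1 else 0)"
     using e0 E x unfolding u_def by (intro sum.cong) (auto simp: subset_iff)
    then show ?thesis using e0 E by simp
   qed
   have "(\<Sum>i\<in>I. u i x) = (\<Sum>e\<in>E. \<Sum>b\<in>UNIV. u (e, b) x)"
    unfolding I_def by (simp add: sum.cartesian_product)
   also have "\<dots> = (\<Sum>b\<in>UNIV. \<Sum>e\<in>E. u (e, b) x)" by (rule sum.swap)
   finally show ?thesis using 1 by (simp add: UNIV_bool)
  qed
  then show "AE x in count_space (carrier G). (\<Sum>i\<in>I. u i x) = 2 * 1"
   by (simp add: AE_count_space)
 qed
 also have "\<dots> = 2"
  using mean_on_cmult[OF mean, of "\<lambda>_. 1" 2] mean_on_one[OF mean]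
   Linfty_count_space_bounded[of "carrier G" "\<lambda>_. 1" 1] by simp
 finally have two: "(\<Sum>i\<in>I. m (u i)) = 2"
  using mean_on_count_space_sum[OF mean fI, of u] bd by simp
 \<comment> \<open>Summed over \<open>I\<close>, the functions \<open>v i\<close> count at x the
   pairs that \<open>f\<close> sends to x, which is at most 1 by injectivity; the \<open>u i\<close>
   add up to 2 at every point because \<open>f\<close> is defined on both copies.\<close>
 define v where "v = (\<lambda>i x. u i (inv (fst i) \<otimes> x))"
 have mv: "m (v i) = m (u i)" if "i \<in> I" for i
 proof -
  have "fst i \<in> carrier G" using that E unfolding I_def by auto
  then show ?thesis
   using m Lf[of i] unfolding invariant_mean_on_def v_def by (elim conjE) (drule (1) bspec, drule (1) bspec)
 qed
 have bdv: "norm (v i x) \<le> 1" for i x unfolding v_def by (rule bd)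
 have le1: "(\<Sum>i\<in>I. v i x) = 0 \<or> (\<Sum>i\<in>I. v i x) = 1" if x: "x \<in> carrier G" for x
 proof -
  have v1: "v i x \<noteq> 0 \<longleftrightarrow> f (inv (fst i) \<otimes> x, snd i) = x" if i: "i \<in> I" for i
  proof -
   have "fst i \<in> carrier G" using i E unfolding I_def by auto
   then show ?thesis using x unfolding v_def u_def by (auto split: prod.split simp: m_assoc[symmetric])
  qed
  have uniq: "i = j" if "i \<in> I" "j \<in> I" "v i x \<noteq> 0" "v j x \<noteq> 0" for i j
  proof -
   have c: "fst i \<in> carrier G" "fst j \<in> carrier G" using that E unfolding I_def by auto
   have "f (inv (fst i) \<otimes> x, snd i) = f (inv (fst j) \<otimes> x, snd j)" using v1 that by metis
   then have "(inv (fst i) \<otimes> x, snd i) = (inv (fst j) \<otimes> x, snd j)"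
    using inj_onD[OF inj] c x by blast
   then show ?thesis using c x by (metis inv_closed inv_inv prod.collapse prod.inject right_cancel)
  qed
  have vv: "v i x = 0 \<or> v i x = 1" for i unfolding v_def u_def by (auto split: prod.split)
  show ?thesis
  proof (cases "\<exists>j\<in>I. v j x \<noteq> 0")
   case True
   then obtain j where j: "j \<in> I" "v j x \<noteq> 0" by blast
   have "(\<Sum>i\<in>I. v i x) = (\<Sum>i\<in>I. if i = j then 1 else 0)"
   proof (intro sum.cong refl)
    fix i assume "i \<in> I"
    then show "v i x = (if i = j then 1 else 0)" using uniq[of i j] j vv[of i]
     by (metis (full_types))
   qed
   then show ?thesis using fI j by simp
  qed simp
 qed
 have Lv: "(\<lambda>x. \<Sum>i\<in>I. v i x) \<in> Linfty (count_space (carrier G))"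
  by (rule Linfty_count_space_bounded[of _ _ 1]) (use le1 in force)
 have L1: "(\<lambda>x. 1) \<in> Linfty (count_space (carrier G))"
  by (rule Linfty_count_space_bounded[of _ _ 1]) auto
 have Lm: "(\<lambda>x. (-1) * (\<Sum>i\<in>I. v i x)) \<in> Linfty (count_space (carrier G))"
  by (rule Linfty_count_space_bounded[of _ _ 1]) (use le1 in force)
 have Ld: "(\<lambda>x. 1 + (-1) * (\<Sum>i\<in>I. v i x)) \<in> Linfty (count_space (carrier G))"
  by (rule Linfty_count_space_bounded[of _ _ 1]) (use le1 in force)
 have "m (\<lambda>x. 1 + (-1) * (\<Sum>i\<in>I. v i x)) \<in> \<real>\<^sub>\<ge>\<^sub>0"
  by (rule mean_on_nonneg[OF mean Ld]) (use le1 in \<open>force simp: AE_count_space\<close>)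
 also have "m (\<lambda>x. 1 + (-1) * (\<Sum>i\<in>I. v i x)) = 1 + (-1) * m (\<lambda>x. \<Sum>i\<in>I. v i x)"
  using mean_on_add[OF mean L1 Lm] mean_on_cmult[OF mean Lv, of "-1"] mean_on_one[OF mean] by metis
 also have "m (\<lambda>x. \<Sum>i\<in>I. v i x) = (\<Sum>i\<in>I. m (v i))"
  using mean_on_count_space_sum[OF mean fI, of v] bdv by blast
 also have "\<dots> = 2" using mv two by simp
 finally show False by (simp add: complex_nonneg_Reals_iff)
qed

text \<open>Without such a set, multiplication by \<open>T\<close> and the identity enlarges every
  finite set by the factor 1 + \<open>ep\<close>; sufficiently many repetitions exceed the factor 2
  and contradict \<open>amenable_not_doubling\<close>.\<close>

lemma (in group) amenable_Foelner:
 assumes "amenable G" and T: "finite T" "T \<subseteq> carrier G" and "(ep::real) > 0"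
 shows "\<exists>F. finite F \<and> F \<noteq> {} \<and> F \<subseteq> carrier G \<and>
      (\<forall>t\<in>T. rcard {f \<in> F. t \<otimes> f \<notin> F} \<le> ep * card F)"
proof (rule ccontr)
 assume neg: "\<not> ?thesis"
 define T1 where "T1 = insert \<one> T"
 define X where "X = (\<lambda>Y. \<Union>g\<in>Y. (\<lambda>e. e \<otimes> g) ` T1)"
 have T1: "finite T1" "T1 \<subseteq> carrier G" using T unfolding T1_def by auto
 have Xc: "finite (X Y)" "X Y \<subseteq> carrier G" if "finite Y" "Y \<subseteq> carrier G" for Y
  using that T1 unfolding X_def by (auto simp: subset_iff)
 have grow: "(1 + ep) * card F \<le> card (X F)" if F: "finite F" "F \<subseteq> carrier G" for F
 proof (cases "F = {}")
  case False
  then obtain t where t: "t \<in> T" "rcard {f \<in> F. t \<otimes> f \<notin> F} > ep * card F"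
   using neg F by (meson not_le)
  have "card {f \<in> F. t \<otimes> f \<notin> F} = card ((\<lambda>f. t \<otimes> f) ` {f \<in> F. t \<otimes> f \<notin> F})"
   using t T F by (intro card_image[symmetric] inj_onI) (auto simp: subset_iff)
  also have "card F + \<dots> = card (F \<union> (\<lambda>f. t \<otimes> f) ` {f \<in> F. t \<otimes> f \<notin> F})"
   using F by (intro card_Un_disjoint[symmetric]) auto
  also have "\<dots> \<le> card (X F)"
  proof (intro card_mono Xc F)
   have "f \<in> X F" if "f \<in> F" for f
    using that F unfolding X_def T1_def by (auto intro!: bexI[of _ f] image_eqI[of _ _ \<one>] simp: subset_iff)
   then show "F \<union> (\<lambda>f. t \<otimes> f) ` {f \<in> F. t \<otimes> f \<notin> F} \<subseteq> X F"
    using t unfolding X_def T1_def by auto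
  qed
  finally have "card F + card {f \<in> F. t \<otimes> f \<notin> F} \<le> card (X F)" by simp
  then show ?thesis using t by (simp add: algebra_simps)
 qed simp
 have iter: "finite ((X ^^ n) F) \<and> (X ^^ n) F \<subseteq> carrier G \<and> (1 + ep) ^ n * card F \<le> card ((X ^^ n) F)"
  if F: "finite F" "F \<subseteq> carrier G" for F n
 proof (induction n)
  case (Suc n)
  have "(1 + ep) ^ Suc n * card F \<le> (1 + ep) * card ((X ^^ n) F)"
   using Suc \<open>ep > 0\<close> by (simp add: mult.assoc)
  also have "\<dots> \<le> card ((X ^^ Suc n) F)" using grow Suc by simp
  finally show ?case using Xc Suc by simp
 qed (use F in simp)
 obtain n where n: "2 < (1 + ep) ^ n" using real_arch_pow[of "1 + ep" 2] \<open>ep > 0\<close> by auto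
 define E where "E = (X ^^ n) {\<one>}"
 have E: "finite E" "E \<subseteq> carrier G" using iter[of "{\<one>}" n] unfolding E_def by auto
 \<comment> \<open>Left multiplication commutes with right translation, so the iterated enlargement
   of every \<open>F\<close> is the product of one fixed finite set with \<open>F\<close>.\<close>
 have XE: "(X ^^ k) F = (\<Union>g\<in>F. (\<lambda>e. e \<otimes> g) ` (X ^^ k) {\<one>})" if F: "F \<subseteq> carrier G" "finite F" for F k
 proof (induction k)
  case 0
  then show ?case using F by (auto simp: subset_iff)
 next
  case (Suc k)
  have c: "(X ^^ k) {\<one>} \<subseteq> carrier G" using iter[of "{\<one>}" k] by auto
  have "(X ^^ Suc k) F = (\<Union>g\<in>F. \<Union>h\<in>(X ^^ k) {\<one>}. (\<lambda>e. e \<otimes> (h \<otimes> g)) ` T1)"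
   using Suc unfolding X_def by auto
  also have "\<dots> = (\<Union>g\<in>F. \<Union>h\<in>(X ^^ k) {\<one>}. (\<lambda>e. (e \<otimes> h) \<otimes> g) ` T1)"
   using c F T1 by (intro SUP_cong image_cong refl) (auto simp: m_assoc subset_iff)
  also have "\<dots> = (\<Union>g\<in>F. (\<lambda>e. e \<otimes> g) ` (X ^^ Suc k) {\<one>})"
   unfolding X_def by (auto simp: image_iff)
  finally show ?case .
 qed
 obtain F where F: "finite F" "F \<subseteq> carrier G" "card (\<Union>g\<in>F. (\<lambda>e. e \<otimes> g) ` E) < 2 * card F"
  using amenable_not_doubling[OF assms(1) E] by blast
 have "(1 + ep) ^ n * card F \<le> card ((X ^^ n) F)" using iter[OF F(1,2)] by blast
 also have "\<dots> < 2 * card F" using F XE[OF F(2,1)] unfolding E_def by simp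
 also have "\<dots> \<le> (1 + ep) ^ n * card F" using n by (simp add: mult_right_mono)
 finally show False by simp
qed

section \<open>Growth\<close>

text \<open>For a symmetric \<open>F\<close> containing the identity this is the ball of radius n
  about the identity, in the Cayley graph whose edges multiply from the left.\<close>

primrec spow :: "('a, 'b) monoid_scheme => 'a set => nat => 'a set" where
 "spow G F 0 = {\<one>\<^bsub>G\<^esub>}"
| "spow G F (Suc n) = (\<Union>f\<in>F. (\<lambda>x. f \<otimes>\<^bsub>G\<^esub> x) ` spow G F n)"

context group
begin

lemma spow_closed: "F \<subseteq> carrier G ==> spow G F n \<subseteq> carrier G"
 by (induction n) auto

lemma spow_finite: "finite F ==> finite (spow G F n)"
 by (induction n) auto

lemma spow_add_mem:
 "F \<subseteq> carrier G ==> x \<in> spow G F m ==> y \<in> spow G F n ==> x \<otimes> y \<in> spow G F (m + n)"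
proof (induction m arbitrary: x)
 case 0
 then show ?case using spow_closed[of F n] by auto
next
 case (Suc m)
 then obtain f z where z: "f \<in> F" "z \<in> spow G F m" "x = f \<otimes> z" by auto
 then have "x \<otimes> y = f \<otimes> (z \<otimes> y)"
  using Suc.prems spow_closed[of F] by (auto simp: m_assoc subset_iff)
 then show ?case using Suc z by auto
qed

lemma spow_add_split:
 "F \<subseteq> carrier G ==> x \<in> spow G F (m + n) ==> \<exists>y\<in>spow G F m. \<exists>z\<in>spow G F n. x = y \<otimes> z"
proof (induction m arbitrary: x)
 case 0
 then have "x = \<one> \<otimes> x" using spow_closed[of F n] by auto
 then show ?case using 0 by auto
next
 case (Suc m)
 then obtain f x' where x': "f \<in> F" "x' \<in> spow G F (m + n)" "x = f \<otimes> x'" by auto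
 then obtain y z where yz: "y \<in> spow G F m" "z \<in> spow G F n" "x' = y \<otimes> z" using Suc by blast
 have "x = (f \<otimes> y) \<otimes> z" using x' yz Suc.prems spow_closed[of F] by (auto simp: m_assoc subset_iff)
 moreover have "f \<otimes> y \<in> spow G F (Suc m)" using x' yz by auto
 ultimately show ?case using yz by blast
qed

lemma spow_1: "F \<subseteq> carrier G ==> spow G F 1 = F"
 by (auto simp: subset_iff image_iff)

lemma spow_mono:
 assumes "F \<subseteq> carrier G" "\<one> \<in> F" "m \<le> n"
 shows "spow G F m \<subseteq> spow G F n"
proof -
 have 1: "\<one> \<in> spow G F k" for k
  using assms by (induction k) (auto intro!: bexI[of _ \<one>] image_eqI[of _ _ \<one>])
 show ?thesis
 proof
  fix x assume x: "x \<in> spow G F m"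
  then have "x \<otimes> \<one> \<in> spow G F (m + (n - m))" by (intro spow_add_mem assms 1)
  then show "x \<in> spow G F n" using x assms spow_closed[OF assms(1), of m] by auto
 qed
qed

lemma spow_inv:
 assumes F: "F \<subseteq> carrier G" "\<And>f. f \<in> F ==> inv f \<in> F"
 shows "x \<in> spow G F n ==> inv x \<in> spow G F n"
proof (induction n arbitrary: x)
 case (Suc n)
 then obtain f y where y: "f \<in> F" "y \<in> spow G F n" "x = f \<otimes> y" by auto
 then have "inv x = inv y \<otimes> inv f"
  using F spow_closed[OF F(1), of n] by (auto simp: inv_mult_group subset_iff)
 moreover have "inv f \<in> spow G F 1" using F y spow_1[OF F(1)] by auto
 ultimately have "inv x \<in> spow G F (n + 1)" using Suc.IH[OF y(2)] spow_add_mem[OF F(1)] by metis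
 then show ?case by simp
qed simp

lemma generate_eq_UN_spow:
 assumes F: "F \<subseteq> carrier G" "\<one> \<in> F" "\<And>f. f \<in> F ==> inv f \<in> F"
 shows "generate G F = (\<Union>n. spow G F n)"
proof
 show "generate G F \<subseteq> (\<Union>n. spow G F n)"
 proof
  fix x assume "x \<in> generate G F"
  then show "x \<in> (\<Union>n. spow G F n)"
  proof induction
   case one
   show ?case by (rule UN_I[of 0]) auto
  next
   case (incl h)
   then have "h \<in> spow G F 1" using spow_1[OF F(1)] by simp
   then show ?case by blast
  next
   case (inv h)
   then have "inv h \<in> spow G F 1" using spow_1[OF F(1)] F(3) by simp
   then show ?case by blast
  next
   case (eng h1 h2)
   then show ?case using spow_add_mem[OF F(1)] by blast
  qed
 qed
 have "spow G F n \<subseteq> generate G F" for n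
  by (induction n) (auto intro: generate.intros)
 then show "(\<Union>n. spow G F n) \<subseteq> generate G F" by blast
qed

end

definition word_val :: "('a, 'b) monoid_scheme => (nat => 'a) => nat list => 'a" where
 "word_val G e ws = foldr (\<lambda>i x. e i \<otimes>\<^bsub>G\<^esub> x) ws \<one>\<^bsub>G\<^esub>"

text \<open>As \<open>lenlex\<close> compares lengths before letters and is a well-order, every
  value of a word over the letters below \<open>k\<close> has exactly one such normal form, even if
  \<open>e\<close> repeats elements.\<close>

definition reduced_word :: "('a, 'b) monoid_scheme => (nat => 'a) => nat => nat list => bool" where
 "reduced_word G e k ws \<longleftrightarrow> set ws \<subseteq> {0..<k} \<and>
   (\<forall>u. set u \<subseteq> {0..<k} \<and> word_val G e u = word_val G e ws --> (u, ws) \<notin> lenlex less_than)"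

lemma concat_replicate_periodic:
 assumes "take n z = take n (drop d z)" "l * d \<le> n" "length z \<ge> n + d"
 shows "concat (replicate l (take d z)) = take (l * d) z"
 using assms(2)
proof (induction l)
 case (Suc l)
 have le: "l * d \<le> n" using Suc.prems by simp
 have "take (l * d) (drop d z) = take (l * d) (take n (drop d z))" using le by (simp add: min_def)
 also have "\<dots> = take (l * d) z" using assms(1) le by (metis take_take min_absorb1)
 finally have *: "take (l * d) (drop d z) = take (l * d) z" .
 have "concat (replicate (Suc l) (take d z)) = take d z @ take (l * d) z"
  using Suc le by simp
 also have "\<dots> = take d z @ take (l * d) (drop d z)" using * by simp
 also have "\<dots> = take (Suc l * d) z" by (simp add: take_add)
 finally show ?case .
qed simp

context group
begin

lemma word_val_closed: "e ` {0..<k} \<subseteq> carrier G ==> set ws \<subseteq> {0..<k} ==> word_val G e ws \<in> carrier G"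
 by (induction ws) (auto simp: word_val_def image_subset_iff)

lemma word_val_append:
 "e ` {0..<k} \<subseteq> carrier G ==> set u \<subseteq> {0..<k} ==> set v \<subseteq> {0..<k} ==>
  word_val G e (u @ v) = word_val G e u \<otimes> word_val G e v"
proof (induction u)
 case Nil
 then show ?case using word_val_closed[of e k v] by (simp add: word_val_def)
next
 case (Cons i u)
 then have "word_val G e (i # (u @ v)) = e i \<otimes> (word_val G e u \<otimes> word_val G e v)"
  by (simp add: word_val_def)
 also have "\<dots> = (e i \<otimes> word_val G e u) \<otimes> word_val G e v"
  using Cons.prems word_val_closed[of e k] by (intro m_assoc[symmetric]) (auto simp: subset_iff)
 finally show ?case by (simp add: word_val_def)
qed

lemma word_val_replicate:
 assumes "e ` {0..<k} \<subseteq> carrier G" "set p \<subseteq> {0..<k}"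
 shows "word_val G e (concat (replicate l p)) = word_val G e p [^] l"
proof (induction l)
 case (Suc l)
 have "word_val G e (concat (replicate (Suc l) p)) = word_val G e p \<otimes> word_val G e p [^] l"
 proof -
  have "set (concat (replicate l p)) \<subseteq> {0..<k}" using assms(2) by (induction l) auto
  then show ?thesis using word_val_append[OF assms, of "concat (replicate l p)"] Suc by simp
 qed
 also have "\<dots> = word_val G e p [^] Suc l"
  using nat_pow_Suc2[OF word_val_closed[OF assms], of l] by simp
 finally show ?case .
qed (simp add: word_val_def)

lemma word_val_spow:
 assumes "e ` {0..<k} = F"
 shows "word_val G e ` {ws. set ws \<subseteq> {0..<k} \<and> length ws = n} = spow G F n"
proof (induction n)
 case 0
 then show ?case by (auto simp: word_val_def image_iff)
next
 case (Suc n)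
 show ?case
 proof (intro equalityI subsetI)
  fix x assume "x \<in> word_val G e ` {ws. set ws \<subseteq> {0..<k} \<and> length ws = Suc n}"
  then obtain i u where u: "set (i # u) \<subseteq> {0..<k}" "length u = n" "x = word_val G e (i # u)"
   by (auto simp: length_Suc_conv image_iff)
  then have "word_val G e u \<in> spow G F n" using Suc by auto
  then show "x \<in> spow G F (Suc n)" using u assms by (auto simp: word_val_def)
 next
  fix x assume "x \<in> spow G F (Suc n)"
  then obtain f y where y: "f \<in> F" "y \<in> spow G F n" "x = f \<otimes> y" by auto
  then obtain i u where "i < k" "f = e i" "set u \<subseteq> {0..<k}" "length u = n" "y = word_val G e u"
   using assms Suc[symmetric] by auto
  then show "x \<in> word_val G e ` {ws. set ws \<subseteq> {0..<k} \<and> length ws = Suc n}"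
   using y by (intro image_eqI[of _ _ "i # u"]) (auto simp: word_val_def)
 qed
qed

text \<open>The order \<open>lenlex\<close> is compatible with concatenation on both sides, so a
  smaller word with the value of \<open>v\<close> could be substituted inside the long word.\<close>

lemma reduced_word_subword:
 assumes e: "e ` {0..<k} \<subseteq> carrier G" and r: "reduced_word G e k (u @ v @ w)"
 shows "reduced_word G e k v"
 unfolding reduced_word_def
proof (intro conjI allI impI notI)
 have s: "set u \<subseteq> {0..<k}" "set v \<subseteq> {0..<k}" "set w \<subseteq> {0..<k}"
  using r unfolding reduced_word_def by auto
 show "set v \<subseteq> {0..<k}" by fact
 fix v' assume v': "set v' \<subseteq> {0..<k} \<and> word_val G e v' = word_val G e v" and l: "(v', v) \<in> lenlex less_than"
 have "(v' @ w, v @ w) \<in> lenlex less_than" using l by (rule lenlex_append1) simp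
 then have "(u @ v' @ w, u @ v @ w) \<in> lenlex less_than"
  by (subst lenlex_append2) (auto simp: irrefl_def)
 moreover have "word_val G e (u @ v' @ w) = word_val G e (u @ v @ w)"
  using s v' e by (simp add: word_val_append[of e k])
 moreover have "set (u @ v' @ w) \<subseteq> {0..<k}" using s v' by auto
 ultimately show False using r unfolding reduced_word_def by blast
qed

text \<open>Shortlex geodesic words are closed under subwords. When a sphere of radius \<open>n\<close> has at most \<open>c\<close>
 elements, two of the subwords of length \<open>n\<close> at the positions \<open>0, \<dots>, c\<close> of a long reduced word coincide,
 which makes the word periodic.\<close>

lemma infinite_order_if_linear_growth:
 assumes F: "finite F" "F \<subseteq> carrier G" "\<one> \<in> F" and inf: "infinite (\<Union>n. spow G F n)"
  and lin: "\<And>r. r \<ge> 1 ==> card (spow G F r) \<le> c * r"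
 shows "\<exists>a\<in>(\<Union>n. spow G F n). \<forall>n\<ge>1. a [^] (n::nat) \<noteq> \<one>"
proof -
 obtain e :: "nat => 'a" and k where ek: "e ` {0..<k} = F"
  using ex_bij_betw_nat_finite[OF F(1)] bij_betw_imp_surj_on by blast
 have eC: "e ` {0..<k} \<subseteq> carrier G" using ek F by simp
 define val where "val = word_val G e"
 define R where "R = (\<lambda>n. {ws. reduced_word G e k ws \<and> length ws = n})"
 have setR: "set ws \<subseteq> {0..<k}" if "reduced_word G e k ws" for ws
  using that unfolding reduced_word_def by blast
 have finL: "finite {ws. set ws \<subseteq> {0..<k} \<and> length ws = n}" for n
  by (rule finite_lists_length_eq) simp
 have finR: "finite (R n)" for n
  by (rule finite_subset[OF _ finL[of n]]) (use setR in \<open>auto simp: R_def\<close>)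
 have inj: "u = w" if "reduced_word G e k u" "reduced_word G e k w" "val u = val w" for u w
 proof (rule ccontr)
  assume "u \<noteq> w"
  then have "(u, w) \<in> lenlex less_than \<or> (w, u) \<in> lenlex less_than"
   using total_lenlex[OF total_less_than] by (auto simp: total_on_def)
  then show False using that unfolding reduced_word_def val_def by metis
 qed
 have ex: "\<exists>u. reduced_word G e k u \<and> val u = x" if x: "x \<in> spow G F n" for x n
 proof -
  obtain ws where "set ws \<subseteq> {0..<k}" "val ws = x"
   using x word_val_spow[OF ek, of n, symmetric] unfolding val_def by auto
  then have "ws \<in> {u. set u \<subseteq> {0..<k} \<and> val u = x}" by simp
  from wfE_min[OF wf_lenlex[OF wf_less_than] this] obtain u
   where u: "u \<in> {u. set u \<subseteq> {0..<k} \<and> val u = x}"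
   "\<And>y. (y, u) \<in> lenlex less_than ==> y \<notin> {u. set u \<subseteq> {0..<k} \<and> val u = x}"
   by blast
  then have "reduced_word G e k u" unfolding reduced_word_def val_def by auto
  then show ?thesis using u by blast
 qed
 have cnt: "(\<Sum>i\<le>n. card (R i)) \<le> c * n" if "n \<ge> 1" for n
 proof -
  have "(\<Sum>i\<le>n. card (R i)) = card (\<Union>i\<le>n. R i)"
   by (rule card_UN_disjoint[symmetric]) (use finR in \<open>auto simp: R_def\<close>)
  also have "\<dots> = card (val ` (\<Union>i\<le>n. R i))"
   by (rule card_image[symmetric], rule inj_onI) (use inj in \<open>auto simp: R_def\<close>)
  also have "\<dots> \<le> card (spow G F n)"
  proof (rule card_mono[OF spow_finite[OF F(1)]], rule image_subsetI)
   fix ws assume "ws \<in> (\<Union>i\<le>n. R i)"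
   then have w: "reduced_word G e k ws" "length ws \<le> n" unfolding R_def by auto
   then have "val ws \<in> spow G F (length ws)"
    using word_val_spow[OF ek, of "length ws"] setR unfolding val_def by blast
   then show "val ws \<in> spow G F n" using spow_mono[OF F(2,3) w(2)] by blast
  qed
  also have "\<dots> \<le> c * n" using lin that by blast
  finally show ?thesis .
 qed
 \<comment> \<open>The radius \<open>n1\<close> is so large that more than \<open>c\<close> reduced
   words of each length from \<open>n0\<close> to \<open>n1\<close> would exceed the total
   \<open>c * n1\<close> allowed by linear growth.\<close>
 have small: "\<exists>n\<ge>n0. card (R n) \<le> c" for n0
 proof (rule ccontr)
  assume "\<not> ?thesis"
  then have big: "card (R n) \<ge> c + 1" if "n \<ge> n0" for n using that by (metis Suc_eq_plus1 Suc_leI not_le)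
  define n1 where "n1 = (c + 1) * (n0 + 1)"
  have "n0 \<le> n1" unfolding n1_def by simp
  then obtain p where p: "n1 = n0 + p" using le_Suc_ex[of n0 n1] by auto
  have "(c + 1) * (p + 1) = (\<Sum>i\<in>{n0..n1}. c + 1)" using p by simp
  also have "\<dots> \<le> (\<Sum>i\<in>{n0..n1}. card (R i))" using big by (intro sum_mono) auto
  also have "\<dots> \<le> (\<Sum>i\<le>n1. card (R i))" by (rule sum_mono2) auto
  also have "\<dots> \<le> c * n1" using cnt[of n1] unfolding n1_def by simp
  finally have "c * p + p + c + 1 \<le> c * n0 + c * p" using p by (simp add: algebra_simps)
  moreover have "c * n0 + c + 1 = p" using p unfolding n1_def by (simp add: algebra_simps)
  ultimately show False by linarith
 qed
 \<comment> \<open>Infinitely many elements cannot all be reached by reduced words shorter than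
   \<open>m\<close>; a longer one is cut down to length \<open>m\<close>.\<close>
 have long: "\<exists>w. reduced_word G e k w \<and> length w = m" for m
 proof -
  have "finite (val ` (\<Union>i<m. R i))" using finR by auto
  then have "\<not> (\<Union>n. spow G F n) \<subseteq> val ` (\<Union>i<m. R i)" using inf finite_subset by blast
  then obtain x n where "x \<in> spow G F n" "x \<notin> val ` (\<Union>i<m. R i)" by blast
  then obtain u where u: "reduced_word G e k u" "val u = x" using ex by blast
  then have "length u \<ge> m" using \<open>x \<notin> _\<close> unfolding R_def by (auto simp: image_iff not_le)
  moreover have "reduced_word G e k (take m u)"
   using reduced_word_subword[OF eC, of "[]" "take m u" "drop m u"] u by simp
  ultimately show ?thesis by (metis length_take min_absorb2)
 qed
 define P where "P = {p. set p \<subseteq> {0..<k} \<and> length p \<le> c \<and> p \<noteq> []}"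
 have finP: "finite P"
  by (rule finite_subset[OF _ finite_lists_length_le[of "{0..<k}" c]]) (auto simp: P_def)
 have per: "\<exists>p\<in>P. \<forall>l. l * length p \<le> n0 --> reduced_word G e k (concat (replicate l p))" for n0
 proof -
  obtain n where n: "n \<ge> n0" "card (R n) \<le> c" using small by blast
  obtain w where w: "reduced_word G e k w" "length w = n + c" using long by blast
  have sub: "reduced_word G e k (take j (drop i w))" for i j
   using reduced_word_subword[OF eC, of "take i w" "take j (drop i w)" "drop j (drop i w)"] w(1)
   by (metis append_take_drop_id)
  have "(\<lambda>i. take n (drop i w)) ` {0..c} \<subseteq> R n"
   using sub w(2) unfolding R_def by auto
  then have "card ((\<lambda>i. take n (drop i w)) ` {0..c}) \<le> c"
   using card_mono[OF finR] n(2) order_trans by blast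
  then have "\<not> inj_on (\<lambda>i. take n (drop i w)) {0..c}" by (intro pigeonhole) simp
  then obtain i0 j0 where "i0 \<le> c" "j0 \<le> c" "i0 \<noteq> j0" "take n (drop i0 w) = take n (drop j0 w)"
   unfolding inj_on_def by auto
  then obtain i j where ij: "i < j" "j \<le> c" "take n (drop i w) = take n (drop j w)"
   by (cases "i0 < j0") (auto simp: not_less le_less)
  define z where "z = drop i w"
  define d where "d = j - i"
  have z: "take n z = take n (drop d z)" "length z \<ge> n + d"
   using ij w(2) unfolding z_def d_def by auto
  have lp: "length (take d z) = d" using z(2) by simp
  have "reduced_word G e k (concat (replicate l (take d z)))" if "l * length (take d z) \<le> n0" for l
   using concat_replicate_periodic[OF z(1) _ z(2), of l] that lp n(1) sub[of "l * d" i]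
   unfolding z_def by simp
  moreover have "take d z \<in> P"
  proof -
   have "set (take d z) \<subseteq> {0..<k}" using sub[of d i] setR unfolding z_def by blast
   moreover have "d \<noteq> 0" "d \<le> c" using ij unfolding d_def by auto
   ultimately show ?thesis using lp unfolding P_def by auto
  qed
  ultimately show ?thesis by blast
 qed
 \<comment> \<open>There are finitely many possible periods, so one of them serves for all numbers
   of repetitions: otherwise take \<open>n0\<close> beyond a failing number of repetitions of each
   period.\<close>
 have "\<exists>p\<in>P. \<forall>l. reduced_word G e k (concat (replicate l p))"
 proof (rule ccontr)
  assume "\<not> ?thesis"
  then have "\<forall>p\<in>P. \<exists>l. \<not> reduced_word G e k (concat (replicate l p))" by blast
  then obtain l where l: "\<forall>p\<in>P. \<not> reduced_word G e k (concat (replicate (l p) p))"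
   by (rule bchoice[THEN exE])
  define n0 where "n0 = (\<Sum>p\<in>P. l p * length p)"
  obtain p where p: "p \<in> P" "\<forall>l. l * length p \<le> n0 --> reduced_word G e k (concat (replicate l p))"
   using per by blast
  have "l p * length p \<le> n0" unfolding n0_def using p(1) finP by (intro member_le_sum) auto
  then show False using p l by blast
 qed
 then obtain p where p: "p \<in> P" "\<And>l. reduced_word G e k (concat (replicate l p))" by blast
 have ps: "set p \<subseteq> {0..<k}" "p \<noteq> []" using p(1) unfolding P_def by auto
 \<comment> \<open>If a power were trivial, the empty word would be a smaller word with the value of
   a nonempty reduced one.\<close>
 have "val p [^] n \<noteq> \<one>" if "n \<ge> 1" for n :: nat
 proof
  assume "val p [^] n = \<one>"
  then have "word_val G e [] = word_val G e (concat (replicate n p))"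
   using word_val_replicate[OF eC ps(1), of n] unfolding val_def by (simp add: word_val_def)
  moreover have "concat (replicate n p) \<noteq> []" using that ps by (cases n) auto
  ultimately show False
   using p(2)[of n] Nil_lenlex_iff1[of "concat (replicate n p)" less_than]
   unfolding reduced_word_def by (metis empty_set empty_subsetI)
 qed
 moreover have "val p \<in> (\<Union>n. spow G F n)"
  using word_val_spow[OF ek, of "length p"] ps unfolding val_def by blast
 ultimately show ?thesis by blast
qed

lemma nat_pow_inj_infinite_order:
 assumes a: "a \<in> carrier G" "\<And>n. n \<ge> 1 ==> a [^] (n::nat) \<noteq> \<one>" and eq: "a [^] i = a [^] (j::nat)"
 shows "i = j"
proof -
 have *: "i = j" if "i \<le> j" "a [^] i = a [^] j" for i j :: nat
 proof (rule ccontr)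
  assume "i \<noteq> j"
  have "a [^] i \<otimes> a [^] (j - i) = a [^] j"
   using that(1) nat_pow_mult[OF a(1), of i "j - i"] by simp
  then have "a [^] i \<otimes> a [^] (j - i) = a [^] i \<otimes> \<one>"
   using that(2) a(1) by simp
  then have "a [^] (j - i) = \<one>" using a(1) by simp
  then show False using a(2)[of "j - i"] \<open>i \<noteq> j\<close> that(1) by simp
 qed
 then show ?thesis using eq by (metis nat_le_linear)
qed

text \<open>If the balls kept meeting new cosets of \<open>A\<close>, the ball of radius r would
  meet at least r + 1 of them. Multiplying representatives by the powers of \<open>a\<close> with
  exponents 0 to r gives (r + 1)^2 elements in the ball of radius 2 r, too many for linear
  growth.\<close>

lemma finitely_many_cosets_if_linear_growth:
 assumes F: "finite F" "F \<subseteq> carrier G" "\<one> \<in> F"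
  and lin: "\<And>r. r \<ge> 1 ==> card (spow G F r) \<le> c * r"
  and a: "a \<in> F" "\<And>n. n \<ge> 1 ==> a [^] (n::nat) \<noteq> \<one>"
  and A: "subgroup A G" "a \<in> A"
 shows "finite ((\<lambda>x. A #> x) ` (\<Union>n. spow G F n))"
proof (rule ccontr)
 assume inf: "\<not> ?thesis"
 have Ac: "A \<subseteq> carrier G" using A by (simp add: subgroup.subset)
 have aC: "a \<in> carrier G" using a F by auto
 define Q where "Q = (\<lambda>r. (\<lambda>x. A #> x) ` spow G F r)"
 have finQ: "finite (Q r)" for r unfolding Q_def using spow_finite[OF F(1)] by blast
 have monoQ: "Q r \<subseteq> Q s" if "r \<le> s" for r s
  unfolding Q_def using spow_mono[OF F(2,3) that] by blast
 \<comment> \<open>A single radius without a new coset stops the process for ever, because each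
   coset in the next ball arises from one in the present ball by right multiplication with a
   generator.\<close>
 have strict: "Q r \<noteq> Q (Suc r)" for r
 proof
  assume eq: "Q r = Q (Suc r)"
  have ksub: "Q (r + k) \<subseteq> Q r" for k
  proof (induction k)
   case (Suc k)
   show ?case
   proof
    fix C assume "C \<in> Q (r + Suc k)"
    then obtain x where x: "x \<in> spow G F ((r + k) + 1)" "C = A #> x" unfolding Q_def by auto
    then obtain y f where yf: "y \<in> spow G F (r + k)" "f \<in> spow G F 1" "x = y \<otimes> f"
     using spow_add_split[OF F(2)] by blast
    have "A #> y \<in> Q r" using yf(1) Suc unfolding Q_def by blast
    then obtain z where z: "z \<in> spow G F r" "A #> y = A #> z" unfolding Q_def by blast
    have cl: "y \<in> carrier G" "f \<in> carrier G" "z \<in> carrier G"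
     using yf z spow_closed[OF F(2)] by blast+
    have "C = (A #> y) #> f" using x yf cl Ac coset_mult_assoc by metis
    also have "\<dots> = A #> (z \<otimes> f)" using z cl Ac coset_mult_assoc by metis
    also have "\<dots> \<in> Q (Suc r)"
     unfolding Q_def using spow_add_mem[OF F(2) z(1) yf(2)] by simp
    finally show "C \<in> Q r" using eq by simp
   qed
  qed simp
  have "Q n \<subseteq> Q r" for n
   using monoQ[of n r] ksub[of "n - r"] by (cases "n \<le> r") auto
  then have "(\<lambda>x. A #> x) ` (\<Union>n. spow G F n) \<subseteq> Q r"
   unfolding Q_def by (simp add: image_UN UN_subset_iff)
  then show False using inf finQ finite_subset by blast
 qed
 have cardQ: "card (Q r) \<ge> r + 1" for r
 proof (induction r)
  case 0
  then show ?case unfolding Q_def by simp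
 next
  case (Suc r)
  have "Q r \<subset> Q (Suc r)" using strict[of r] monoQ[of r "Suc r"] by auto
  then have "card (Q r) < card (Q (Suc r))" using finQ by (intro psubset_card_mono)
  then show ?case using Suc by simp
 qed
 \<comment> \<open>For this r the number (r + 1)^2 exceeds the bound 2 c r.\<close>
 define r where "r = 2 * c + 1"
 obtain X where X: "X \<subseteq> spow G F r" "inj_on (\<lambda>x. A #> x) X" "(\<lambda>x. A #> x) ` X = Q r"
  unfolding Q_def by (metis subset_image_inj subset_refl)
 have XC: "X \<subseteq> carrier G" using X spow_closed[OF F(2)] by blast
 have cX: "card X \<ge> r + 1" using cardQ[of r] X card_image by metis
 have apow: "a [^] (n::nat) \<in> spow G F n" for n
 proof (induction n)
  case (Suc n)
  have "a [^] Suc n = a \<otimes> a [^] n" by (rule nat_pow_Suc2[OF aC])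
  then show ?case using Suc a by auto
 qed simp
 have aA: "a [^] (n::nat) \<in> A" for n
  using A by (induction n) (auto simp: subgroup.one_closed subgroup.m_closed)
 have "(r + 1) * (r + 1) \<le> card ({0..r} \<times> X)"
  using mult_le_mono2[OF cX, of "r + 1"] by (simp add: card_cartesian_product)
 also have "\<dots> = card ((\<lambda>(i, x). a [^] i \<otimes> x) ` ({0..r} \<times> X))"
 proof (rule card_image[symmetric], rule inj_onI, clarify)
  fix i j x y assume h: "x \<in> X" "y \<in> X" "a [^] (i::nat) \<otimes> x = a [^] (j::nat) \<otimes> y"
  have xy: "x \<in> carrier G" "y \<in> carrier G" using h XC by auto
  have "A #> x = A #> (a [^] i \<otimes> x)"
   using coset_mult_assoc[OF Ac, of "a [^] i" x] coset_join2[OF _ A(1) aA[of i]] aC xy by simp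
  also have "\<dots> = A #> y"
   using h(3) coset_mult_assoc[OF Ac, of "a [^] j" y] coset_join2[OF _ A(1) aA[of j]] aC xy by simp
  finally have "x = y" using X(2) h unfolding inj_on_def by blast
  then show "i = j \<and> x = y" using h(3) xy aC nat_pow_inj_infinite_order[OF aC a(2)] by simp
 qed
 also have "\<dots> \<le> card (spow G F (r + r))"
 proof (rule card_mono[OF spow_finite[OF F(1)]], rule image_subsetI, clarify)
  fix i x assume "i \<in> {0..r}" "x \<in> X"
  then have "a [^] i \<in> spow G F r" "x \<in> spow G F r"
   using apow[of i] spow_mono[OF F(2,3), of i r] X by auto
  then show "a [^] i \<otimes> x \<in> spow G F (r + r)" using spow_add_mem[OF F(2)] by blast
 qed
 also have "\<dots> \<le> c * (r + r)" using lin[of "r + r"] unfolding r_def by simp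
 finally show False unfolding r_def by (simp add: algebra_simps)
qed

text \<open>Without superlinear growth every finitely generated subgroup grows at most linearly, so
  an element \<open>a\<close> of infinite order exists. The group is not virtually cyclic, so
  \<open>a\<close> generates a subgroup of infinite index; adjoining representatives of m of its
  cosets to \<open>a\<close> generates a subgroup in which the index is finite but at least
  m.\<close>

lemma growth_dichotomy:
 assumes nlf: "\<not> locally_finite_group G" and nvc: "\<not> virtually_cyclic G"
 obtains (superlinear) F where "finite F" "F \<subseteq> carrier G" "\<one> \<in> F" "\<And>f. f \<in> F ==> inv f \<in> F"
   "\<And>c. \<exists>r\<ge>1. card (spow G F r) > c * r"
 | (cyclic) a where "a \<in> carrier G" "\<And>n. n \<ge> 1 ==> a [^] (n::nat) \<noteq> \<one>"
   "\<And>m. \<exists>E C. finite E \<and> subgroup (E <#> generate G {a}) G \<and> E \<subseteq> carrier G \<and> finite C \<and>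
     C \<subseteq> E <#> generate G {a} \<and> card C = m \<and> inj_on (\<lambda>x. generate G {a} #> x) C"
proof (cases "\<exists>F. finite F \<and> F \<subseteq> carrier G \<and> \<one> \<in> F \<and> (\<forall>f\<in>F. inv f \<in> F) \<and>
  (\<forall>c. \<exists>r\<ge>1. card (spow G F r) > c * r)")
 case True
 then show ?thesis using superlinear by metis
next
 case False
 have lin: "\<exists>c. \<forall>r\<ge>1. card (spow G F r) \<le> c * r"
  if "finite F" "F \<subseteq> carrier G" "\<one> \<in> F" "\<And>f. f \<in> F ==> inv f \<in> F" for F
  using False that by (metis not_le)
 obtain S where S: "S \<subseteq> carrier G" "finite S" "infinite (generate G S)"
  using nlf unfolding locally_finite_group_def by blast
 define sy where "sy = (\<lambda>S. insert \<one> (S \<union> m_inv G ` S))"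
 have sy: "finite (sy T)" "sy T \<subseteq> carrier G" "\<one> \<in> sy T" "\<And>f. f \<in> sy T ==> inv f \<in> sy T"
  if "T \<subseteq> carrier G" "finite T" for T
  using that unfolding sy_def by auto
 have "generate G S \<subseteq> generate G (sy S)" by (rule mono_generate) (auto simp: sy_def)
 then have "infinite (\<Union>n. spow G (sy S) n)"
  using S sy[OF S(1,2)] generate_eq_UN_spow[of "sy S"] finite_subset by metis
 then obtain a n0 where a: "a \<in> spow G (sy S) n0" "\<And>n. n \<ge> 1 ==> a [^] (n::nat) \<noteq> \<one>"
  using infinite_order_if_linear_growth[of "sy S"] lin[of "sy S"] sy[OF S(1,2)] by (metis UN_iff)
 have aC: "a \<in> carrier G" using a(1) spow_closed sy[OF S(1,2)] by blast
 define A where "A = generate G {a}"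
 have A: "subgroup A G" unfolding A_def using aC by (intro generate_is_subgroup) auto
 have Ac: "A \<subseteq> carrier G" using A by (simp add: subgroup.subset)
 have aA: "a \<in> A" unfolding A_def by (auto intro: generate.incl)
 have infA: "infinite (rcosets A)" using nvc aC unfolding virtually_cyclic_def A_def by blast
 have "\<exists>E C. finite E \<and> subgroup (E <#> A) G \<and> E \<subseteq> carrier G \<and> finite C \<and>
     C \<subseteq> E <#> A \<and> card C = m \<and> inj_on (\<lambda>x. A #> x) C" for m
 proof -
  obtain Q where Q: "Q \<subseteq> rcosets A" "finite Q" "card Q = m"
   using infinite_arbitrarily_large[OF infA] by blast
  have "Q \<subseteq> (\<lambda>x. A #> x) ` carrier G" using Q unfolding RCOSETS_def by auto
  then obtain C where C: "C \<subseteq> carrier G" "inj_on (\<lambda>x. A #> x) C" "Q = (\<lambda>x. A #> x) ` C"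
   by (metis subset_image_inj)
  have finC: "finite C" "card C = m" using C Q finite_image_iff card_image by metis+
  define F where "F = sy (insert a C)"
  have F: "finite F" "F \<subseteq> carrier G" "\<one> \<in> F" "\<And>f. f \<in> F ==> inv f \<in> F"
   unfolding F_def using sy[of "insert a C"] finC C aC by auto
  obtain c where c: "\<forall>r\<ge>1. card (spow G F r) \<le> c * r" using lin[OF F] by blast
  define N where "N = (\<Union>n. spow G F n)"
  have NG: "N = generate G F" unfolding N_def using generate_eq_UN_spow F by blast
  have N: "subgroup N G" unfolding NG using F by (intro generate_is_subgroup)
  have aF: "a \<in> F" "C \<subseteq> F" unfolding F_def sy_def by auto
  have fin: "finite ((\<lambda>x. A #> x) ` N)"
   unfolding N_def using finitely_many_cosets_if_linear_growth[OF F(1-3) _ aF(1) a(2) A aA] c by blast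
  then obtain R where R: "R \<subseteq> N" "finite R" "(\<lambda>x. A #> x) ` N = (\<lambda>x. A #> x) ` R"
   by (metis finite_subset_image order_refl)
  have FN: "F \<subseteq> N" unfolding NG by (auto intro: generate.incl)
  have AN: "A \<subseteq> N" unfolding A_def using N aF FN by (intro generate_subgroup_incl) auto
  have NC: "N \<subseteq> carrier G" using N by (simp add: subgroup.subset)
  \<comment> \<open>Inverting the representatives of right cosets puts the finite set on the left,
    in the form \<open>E <#> A\<close>.\<close>
  define E where "E = m_inv G ` R"
  have EN: "E \<subseteq> N" using R N unfolding E_def by (auto simp: subgroup.m_inv_closed)
  have "E <#> A = N"
  proof
   show "E <#> A \<subseteq> N" using EN AN N unfolding set_mult_def by (auto simp: subgroup.m_closed subset_iff)
   show "N \<subseteq> E <#> A"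
   proof
    fix x assume x: "x \<in> N"
    then have "inv x \<in> N" using N by (simp add: subgroup.m_inv_closed)
    then obtain y where y: "y \<in> R" "A #> inv x = A #> y" using R by (metis (no_types, lifting) image_iff)
    have cl: "x \<in> carrier G" "y \<in> carrier G" using x y R NC by auto
    have "inv x \<in> A #> y" using y rcos_self[OF _ A, of "inv x"] cl by simp
    then obtain b where b: "b \<in> A" "inv x = b \<otimes> y" unfolding r_coset_def by auto
    have bC: "b \<in> carrier G" using b Ac by auto
    have "x = inv y \<otimes> inv b" using b(2) cl bC by (metis inv_inv inv_mult_group)
    moreover have "inv b \<in> A" using b A by (simp add: subgroup.m_inv_closed)
    ultimately show "x \<in> E <#> A" using y unfolding E_def set_mult_def by blast
   qed
  qed
  moreover have "finite E" using R unfolding E_def by auto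
  moreover have "E \<subseteq> carrier G" using EN NC by blast
  ultimately show ?thesis using N C finC aF FN by blast
 qed
 then show ?thesis using cyclic[OF aC a(2)] unfolding A_def by blast
qed

end

section \<open>Sparse connected sets in Cayley graphs\<close>

text \<open>A maximal conflict-free set is also a net. With conflict meaning that translates by a
  finite set meet, it is a packing and a covering set at once.\<close>

lemma maximal_conflict_free_subset:
 assumes "finite D" and refl: "\<And>d. d \<in> D ==> conf d d" and sym: "\<And>x y. conf x y ==> conf y x"
 shows "\<exists>Y\<subseteq>D. (\<forall>x\<in>Y. \<forall>y\<in>Y. x \<noteq> y --> \<not> conf x y) \<and> (\<forall>d\<in>D. \<exists>y\<in>Y. conf d y)"
 using assms(1,2)
proof (induction D rule: finite_induct)
 case (insert d D)
 then obtain Y where Y: "Y \<subseteq> D" "\<forall>x\<in>Y. \<forall>y\<in>Y. x \<noteq> y --> \<not> conf x y" "\<forall>d\<in>D. \<exists>y\<in>Y. conf d y"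
  by auto
 show ?case
 proof (cases "\<exists>y\<in>Y. conf d y")
  case True
  then show ?thesis using Y by (intro exI[of _ Y]) auto
 next
  case False
  then have "\<forall>y\<in>Y. \<not> conf d y \<and> \<not> conf y d" using sym by blast
  then show ?thesis using Y insert.prems by (intro exI[of _ "insert d Y"]) auto
 qed
qed auto

lemma spanning_edges:
 fixes E E' :: "'a rel"
 assumes "finite R" "sym E" "sym E'" and "\<And>x y. (x, y) \<in> E' ==> \<exists>rh\<in>R. (x, rh) \<in> E\<^sup>*"
 shows "\<exists>E''\<subseteq>E'. finite E'' \<and> card E'' \<le> 2 * card R \<and> sym E'' \<and> E' \<subseteq> (E \<union> E'')\<^sup>*"
 using assms
proof (induction "card R" arbitrary: R E rule: less_induct)
 case less
 show ?case
 proof (cases "E' \<subseteq> E\<^sup>*")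
  case True
  then show ?thesis by (intro exI[of _ "{}"]) (auto simp: sym_def)
 next
  case False
  then obtain x y where xy: "(x, y) \<in> E'" "(x, y) \<notin> E\<^sup>*" by auto
  have syE: "sym (E\<^sup>*)" using less.prems(2) by (rule sym_rtrancl)
  have yx: "(y, x) \<in> E'" using xy less.prems(3) by (auto dest: symD)
  obtain p where p: "p \<in> R" "(x, p) \<in> E\<^sup>*" using less.prems(4) xy by blast
  obtain q where q: "q \<in> R" "(y, q) \<in> E\<^sup>*" using less.prems(4) yx by blast
  have "p \<noteq> q" using p q xy syE by (metis rtrancl_trans symE)
  define E1 where "E1 = E \<union> {(x, y), (y, x)}"
  have sub: "E\<^sup>* \<subseteq> E1\<^sup>*" unfolding E1_def by (rule rtrancl_mono) auto
  have reach: "\<exists>rh\<in>R - {q}. (z, rh) \<in> E1\<^sup>*" if zw: "(z, w) \<in> E'" for z w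
  proof -
   obtain rh where r: "rh \<in> R" "(z, rh) \<in> E\<^sup>*" using less.prems(4)[OF zw] by blast
   show ?thesis
   proof (cases "rh = q")
    case True
    have "(q, y) \<in> E\<^sup>*" using q syE by (auto dest: symD)
    then have "(z, y) \<in> E\<^sup>*" using r True by auto
    moreover have "(y, x) \<in> E1" unfolding E1_def by simp
    ultimately have "(z, p) \<in> E1\<^sup>*" using sub p(2)
     by (meson r_into_rtrancl rtrancl_trans subsetD)
    then show ?thesis using p \<open>p \<noteq> q\<close> by blast
   qed (use r sub in blast)
  qed
  have "card (R - {q}) < card R" using q less.prems(1) by (metis card_Diff1_less)
  moreover have "sym E1" using less.prems(2) unfolding E1_def sym_def by auto
  ultimately obtain E2 where E2: "E2 \<subseteq> E'" "finite E2" "card E2 \<le> 2 * card (R - {q})" "sym E2"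
   "E' \<subseteq> (E1 \<union> E2)\<^sup>*"
   using less.hyps[of "R - {q}" E1] less.prems(1,3) reach by blast
  define E'' where "E'' = E2 \<union> {(x, y), (y, x)}"
  have "card E'' \<le> card E2 + card {(x, y), (y, x)}" unfolding E''_def by (rule card_Un_le)
  moreover have "card {(x, y), (y, x)} \<le> 2"
   using card_insert_le_m1[of 2 "{(y, x)}" "(x, y)"] by simp
  moreover have "card R = Suc (card (R - {q}))"
   by (rule card_Suc_Diff1[OF less.prems(1) q(1), symmetric])
  ultimately have "card E'' \<le> 2 * card R" using E2(3) by linarith
  moreover have "E \<union> E'' = E1 \<union> E2" unfolding E''_def E1_def by auto
  moreover have "sym E''" unfolding E''_def using E2(4) by (intro sym_Un) (auto simp: sym_def)
  ultimately show ?thesis using E2 xy yx unfolding E''_def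
   by (intro exI[of _ "E2 \<union> {(x, y), (y, x)}"]) auto
 qed
qed

definition cayley_edges :: "('a, 'b) monoid_scheme => 'a set => 'a set => 'a rel" where
 "cayley_edges G F V = {(u, v). u \<in> V \<and> v \<in> V \<and> (\<exists>f\<in>F. v = f \<otimes>\<^bsub>G\<^esub> u)}"

text \<open>A sparse connected skeleton of the finite set \<open>X\<close>: every interior point is
  reached from \<open>W\<close> through \<open>S\<close>, and \<open>V\<close> connects
  \<open>W\<close> to few roots. The degree of invariance of \<open>X\<close> enters only through
  the size of its boundary, so one set \<open>S\<close> can serve all pieces of a
  decomposition.\<close>

abbreviation tileable :: "('g, 'c) monoid_scheme => 'g set => 'g set => real => 'g set => bool" where
 "tileable G F S ep X \<equiv> \<exists>W V R. W \<subseteq> V \<and> V \<subseteq> X \<and> R \<subseteq> V \<and> rcard V \<le> ep * card X \<and>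
   core G S X \<subseteq> S <#>\<^bsub>G\<^esub> W \<and> card R \<le> card (bdry G S X) \<and>
   (\<forall>v\<in>V. \<exists>rh\<in>R. (v, rh) \<in> (cayley_edges G F V)\<^sup>*)"

abbreviation "has_tiles G F ep \<equiv>
 \<exists>S. finite S \<and> S \<subseteq> carrier G \<and> \<one>\<^bsub>G\<^esub> \<in> S \<and> (\<forall>X. finite X \<and> X \<subseteq> carrier G --> tileable G F S ep X)"

context group
begin

lemma sym_cayley_edges:
 assumes "F \<subseteq> carrier G" "V \<subseteq> carrier G" "\<And>f. f \<in> F ==> inv f \<in> F"
 shows "sym (cayley_edges G F V)"
proof (rule symI)
 fix u v assume "(u, v) \<in> cayley_edges G F V"
 then obtain f where f: "u \<in> V" "v \<in> V" "f \<in> F" "v = f \<otimes> u" unfolding cayley_edges_def by auto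
 then have "u = inv f \<otimes> v" using assms by (auto simp: m_assoc[symmetric] subset_iff)
 then show "(v, u) \<in> cayley_edges G F V" using f assms unfolding cayley_edges_def by blast
qed

lemma cayley_path:
 assumes F: "F \<subseteq> carrier G" "\<one> \<in> F" and y: "y \<in> carrier G"
  and "s \<in> spow G F n" "\<And>t. t \<in> spow G F n ==> t \<otimes> y \<in> X"
 shows "\<exists>P\<subseteq>X. finite P \<and> card P \<le> n + 1 \<and> y \<in> P \<and> s \<otimes> y \<in> P \<and>
  (\<forall>p\<in>P. (y, p) \<in> (cayley_edges G F P)\<^sup>*)"
 using assms(4,5)
proof (induction n arbitrary: s)
 case 0
 then show ?case using y by (intro exI[of _ "{y}"]) auto
next
 case (Suc n)
 then obtain f s' where s: "f \<in> F" "s' \<in> spow G F n" "s = f \<otimes> s'" by auto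
 have "spow G F n \<subseteq> spow G F (Suc n)" by (rule spow_mono[OF F]) simp
 then have "t \<otimes> y \<in> X" if "t \<in> spow G F n" for t
  using Suc.prems(2)[of t] that by blast
 then obtain P where P: "P \<subseteq> X" "finite P" "card P \<le> n + 1" "y \<in> P" "s' \<otimes> y \<in> P"
  "\<forall>p\<in>P. (y, p) \<in> (cayley_edges G F P)\<^sup>*"
  using Suc.IH[OF s(2)] by blast
 have sy: "s \<otimes> y = f \<otimes> (s' \<otimes> y)"
  using s F y spow_closed[OF F(1), of n] by (auto simp: m_assoc subset_iff)
 let ?P = "insert (s \<otimes> y) P"
 have "(cayley_edges G F P)\<^sup>* \<subseteq> (cayley_edges G F ?P)\<^sup>*"
  by (rule rtrancl_mono) (auto simp: cayley_edges_def)
 moreover have "(s' \<otimes> y, s \<otimes> y) \<in> cayley_edges G F ?P"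
  using P s sy unfolding cayley_edges_def by auto
 ultimately have "\<forall>p\<in>?P. (y, p) \<in> (cayley_edges G F ?P)\<^sup>*"
  using P by (metis (no_types, lifting) insert_iff rtrancl.rtrancl_into_rtrancl subsetD)
 moreover have "card ?P \<le> Suc n + 1" using P by (simp add: card_insert_if)
 moreover have "s \<otimes> y \<in> X" using Suc.prems by blast
 ultimately show ?case using P by (intro exI[of _ ?P]) auto
qed

text \<open>The points of \<open>Y\<close> are centres of disjoint balls of radius r, each with more
  than \<open>c * r\<close> points, so they are rare; joining neighbouring centres by spanning paths
  of length at most 4 r + 1 still uses a small fraction of \<open>X\<close>. Every cluster of
  centres comes near the boundary of \<open>X\<close>, which bounds the number of clusters.\<close>

lemma sparse_connected_superlinear:
 fixes ep :: real
 assumes F: "finite F" "F \<subseteq> carrier G" "\<one> \<in> F" "\<And>f. f \<in> F ==> inv f \<in> F"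
  and growth: "\<And>c. \<exists>r\<ge>1. card (spow G F r) > c * r" and eps: "ep > 0"
 shows "has_tiles G F ep"
proof -
 obtain c :: nat where c: "13 / ep \<le> c" using real_arch_simple by blast
 obtain r where r: "r \<ge> 1" "card (spow G F r) > c * r" using growth by blast
 \<comment> \<open>The radius is one more than in \<open>deep\<close> below, so that a point of
   \<open>X\<close> outside the boundary has all its neighbours under \<open>F\<close> in
   \<open>deep\<close>.\<close>
 define S where "S = spow G F (4 * r + 2)"
 have sp1: "\<one> \<in> spow G F n" for n using spow_mono[OF F(2,3), of 0 n] by auto
 have spc: "s \<in> carrier G" if "s \<in> spow G F n" for s n using that spow_closed[OF F(2)] by blast
 have spi: "inv s \<in> spow G F n" if "s \<in> spow G F n" for s n using spow_inv[OF F(2,4)] that by blast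
 have S: "finite S" "S \<subseteq> carrier G" "\<one> \<in> S"
  unfolding S_def by (rule spow_finite[OF F(1)], rule spow_closed[OF F(2)], rule sp1)
 have main: "tileable G F S ep X"
  if X: "finite X" "X \<subseteq> carrier G" for X
 proof -
  define deep where "deep = {g \<in> X. \<forall>s\<in>spow G F (4 * r + 1). s \<otimes> g \<in> X}"
  define conf where "conf = (\<lambda>x y. \<exists>s\<in>spow G F r. \<exists>t\<in>spow G F r. s \<otimes> x = t \<otimes> y)"
  have deepX: "deep \<subseteq> X" "finite deep" unfolding deep_def using X by auto
  have "\<exists>Y\<subseteq>deep. (\<forall>x\<in>Y. \<forall>y\<in>Y. x \<noteq> y --> \<not> conf x y) \<and> (\<forall>d\<in>deep. \<exists>y\<in>Y. conf d y)"
   by (rule maximal_conflict_free_subset[OF deepX(2)])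
    (use sp1[of r] in \<open>auto simp: conf_def\<close>, metis)
  then obtain Y where Y: "Y \<subseteq> deep" "\<And>x y. x \<in> Y ==> y \<in> Y ==> conf x y ==> x = y"
   "\<And>d. d \<in> deep ==> \<exists>y\<in>Y. conf d y" by metis
  have YX: "Y \<subseteq> X" "finite Y" "Y \<subseteq> carrier G"
   using Y(1) deepX X by (blast, blast intro: finite_subset, blast)
  have near: "\<exists>y\<in>Y. \<exists>s\<in>spow G F (2 * r). d = s \<otimes> y" if d: "d \<in> deep" for d
  proof -
   obtain y s t where y: "y \<in> Y" "s \<in> spow G F r" "t \<in> spow G F r" "s \<otimes> d = t \<otimes> y"
    using Y(3)[OF d] unfolding conf_def by blast
   have cl: "d \<in> carrier G" "y \<in> carrier G" "s \<in> carrier G" "t \<in> carrier G"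
    using d y deepX X YX spc by auto
   have "d = inv s \<otimes> (s \<otimes> d)" using cl by (simp add: m_assoc[symmetric])
   also have "\<dots> = (inv s \<otimes> t) \<otimes> y" using y(4) cl by (simp add: m_assoc)
   finally have "d = (inv s \<otimes> t) \<otimes> y" .
   moreover have "inv s \<otimes> t \<in> spow G F (2 * r)"
    using spow_add_mem[OF F(2) spi[OF y(2)] y(3)] by (simp add: mult_2)
   ultimately show ?thesis using y(1) by blast
  qed
  have cardY: "card Y * card (spow G F r) \<le> card X"
  proof -
   have "card Y * card (spow G F r) = card (Y \<times> spow G F r)" by (simp add: card_cartesian_product)
   also have "\<dots> = card ((\<lambda>(y, s). s \<otimes> y) ` (Y \<times> spow G F r))"
   proof (rule card_image[symmetric], rule inj_onI, clarify)
    fix y s y' s' assume h: "y \<in> Y" "s \<in> spow G F r" "y' \<in> Y" "s' \<in> spow G F r" "s \<otimes> y = s' \<otimes> y'"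
    have "conf y y'" unfolding conf_def using h(2,4,5) by blast
    then have "y = y'" using Y(2)[OF h(1,3)] by simp
    then show "y = y' \<and> s = s'" using h(5) spc[OF h(2)] spc[OF h(4)] YX(3) h(3) by auto
   qed
   also have "\<dots> \<le> card X"
   proof (rule card_mono[OF X(1)], rule image_subsetI, clarify)
    fix y s assume "y \<in> Y" "s \<in> spow G F r"
    moreover have "spow G F r \<subseteq> spow G F (4 * r + 1)" by (rule spow_mono[OF F(2,3)]) simp
    ultimately show "s \<otimes> y \<in> X" using Y(1) unfolding deep_def by blast
   qed
   finally show ?thesis .
  qed
  \<comment> \<open>If two balls of radius 2 r meet or are joined by an edge of \<open>F\<close>,
    their centres are at distance at most 4 r + 1.\<close>
  define E' where "E' = {(y, z). y \<in> Y \<and> z \<in> Y \<and> (\<exists>s\<in>spow G F (4 * r + 1). z = s \<otimes> y)}"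
  have symE': "sym E'"
  proof (rule symI)
   fix y z assume "(y, z) \<in> E'"
   then obtain s where s: "y \<in> Y" "z \<in> Y" "s \<in> spow G F (4 * r + 1)" "z = s \<otimes> y" unfolding E'_def mem_Collect_eq case_prod_conv by blast
   then have "y = inv s \<otimes> z" using YX spc[OF s(3)] by (auto simp: m_assoc[symmetric] subset_iff)
   then show "(z, y) \<in> E'" using s spi unfolding E'_def by blast
  qed
  have "\<exists>E''\<subseteq>E'. finite E'' \<and> card E'' \<le> 2 * card Y \<and> sym E'' \<and> E' \<subseteq> ({} \<union> E'')\<^sup>*"
   by (rule spanning_edges[OF YX(2) _ symE']) (auto simp: E'_def sym_def)
  then obtain E'' where E'': "E'' \<subseteq> E'" "finite E''" "card E'' \<le> 2 * card Y" "E' \<subseteq> E''\<^sup>*"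
   unfolding Un_empty_left by blast
  have "\<exists>P\<subseteq>X. finite P \<and> card P \<le> (4 * r + 1) + 1 \<and> y \<in> P \<and> z \<in> P \<and>
   (\<forall>p\<in>P. (y, p) \<in> (cayley_edges G F P)\<^sup>*)" if yz: "(y, z) \<in> E'" for y z
  proof -
   obtain s where s: "y \<in> Y" "s \<in> spow G F (4 * r + 1)" "z = s \<otimes> y" using yz unfolding E'_def mem_Collect_eq case_prod_conv by blast
   show ?thesis unfolding s(3)
    by (rule cayley_path[OF F(2,3) _ s(2)]) (use s Y YX in \<open>auto simp: deep_def\<close>)
  qed
  then have "\<forall>e\<in>E'. \<exists>P\<subseteq>X. finite P \<and> card P \<le> (4 * r + 1) + 1 \<and> fst e \<in> P \<and> snd e \<in> P \<and>
   (\<forall>p\<in>P. (fst e, p) \<in> (cayley_edges G F P)\<^sup>*)" by auto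
  then obtain P where P: "\<And>e. e \<in> E' ==> P e \<subseteq> X \<and> finite (P e) \<and> card (P e) \<le> (4 * r + 1) + 1 \<and>
   fst e \<in> P e \<and> snd e \<in> P e \<and> (\<forall>p\<in>P e. (fst e, p) \<in> (cayley_edges G F (P e))\<^sup>*)"
   by (auto dest!: bchoice)
  define V where "V = Y \<union> (\<Union>e\<in>E''. P e)"
  have VX: "V \<subseteq> X" unfolding V_def using YX(1) P[THEN conjunct1] E''(1) by (intro Un_least UN_least) auto
  define C where "C = (cayley_edges G F V)\<^sup>*"
  have symC: "sym C" unfolding C_def
   by (rule sym_rtrancl, rule sym_cayley_edges) (use F VX X in auto)
  have PC: "(fst e, p) \<in> C" if "e \<in> E''" "p \<in> P e" for e p
  proof -
   have "(cayley_edges G F (P e))\<^sup>* \<subseteq> C"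
    unfolding C_def by (rule rtrancl_mono) (use that in \<open>auto simp: V_def cayley_edges_def\<close>)
   moreover have "e \<in> E'" using that(1) E''(1) by auto
   ultimately show ?thesis using P[of e] that(2) by auto
  qed
  have tC: "(x, z) \<in> C" if "(x, y) \<in> C" "(y, z) \<in> C" for x y z
   using that unfolding C_def by auto
  have "E'' \<subseteq> C" using PC P E''(1) by (metis prod.collapse subsetD subsetI)
  then have "E''\<^sup>* \<subseteq> C" unfolding C_def by (metis rtrancl_idemp rtrancl_mono)
  then have E'C: "E'\<^sup>* \<subseteq> C" using E''(4) unfolding C_def by (metis order_trans rtrancl_idemp rtrancl_mono)
  have cardV: "card V \<le> ep * card X"
  proof -
   have "card V \<le> card Y + card (\<Union>e\<in>E''. P e)" unfolding V_def by (rule card_Un_le)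
   also have "card (\<Union>e\<in>E''. P e) \<le> (\<Sum>e\<in>E''. card (P e))" using E''(2) by (rule card_UN_le)
   also have "\<dots> \<le> (\<Sum>e\<in>E''. 4 * r + 2)" using P E''(1) by (intro sum_mono) force
   also have "\<dots> = card E'' * (4 * r + 2)" by simp
   also have "\<dots> \<le> 2 * card Y * (4 * r + 2)" using E''(3) by (rule mult_right_mono) simp
   finally have "card V \<le> card Y + 2 * card Y * (4 * r + 2)" by simp
   also have "\<dots> = card Y * (8 * r + 5)" by (simp add: algebra_simps)
   \<comment> \<open>Origin of the constant 13: each centre pays for itself and for two paths of at
     most 4 r + 2 points, and r is at least 1.\<close>
   also have "\<dots> \<le> card Y * (13 * r)" using r(1) by (intro mult_left_mono) auto
   finally have 1: "rcard V \<le> 13 * real r * card Y"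
    by (metis (mono_tags, lifting) mult.commute of_nat_le_iff of_nat_mult of_nat_numeral)
   have "13 * real r * card Y \<le> ep * c * r * card Y"
    using c eps by (intro mult_right_mono) (auto simp: field_simps)
   also have "\<dots> = ep * (card Y * (c * r))" by simp
   also have "\<dots> \<le> ep * (card Y * card (spow G F r))"
    using r(2) eps by (intro mult_left_mono) (auto simp flip: of_nat_mult)
   also have "\<dots> \<le> ep * card X"
    using cardY eps by (intro mult_left_mono) (auto simp flip: of_nat_mult)
   finally show ?thesis using 1 by linarith
  qed
  define Bd where "Bd = bdry G S X"
  define U where "U = (\<lambda>y. {d \<in> deep. \<exists>z\<in>Y. (y, z) \<in> E'\<^sup>* \<and> (\<exists>s\<in>spow G F (2 * r). d = s \<otimes> z)})"
  have step: "(z, z') \<in> E'" if "z \<in> Y" "z' \<in> Y" "s \<in> spow G F (2 * r)" "s' \<in> spow G F (2 * r)"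
   "f \<in> F" "f \<otimes> (s \<otimes> z) = s' \<otimes> z'" for z z' s s' f
  proof -
   have cl: "z \<in> carrier G" "z' \<in> carrier G" "s \<in> carrier G" "s' \<in> carrier G" "f \<in> carrier G"
    using subsetD[OF YX(3)] that(1,2,5) spc[OF that(3)] spc[OF that(4)] subsetD[OF F(2)] by blast+
   have "z' = inv s' \<otimes> (f \<otimes> (s \<otimes> z))" using that(6) cl by (simp add: m_assoc[symmetric])
   also have "\<dots> = (inv s' \<otimes> (f \<otimes> s)) \<otimes> z" using cl by (simp add: m_assoc)
   finally have "z' = (inv s' \<otimes> (f \<otimes> s)) \<otimes> z" .
   moreover have "f \<otimes> s \<in> spow G F (Suc (2 * r))" using that(3,5) unfolding spow.simps by blast
   then have "inv s' \<otimes> (f \<otimes> s) \<in> spow G F (2 * r + Suc (2 * r))"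
    using spow_add_mem[OF F(2) spi[OF that(4)]] by blast
   moreover have "2 * r + Suc (2 * r) = 4 * r + 1" by simp
   ultimately show ?thesis using that(1,2) unfolding E'_def mem_Collect_eq case_prod_conv by metis
  qed
  \<comment> \<open>A cluster that avoids the boundary would be closed under \<open>F\<close>, and
    the finite set \<open>X\<close> would contain translates of all balls, whose sizes are
    unbounded.\<close>
  have exit: "\<exists>h. h \<in> U y \<and> h \<in> Bd" if y: "y \<in> Y" for y
  proof (rule ccontr)
   assume neg: "\<not> ?thesis"
   have y0: "y \<in> U y"
   proof -
    have "y = \<one> \<otimes> y" using y YX(3) by auto
    then show ?thesis unfolding U_def using subsetD[OF Y(1) y] y sp1[of "2 * r"] by blast
   qed
   have clo: "f \<otimes> h \<in> U y" if f: "f \<in> F" and h: "h \<in> U y" for f h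
   proof -
    obtain z s where z: "h \<in> deep" "z \<in> Y" "(y, z) \<in> E'\<^sup>*" "s \<in> spow G F (2 * r)" "h = s \<otimes> z"
     using h unfolding U_def by auto
    have hX: "h \<in> X" using z deepX by blast
    have hc: "h \<in> carrier G" "f \<in> carrier G" using hX X f F by auto
    have nb: "\<forall>s\<in>S. s \<otimes> h \<in> X" using neg h hX unfolding Bd_def by blast
    have "f \<otimes> h \<in> deep"
    proof -
     have "spow G F 1 \<subseteq> S" unfolding S_def by (rule spow_mono[OF F(2,3)]) simp
     then have "f \<in> S" using spow_1[OF F(2)] f by blast
     moreover have "s \<otimes> (f \<otimes> h) \<in> X" if "s \<in> spow G F (4 * r + 1)" for s
     proof -
      have "f \<in> spow G F 1" using f spow_1[OF F(2)] by blast
      then have "s \<otimes> f \<in> spow G F ((4 * r + 1) + 1)" by (rule spow_add_mem[OF F(2) that])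
      moreover have "(4 * r + 1) + 1 = 4 * r + 2" by simp
      ultimately have "s \<otimes> f \<in> S" unfolding S_def by metis
      then have "s \<otimes> f \<otimes> h \<in> X" using nb by blast
      then show ?thesis using hc spc[OF that] by (simp add: m_assoc)
     qed
     ultimately show ?thesis using nb unfolding deep_def by blast
    qed
    moreover obtain z' s' where z': "z' \<in> Y" "s' \<in> spow G F (2 * r)" "f \<otimes> h = s' \<otimes> z'"
     using near[OF calculation] by blast
    moreover have "(z, z') \<in> E'" using step[OF z(2) z'(1) z(4) z'(2) f] z(5) z'(3) by simp
    ultimately show ?thesis unfolding U_def using z(3) by (auto intro: rtrancl.rtrancl_into_rtrancl)
   qed
   have "s \<otimes> y \<in> U y" if "s \<in> spow G F n" for s n
    using that
   proof (induction n arbitrary: s)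
    case 0
    then show ?case using y0 y YX by auto
   next
    case (Suc n)
    then obtain f s' where s: "f \<in> F" "s' \<in> spow G F n" "s = f \<otimes> s'" by auto
    then have "f \<otimes> (s' \<otimes> y) \<in> U y" using Suc.IH clo by blast
    moreover have "f \<otimes> (s' \<otimes> y) = s \<otimes> y" using s F YX y spc[OF s(2)] by (auto simp: m_assoc subset_iff)
    ultimately show ?case by simp
   qed
   then have sub: "(\<lambda>s. s \<otimes> y) ` spow G F n \<subseteq> X" for n
    using deepX unfolding U_def by blast
   have "card (spow G F n) \<le> card X" for n
   proof -
    have "inj_on (\<lambda>s. s \<otimes> y) (spow G F n)"
     using y YX(3) spc by (intro inj_onI) (auto simp: subset_iff)
    then show ?thesis using sub X(1) card_inj_on_le by blast
   qed
   then show False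
    using growth[of "card X"] by (metis le_less_trans less_le_not_le mult.right_neutral mult_le_mono2)
  qed
  then obtain h where h: "\<And>y. y \<in> Y ==> h y \<in> U y \<and> h y \<in> Bd" by metis
  \<comment> \<open>Centres with the same exit point lie in one cluster, so one root for each exit
    point suffices.\<close>
  obtain R where R: "R \<subseteq> Y" "inj_on h R" "h ` R = h ` Y"
   by (metis subset_image_inj subset_refl)
  have finBd: "finite Bd" unfolding Bd_def using X by auto
  have "card R = card (h ` R)" using R(2) by (rule card_image[symmetric])
  also have "\<dots> \<le> card Bd" using h R by (intro card_mono[OF finBd]) auto
  finally have cardR: "card R \<le> card Bd" .
  have YR: "\<exists>rh\<in>R. (y, rh) \<in> C" if y: "y \<in> Y" for y
  proof -
   obtain rh where rho: "rh \<in> R" "h rh = h y" using R(3) y by (metis (no_types, lifting) imageE imageI)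
   obtain z s where z: "z \<in> Y" "(y, z) \<in> E'\<^sup>*" "s \<in> spow G F (2 * r)" "h y = s \<otimes> z"
    using h[OF y] unfolding U_def by auto
   obtain z' s' where z': "z' \<in> Y" "(rh, z') \<in> E'\<^sup>*" "s' \<in> spow G F (2 * r)" "h y = s' \<otimes> z'"
    using h[of rh] rho R unfolding U_def by auto
   have "\<one> \<otimes> (s \<otimes> z) = s' \<otimes> z'"
    using z z' YX spc[OF z(3)] by (auto simp: subset_iff)
   then have "(z, z') \<in> E'" using step[OF z(1) z'(1) z(3) z'(3) F(3)] by simp
   moreover have "(z', rh) \<in> E'\<^sup>*" using z'(2) sym_rtrancl[OF symE'] by (auto dest: symD)
   ultimately have "(y, rh) \<in> E'\<^sup>*" using z(2) by (meson r_into_rtrancl rtrancl_trans)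
   then show ?thesis using rho E'C by blast
  qed
  have "\<exists>rh\<in>R. (v, rh) \<in> C" if v: "v \<in> V" for v
  proof (cases "v \<in> Y")
   case False
   then have "v \<in> (\<Union>e\<in>E''. P e)" using v unfolding V_def by simp
   then obtain e where e: "e \<in> E''" "v \<in> P e" by (rule UN_E)
   then have "(v, fst e) \<in> C" using symD[OF symC PC] by blast
   moreover have "fst e \<in> Y"
    using subsetD[OF E''(1) e(1)] unfolding E'_def by (simp add: case_prod_unfold)
   ultimately show ?thesis using YR tC by blast
  qed (use YR in blast)
  moreover have "core G S X \<subseteq> S <#> Y"
  proof
   fix g assume g: "g \<in> core G S X"
   have "spow G F (4 * r + 1) \<subseteq> S" unfolding S_def by (rule spow_mono[OF F(2,3)]) simp
   then have "g \<in> deep" unfolding deep_def using g by blast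
   then obtain y s where y: "y \<in> Y" "s \<in> spow G F (2 * r)" "g = s \<otimes> y" using near by blast
   have "spow G F (2 * r) \<subseteq> S" unfolding S_def by (rule spow_mono[OF F(2,3)]) simp
   then show "g \<in> S <#> Y" unfolding set_mult_def using y by blast
  qed
  moreover have "Y \<subseteq> V" "R \<subseteq> V" unfolding V_def using R by auto
  ultimately show ?thesis
   using VX cardV cardR unfolding C_def Bd_def
   by - (rule exI[of _ Y], rule exI[of _ V], rule exI[of _ R], (intro conjI ballI; blast))
 qed
 show ?thesis
  by (rule exI[of _ S], intro conjI S allI impI, elim conjE, rule main)
qed

text \<open>Each coset of \<open>N\<close> contains m disjoint lines, which are cosets of the
  infinite cyclic group; the line meeting \<open>X\<close> least has at most the fraction 1 / m of
  the points. Finitely many translates by \<open>E\<close> recover the coset from this line, and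
  along it the powers of \<open>a\<close> lead out of the finite set \<open>X\<close>, which yields
  the roots.\<close>

lemma sparse_connected_cyclic:
 fixes ep :: real
 assumes a: "a \<in> carrier G" "\<And>n. n \<ge> 1 ==> a [^] (n::nat) \<noteq> \<one>"
  and cos: "\<And>m. \<exists>E C. finite E \<and> subgroup (E <#> generate G {a}) G \<and> E \<subseteq> carrier G \<and> finite C \<and>
     C \<subseteq> E <#> generate G {a} \<and> card C = m \<and> inj_on (\<lambda>x. generate G {a} #> x) C"
  and eps: "ep > 0" and F: "F = {a, inv a}"
 shows "has_tiles G F ep"
proof -
 define A where "A = generate G {a}"
 have A: "subgroup A G" unfolding A_def using a by (intro generate_is_subgroup) auto
 have AC: "A \<subseteq> carrier G" using A by (rule subgroup.subset)
 have aA: "a \<in> A" unfolding A_def by (auto intro: generate.incl)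
 obtain m0 :: nat where "1 / ep \<le> m0" using real_arch_simple by blast
 define m where "m = Suc m0"
 have m: "1 \<le> ep * m" "m \<ge> 1"
  using \<open>1 / ep \<le> m0\<close> eps unfolding m_def by (auto simp: field_simps)
 obtain E C where E: "finite E" "subgroup (E <#> A) G" "E \<subseteq> carrier G" "finite C" "C \<subseteq> E <#> A" "card C = m"
  "inj_on (\<lambda>x. A #> x) C" using cos[of m] unfolding A_def[symmetric] by blast
 define N where "N = E <#> A"
 have N: "subgroup N G" using E(2) unfolding N_def .
 have NC: "N \<subseteq> carrier G" using N by (rule subgroup.subset)
 have CN: "C \<subseteq> N" using E(5) unfolding N_def .
 have CC: "C \<subseteq> carrier G" using CN NC by blast
 have AN: "A \<subseteq> N"
 proof
  fix b assume b: "b \<in> A"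
  have "\<one> \<in> N" using N by (rule subgroup.one_closed)
  then obtain e b' where e: "e \<in> E" "b' \<in> A" "\<one> = e \<otimes> b'" unfolding N_def set_mult_def by blast
  have cl: "e \<in> carrier G" "b' \<in> carrier G" "b \<in> carrier G" using e b E AC by auto
  have "b = e \<otimes> (b' \<otimes> b)" using e(3) cl by (metis l_one m_assoc)
  moreover have "b' \<otimes> b \<in> A" using A e b by (simp add: subgroup.m_closed)
  ultimately show "b \<in> N" using e unfolding N_def set_mult_def by blast
 qed
 define S where "S = insert \<one> (insert a (E \<union> m_inv G ` E))"
 have S: "finite S" "S \<subseteq> carrier G" "\<one> \<in> S" unfolding S_def using E a by auto
 have main: "tileable G F S ep X"
  if X: "finite X" "X \<subseteq> carrier G" for X
 proof -
  define Q where "Q = (\<lambda>x. N #> x) ` X"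
  have finQ: "finite Q" unfolding Q_def using X by auto
  have Qr: "Q \<subseteq> rcosets N" unfolding Q_def RCOSETS_def using X by auto
  have disjQ: "c \<inter> c' = {}" if "c \<in> Q" "c' \<in> Q" "c \<noteq> c'" for c c'
   using rcos_disjoint[OF N] that Qr unfolding pairwise_def disjnt_def by blast
  have "\<exists>n\<in>c. m * card ((A #> n) \<inter> X) \<le> card (c \<inter> X) \<and> A #> n \<subseteq> c \<and> c = N #> n \<and> n \<in> carrier G" if cQ: "c \<in> Q" for c
  proof -
   obtain x0 where x0: "x0 \<in> X" "c = N #> x0" using cQ unfolding Q_def by blast
   have x0C: "x0 \<in> carrier G" using x0 X by auto
   have mem: "y \<otimes> x0 \<in> c" if "y \<in> C" for y
    using that CN x0 unfolding r_coset_def by blast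
   have line: "A #> (y \<otimes> x0) \<subseteq> c" if yC: "y \<in> C" for y
   proof
    fix z assume "z \<in> A #> (y \<otimes> x0)"
    then obtain b where b: "b \<in> A" "z = b \<otimes> (y \<otimes> x0)" unfolding r_coset_def by blast
    have "z = (b \<otimes> y) \<otimes> x0" using b AC yC CC x0C by (auto simp: m_assoc subset_iff)
    moreover have "b \<otimes> y \<in> N" using subgroup.m_closed[OF N] b AN yC CN by blast
    ultimately show "z \<in> c" using x0 unfolding r_coset_def by blast
   qed
   have ceq: "c = N #> (y \<otimes> x0)" if "y \<in> C" for y
    using repr_independence[OF _ x0C N, of "y \<otimes> x0"] mem[OF that] x0(2) by simp
   have disj: "(A #> (y \<otimes> x0)) \<inter> (A #> (z \<otimes> x0)) = {}" if "y \<in> C" "z \<in> C" "y \<noteq> z" for y z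
   proof (rule ccontr)
    assume "\<not> ?thesis"
    then obtain b b' where b: "b \<in> A" "b' \<in> A" "b \<otimes> (y \<otimes> x0) = b' \<otimes> (z \<otimes> x0)"
     unfolding r_coset_def by blast
    have cl: "b \<in> carrier G" "b' \<in> carrier G" "y \<in> carrier G" "z \<in> carrier G"
     using b AC that CC by auto
    have "b \<otimes> y = b' \<otimes> z" using b(3) cl x0C by (simp add: m_assoc[symmetric])
    moreover have "A #> (b \<otimes> y) = A #> y" "A #> (b' \<otimes> z) = A #> z"
     using coset_mult_assoc[OF AC, of b y] coset_mult_assoc[OF AC, of b' z]
      coset_join2[OF _ A b(1)] coset_join2[OF _ A b(2)] cl by auto
    ultimately have "A #> y = A #> z" by metis
    then show False using E(7) that unfolding inj_on_def by blast
   qed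
   have "\<exists>y\<in>C. m * card ((A #> (y \<otimes> x0)) \<inter> X) \<le> card (c \<inter> X)"
   proof (rule ccontr)
    assume "\<not> ?thesis"
    then have gt: "card (c \<inter> X) < m * card ((A #> (y \<otimes> x0)) \<inter> X)" if "y \<in> C" for y
     using that by (simp add: not_le)
    have "C \<noteq> {}" using E(6) m(2) by auto
    then have "(\<Sum>y\<in>C. card (c \<inter> X)) < (\<Sum>y\<in>C. m * card ((A #> (y \<otimes> x0)) \<inter> X))"
     using gt E(4) by (intro sum_strict_mono) auto
    also have "\<dots> = m * card (\<Union>y\<in>C. (A #> (y \<otimes> x0)) \<inter> X)"
     using E(4) X disj by (subst card_UN_disjoint) (auto simp: sum_distrib_left)
    also have "\<dots> \<le> m * card (c \<inter> X)"
     using line X by (intro mult_left_mono card_mono) auto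
    finally show False using E(6) by simp
   qed
   then obtain y where y: "y \<in> C" "m * card ((A #> (y \<otimes> x0)) \<inter> X) \<le> card (c \<inter> X)" by blast
   have "y \<otimes> x0 \<in> carrier G" using y CC x0C by auto
   then show ?thesis using y(2) mem[OF y(1)] line[OF y(1)] ceq[OF y(1)] by blast
  qed
  then have "\<forall>c\<in>Q. \<exists>n. n \<in> c \<and> m * card ((A #> n) \<inter> X) \<le> card (c \<inter> X) \<and> A #> n \<subseteq> c \<and> c = N #> n \<and> n \<in> carrier G"
   by blast
  then obtain n where n: "\<And>c. c \<in> Q ==> n c \<in> c \<and> m * card ((A #> n c) \<inter> X) \<le> card (c \<inter> X) \<and>
    A #> n c \<subseteq> c \<and> c = N #> n c \<and> n c \<in> carrier G"
   by (auto dest!: bchoice)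
  define V where "V = (\<Union>c\<in>Q. (A #> n c) \<inter> X)"
  have VX: "V \<subseteq> X" unfolding V_def by blast
  have "m * card V \<le> card X"
  proof -
   have "m * card V \<le> m * (\<Sum>c\<in>Q. card ((A #> n c) \<inter> X))"
    unfolding V_def using finQ by (intro mult_left_mono card_UN_le) auto
   also have "\<dots> \<le> (\<Sum>c\<in>Q. card (c \<inter> X))"
    unfolding sum_distrib_left using n by (intro sum_mono) blast
   also have "\<dots> = card (\<Union>c\<in>Q. c \<inter> X)"
    using finQ X disjQ by (intro card_UN_disjoint[symmetric]) auto
   also have "\<dots> \<le> card X" using X by (intro card_mono) auto
   finally show ?thesis .
  qed
  then have mV: "real m * card V \<le> card X" unfolding of_nat_mult[symmetric] of_nat_le_iff .
  have "1 * rcard V \<le> (ep * m) * card V" using m(1) by (rule mult_right_mono) simp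
  also have "\<dots> = ep * (m * card V)" by simp
  also have "\<dots> \<le> ep * card X" using mV eps by (intro mult_left_mono) auto
  finally have cardV: "card V \<le> ep * card X" by simp
  have cover: "core G S X \<subseteq> S <#> V"
  proof
   fix g assume g: "g \<in> core G S X"
   define c where "c = N #> g"
   have cQ: "c \<in> Q" using g unfolding c_def Q_def by blast
   have "g \<in> c" unfolding c_def using rcos_self[OF _ N] g X by auto
   then have "g \<in> N #> n c" using n[OF cQ] by blast
   then obtain e b where eb: "e \<in> E" "b \<in> A" "g = (e \<otimes> b) \<otimes> n c"
    unfolding r_coset_def N_def set_mult_def by blast
   have cl: "e \<in> carrier G" "b \<in> carrier G" "n c \<in> carrier G" using eb E AC n[OF cQ] by auto
   have g2: "g = e \<otimes> (b \<otimes> n c)" using eb(3) cl by (simp add: m_assoc)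
   then have "inv e \<otimes> g = b \<otimes> n c" using cl by (simp add: m_assoc[symmetric])
   moreover have "inv e \<otimes> g \<in> X" using g eb unfolding S_def by blast
   ultimately have "b \<otimes> n c \<in> V" using cQ eb unfolding V_def r_coset_def by auto
   then show "g \<in> S <#> V" unfolding set_mult_def S_def using g2 eb by blast
  qed
  define R where "R = {v \<in> V. a \<otimes> v \<notin> X}"
  have cardR: "card R \<le> card (bdry G S X)"
   unfolding R_def S_def using X VX by (intro card_mono) auto
  have "\<exists>rh\<in>R. (v, rh) \<in> (cayley_edges G F V)\<^sup>*" if v: "v \<in> V" for v
  proof -
   obtain c where c: "c \<in> Q" "v \<in> A #> n c" "v \<in> X" using v unfolding V_def by blast
   have vC: "v \<in> carrier G" using c X by auto
   have stay: "a [^] i \<otimes> v \<in> A #> n c" for i :: nat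
   proof -
    have "a [^] i \<in> A" using A aA by (induction i) (auto simp: subgroup.one_closed subgroup.m_closed)
    moreover obtain b where b: "b \<in> A" "v = b \<otimes> n c" using c unfolding r_coset_def by blast
    ultimately have "a [^] i \<otimes> b \<in> A" "a [^] i \<otimes> v = (a [^] i \<otimes> b) \<otimes> n c"
     using A AC n[OF c(1)] a(1) by (auto simp: subgroup.m_closed m_assoc subset_iff)
    then show ?thesis unfolding r_coset_def by blast
   qed
   have "\<exists>i::nat. a [^] i \<otimes> v \<notin> X"
   proof (rule ccontr)
    assume "\<not> ?thesis"
    then have "range (\<lambda>i::nat. a [^] i \<otimes> v) \<subseteq> X" by blast
    moreover have "inj (\<lambda>i::nat. a [^] i \<otimes> v)"
     using vC a(1) by (auto intro!: injI nat_pow_inj_infinite_order[OF a])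
    ultimately show False using X(1) by (metis finite_subset range_inj_infinite)
   qed
   then have ex: "\<exists>i::nat. a [^] i \<otimes> v \<notin> X" .
   \<comment> \<open>Up to the first exit time the powers stay in the chosen line and in
     \<open>X\<close>; the last point before the exit is a root.\<close>
   define i where "i = (LEAST i::nat. a [^] i \<otimes> v \<notin> X)"
   have i: "a [^] i \<otimes> v \<notin> X" "\<And>j. j < i ==> a [^] j \<otimes> v \<in> X"
    unfolding i_def using LeastI_ex[OF ex] not_less_Least by blast+
   have "i \<noteq> 0" using i(1) c vC by (auto intro: gr0I)
   then obtain k where k: "i = Suc k" by (cases i) auto
   have inV: "a [^] j \<otimes> v \<in> V" if "j \<le> k" for j
    using i(2)[of j] k that stay[of j] c(1) unfolding V_def by auto
   have sucp: "a \<otimes> (a [^] j \<otimes> v) = a [^] Suc j \<otimes> v" for j :: nat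
    using a(1) vC nat_pow_Suc2[OF a(1), of j] by (simp add: m_assoc)
   have "j \<le> k ==> (v, a [^] j \<otimes> v) \<in> (cayley_edges G F V)\<^sup>*" for j
   proof (induction j)
    case 0
    then show ?case using vC by simp
   next
    case (Suc j)
    have "(a [^] j \<otimes> v, a [^] Suc j \<otimes> v) \<in> cayley_edges G F V"
     unfolding cayley_edges_def F using inV[of j] inV[of "Suc j"] Suc.prems sucp[of j] by force
    then show ?case using Suc by (auto intro: rtrancl.rtrancl_into_rtrancl)
   qed
   moreover have "a [^] k \<otimes> v \<in> R" unfolding R_def using inV[of k] i(1) k sucp[of k] by simp
   ultimately show ?thesis by blast
  qed
  moreover have "R \<subseteq> V" unfolding R_def by blast
  ultimately show ?thesis using VX cardV cover cardR
   by - (rule exI[of _ V], rule exI[of _ V], rule exI[of _ R], (intro conjI ballI; blast))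
 qed
 show ?thesis
  by (rule exI[of _ S], intro conjI S allI impI, elim conjE, rule main)
qed

text \<open>\<open>F\<close> is found before \<open>ep\<close>, so that the choice of
  \<open>ep\<close> can later absorb any cost attached to the elements of \<open>F\<close>.\<close>

lemma sparse_connected_sets:
 assumes "\<not> locally_finite_group G" "\<not> virtually_cyclic G"
 shows "\<exists>F. finite F \<and> F \<subseteq> carrier G \<and> (\<forall>f\<in>F. inv f \<in> F) \<and> (\<forall>ep>0. has_tiles G F ep)"
 using assms
proof (cases rule: growth_dichotomy)
 case (superlinear F)
 show ?thesis
  by (rule exI[of _ F], intro conjI ballI allI impI, (fact superlinear)+,
   rule sparse_connected_superlinear[OF superlinear])
next
 case (cyclic a)
 have "finite {a, inv a}" "{a, inv a} \<subseteq> carrier G" "\<forall>f\<in>{a, inv a}. inv f \<in> {a, inv a}"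
  using cyclic(1) by auto
 then show ?thesis
  by - (rule exI[of _ "{a, inv a}"], intro conjI allI impI, assumption+, rule sparse_connected_cyclic[OF cyclic _ refl])
qed

end

section \<open>Sparse connectivity of sofic approximations\<close>

lemma sum_card_permutes:
 fixes V :: "'d set" and K :: "'c set"
 assumes "finite V" "finite K" "\<And>k. k \<in> K ==> sm k permutes V" "U \<subseteq> V"
 shows "(\<Sum>v\<in>V. card (hits K sm U v)) = card K * card U"
proof -
 have "card {v \<in> V. sm k v \<in> U} = card U" if "k \<in> K" for k
 proof -
  have p: "sm k permutes V" using assms that by blast
  have "bij_betw (sm k) {v \<in> V. sm k v \<in> U} U"
  proof (rule bij_betw_imageI)
   show "inj_on (sm k) {v \<in> V. sm k v \<in> U}" using permutes_inj_on[OF p] .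
   show "sm k ` {v \<in> V. sm k v \<in> U} = U"
   proof
    show "U \<subseteq> sm k ` {v \<in> V. sm k v \<in> U}"
    proof
     fix u assume u: "u \<in> U"
     then obtain v where "v \<in> V" "u = sm k v" using permutes_image[OF p] assms(4) by blast
     then show "u \<in> sm k ` {v \<in> V. sm k v \<in> U}" using u by blast
    qed
   qed auto
  qed
  then show ?thesis by (rule bij_betw_same_card)
 qed
 then have "(\<Sum>k\<in>K. card {v \<in> V. sm k v \<in> U}) = card K * card U" by simp
 moreover have "(\<Sum>v\<in>V. card (hits K sm U v)) = (\<Sum>k\<in>K. card {v \<in> V. sm k v \<in> U})"
 proof -
  have c: "card {x \<in> A. P x} = (\<Sum>x\<in>A. if P x then 1 else 0)" if "finite A" for A :: "'c set" and P
   using that by (simp add: sum.inter_filter[symmetric])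
  have c': "card {x \<in> A. P x} = (\<Sum>x\<in>A. if P x then 1 else 0)" if "finite A" for A :: "'d set" and P
   using that by (simp add: sum.inter_filter[symmetric])
  show ?thesis unfolding c[OF assms(2)] c'[OF assms(1)] by (rule sum.swap)
 qed
 ultimately show ?thesis by simp
qed

text \<open>Double counting over all v: among the k in \<open>K\<close> that move v into
  \<open>U\<close>, the share of \<open>d\<close> is on average at most \<open>ep\<close>. The
  points outside \<open>Vg\<close> account for less than half of the hits, which costs the factor
  2.\<close>

lemma exists_efficient_tile:
 fixes ep et :: real
 assumes fin: "finite V" "finite K" "K \<noteq> {}" and perm: "\<And>k. k \<in> K ==> sm k permutes V"
  and U: "U \<subseteq> V" and d: "d \<subseteq> K" "card d \<le> ep * card K" "ep > 0"
  and big: "2 * card (V - Vg) < card U" and Vg: "Vg \<subseteq> V"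
 shows "\<exists>v\<in>Vg. (hits K sm U v) \<noteq> {} \<and>
  card ((hits K sm U v) \<inter> d) \<le> 2 * ep * card (hits K sm U v)"
proof (rule ccontr)
 define p where "p = (\<lambda>v. card (hits K sm U v))"
 define q where "q = (\<lambda>v. card {k \<in> d. sm k v \<in> U})"
 have qe: "hits K sm U v \<inter> d = {k \<in> d. sm k v \<in> U}" for v using d(1) by auto
 assume neg: "\<not> ?thesis"
 have le: "2 * ep * p v \<le> q v" if "v \<in> Vg" for v
 proof (cases "(hits K sm U v) = {}")
  case True
  then have "p v = 0" unfolding p_def by (simp only: card.empty)
  then show ?thesis by simp
 next
  case False
  then have "\<not> card ((hits K sm U v) \<inter> d) \<le> 2 * ep * card (hits K sm U v)"
   using neg that by blast
  then show ?thesis unfolding p_def q_def qe by linarith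
 qed
 have fd: "finite d" using d fin finite_subset by blast
 have sp: "(\<Sum>v\<in>V. p v) = card K * card U" unfolding p_def
  by (rule sum_card_permutes[OF fin(1,2) perm U])
 have sq: "(\<Sum>v\<in>V. q v) = card d * card U" unfolding q_def
  by (rule sum_card_permutes[OF fin(1) fd _ U]) (use perm d in auto)
 have "(\<Sum>v\<in>V. p v) = (\<Sum>v\<in>Vg. p v) + (\<Sum>v\<in>V - Vg. p v)"
  using sum.subset_diff[OF Vg fin(1), of p] by simp
 also have "(\<Sum>v\<in>V - Vg. p v) \<le> (\<Sum>v\<in>V - Vg. card K)"
  unfolding p_def using fin by (intro sum_mono card_mono) auto
 finally have "card K * card U \<le> (\<Sum>v\<in>Vg. p v) + card (V - Vg) * card K" using sp by simp
 then have 1: "rcard K * card U \<le> (\<Sum>v\<in>Vg. real (p v)) + rcard (V - Vg) * card K"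
  unfolding of_nat_sum[symmetric] of_nat_mult[symmetric] of_nat_add[symmetric] of_nat_le_iff .
 have "2 * ep * (\<Sum>v\<in>Vg. real (p v)) = (\<Sum>v\<in>Vg. 2 * ep * p v)" by (simp add: sum_distrib_left)
 also have "\<dots> \<le> (\<Sum>v\<in>Vg. real (q v))" using le by (intro sum_mono) auto
 also have "\<dots> \<le> (\<Sum>v\<in>V. real (q v))" using Vg fin by (intro sum_mono2) auto
 also have "\<dots> = rcard d * card U" using sq by (metis of_nat_mult of_nat_sum)
 also have "\<dots> \<le> ep * card K * card U" using d(2) by (intro mult_right_mono) auto
 finally have "2 * (\<Sum>v\<in>Vg. real (p v)) \<le> card K * card U" using d(3) by (simp add: mult.assoc)
 then have "rcard K * card U \<le> 2 * (rcard (V - Vg) * card K)" using 1 unfolding of_nat_mult by linarith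
 also have "\<dots> = card K * (2 * card (V - Vg))" by simp
 also have "\<dots> < card K * card U"
  unfolding of_nat_less_iff using big fin by (intro mult_strict_left_mono) (auto simp: card_gt_0_iff)
 finally show False by simp
qed

text \<open>Pieces are removed greedily, each taking all hits in what is left. A boundary edge
  between two pieces is charged to the one removed earlier, where it ends at a boundary point of
  \<open>K\<close>; \<open>exists_efficient_tile\<close> makes such points rare in each
  piece.\<close>

lemma (in group) hyperfinite_pieces:
 fixes ep et :: real
 assumes fin: "finite V" "finite K" "K \<noteq> {}" "K \<subseteq> carrier G" and S: "finite S" "S \<subseteq> carrier G" "\<And>s. s \<in> S ==> inv s \<in> S"
  and perm: "\<And>g. g \<in> carrier G ==> sm g permutes V"
  and d: "card (bdry G S K) \<le> ep * card K" "ep > 0"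
  and Vg: "Vg \<subseteq> V" "2 * card (V - Vg) \<le> et * card V"
  and good: "\<And>v. v \<in> Vg ==> inj_on (\<lambda>k. sm k v) K"
   "\<And>v s k. v \<in> Vg ==> s \<in> S ==> k \<in> K ==> sm (s \<otimes> k) v = sm s (sm k v)"
 shows "\<exists>I. finite I \<and> (\<forall>(v, X)\<in>I. v \<in> Vg \<and> X \<subseteq> K) \<and>
  (\<forall>i\<in>I. \<forall>j\<in>I. i \<noteq> j --> (\<lambda>g. sm g (fst i)) ` snd i \<inter> (\<lambda>g. sm g (fst j)) ` snd j = {}) \<and>
  card (V - (\<Union>(v, X)\<in>I. (\<lambda>g. sm g v) ` X)) \<le> et * card V \<and>
  (\<Sum>(v, X)\<in>I. card (bdry G S X)) \<le> 2 * ep * (1 + card S) * card V"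
proof -
 define Z where "Z = (\<lambda>i. (\<lambda>g. sm g (fst i)) ` snd i)"
 \<comment> \<open>The boundary relative to the part \<open>U\<close> still present: a neighbour
   that has already been removed does not count. For \<open>U = V\<close> this contains the full
   boundary.\<close>
 define bd where "bd = (\<lambda>U i. {x \<in> snd i. \<exists>s\<in>S. s \<otimes> x \<notin> snd i \<and> (s \<otimes> x \<in> K --> sm (s \<otimes> x) (fst i) \<in> U)})"
 define d where "d = bdry G S K"
 have fd: "finite d" unfolding d_def using fin by auto
 let ?P = "\<lambda>U I. finite I \<and> (\<forall>i\<in>I. fst i \<in> Vg \<and> snd i \<subseteq> K) \<and> (\<forall>i\<in>I. Z i \<subseteq> U) \<and>
   (\<forall>i\<in>I. \<forall>j\<in>I. i \<noteq> j --> Z i \<inter> Z j = {}) \<and> card (U - (\<Union>i\<in>I. Z i)) \<le> et * card V \<and>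
   (\<Sum>i\<in>I. card (bd U i)) \<le> 2 * ep * (1 + card S) * card (\<Union>i\<in>I. Z i)"
 have ind: "\<exists>I. ?P U I" if "U \<subseteq> V" for U
  using that
 proof (induction "card U" arbitrary: U rule: less_induct)
  case less
  show ?case
  proof (cases "card U \<le> et * card V")
   case True
   then show ?thesis by (intro exI[of _ "{}"]) auto
  next
   case False
   then have big: "2 * card (V - Vg) < card U" using Vg(2) by linarith
   have dK: "d \<subseteq> K" unfolding d_def by blast
   have de: "card d \<le> ep * card K" unfolding d_def by (rule assms(9))
   have "\<exists>v\<in>Vg. (hits K sm U v) \<noteq> {} \<and>
     card ((hits K sm U v) \<inter> d) \<le> 2 * ep * card (hits K sm U v)"
    by (rule exists_efficient_tile[OF fin(1-3) perm less.prems dK de assms(10) big Vg(1)]) (use fin(4) in blast)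
   then obtain v where v: "v \<in> Vg" "hits K sm U v \<noteq> {}"
    "card ((hits K sm U v) \<inter> d) \<le> 2 * ep * card (hits K sm U v)"
    by (elim bexE conjE)
   define X where "X = hits K sm U v"
   define i0 where "i0 = (v, X)"
   have XK: "X \<subseteq> K" "finite X" "X \<noteq> {}" unfolding X_def using fin v(2) by auto
   have Z0: "Z i0 \<subseteq> U" "Z i0 \<noteq> {}" unfolding Z_def i0_def X_def using v(2) by auto
   define U' where "U' = U - Z i0"
   have fU: "finite U" using less.prems fin(1) finite_subset by blast
   have lt: "card U' < card U" unfolding U'_def using Z0 fU by (intro psubset_card_mono) auto
   have U'V: "U' \<subseteq> V" unfolding U'_def using less.prems by blast
   obtain I' where "?P U' I'" using less.hyps[OF lt U'V] by (elim exE)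
   then have I': "finite I'" "\<And>i. i \<in> I' ==> fst i \<in> Vg \<and> snd i \<subseteq> K" "\<And>i. i \<in> I' ==> Z i \<subseteq> U'"
    "\<And>i j. i \<in> I' ==> j \<in> I' ==> i \<noteq> j ==> Z i \<inter> Z j = {}"
    "card (U' - (\<Union>i\<in>I'. Z i)) \<le> et * card V"
    "(\<Sum>i\<in>I'. card (bd U' i)) \<le> 2 * ep * (1 + card S) * card (\<Union>i\<in>I'. Z i)"
    by (simp_all only: Ball_def) (blast+)?
   have new: "i0 \<notin> I'" using I'(3)[of i0] Z0 unfolding U'_def by blast
   \<comment> \<open>The points of later pieces that become boundary points when the piece
     \<open>i0\<close> is put back into the set.\<close>
   define E where "E = (\<lambda>i. {x \<in> snd i. \<exists>s\<in>S. s \<otimes> x \<in> K \<and> sm (s \<otimes> x) (fst i) \<in> Z i0})"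
   have bdE: "card (bd U i) \<le> card (bd U' i) + card (E i)" if "i \<in> I'" for i
   proof -
    have fi: "finite (snd i)" using I'(2)[OF that] fin(2) finite_subset by blast
    have "bd U i \<subseteq> bd U' i \<union> E i" unfolding bd_def E_def U'_def by blast
    then have "card (bd U i) \<le> card (bd U' i \<union> E i)"
     using fi by (intro card_mono) (auto simp: bd_def E_def)
    then show ?thesis using card_Un_le[of "bd U' i" "E i"] by linarith
   qed
   have E_le: "(\<Sum>i\<in>I'. card (E i)) \<le> card S * card (X \<inter> d)"
   proof -
    let ?Y = "\<lambda>s. {z \<in> V. sm s z \<in> (\<lambda>g. sm g v) ` (X \<inter> d)}"
    define ZE where "ZE = (\<lambda>i. (\<lambda>g. sm g (fst i)) ` E i)"
    have EX: "E i \<subseteq> snd i" for i unfolding E_def by blast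
    have "card (ZE i) = card (E i)" if "i \<in> I'" for i
     unfolding ZE_def using good(1) I'(2)[OF that] EX[of i] by (meson card_image inj_on_subset)
    then have "(\<Sum>i\<in>I'. card (E i)) = (\<Sum>i\<in>I'. card (ZE i))" by simp
    also have "\<dots> = card (\<Union>i\<in>I'. ZE i)"
    proof (rule card_UN_disjoint[symmetric, OF I'(1)])
     show "\<forall>i\<in>I'. finite (ZE i)"
      unfolding ZE_def using EX I'(2) fin(2) by (meson finite_imageI finite_subset)
     show "\<forall>i\<in>I'. \<forall>j\<in>I'. i \<noteq> j --> ZE i \<inter> ZE j = {}"
     proof (intro ballI impI)
      fix i j assume "i \<in> I'" "j \<in> I'" "i \<noteq> j"
      moreover have "ZE i \<subseteq> Z i" "ZE j \<subseteq> Z j" unfolding ZE_def Z_def using EX by blast+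
      ultimately show "ZE i \<inter> ZE j = {}" using I'(4)[of i j] by blast
     qed
    qed
    also have "\<dots> \<le> card (\<Union>s\<in>S. ?Y s)"
    proof (rule card_mono)
     show "finite (\<Union>s\<in>S. ?Y s)" using S fin by auto
     show "(\<Union>i\<in>I'. ZE i) \<subseteq> (\<Union>s\<in>S. ?Y s)"
     proof
      fix z assume "z \<in> (\<Union>i\<in>I'. ZE i)"
      then obtain i x s where i: "i \<in> I'" "x \<in> snd i" "s \<in> S" "s \<otimes> x \<in> K"
       "sm (s \<otimes> x) (fst i) \<in> Z i0" "z = sm x (fst i)" unfolding ZE_def E_def by blast
      have xK: "x \<in> K" and iVg: "fst i \<in> Vg" using i I'(2) by blast+
      have sz: "sm s z = sm (s \<otimes> x) (fst i)" using good(2)[OF iVg i(3) xK] i(6) by simp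
      obtain x0 where x0: "x0 \<in> X" "sm s z = sm x0 v" using i(5) sz unfolding Z_def i0_def by auto
      have zU': "z \<in> U'" using i I'(3)[OF i(1)] unfolding Z_def by blast
      have sC: "s \<in> carrier G" "x0 \<in> carrier G" using i(3) S x0 XK fin by auto
      \<comment> \<open>If \<open>x0\<close> were interior, stepping back by \<open>inv s\<close>
        would stay inside \<open>K\<close> and put z into the piece \<open>i0\<close>, which has
        just been removed.\<close>
      have "x0 \<in> d"
      proof (rule ccontr)
       assume "x0 \<notin> d"
       then have k: "inv s \<otimes> x0 \<in> K" using x0 XK i(3) S(3) unfolding d_def by blast
       have "sm s (sm (inv s \<otimes> x0) v) = sm (s \<otimes> (inv s \<otimes> x0)) v"
        using good(2)[OF v(1) i(3) k] by simp
       also have "\<dots> = sm s z" using x0(2) sC by (simp add: m_assoc[symmetric])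
       finally have "z = sm (inv s \<otimes> x0) v" using permutes_inj[OF perm[OF sC(1)]] by (simp add: inj_eq)
       then have "z \<in> Z i0" using k zU' unfolding Z_def i0_def X_def U'_def by auto
       then show False using zU' unfolding U'_def by blast
      qed
      moreover have "z \<in> V" using zU' less.prems unfolding U'_def by blast
      ultimately show "z \<in> (\<Union>s\<in>S. ?Y s)"
       using i(3) x0 by blast
     qed
    qed
    also have "\<dots> \<le> (\<Sum>s\<in>S. card (?Y s))"
     by (rule card_UN_le[OF S(1)])
    also have "\<dots> \<le> (\<Sum>s\<in>S. card (X \<inter> d))"
    proof (rule sum_mono)
     fix s assume s: "s \<in> S"
     have "inj_on (sm s) (?Y s)"
      using permutes_inj_on[OF perm] s S by blast
     then have "card (?Y s) \<le> card ((\<lambda>g. sm g v) ` (X \<inter> d))"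
      by (rule card_inj_on_le) (use XK in auto)
     also have "\<dots> \<le> card (X \<inter> d)" using XK by (intro card_image_le) auto
     finally show "card (?Y s) \<le> card (X \<inter> d)" .
    qed
    finally show ?thesis by simp
   qed
   have bd0: "card (bd U i0) \<le> card (X \<inter> d)"
    using XK by (intro card_mono) (auto simp: bd_def i0_def X_def d_def)
   have cZ0: "card (Z i0) = card X"
    unfolding Z_def i0_def using good(1)[OF v(1)] XK(1) by (simp add: card_image inj_on_subset)
   have cZ: "card (\<Union>i\<in>insert i0 I'. Z i) = card X + card (\<Union>i\<in>I'. Z i)"
   proof -
    have "Z i0 \<inter> (\<Union>i\<in>I'. Z i) = {}" using I'(3) unfolding U'_def by blast
    moreover have "(\<Union>i\<in>I'. Z i) \<subseteq> U" using I'(3) unfolding U'_def by blast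
    then have "finite (\<Union>i\<in>I'. Z i)" using fU by (rule finite_subset)
    moreover have "finite (Z i0)" using Z0(1) fU by (rule finite_subset)
    ultimately show ?thesis using cZ0 by (simp add: card_Un_disjoint)
   qed
   have "(\<Sum>i\<in>insert i0 I'. card (bd U i)) = card (bd U i0) + (\<Sum>i\<in>I'. card (bd U i))"
    using new I'(1) by simp
   also have "(\<Sum>i\<in>I'. card (bd U i)) \<le> (\<Sum>i\<in>I'. card (bd U' i)) + (\<Sum>i\<in>I'. card (E i))"
    unfolding sum.distrib[symmetric] using bdE by (rule sum_mono)
   finally have "(\<Sum>i\<in>insert i0 I'. card (bd U i)) \<le> (\<Sum>i\<in>I'. card (bd U' i)) + (1 + card S) * card (X \<inter> d)"
    using bd0 E_le by (simp add: algebra_simps)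
   then have "real (\<Sum>i\<in>insert i0 I'. card (bd U i)) \<le> (\<Sum>i\<in>I'. card (bd U' i)) + real (1 + card S) * card (X \<inter> d)"
    unfolding of_nat_mult[symmetric] of_nat_add[symmetric] of_nat_le_iff .
   also have "\<dots> \<le> 2 * ep * (1 + card S) * card (\<Union>i\<in>I'. Z i) + real (1 + card S) * (2 * ep * card X)"
    using I'(6) v(3) unfolding X_def by (intro add_mono mult_left_mono) auto
   also have "\<dots> = 2 * ep * (1 + card S) * card (\<Union>i\<in>insert i0 I'. Z i)"
    unfolding cZ by (simp add: algebra_simps)
   finally have b: "real (\<Sum>i\<in>insert i0 I'. card (bd U i)) \<le> 2 * ep * (1 + card S) * card (\<Union>i\<in>insert i0 I'. Z i)" .
   have r: "U - (\<Union>i\<in>insert i0 I'. Z i) = U' - (\<Union>i\<in>I'. Z i)" unfolding U'_def by auto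
   show ?thesis
   proof (rule exI[of _ "insert i0 I'"], intro conjI)
    show "finite (insert i0 I')" using I'(1) by simp
    show "\<forall>i\<in>insert i0 I'. fst i \<in> Vg \<and> snd i \<subseteq> K" using I'(2) v XK unfolding i0_def by auto
    show "\<forall>i\<in>insert i0 I'. Z i \<subseteq> U" using I'(3) Z0 unfolding U'_def by blast
    show "\<forall>i\<in>insert i0 I'. \<forall>j\<in>insert i0 I'. i \<noteq> j --> Z i \<inter> Z j = {}"
     using I'(3,4) unfolding U'_def by blast
    show "card (U - (\<Union>i\<in>insert i0 I'. Z i)) \<le> et * card V" unfolding r by (rule I'(5))
    show "(\<Sum>i\<in>insert i0 I'. card (bd U i)) \<le> 2 * ep * (1 + card S) * card (\<Union>i\<in>insert i0 I'. Z i)" by (rule b)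
   qed
  qed
 qed
 obtain I where I: "finite I" "\<forall>i\<in>I. fst i \<in> Vg \<and> snd i \<subseteq> K" "\<forall>i\<in>I. Z i \<subseteq> V"
   "\<forall>i\<in>I. \<forall>j\<in>I. i \<noteq> j --> Z i \<inter> Z j = {}" "card (V - (\<Union>i\<in>I. Z i)) \<le> et * card V"
   "(\<Sum>i\<in>I. card (bd V i)) \<le> 2 * ep * (1 + card S) * card (\<Union>i\<in>I. Z i)"
  using ind[OF order_refl] by (elim exE conjE) (rule that)
 have "card (bdry G S (snd i)) \<le> card (bd V i)" if i: "i \<in> I" for i
 proof (rule card_mono)
  have iK: "snd i \<subseteq> K" "fst i \<in> Vg" using I(2) i by blast+
  have "finite (snd i)" using iK(1) fin(2) by (rule finite_subset)
  then show "finite (bd V i)" unfolding bd_def by simp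
  have "sm k (fst i) \<in> V" if "k \<in> K" for k
   using permutes_in_image[OF perm, of k "fst i"] that fin(4) iK(2) Vg(1) by blast
  then show "bdry G S (snd i) \<subseteq> bd V i" unfolding bd_def by blast
 qed
 then have "(\<Sum>i\<in>I. card (bdry G S (snd i))) \<le> (\<Sum>i\<in>I. card (bd V i))" by (rule sum_mono)
 then have "real (\<Sum>i\<in>I. card (bdry G S (snd i))) \<le> 2 * ep * (1 + card S) * card (\<Union>i\<in>I. Z i)"
  using I(6) by linarith
 also have "\<dots> \<le> 2 * ep * (1 + card S) * card V"
  using I(3) fin(1) assms(10) by (intro mult_left_mono of_nat_mono card_mono) auto
 finally have b: "(\<Sum>i\<in>I. card (bdry G S (snd i))) \<le> 2 * ep * (1 + card S) * card V" .
 show ?thesis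
  using I(1,2,4,5) b unfolding Z_def by (intro exI[of _ I]) (simp add: case_prod_unfold)
qed

section \<open>Sparse connectivity relative to a subgroup\<close>

text \<open>The group element is recorded along with the vertex, because a cocycle value belongs to
  the element. Confining the partial products to a finite \<open>A\<close> allows multiplicativity
  of \<open>sm\<close> for all of them at once, at almost every point.\<close>

inductive reach :: "('g, 'c) monoid_scheme => ('g => 'v => 'v) => ('g \<times> 'v) set => 'g set => 'v => 'g => bool"
 for G sm D A w where
 reach_one: "\<one>\<^bsub>G\<^esub> \<in> A ==> reach G sm D A w \<one>\<^bsub>G\<^esub>"
| reach_step: "reach G sm D A w t ==> (s, sm t w) \<in> D ==> s \<otimes>\<^bsub>G\<^esub> t \<in> A ==> reach G sm D A w (s \<otimes>\<^bsub>G\<^esub> t)"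

text \<open>A relative form of the sparse connectivity property: points of \<open>W\<close> which differ by an element of \<open>T\<close> are
 joined by a path of steps \<open>(s, u) \<in> D\<close>, and \<open>D\<close> is so sparse that recording at each of its steps an amount of
 information \<open>c' s\<close> is cheap. The set \<open>S\<close> is chosen before \<open>T\<close>, and \<open>A\<close> before the sofic approximation.\<close>

definition sparse_at :: "('g, 'c) monoid_scheme => 'v set => ('g => 'v => 'v) => ('g => real) =>
  'g set => 'g set => 'g set => real => real => bool" where
 "sparse_at G V sm c' S T A c ep \<longleftrightarrow> (\<exists>W D. W \<subseteq> V \<and> D \<subseteq> A \<times> V \<and> (\<Sum>(s, u)\<in>D. c' s) \<le> c * rcard V \<and>
   rcard (V - cover S sm W) \<le> ep * rcard V \<and>
   (\<forall>w\<in>W. \<forall>t\<in>T. sm t w \<in> W --> reach G sm D A w t))"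

abbreviation "ev_sparse G V sm c' S T c ep \<equiv>
 \<exists>A. finite A \<and> A \<subseteq> carrier G \<and> (\<forall>\<^sub>F k in sequentially. sparse_at G (V k) (sm k) c' S T A c ep)"

definition sparse_conn :: "('g, 'c) monoid_scheme => (nat => 'v set) => (nat => 'g => 'v => 'v) => ('g => real) =>
  'g set => 'g set => real => bool" where
 "sparse_conn G V sm c' S K c \<longleftrightarrow> (\<forall>T ep. finite T \<and> T \<subseteq> K \<and> ep > 0 --> ev_sparse G V sm c' S T c ep)"

lemma sparse_atI:
 assumes "W \<subseteq> V" "D \<subseteq> A \<times> V" "(\<Sum>(s, u)\<in>D. c' s) \<le> c * rcard V"
  "rcard (V - cover S sm W) \<le> ep * rcard V"
  "\<And>w t. w \<in> W ==> t \<in> T ==> sm t w \<in> W ==> reach G sm D A w t"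
 shows "sparse_at G V sm c' S T A c ep"
 unfolding sparse_at_def by (rule exI[of _ W], rule exI[of _ D]) (intro conjI ballI impI assms)

lemma sparse_atE:
 assumes "sparse_at G V sm c' S T A c ep"
 obtains W D where "W \<subseteq> V" "D \<subseteq> A \<times> V" "(\<Sum>(s, u)\<in>D. c' s) \<le> c * rcard V"
  "rcard (V - cover S sm W) \<le> ep * rcard V"
  "\<forall>w\<in>W. \<forall>t\<in>T. sm t w \<in> W --> reach G sm D A w t"
 using assms unfolding sparse_at_def by (elim exE conjE) (rule that)

abbreviation "sparse_within G V sm c' N \<equiv> \<exists>S. finite S \<and> S \<subseteq> N \<and> (\<forall>c>1. sparse_conn G V sm c' S N c)"

lemma sparse_connI:
 assumes "\<And>T ep. finite T ==> T \<subseteq> K ==> ep > 0 ==> ev_sparse G V sm c' S T c ep"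
 shows "sparse_conn G V sm c' S K c"
 unfolding sparse_conn_def by (intro allI impI, elim conjE) (rule assms)

lemma sparse_connE:
 assumes "sparse_conn G V sm c' S K c" "finite T" "T \<subseteq> K" "ep > 0"
 obtains A where "finite A" "A \<subseteq> carrier G" "\<forall>\<^sub>F k in sequentially. sparse_at G (V k) (sm k) c' S T A c ep"
 using assms(1)[unfolded sparse_conn_def, rule_format, OF conjI[OF assms(2) conjI[OF assms(3,4)]]] by (elim exE conjE) (rule that)

text \<open>At these points the approximation behaves like a free action as far as \<open>A\<close>
  can see; all exact computations are made there.\<close>

definition good_pts :: "('g, 'c) monoid_scheme => 'v set => ('g => 'v => 'v) => 'g set => 'v set" where
 "good_pts G V sm A = {v \<in> V. \<forall>g\<in>A. \<forall>h\<in>A. sm (g \<otimes>\<^bsub>G\<^esub> h) v = sm g (sm h v) \<and> (g \<noteq> h --> sm g v \<noteq> sm h v)}"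

lemma good_pts_mult: "v \<in> good_pts G V sm A ==> g \<in> A ==> h \<in> A ==> sm (g \<otimes>\<^bsub>G\<^esub> h) v = sm g (sm h v)"
 unfolding good_pts_def by blast

lemma good_pts_inj: "v \<in> good_pts G V sm A ==> g \<in> A ==> h \<in> A ==> sm g v = sm h v ==> g = h"
 unfolding good_pts_def by blast

lemma reach_mem: "reach G sm D A w t ==> t \<in> A"
 by (induction rule: reach.induct) auto

lemma sofic_approx_permutes: "sofic_approx G V sm ==> g \<in> carrier G ==> sm g permutes V"
 unfolding sofic_approx_def by blast

lemma card_vimage_permutes:
 assumes "pe permutes V" "finite V" "B \<subseteq> V"
 shows "card {v \<in> V. pe v \<in> B} = card B"
proof -
 have "card (pe ` {v \<in> V. pe v \<in> B}) = card {v \<in> V. pe v \<in> B}"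
  by (rule card_image[OF permutes_inj_on[OF assms(1)]])
 moreover have "pe ` {v \<in> V. pe v \<in> B} = B"
 proof
  show "B \<subseteq> pe ` {v \<in> V. pe v \<in> B}"
  proof
   fix u assume u: "u \<in> B"
   then obtain v where "v \<in> V" "u = pe v" using permutes_image[OF assms(1)] assms(3) by blast
   then show "u \<in> pe ` {v \<in> V. pe v \<in> B}" using u by blast
  qed
 qed auto
 ultimately show ?thesis by simp
qed

lemma card_UN_vimage_permutes:
 assumes "finite A" "finite V" "B \<subseteq> V" "\<And>g. g \<in> A ==> sm g permutes V"
 shows "card (\<Union>g\<in>A. {v \<in> V. sm g v \<in> B}) \<le> card A * card B"
proof -
 have "card (\<Union>g\<in>A. {v \<in> V. sm g v \<in> B}) \<le> (\<Sum>g\<in>A. card {v \<in> V. sm g v \<in> B})" by (rule card_UN_le[OF assms(1)])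
 also have "\<dots> = (\<Sum>g\<in>A. card B)" using assms(2-4) by (intro sum.cong refl card_vimage_permutes)
 finally show ?thesis by simp
qed

lemma card_uncovered:
 assumes "finite S" "finite X" "B \<subseteq> X"
 shows "card (X - (\<Union>s\<in>S. ta s ` (W - B))) \<le> card (X - cover S ta W) + card S * card B"
proof -
 have fB: "finite B" using assms(2,3) finite_subset by blast
 have "card (X - (\<Union>s\<in>S. ta s ` (W - B))) \<le> card ((X - cover S ta W) \<union> cover S ta B)"
 proof (rule card_mono)
  show "finite ((X - cover S ta W) \<union> cover S ta B)" using assms fB by blast
 qed blast
 also have "\<dots> \<le> card (X - cover S ta W) + (\<Sum>s\<in>S. card (ta s ` B))"
  by (intro order_trans[OF card_Un_le] add_mono order_refl card_UN_le assms)
 also have "(\<Sum>s\<in>S. card (ta s ` B)) \<le> (\<Sum>s\<in>S. card B)" using fB by (intro sum_mono card_image_le)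
 finally show ?thesis by simp
qed

lemma sum_cost_Times:
 fixes c' :: "'s => real"
 shows "(\<Sum>(s, u)\<in>A \<times> U. c' s) = (\<Sum>s\<in>A. c' s) * card U"
 by (simp add: sum.cartesian_product[symmetric] sum_distrib_right mult.commute)

lemma sum_cost_le:
 fixes c' :: "'s => real"
 assumes "\<And>g. c' g \<ge> 0" "finite (A \<times> U)" "finite E"
 shows "(\<Sum>(s, u)\<in>E \<union> A \<times> U. c' s) \<le> (\<Sum>(s, u)\<in>E. c' s) + (\<Sum>s\<in>A. c' s) * card U"
proof -
 have "(\<Sum>(s, u)\<in>E \<union> A \<times> U. c' s) \<le> (\<Sum>(s, u)\<in>E. c' s) + (\<Sum>(s, u)\<in>A \<times> U. c' s)"
  using assms by (subst sum.union_inter[symmetric]) (auto simp: sum_nonneg case_prod_unfold)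
 then show ?thesis unfolding sum_cost_Times .
qed

text \<open>Disjointness of the translates makes \<open>W\<close> as sparse as \<open>Q\<close> is
  large, while maximality lets every point of \<open>Y\<close> reach \<open>W\<close> by an element
  of the form inv y x with x and y in \<open>Q\<close>.\<close>

lemma sparse_net:
 fixes Q :: "'q set" and gm :: "'q => 'v => 'v"
 assumes Z: "finite Z" "Y \<subseteq> Z" and Q: "Q \<noteq> {}" "finite Q" "\<And>x v. x \<in> Q ==> v \<in> Z ==> gm x v \<in> Z"
  and inj: "\<And>w x y. w \<in> Y ==> x \<in> Q ==> y \<in> Q ==> gm x w = gm y w ==> x = y"
 obtains W where "W \<subseteq> Y" "card Q * card W \<le> card Z" "\<forall>d\<in>Y. \<exists>w\<in>W. \<exists>x\<in>Q. \<exists>y\<in>Q. gm x d = gm y w"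
proof -
 define conf where "conf = (\<lambda>v w. \<exists>x\<in>Q. \<exists>y\<in>Q. gm x v = gm y w)"
 have fY: "finite Y" using Z finite_subset by blast
 have cr: "conf d d" for d unfolding conf_def using Q(1) by blast
 have cs: "conf x y ==> conf y x" for x y unfolding conf_def by metis
 obtain W where W: "W \<subseteq> Y" "\<forall>x\<in>W. \<forall>y\<in>W. x \<noteq> y --> \<not> conf x y" "\<forall>d\<in>Y. \<exists>y\<in>W. conf d y"
  using maximal_conflict_free_subset[OF fY, of conf] cr cs by blast
 have "card Q * card W = card ((\<lambda>(x, w). gm x w) ` (Q \<times> W))"
  unfolding card_cartesian_product[symmetric]
 proof (rule card_image[symmetric], rule inj_onI, clarify)
  fix x w y v assume g: "x \<in> Q" "w \<in> W" "y \<in> Q" "v \<in> W" "gm x w = gm y v"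
  then have "w = v" using W(2) unfolding conf_def by blast
  then show "x = y \<and> w = v" using inj[of w x y] g W(1) by blast
 qed
 also have "\<dots> \<le> card Z"
 proof (rule card_mono[OF Z(1)], rule image_subsetI, clarify)
  fix x w assume "x \<in> Q" "w \<in> W"
  then show "gm x w \<in> Z" using Z(2) Q(3) W(1) by blast
 qed
 finally show ?thesis using that[OF W(1)] W(3) unfolding conf_def by blast
qed

context group
begin

lemma good_pts_one:
 assumes "sofic_approx G V sm" "v \<in> good_pts G V sm A" "\<one> \<in> A"
 shows "sm \<one> v = v"
proof -
 have "sm \<one> (sm \<one> v) = sm \<one> v" using good_pts_mult[OF assms(2,3,3)] by simp
 then show ?thesis
  using permutes_inj[OF sofic_approx_permutes[OF assms(1) one_closed]] by (simp add: inj_eq)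
qed

lemma card_good_pts:
 fixes dl :: real
 assumes s: "sofic_approx G V sm" and g: "good_approx G A dl V sm" and A: "finite A"
 shows "card (V - good_pts G V sm A) \<le> 2 * (card A)\<^sup>2 * dl * card V"
proof -
 have fin: "finite V" "card V > 0" using s unfolding sofic_approx_def by (auto simp: card_gt_0_iff)
 define B where "B = (\<lambda>(g, h). {v \<in> V. sm (g \<otimes> h) v \<noteq> (sm g \<circ> sm h) v} \<union> {v \<in> V. g \<noteq> h \<and> sm g v = sm h v})"
 have cB: "rcard (B (g, h)) \<le> 2 * dl * card V" if gh: "g \<in> A" "h \<in> A" for g h
 proof -
  have "hamming_dist V (sm (g \<otimes> h)) (sm g \<circ> sm h) \<le> dl"
   using g gh unfolding good_approx_def by blast
  then have 1: "rcard {v \<in> V. sm (g \<otimes> h) v \<noteq> (sm g \<circ> sm h) v} \<le> dl * card V"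
   using fin unfolding hamming_dist_def by (simp add: pos_divide_le_eq)
  have "0 \<le> dl * card V" using 1 by linarith
  have 2: "rcard {v \<in> V. g \<noteq> h \<and> sm g v = sm h v} \<le> dl * card V"
  proof (cases "g = h")
   case False
   then have "1 - dl \<le> hamming_dist V (sm g) (sm h)"
    using g gh unfolding good_approx_def by blast
   then have "(1 - dl) * card V \<le> card {v \<in> V. sm g v \<noteq> sm h v}"
    using fin unfolding hamming_dist_def by (simp add: pos_le_divide_eq)
   moreover have "card V = card {v \<in> V. sm g v \<noteq> sm h v} + card {v \<in> V. g \<noteq> h \<and> sm g v = sm h v}"
    using fin False by (subst card_Un_disjoint[symmetric]) (auto intro: arg_cong[where f = card])
   ultimately show ?thesis by (simp add: algebra_simps)
  qed (use \<open>0 \<le> dl * card V\<close> in simp)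
  have "card (B (g, h)) \<le> card {v \<in> V. sm (g \<otimes> h) v \<noteq> (sm g \<circ> sm h) v} + card {v \<in> V. g \<noteq> h \<and> sm g v = sm h v}"
   unfolding B_def prod.case by (rule card_Un_le)
  then show ?thesis using 1 2 by linarith
 qed
 have "V - good_pts G V sm A \<subseteq> (\<Union>p\<in>A \<times> A. B p)"
 proof
  fix v assume "v \<in> V - good_pts G V sm A"
  then obtain g h where "g \<in> A" "h \<in> A" "v \<in> B (g, h)"
   unfolding good_pts_def B_def by fastforce
  then show "v \<in> (\<Union>p\<in>A \<times> A. B p)" by blast
 qed
 then have "card (V - good_pts G V sm A) \<le> card (\<Union>p\<in>A \<times> A. B p)"
  using A fin by (intro card_mono) (auto simp: B_def)
 also have "\<dots> \<le> (\<Sum>p\<in>A \<times> A. card (B p))" using A by (intro card_UN_le) auto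
 finally have "rcard (V - good_pts G V sm A) \<le> (\<Sum>p\<in>A \<times> A. rcard (B p))"
  unfolding of_nat_sum[symmetric] of_nat_le_iff .
 also have "\<dots> \<le> (\<Sum>p\<in>A \<times> A. 2 * dl * card V)" using cB by (intro sum_mono) auto
 also have "\<dots> = 2 * (card A)\<^sup>2 * dl * card V"
  by (simp add: card_cartesian_product power2_eq_square)
 finally show ?thesis .
qed

lemma eventually_good_pts:
 fixes gm :: real
 assumes s: "sofic_approx_seq G V sm" and A: "finite A" "A \<subseteq> carrier G" and "gm > 0"
 shows "\<forall>\<^sub>F k in sequentially. card (V k - good_pts G (V k) (sm k) A) \<le> gm * card (V k)"
proof -
 define dl where "dl = gm / (2 * ((card A)\<^sup>2 + 1))"
 have den: "(rcard A)\<^sup>2 + 1 > 0" by (simp add: add_nonneg_pos)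
 then have "dl > 0" unfolding dl_def using assms(4) by simp
 then have "\<forall>\<^sub>F k in sequentially. good_approx G A dl (V k) (sm k)"
  using s A unfolding sofic_approx_seq_def by blast
 moreover have "2 * (card A)\<^sup>2 * dl \<le> gm"
  unfolding dl_def using assms(4) den by (simp add: field_simps)
 ultimately show ?thesis
 proof (elim eventually_mono)
  fix k assume "good_approx G A dl (V k) (sm k)"
  then have "card (V k - good_pts G (V k) (sm k) A) \<le> 2 * (card A)\<^sup>2 * dl * card (V k)"
   using card_good_pts[of "V k" "sm k" A dl] s A unfolding sofic_approx_seq_def by blast
  also have "\<dots> \<le> gm * card (V k)" using \<open>2 * (card A)\<^sup>2 * dl \<le> gm\<close> by (rule mult_right_mono) simp
  finally show "card (V k - good_pts G (V k) (sm k) A) \<le> gm * card (V k)" .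
 qed
qed

lemma reach_mono:
 "reach G sm D A w t ==> D \<subseteq> D' ==> A \<subseteq> A' ==> reach G sm D' A' w t"
 by (induction rule: reach.induct) (auto intro: reach.intros)

text \<open>When a path is continued behind \<open>p\<close>, the partial products a of the
  continuation turn into a p; these must lie in \<open>A\<close> and be points of multiplicativity
  at \<open>w\<close>.\<close>

lemma reach_trans:
 assumes r: "reach G sm D0 A0 w' y" and w': "w' = sm p w" and p: "reach G sm D A w p" "p \<in> carrier G"
  and sub: "D0 \<subseteq> D" "D0 \<subseteq> A0 \<times> V" "A0 \<subseteq> carrier G"
  and A: "\<And>a. a \<in> A0 ==> a \<otimes> p \<in> A \<and> sm (a \<otimes> p) w = sm a (sm p w)"
 shows "reach G sm D A w (y \<otimes> p)"
 using r
proof (induction rule: reach.induct)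
 case reach_one
 then show ?case using p by simp
next
 case (reach_step t s)
 have t: "t \<in> A0" using reach_mem[OF reach_step(1)] .
 have st: "s \<otimes> t \<otimes> p = s \<otimes> (t \<otimes> p)"
  using reach_step t sub p(2) by (intro m_assoc) auto
 have "(s, sm (t \<otimes> p) w) \<in> D" using reach_step A[OF t] sub w' by auto
 then show ?case unfolding st
  using reach.reach_step[OF reach_step.IH] A[OF reach_step.hyps(3)] st by simp
qed

text \<open>A path from \<open>w\<close> to \<open>t w\<close> for \<open>t\<close> in the bigger group first moves inside the smaller one to a point of a very
 sparse set \<open>W1\<close>, then uses \<open>t\<close> there, and comes back inside the smaller group.\<close>

lemma sparse_conn_normal_step:
 fixes c' :: "'a => real"
 assumes s: "sofic_approx_seq G V sm" and c': "\<And>g. c' g \<ge> 0"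
  and N: "subgroup N G" "infinite N" "finite S" "S \<subseteq> N" and K: "subgroup K G" "N \<subseteq> K" "K' \<subseteq> carrier G"
  and nor: "\<And>t x. t \<in> K' ==> x \<in> K ==> t \<otimes> x \<otimes> inv t \<in> K"
  and IH: "\<And>c. c > c0 ==> sparse_conn G V sm c' S K c" and c: "c > c0"
 shows "sparse_conn G V sm c' S K' c"
proof (rule sparse_connI)
 fix T and ep :: real assume T: "finite T" "T \<subseteq> K'" and eps: "ep > 0"
 \<comment> \<open>One half of the slack between \<open>c0\<close> and \<open>c\<close> goes to the
   induction hypothesis, the other half pays for the steps \<open>D2\<close> at the very sparse set
   \<open>W1\<close>.\<close>
 define c1 where "c1 = (c0 + c) / 2"
 have c1: "c1 > c0" "c1 < c" using c unfolding c1_def by auto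
 define D2 where "D2 = (\<lambda>(s, t). inv s \<otimes> t) ` (S \<times> T)"
 define C2 where "C2 = (\<Sum>d\<in>D2. c' d)"
 have C2: "C2 \<ge> 0" unfolding C2_def using c' by (simp add: sum_nonneg)
 obtain q0 :: nat where "C2 / (c - c1) \<le> q0" using real_arch_simple by blast
 define q where "q = Suc q0"
 have q: "C2 \<le> (c - c1) * q" "q \<ge> 1"
  using \<open>C2 / (c - c1) \<le> q0\<close> c1 unfolding q_def by (auto simp: field_simps)
 \<comment> \<open>The \<open>Q\<close>-translates of \<open>W1\<close> will be disjoint, so this
   size makes \<open>C2 * card W1\<close> at most \<open>(c - c1) * card X\<close>.\<close>
 obtain Q where Q: "Q \<subseteq> N" "finite Q" "card Q = q" using infinite_arbitrarily_large[OF N(2)] by blast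
 have NC: "N \<subseteq> carrier G" using N(1) by (rule subgroup.subset)
 have KC: "K \<subseteq> carrier G" using K(1) by (rule subgroup.subset)
 define Q' where "Q' = (\<lambda>(x, y). inv x \<otimes> y) ` (Q \<times> Q)"
 have Q': "finite Q'" "Q' \<subseteq> N"
  unfolding Q'_def using Q N(1) by (auto simp: subgroup.m_closed subgroup.m_inv_closed subset_iff)
 define Y where "Y = (\<lambda>(t, x, s). t \<otimes> inv x \<otimes> inv t \<otimes> s) ` (T \<times> Q' \<times> S)"
 have Y: "finite Y" "Y \<subseteq> K"
 proof -
  show "finite Y" unfolding Y_def using T Q' N by auto
  have "t \<otimes> inv x \<otimes> inv t \<otimes> s \<in> K" if h: "t \<in> T" "x \<in> Q'" "s \<in> S" for t x s
  proof -
   have "inv x \<in> K" using h Q' K by (auto simp: subgroup.m_inv_closed subset_iff)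
   then have "t \<otimes> inv x \<otimes> inv t \<in> K" using nor h T by blast
   then show ?thesis using h N K by (auto simp: subgroup.m_closed subset_iff)
  qed
  then show "Y \<subseteq> K" unfolding Y_def by auto
 qed
 define nn where "nn = 1 + rcard Q' + rcard Q' * card T"
 define gm where "gm = ep / (1 + card S * nn)"
 have nn: "nn \<ge> 1" unfolding nn_def by simp
 have den: "1 + card S * nn > 0" using nn by (simp add: add_pos_nonneg)
 have gam: "gm > 0" unfolding gm_def using eps den by simp
 have QY: "finite (Q' \<union> Y)" "Q' \<union> Y \<subseteq> K" using Q' Y K by auto
 obtain A' where A': "finite A'" "A' \<subseteq> carrier G"
  and ev: "\<forall>\<^sub>F k in sequentially. sparse_at G (V k) (sm k) c' S (Q' \<union> Y) A' c1 gm"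
  by (rule sparse_connE[OF IH[OF c1(1)] QY gam])
 define P where "P = (\<lambda>(d, x). d \<otimes> x) ` (D2 \<times> Q')"
 define A where "A = A' \<union> D2 \<union> P \<union> (\<lambda>(a, p). a \<otimes> p) ` (A' \<times> P)"
 define Gm where "Gm = insert \<one> (A \<union> T \<union> S \<union> m_inv G ` S \<union> Q \<union> m_inv G ` Q \<union> Q' \<union> Y)"
 have TC: "T \<subseteq> carrier G" "S \<subseteq> carrier G" "Q \<subseteq> carrier G" "Q' \<subseteq> carrier G" "Y \<subseteq> carrier G"
  using T K N Q Q' Y NC KC by blast+
 have D2: "finite D2" "D2 \<subseteq> carrier G" unfolding D2_def using T N TC by (auto simp: subset_iff)
 have P: "finite P" "P \<subseteq> carrier G" unfolding P_def using D2 Q' TC by (auto simp: subset_iff)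
 have A: "finite A" "A \<subseteq> carrier G" unfolding A_def using A' D2 P by (auto simp: subset_iff)
 have Gm: "finite Gm" "Gm \<subseteq> carrier G"
  unfolding Gm_def using A TC T N Q Q' Y by (auto simp: subset_iff)
 show "ev_sparse G V sm c' S T c ep"
 proof (rule exI[of _ A], intro conjI A, rule eventually_mono[OF eventually_conj[OF ev eventually_good_pts[OF s Gm gam]]], elim conjE)
  fix k
  define ta where "ta = sm k"
  define X where "X = V k"
  define Gd where "Gd = good_pts G X ta Gm"
  assume "sparse_at G (V k) (sm k) c' S (Q' \<union> Y) A' c1 gm" "card (V k - good_pts G (V k) (sm k) Gm) \<le> gm * card (V k)"
  then have sp: "sparse_at G X ta c' S (Q' \<union> Y) A' c1 gm" and h6: "card (X - Gd) \<le> gm * card X"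
   unfolding ta_def X_def Gd_def by blast+
  obtain W0 D0 where h: "W0 \<subseteq> X" "D0 \<subseteq> A' \<times> X" "(\<Sum>(s, u)\<in>D0. c' s) \<le> c1 * card X"
   "card (X - cover S ta W0) \<le> gm * card X"
   and h5: "\<forall>w\<in>W0. \<forall>t\<in>Q' \<union> Y. ta t w \<in> W0 --> reach G ta D0 A' w t"
   by (rule sparse_atE[OF sp])
  note h5 = h5[rule_format]
  have sa: "sofic_approx G X ta" using s unfolding sofic_approx_seq_def X_def ta_def by blast
  have fX: "finite X" using sa unfolding sofic_approx_def by blast
  have perm: "ta g permutes X" if "g \<in> Gm" for g using sofic_approx_permutes[OF sa] that Gm by blast
  have injt: "a = b" if "ta g a = ta g b" "g \<in> Gm" for g a b
   using permutes_inj[OF perm[OF that(2)]] that(1) by (simp add: inj_eq)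
  have mul: "ta (g \<otimes> h) v = ta g (ta h v)" if "v \<in> Gd" "g \<in> Gm" "h \<in> Gm" for v g h
   using good_pts_mult that unfolding Gd_def by metis
  have one: "ta \<one> v = v" if "v \<in> Gd" for v
   using good_pts_one[OF sa] that unfolding Gd_def Gm_def by blast
  have GdX: "Gd \<subseteq> X" unfolding Gd_def good_pts_def by blast
  have inG: "A \<subseteq> Gm" "T \<subseteq> Gm" "S \<subseteq> Gm" "m_inv G ` S \<subseteq> Gm" "Q \<subseteq> Gm" "m_inv G ` Q \<subseteq> Gm" "Q' \<subseteq> Gm" "Y \<subseteq> Gm"
   unfolding Gm_def by blast+
  have Qne: "Q \<noteq> {}" using Q q by auto
  obtain W1 where W1: "W1 \<subseteq> W0 \<inter> Gd" "card Q * card W1 \<le> card X" "\<forall>d\<in>W0 \<inter> Gd. \<exists>w\<in>W1. \<exists>x\<in>Q. \<exists>y\<in>Q. ta x d = ta y w"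
  proof (rule sparse_net[OF fX _ Qne Q(2), of "W0 \<inter> Gd" ta])
   show "W0 \<inter> Gd \<subseteq> X" using h(1) by blast
   show "ta x v \<in> X" if "x \<in> Q" "v \<in> X" for x v using permutes_in_image[OF perm, of x v] inG(5) that by blast
   show "x = y" if "w \<in> W0 \<inter> Gd" "x \<in> Q" "y \<in> Q" "ta x w = ta y w" for w x y
    using good_pts_inj[of w G X ta Gm x y] that inG(5) unfolding Gd_def by blast
  qed
  have fW1: "finite W1" using W1(1) h(1) fX finite_subset by (metis le_infI1)
  define D where "D = D0 \<union> D2 \<times> W1"
  have fD0: "finite D0" using h(2) A'(1) fX finite_subset by (metis finite_cartesian_product)
  have "(\<Sum>(s, u)\<in>D. c' s) \<le> (\<Sum>(s, u)\<in>D0. c' s) + C2 * card W1"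
   unfolding D_def C2_def by (rule sum_cost_le) (use c' fD0 D2 fW1 in auto)
  also have "C2 * card W1 \<le> (c - c1) * q * card W1" using q(1) by (rule mult_right_mono) simp
  also have "\<dots> = (c - c1) * (q * card W1)" by simp
  also have "\<dots> \<le> (c - c1) * card X" using W1(2) Q(3) c1 by (intro mult_left_mono of_nat_mono) auto
  finally have cost: "(\<Sum>(s, u)\<in>D. c' s) \<le> c * card X" using h(3) by (simp add: algebra_simps)
  define Cov where "Cov = cover S ta W0"
  \<comment> \<open>Discarded from \<open>W0\<close>: the points that are not good, either at once
    or after a move by \<open>Q'\<close>, and those which such a move followed by some t sends to an
    uncovered point.\<close>
  define B where "B = (X - Gd) \<union> (\<Union>x\<in>Q'. {v \<in> X. ta x v \<in> X - Gd}) \<union>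
   (\<Union>(x, t)\<in>Q' \<times> T. {v \<in> X. ta x v \<in> {u \<in> X. ta t u \<in> X - Cov}})"
  have BX: "B \<subseteq> X" unfolding B_def by auto
  have cB: "card B \<le> nn * (gm * card X)"
  proof -
   have 1: "card (\<Union>x\<in>Q'. {v \<in> X. ta x v \<in> X - Gd}) \<le> card Q' * card (X - Gd)"
    using inG(7) by (intro card_UN_vimage_permutes Q' fX perm) auto
   have "(\<Union>(x, t)\<in>Q' \<times> T. {v \<in> X. ta x v \<in> {u \<in> X. ta t u \<in> X - Cov}}) = (\<Union>x\<in>Q'. {v \<in> X. ta x v \<in> (\<Union>t\<in>T. {u \<in> X. ta t u \<in> X - Cov})})"
    by auto
   also have "card \<dots> \<le> card Q' * card (\<Union>t\<in>T. {u \<in> X. ta t u \<in> X - Cov})"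
    using inG(7) by (intro card_UN_vimage_permutes Q' fX perm) auto
   also have "\<dots> \<le> card Q' * (card T * card (X - Cov))"
    using inG(2) by (intro mult_left_mono card_UN_vimage_permutes T fX perm) auto
   finally have 2: "card (\<Union>(x, t)\<in>Q' \<times> T. {v \<in> X. ta x v \<in> {u \<in> X. ta t u \<in> X - Cov}}) \<le> card Q' * card T * card (X - Cov)"
    by simp
   have "card B \<le> card (X - Gd) + card Q' * card (X - Gd) + card Q' * card T * card (X - Cov)"
    unfolding B_def using 1 2 by (intro order_trans[OF card_Un_le] add_mono order_trans[OF card_Un_le]) auto
   then have "rcard B \<le> card (X - Gd) + rcard Q' * card (X - Gd) + rcard Q' * card T * card (X - Cov)"
    unfolding of_nat_mult[symmetric] of_nat_add[symmetric] of_nat_le_iff .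
   also have "\<dots> \<le> gm * card X + rcard Q' * (gm * card X) + rcard Q' * card T * (gm * card X)"
    using h(4) h6 unfolding Cov_def by (intro add_mono mult_left_mono) auto
   also have "\<dots> = nn * (gm * card X)" unfolding nn_def by (simp add: algebra_simps)
   finally show ?thesis .
  qed
  define W where "W = W0 - B"
  have unc: "card (X - cover S ta W) \<le> ep * card X"
  proof -
   have "card (X - cover S ta W) \<le> card (X - Cov) + card S * card B"
    unfolding W_def Cov_def by (rule card_uncovered[OF N(3) fX BX])
   then have "rcard (X - cover S ta W) \<le> card (X - Cov) + rcard S * card B"
    unfolding of_nat_mult[symmetric] of_nat_add[symmetric] of_nat_le_iff .
   also have "\<dots> \<le> gm * card X + rcard S * (nn * (gm * card X))"
    using h(4) cB unfolding Cov_def by (intro add_mono mult_left_mono) auto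
   also have "\<dots> = (1 + card S * nn) * gm * card X" by (simp add: algebra_simps)
   also have "\<dots> = ep * card X" unfolding gm_def using den by simp
   finally show ?thesis .
  qed
  have conn: "reach G ta D A w t" if w: "w \<in> W" "t \<in> T" "ta t w \<in> W" for w t
  proof -
   have wX: "w \<in> X" using w h(1) unfolding W_def by blast
   have nB: "w \<notin> B" using w(1) unfolding W_def by blast
   have wG: "w \<in> W0" "w \<in> Gd" "ta t w \<in> W0" using w nB wX unfolding W_def B_def by blast+
   obtain w1 x y where w1: "w1 \<in> W1" "x \<in> Q" "y \<in> Q" "ta x w = ta y w1"
    using W1(3) wG by blast
   have w1G: "w1 \<in> Gd" "w1 \<in> W0" using w1 W1(1) by blast+
   define z where "z = inv y \<otimes> x"
   have zQ: "z \<in> Q'" unfolding z_def Q'_def using w1 by force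
   have xyC: "x \<in> carrier G" "y \<in> carrier G" "z \<in> carrier G" "t \<in> carrier G"
    using w1 TC zQ w by blast+
   have zw: "ta z w = w1"
   proof -
    have "ta z w = ta (inv y) (ta x w)"
     unfolding z_def using mul[OF wG(2)] w1 inG(5,6) by blast
    also have "\<dots> = ta (inv y) (ta y w1)" using w1(4) by simp
    also have "\<dots> = ta (inv y \<otimes> y) w1"
    proof -
     have "inv y \<in> Gm" "y \<in> Gm" using w1(3) inG(5,6) by blast+
     then show ?thesis using mul[OF w1G(1)] by simp
    qed
    finally show ?thesis using one[OF w1G(1)] xyC by simp
   qed
   have r1: "reach G ta D0 A' w z" using h5[OF wG(1), of z] zQ zw w1G by auto
   have tw1: "ta t w1 \<in> X"
    using permutes_in_image[OF perm, of t w1] w(2) inG(2) w1G(1) GdX by blast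
   have "ta t w1 \<in> Cov"
   proof (rule ccontr)
    assume "ta t w1 \<notin> Cov"
    then have "w \<in> {v \<in> X. ta z v \<in> {u \<in> X. ta t u \<in> X - Cov}}"
     using wX zw tw1 w1G(1) GdX by blast
    then show False using nB zQ w(2) unfolding B_def by blast
   qed
   then obtain s w'' where s: "s \<in> S" "w'' \<in> W0" "ta t w1 = ta s w''" unfolding Cov_def by blast
   define d where "d = inv s \<otimes> t"
   have dD: "d \<in> D2" unfolding d_def D2_def using s w by force
   have sC: "s \<in> carrier G" "d \<in> carrier G" using s TC dD D2 by blast+
   have dG: "d \<in> Gm" using dD inG(1) unfolding A_def by blast
   have "ta s (ta d w1) = ta (s \<otimes> d) w1" using mul[OF w1G(1), of s d] s inG dG by auto
   also have "s \<otimes> d = t" unfolding d_def using sC xyC by (simp add: m_assoc[symmetric])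
   finally have w''1: "w'' = ta d w1" using injt[of s "ta d w1" w''] s inG by auto
   define p where "p = d \<otimes> z"
   have pP: "p \<in> P" unfolding p_def P_def using dD zQ by force
   have pC: "p \<in> carrier G" unfolding p_def using sC xyC by simp
   have pA: "p \<in> A" "p \<in> Gm" using pP inG(1) unfolding A_def by blast+
   have w''p: "w'' = ta p w"
    unfolding p_def using mul[OF wG(2) dG, of z] zQ inG(7) zw w''1 by auto
   have A'A: "A' \<subseteq> A" unfolding A_def by blast
   have "reach G ta D A w z" using reach_mono[OF r1 _ A'A] unfolding D_def by blast
   moreover have "(d, ta z w) \<in> D" using dD w1(1) zw unfolding D_def by blast
   ultimately have rp: "reach G ta D A w p" unfolding p_def
    using reach.reach_step[of G ta D A w z d] pA unfolding p_def by blast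
   \<comment> \<open>This is where normality enters: the way back from \<open>w''\<close> to t w is
     a conjugate of an element of the smaller group times s, hence again in the smaller
     group.\<close>
   define r where "r = t \<otimes> inv z \<otimes> inv t \<otimes> s"
   have rY: "r \<in> Y" unfolding r_def Y_def using w(2) zQ s(1) by force
   have rp_eq: "r \<otimes> p = t"
    unfolding r_def p_def d_def using sC xyC by (simp add: m_assoc inv_solve_left')
     (simp add: m_assoc[symmetric])
   have "ta r w'' = ta t w" unfolding w''p using mul[OF wG(2), of r p] rY inG(8) pA rp_eq by auto
   then have r2: "reach G ta D0 A' w'' r" using h5[OF s(2), of r] rY wG(3) by auto
   have "reach G ta D A w (r \<otimes> p)"
   proof (rule reach_trans[OF r2 w''p rp pC _ h(2) A'(2)])
    show "D0 \<subseteq> D" unfolding D_def by blast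
    fix a assume a: "a \<in> A'"
    have "a \<otimes> p \<in> A" unfolding A_def using a pP by force
    moreover have "a \<in> Gm" using a inG(1) A'A by blast
    ultimately show "a \<otimes> p \<in> A \<and> ta (a \<otimes> p) w = ta a (ta p w)" using mul[OF wG(2) _ pA(2)] by blast
   qed
   then show ?thesis using rp_eq by simp
  qed
  have DA: "D \<subseteq> A \<times> X"
   unfolding D_def A_def using h(2) W1(1) GdX by blast
  have "W \<subseteq> X" using h(1) unfolding W_def by blast
  from sparse_atI[OF this DA cost unc conn] show "sparse_at G (V k) (sm k) c' S T A c ep" unfolding X_def ta_def .
 qed
qed

end

section \<open>Amenable subgroups and w-normal chains\<close>

lemma (in group) amenable_subgroup_Foelner:
 fixes dl :: real
 assumes N: "subgroup N G" and am: "amenable (G\<lparr>carrier := N\<rparr>)" and S: "finite S" "S \<subseteq> N" and d: "dl > 0"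
 shows "\<exists>K. finite K \<and> K \<noteq> {} \<and> K \<subseteq> N \<and> card (bdry G S K) \<le> dl * card K"
proof -
 interpret GN: group "G\<lparr>carrier := N\<rparr>" using N by (rule subgroup.subgroup_is_group) (rule is_group)
 define dl' where "dl' = dl / (card S + 1)"
 have d': "dl' > 0" "card S * dl' \<le> dl" unfolding dl'_def using d by (auto simp: field_simps)
 have SN: "S \<subseteq> carrier (G\<lparr>carrier := N\<rparr>)" using S by simp
 have "\<exists>F. finite F \<and> F \<noteq> {} \<and> F \<subseteq> N \<and> (\<forall>t\<in>S. rcard {f \<in> F. t \<otimes> f \<notin> F} \<le> dl' * card F)"
  using GN.amenable_Foelner[OF am S(1) SN d'(1)] by simp
 then obtain K where K: "finite K" "K \<noteq> {}" "K \<subseteq> N"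
  "\<And>s. s \<in> S ==> rcard {f \<in> K. s \<otimes> f \<notin> K} \<le> dl' * card K" by blast
 have "(bdry G S K) = (\<Union>s\<in>S. {f \<in> K. s \<otimes> f \<notin> K})" by blast
 then have "card (bdry G S K) \<le> (\<Sum>s\<in>S. card {f \<in> K. s \<otimes> f \<notin> K})"
  using card_UN_le[OF S(1)] by metis
 then have "rcard (bdry G S K) \<le> (\<Sum>s\<in>S. rcard {f \<in> K. s \<otimes> f \<notin> K})"
  unfolding of_nat_sum[symmetric] of_nat_le_iff .
 also have "\<dots> \<le> (\<Sum>s\<in>S. dl' * card K)" using K(4) by (rule sum_mono)
 also have "\<dots> = (card S * dl') * card K" by simp
 also have "\<dots> \<le> dl * card K" using d'(2) by (rule mult_right_mono) simp
 finally show ?thesis using K(1-3) by blast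
qed

text \<open>The approximation splits into images of parts of a Foelner set of \<open>N\<close>, each
  with the skeleton from \<open>has_tiles\<close>. The points from which edges of \<open>F\<close>
  start are a fraction at most \<open>ep0\<close>, fixed together with \<open>S\<close> before
  \<open>T\<close>. The additional edges from \<open>T'\<close> that join the components number at
  most twice the boundary, which is made small once \<open>T\<close> is known. Each kind costs at
  most half of \<open>card X\<close>.\<close>

lemma (in group) sparse_conn_amenable:
 fixes c' :: "'a => real"
 assumes s: "sofic_approx_seq G V sm" and c': "\<And>g. c' g \<ge> 0" and N: "subgroup N G"
  and am: "amenable (G\<lparr>carrier := N\<rparr>)" and nlf: "\<not> locally_finite_group (G\<lparr>carrier := N\<rparr>)"
  and nvc: "\<not> virtually_cyclic (G\<lparr>carrier := N\<rparr>)"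
 shows "sparse_within G V sm c' N"
proof -
 define GN where "GN = G\<lparr>carrier := N\<rparr>"
 interpret GN: group GN unfolding GN_def using N by (rule subgroup.subgroup_is_group) (rule is_group)
 have GNs: "carrier GN = N" "\<And>x y. x \<otimes>\<^bsub>GN\<^esub> y = x \<otimes> y" "\<one>\<^bsub>GN\<^esub> = \<one>" unfolding GN_def by auto
 have GNi: "inv\<^bsub>GN\<^esub> x = inv x" if "x \<in> N" for x unfolding GN_def using m_inv_consistent[OF N that] .
 have NC: "N \<subseteq> carrier G" using N by (rule subgroup.subset)
 have Nm: "\<And>x y. x \<in> N ==> y \<in> N ==> x \<otimes> y \<in> N" "\<And>x. x \<in> N ==> inv x \<in> N"
  using N by (auto simp: subgroup.m_closed subgroup.m_inv_closed)
 obtain F where "finite F" "F \<subseteq> carrier GN" "\<forall>f\<in>F. inv\<^bsub>GN\<^esub> f \<in> F" "\<forall>ep>0. has_tiles GN F ep"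
  using GN.sparse_connected_sets[OF nlf[folded GN_def] nvc[folded GN_def]] by (elim exE conjE) (rule that)
 note F = this[unfolded GNs(1,3)]
 have Finv: "inv f \<in> F" if "f \<in> F" for f using bspec[OF F(3) that] GNi[of f] F(2) that by auto
 define CF where "CF = (\<Sum>f\<in>F. c' f)"
 have CF: "CF \<ge> 0" unfolding CF_def using c' by (simp add: sum_nonneg)
 define ep0 where "ep0 = 1 / (2 * (CF + 1))"
 have e0: "ep0 > 0" "CF * ep0 \<le> 1 / 2" unfolding ep0_def using CF by (auto simp: field_simps)
 obtain S where S: "finite S" "S \<subseteq> N" "\<one> \<in> S"
  and tile: "\<forall>X. finite X \<and> X \<subseteq> N --> tileable GN F S ep0 X"
  using F(4)[rule_format, OF e0(1)] by (elim exE conjE) (rule that)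
 have "sparse_conn G V sm c' S N c" if c: "c > 1" for c
 proof (rule sparse_connI)
  fix T and ep :: real assume T: "finite T" "T \<subseteq> N" and eps: "ep > 0"
  define T' where "T' = T \<union> m_inv G ` T"
  have T': "finite T'" "T' \<subseteq> N" "\<And>t. t \<in> T' ==> inv t \<in> T'"
   unfolding T'_def using T Nm NC by (auto simp: subset_iff)
  define S' where "S' = S \<union> m_inv G ` S \<union> T'"
  have S': "finite S'" "S' \<subseteq> N" "\<And>t. t \<in> S' ==> inv t \<in> S'"
   unfolding S'_def using T' S Nm NC by (auto simp: subset_iff)
  define CT where "CT = (\<Sum>t\<in>T'. c' t)"
  have CT: "CT \<ge> 0" unfolding CT_def using c' by (simp add: sum_nonneg)
  define be where "be = min (1 / (4 * (CT + 1))) (ep / (2 * (1 + card S)))"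
  have b: "be > 0" unfolding be_def using eps CT by auto
  have b1: "CT * (2 * be) \<le> 1 / 2"
  proof -
   have "CT * (2 * be) \<le> CT * (2 * (1 / (4 * (CT + 1))))"
    using CT unfolding be_def by (intro mult_left_mono) auto
   also have "\<dots> \<le> 1 / 2" using CT by (simp add: field_simps)
   finally show ?thesis .
  qed
  have b2: "(1 + card S) * be \<le> ep / 2"
  proof -
   have "(1 + card S) * be \<le> (1 + card S) * (ep / (2 * (1 + card S)))"
    unfolding be_def by (intro mult_left_mono) auto
   also have "\<dots> = ep / 2" by (simp add: field_simps add_pos_nonneg del: of_nat_add)
   finally show ?thesis .
  qed
  \<comment> \<open>Chosen so that \<open>hyperfinite_pieces\<close> bounds the total boundary by
    \<open>be * card X\<close>.\<close>
  define dl where "dl = be / (2 * (1 + card S'))"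
  have d: "dl > 0" "2 * dl * (1 + card S') = be" unfolding dl_def using b by (auto simp: field_simps add_pos_nonneg)
  obtain K where K: "finite K" "K \<noteq> {}" "K \<subseteq> N" "card (bdry G S' K) \<le> dl * card K"
   using amenable_subgroup_Foelner[OF N am S'(1,2) d(1)] by blast
  have KC: "K \<subseteq> carrier G" using K NC by blast
  \<comment> \<open>Partial products of a path that starts at x and stays in one piece have the form
    y inv x with x and y in \<open>K\<close>.\<close>
  define KK where "KK = (\<lambda>(x, y). y \<otimes> inv x) ` (K \<times> K)"
  have KK: "finite KK" "KK \<subseteq> N" unfolding KK_def using K Nm by (auto simp: subset_iff)
  have KKm: "b \<otimes> inv a \<in> KK" if "a \<in> K" "b \<in> K" for a b
   unfolding KK_def using that by (intro image_eqI[of _ _ "(a, b)"]) auto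
  define A where "A = KK \<union> F \<union> T'"
  have A: "finite A" "A \<subseteq> carrier G" unfolding A_def using KK F T' NC by auto
  define Gm where "Gm = insert \<one> (A \<union> K \<union> S')"
  have Gm: "finite Gm" "Gm \<subseteq> carrier G" unfolding Gm_def using A KC K S' NC by auto
  have g4: "ep / 4 > 0" using eps by simp
  show "ev_sparse G V sm c' S T c ep"
  proof (rule exI[of _ A], intro conjI A, rule eventually_mono[OF eventually_good_pts[OF s Gm g4]])
   fix k
   define ta where "ta = sm k"
   define X where "X = V k"
   define Vg where "Vg = good_pts G X ta Gm"
   assume "card (V k - good_pts G (V k) (sm k) Gm) \<le> ep / 4 * card (V k)"
   then have gd: "2 * card (X - Vg) \<le> (ep / 2) * card X" unfolding X_def ta_def Vg_def by simp
   have sa: "sofic_approx G X ta" using s unfolding sofic_approx_seq_def X_def ta_def by blast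
   have fX: "finite X" using sa unfolding sofic_approx_def by blast
   have perm: "ta g permutes X" if "g \<in> carrier G" for g using sofic_approx_permutes[OF sa that] .
   have VgX: "Vg \<subseteq> X" unfolding Vg_def good_pts_def by blast
   have mul: "ta (g \<otimes> h) v = ta g (ta h v)" if "v \<in> Vg" "g \<in> Gm" "h \<in> Gm" for v g h
    using good_pts_mult that unfolding Vg_def by metis
   have inG: "A \<subseteq> Gm" "K \<subseteq> Gm" "S' \<subseteq> Gm" unfolding Gm_def by blast+
   have inj: "inj_on (\<lambda>k. ta k v) K" if "v \<in> Vg" for v
    by (rule inj_onI, rule good_pts_inj[OF that[unfolded Vg_def]]) (use inG(2) in blast)+
   have "\<exists>I. finite I \<and> (\<forall>(v, X)\<in>I. v \<in> Vg \<and> X \<subseteq> K) \<and>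
    (\<forall>i\<in>I. \<forall>j\<in>I. i \<noteq> j --> (\<lambda>g. ta g (fst i)) ` snd i \<inter> (\<lambda>g. ta g (fst j)) ` snd j = {}) \<and>
    card (X - (\<Union>(v, X)\<in>I. (\<lambda>g. ta g v) ` X)) \<le> (ep / 2) * card X \<and>
    (\<Sum>(v, X)\<in>I. card (bdry G S' X)) \<le> 2 * dl * (1 + card S') * card X"
    by (rule hyperfinite_pieces[OF fX K(1,2) KC S'(1) _ S'(3) perm K(4) d(1) VgX gd inj])
     (use S'(2) NC inG mul in \<open>auto simp: subset_iff\<close>)
   then obtain I where I: "finite I" "\<forall>i\<in>I. fst i \<in> Vg \<and> snd i \<subseteq> K"
    "\<forall>i\<in>I. \<forall>j\<in>I. i \<noteq> j --> (\<lambda>g. ta g (fst i)) ` snd i \<inter> (\<lambda>g. ta g (fst j)) ` snd j = {}"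
    "card (X - (\<Union>i\<in>I. (\<lambda>g. ta g (fst i)) ` snd i)) \<le> (ep / 2) * card X"
    "(\<Sum>i\<in>I. card (bdry G S' (snd i))) \<le> 2 * dl * (1 + card S') * card X"
    unfolding case_prod_unfold by (elim exE conjE) (rule that)
   note I = I(1) I(2,3)[rule_format] I(4,5)
   define Z where "Z = (\<lambda>(i :: nat \<times> 'a set) Y. (\<lambda>g. ta g (fst i)) ` Y)"
   define bd where "bd = (\<lambda>i :: nat \<times> 'a set. (bdry G S' (snd i)))"
   have iN: "finite (snd i)" "snd i \<subseteq> N" "snd i \<subseteq> carrier G" if "i \<in> I" for i
    using I(2)[OF that] K(1,3) KC finite_subset by blast+
   have ZX: "Z i Y \<subseteq> X" if "i \<in> I" "Y \<subseteq> snd i" for i Y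
    unfolding Z_def using I(2)[OF that(1)] that(2) permutes_in_image[OF perm] KC VgX by blast
   have cZ: "card (Z i Y) = card Y" if "i \<in> I" "Y \<subseteq> snd i" for i Y
    unfolding Z_def using inj I(2)[OF that(1)] that(2) by (meson card_image inj_on_subset order_trans)
   have sumX: "(\<Sum>i\<in>I. card (snd i)) \<le> card X"
   proof -
    have "(\<Sum>i\<in>I. card (snd i)) = (\<Sum>i\<in>I. card (Z i (snd i)))" using cZ by simp
    also have "\<dots> = card (\<Union>i\<in>I. Z i (snd i))"
     by (rule card_UN_disjoint[symmetric, OF I(1)]) (use I(3) iN in \<open>auto simp: Z_def\<close>)
    also have "\<dots> \<le> card X" using ZX fX by (intro card_mono) auto
    finally show ?thesis .
   qed
   have sumb: "(\<Sum>i\<in>I. card (bd i)) \<le> be * card X" using I(5) unfolding bd_def d(2) .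
   define Q where "Q = (\<lambda>(i :: nat \<times> 'a set) W V E. W \<subseteq> V \<and> V \<subseteq> snd i \<and> card V \<le> ep0 * card (snd i) \<and>
     (core G S (snd i)) \<subseteq> S <#>\<^bsub>GN\<^esub> W \<and>
     E \<subseteq> {(x, y). x \<in> W \<and> y \<in> W \<and> (\<exists>t\<in>T'. y = t \<otimes> x)} \<and> finite E \<and> card E \<le> 2 * card (bd i) \<and>
     {(x, y). x \<in> W \<and> y \<in> W \<and> (\<exists>t\<in>T'. y = t \<otimes> x)} \<subseteq> (cayley_edges GN F V \<union> E)\<^sup>*)"
   have "\<exists>W V E. Q i W V E" if i: "i \<in> I" for i
   proof -
    obtain W V R where t: "W \<subseteq> V" "V \<subseteq> snd i" "R \<subseteq> V" "card V \<le> ep0 * card (snd i)"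
     "core G S (snd i) \<subseteq> S <#>\<^bsub>GN\<^esub> W"
     "card R \<le> card (bdry G S (snd i))"
     "\<forall>v\<in>V. \<exists>rh\<in>R. (v, rh) \<in> (cayley_edges GN F V)\<^sup>*"
     using tile[rule_format, OF conjI, OF iN(1,2)[OF i]] unfolding GNs(2) by (elim exE conjE) (rule that)
    define E' where "E' = {(x, y). x \<in> W \<and> y \<in> W \<and> (\<exists>t\<in>T'. y = t \<otimes> x)}"
    have WC: "W \<subseteq> carrier G" using t iN(3)[OF i] by blast
    have symE': "sym E'"
    proof (rule symI)
     fix x y assume "(x, y) \<in> E'"
     then obtain a where a: "x \<in> W" "y \<in> W" "a \<in> T'" "y = a \<otimes> x" unfolding E'_def by blast
     then have "x = inv a \<otimes> y" using T'(2) NC WC by (auto simp: m_assoc[symmetric] subset_iff)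
     then show "(y, x) \<in> E'" using a T'(3) unfolding E'_def by blast
    qed
    have symE: "sym (cayley_edges GN F V)"
     by (rule GN.sym_cayley_edges) (use F(1,2) Finv t iN(2)[OF i] GNs GNi in \<open>auto simp: subset_iff\<close>)
    have fR: "finite R" using t(2,3) iN(1)[OF i] by (meson finite_subset)
    have "\<exists>E''\<subseteq>E'. finite E'' \<and> card E'' \<le> 2 * card R \<and> sym E'' \<and> E' \<subseteq> (cayley_edges GN F V \<union> E'')\<^sup>*"
     by (rule spanning_edges[OF fR symE symE']) (use t(1,7) in \<open>auto simp: E'_def\<close>)
    then obtain E where E: "E \<subseteq> E'" "finite E" "card E \<le> 2 * card R" "E' \<subseteq> (cayley_edges GN F V \<union> E)\<^sup>*"
     by blast
    have "bdry G S (snd i) \<subseteq> bd i" unfolding bd_def S'_def by blast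
    then have "card (bdry G S (snd i)) \<le> card (bd i)"
     using iN(1)[OF i] by (intro card_mono) (auto simp: bd_def)
    then have "card E \<le> 2 * card (bd i)" using E(3) t(6) by linarith
    then show ?thesis using t(1,2,4,5) E(1,2,4) unfolding E'_def Q_def
     by - (rule exI[of _ W], rule exI[of _ V], rule exI[of _ E], (intro conjI; assumption))
   qed
   then have ex: "\<forall>i\<in>I. \<exists>W V E. Q i W V E" by (intro ballI)
   obtain Wf where ex2: "\<forall>i\<in>I. \<exists>V E. Q i (Wf i) V E" using bchoice[OF ex] by (elim exE)
   obtain Vf where ex3: "\<forall>i\<in>I. \<exists>E. Q i (Wf i) (Vf i) E" using bchoice[OF ex2] by (elim exE)
   obtain Ef where f: "\<forall>i\<in>I. Q i (Wf i) (Vf i) (Ef i)" using bchoice[OF ex3] by (elim exE)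
   note f0 = bspec[OF f, unfolded Q_def]
   note f2 = f0[THEN conjunct2] note f3 = f2[THEN conjunct2] note f4 = f3[THEN conjunct2] note f5 = f4[THEN conjunct2]
   note f6 = f5[THEN conjunct2] note f7 = f6[THEN conjunct2]
   note f1 = f0[THEN conjunct1] f2[THEN conjunct1] f3[THEN conjunct1] f4[THEN conjunct1] f5[THEN conjunct1]
    f6[THEN conjunct1] f7[THEN conjunct1] f7[THEN conjunct2]
   define U1 where "U1 = (\<Union>i\<in>I. Z i (Vf i))"
   define U2 where "U2 = (\<Union>i\<in>I. Z i (fst ` Ef i))"
   define D where "D = F \<times> U1 \<union> T' \<times> U2"
   \<comment> \<open>Once the boundary points are removed, a step by \<open>T\<close> between two
     points of \<open>W\<close> stays inside one piece, where the skeleton provides a path.\<close>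
   define W where "W = (\<Union>i\<in>I. Z i (Wf i - bd i))"
   have EfX: "fst ` Ef i \<subseteq> snd i" if "i \<in> I" for i
   proof (rule image_subsetI)
    fix e assume "e \<in> Ef i"
    then have "fst e \<in> Wf i" using subsetD[OF f1(5)[OF that], of e] by (simp add: case_prod_unfold)
    then show "fst e \<in> snd i" using f1(1,2)[OF that] by blast
   qed
   have U12: "U1 \<subseteq> X" "U2 \<subseteq> X"
    unfolding U1_def U2_def using ZX f1(2) EfX by (meson UN_least)+
   have WX: "W \<subseteq> X"
    unfolding W_def
   proof (rule UN_least)
    fix i assume i: "i \<in> I"
    have "Wf i - bd i \<subseteq> snd i" using f1(1,2)[OF i] by blast
    then show "Z i (Wf i - bd i) \<subseteq> X" by (rule ZX[OF i])
   qed
   have cU1: "card U1 \<le> ep0 * card X"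
   proof -
    have "card U1 \<le> (\<Sum>i\<in>I. card (Z i (Vf i)))" unfolding U1_def by (rule card_UN_le[OF I(1)])
    also have "\<dots> = (\<Sum>i\<in>I. card (Vf i))" using cZ f1(2) by simp
    finally have "rcard U1 \<le> (\<Sum>i\<in>I. rcard (Vf i))" unfolding of_nat_sum[symmetric] of_nat_le_iff .
    also have "\<dots> \<le> (\<Sum>i\<in>I. ep0 * card (snd i))" using f1(3) by (intro sum_mono) auto
    also have "\<dots> = ep0 * (\<Sum>i\<in>I. card (snd i))" by (simp add: sum_distrib_left)
    also have "\<dots> \<le> ep0 * card X" using sumX e0 by (intro mult_left_mono of_nat_mono) auto
    finally show ?thesis .
   qed
   have cU2: "card U2 \<le> 2 * be * card X"
   proof -
    have "card U2 \<le> (\<Sum>i\<in>I. card (Z i (fst ` Ef i)))" unfolding U2_def by (rule card_UN_le[OF I(1)])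
    also have "\<dots> = (\<Sum>i\<in>I. card (fst ` Ef i))" using cZ EfX by simp
    also have "\<dots> \<le> (\<Sum>i\<in>I. 2 * card (bd i))"
     by (intro sum_mono order_trans[OF card_image_le[OF f1(6)] f1(7)])
    also have "\<dots> = 2 * (\<Sum>i\<in>I. card (bd i))" by (simp add: sum_distrib_left)
    finally have "rcard U2 \<le> real (2 * (\<Sum>i\<in>I. card (bd i)))" unfolding of_nat_le_iff .
    then show ?thesis using sumb by simp
   qed
   have cost: "(\<Sum>(s, u)\<in>D. c' s) \<le> c * card X"
   proof -
    have fU: "finite U1" "finite U2" using U12 fX finite_subset by blast+
    have "(\<Sum>(s, u)\<in>D. c' s) \<le> CF * card U1 + CT * card U2"
     unfolding D_def CF_def CT_def sum_cost_Times[symmetric, of c' F]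
     by (rule sum_cost_le) (use F(1) T'(1) fU c' in auto)
    also have "\<dots> \<le> CF * (ep0 * card X) + CT * (2 * be * card X)"
     using cU1 cU2 CF CT by (intro add_mono mult_left_mono) auto
    also have "\<dots> = (CF * ep0) * card X + (CT * (2 * be)) * card X" by (simp add: algebra_simps)
    also have "\<dots> \<le> 1 / 2 * card X + 1 / 2 * card X"
     using e0(2) b1 by (intro add_mono mult_right_mono) auto
    also have "\<dots> = 1 * rcard X" by simp
    also have "\<dots> \<le> c * card X" using c by (intro mult_right_mono) auto
    finally show ?thesis .
   qed
   have vz: "fst i \<in> Vg" "x \<in> Gm" "x \<in> carrier G" if "i \<in> I" "x \<in> snd i" for i x
    using I(2)[OF that(1)] that(2) inG(2) KC by blast+
   have unc: "card (X - cover S ta W) \<le> ep * card X"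
   proof -
    define B where "B = (\<Union>i\<in>I. Z i (bd i))"
    have bdX: "bd i \<subseteq> snd i" for i unfolding bd_def by simp
    have BX: "B \<subseteq> X" unfolding B_def by (rule UN_least, rule ZX[OF _ bdX])
    have fB: "finite B" using BX fX finite_subset by blast
    have cB: "card B \<le> be * card X"
    proof -
     have "card B \<le> (\<Sum>i\<in>I. card (Z i (bd i)))" unfolding B_def by (rule card_UN_le[OF I(1)])
     also have "\<dots> = (\<Sum>i\<in>I. card (bd i))"
      by (intro sum.cong refl cZ) (auto simp: bd_def)
     finally show ?thesis using sumb by linarith
    qed
    define O' where "O' = X - (\<Union>i\<in>I. (\<lambda>g. ta g (fst i)) ` snd i)"
    have "X - cover S ta W \<subseteq> O' \<union> (B \<union> cover S ta B)"
    proof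
     fix z assume z: "z \<in> X - cover S ta W"
     show "z \<in> O' \<union> (B \<union> cover S ta B)"
     proof (rule ccontr)
      assume no: "z \<notin> O' \<union> (B \<union> cover S ta B)"
      then obtain i x where i: "i \<in> I" "x \<in> snd i" "z = ta x (fst i)" using z unfolding O'_def by blast
      have "x \<notin> bd i" using no i unfolding B_def Z_def by blast
      then have "\<forall>s\<in>S. s \<otimes> x \<in> snd i" using i(2) unfolding bd_def S'_def by blast
      then have "x \<in> S <#>\<^bsub>GN\<^esub> Wf i" using f1(4)[OF i(1)] i(2) by blast
      then obtain a w where a: "a \<in> S" "w \<in> Wf i" "x = a \<otimes> w" unfolding set_mult_def GNs by blast
      have w: "w \<in> snd i" using a f1(1,2)[OF i(1)] by blast
      have "a \<in> Gm" using a(1) inG(3) unfolding S'_def by blast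
      then have za: "z = ta a (ta w (fst i))" using i(3) a(3) mul[OF vz(1)[OF i(1,2)]] vz(2)[OF i(1) w] by simp
      show False
      proof (cases "w \<in> bd i")
       case True
       then have "ta w (fst i) \<in> B" using i(1) unfolding B_def Z_def by blast
       then show False using no za a(1) by blast
      next
       case False
       then have "ta w (fst i) \<in> W" using i(1) a(2) unfolding W_def Z_def by blast
       then show False using z za a(1) by blast
      qed
     qed
    qed
    then have "card (X - cover S ta W) \<le> card (O' \<union> (B \<union> cover S ta B))"
     using S fB fX unfolding O'_def by (intro card_mono) auto
    also have "\<dots> \<le> card O' + (card B + (\<Sum>s\<in>S. card B))"
     by (intro order_trans[OF card_Un_le] add_mono order_refl order_trans[OF card_UN_le[OF S(1)]] sum_mono card_image_le fB)
    finally have "card (X - cover S ta W) \<le> card O' + (1 + card S) * card B" by simp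
    then have "rcard (X - cover S ta W) \<le> card O' + real (1 + card S) * card B"
     unfolding of_nat_mult[symmetric] of_nat_add[symmetric] of_nat_le_iff .
    also have "\<dots> \<le> (ep / 2) * card X + real (1 + card S) * (be * card X)"
     using I(4) cB unfolding O'_def by (intro add_mono mult_left_mono) auto
    also have "\<dots> = (ep / 2) * card X + ((1 + card S) * be) * card X" by simp
    also have "\<dots> \<le> (ep / 2) * card X + (ep / 2) * card X"
     using b2 by (intro add_mono mult_right_mono) auto
    finally show ?thesis by simp
   qed
   have conn: "reach G ta D A w t" if w: "w \<in> W" "t \<in> T" "ta t w \<in> W" for w t
   proof -
    obtain i x where i: "i \<in> I" "x \<in> Wf i" "x \<notin> bd i" "w = ta x (fst i)"
     using w(1) unfolding W_def Z_def by blast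
    have xX: "x \<in> snd i" using i f1(1,2) by blast
    have tT: "t \<in> T'" "t \<in> S'" using w(2) unfolding T'_def S'_def by blast+
    have tG: "t \<in> Gm" "t \<in> carrier G" using tT inG(3) S'(2) NC by blast+
    have tx: "t \<otimes> x \<in> snd i" using i(3) xX tT(2) unfolding bd_def by blast
    have tw: "ta t w = ta (t \<otimes> x) (fst i)" using mul[OF vz(1)[OF i(1) xX] tG(1) vz(2)[OF i(1) xX]] i(4) by simp
    obtain j y where j: "j \<in> I" "y \<in> Wf j" "ta t w = ta y (fst j)" using w(3) unfolding W_def Z_def by blast
    have yX: "y \<in> snd j" using j f1(1,2) by blast
    have ij: "i = j"
    proof (rule ccontr)
     assume "i \<noteq> j"
     then show False using I(3)[OF i(1) j(1)] tx yX tw j(3) by (metis IntI empty_iff image_eqI)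
    qed
    have "y = t \<otimes> x"
     using inj[OF vz(1)[OF i(1) xX]] tw j(3) ij tx yX I(2)[OF i(1)] unfolding inj_on_def by (metis subsetD)
    then have "(x, t \<otimes> x) \<in> {(x, y). x \<in> Wf i \<and> y \<in> Wf i \<and> (\<exists>t\<in>T'. y = t \<otimes> x)}"
     using i(2) j(2) ij tT(1) by blast
    then have path: "(x, t \<otimes> x) \<in> (cayley_edges GN F (Vf i) \<union> Ef i)\<^sup>*" by (rule subsetD[OF f1(8)[OF i(1)]])
    have xK: "y \<in> K" if "y \<in> snd i" for y using I(2)[OF i(1)] that by blast
    have xC: "x \<in> carrier G" using vz(3)[OF i(1) xX] .
    have "y \<in> snd i \<and> reach G ta D A w (y \<otimes> inv x)" if "(x, y) \<in> (cayley_edges GN F (Vf i) \<union> Ef i)\<^sup>*" for y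
     using that
    proof (induction rule: rtrancl_induct)
     case base
     have "\<one> \<in> KK" using KKm[OF xK[OF xX] xK[OF xX]] xC by simp
     then show ?case using xX xC reach_one[of G A ta D w] unfolding A_def by simp
    next
     case (step y z)
     have yX: "y \<in> snd i" using step by blast
     have yC: "y \<in> carrier G" using vz(3)[OF i(1) yX] .
     have pC: "y \<otimes> inv x \<in> carrier G" using yC xC by simp
     have "y \<otimes> inv x \<in> KK" by (rule KKm[OF xK[OF xX] xK[OF yX]])
     then have pG: "y \<otimes> inv x \<in> Gm" using inG(1) unfolding A_def by blast
     have "ta (y \<otimes> inv x) w = ta (y \<otimes> inv x \<otimes> x) (fst i)"
      using mul[OF vz(1)[OF i(1) xX] pG vz(2)[OF i(1) xX]] i(4) by simp
     then have cur: "ta (y \<otimes> inv x) w = ta y (fst i)" using xC yC by (simp add: m_assoc)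
     have "\<exists>a. a \<in> carrier G \<and> z = a \<otimes> y \<and> z \<in> snd i \<and> (a, ta y (fst i)) \<in> D"
      using step.hyps(2)
     proof
      assume "(y, z) \<in> cayley_edges GN F (Vf i)"
      then obtain a where "y \<in> Vf i" "z \<in> Vf i" "a \<in> F" "z = a \<otimes> y" unfolding cayley_edges_def GNs by blast
      then show ?thesis using i(1) f1(2)[OF i(1)] F(2) NC unfolding D_def U1_def Z_def by blast
     next
      assume yz: "(y, z) \<in> Ef i"
      have "z \<in> Wf i \<and> (\<exists>t\<in>T'. z = t \<otimes> y)" using subsetD[OF f1(5)[OF i(1)] yz] by simp
      then obtain a where "z \<in> Wf i" "a \<in> T'" "z = a \<otimes> y" by blast
      moreover have "y \<in> fst ` Ef i" using yz by (intro image_eqI[of _ _ "(y, z)"]) auto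
      then have "ta y (fst i) \<in> U2" unfolding U2_def Z_def using i(1) by blast
      ultimately show ?thesis using f1(1,2)[OF i(1)] T'(2) NC unfolding D_def by blast
     qed
     then obtain a where a: "a \<in> carrier G" "z = a \<otimes> y" "z \<in> snd i" "(a, ta y (fst i)) \<in> D" by blast
     have e: "a \<otimes> (y \<otimes> inv x) = z \<otimes> inv x" using a xC yC by (simp add: m_assoc)
     have "z \<otimes> inv x \<in> KK" by (rule KKm[OF xK[OF xX] xK[OF a(3)]])
     moreover have "reach G ta D A w (a \<otimes> (y \<otimes> inv x))"
     proof (rule reach.reach_step)
      show "reach G ta D A w (y \<otimes> inv x)" using step.IH by blast
      show "(a, ta (y \<otimes> inv x) w) \<in> D" using a(4) cur by simp
      show "a \<otimes> (y \<otimes> inv x) \<in> A" using e \<open>z \<otimes> inv x \<in> KK\<close> unfolding A_def by simp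
     qed
     ultimately show ?case using e a(3) by simp
    qed
    from this[OF path] have "reach G ta D A w (t \<otimes> x \<otimes> inv x)" by blast
    then show ?thesis using tG xC by (simp add: m_assoc)
   qed
   have DA: "D \<subseteq> A \<times> X" unfolding D_def A_def using U12 by blast
   from sparse_atI[OF WX DA cost unc conn] show "sparse_at G (V k) (sm k) c' S T A c ep" unfolding X_def ta_def .
  qed
 qed
 then show ?thesis using S by blast
qed

lemma sparse_conn_mono_left:
 assumes "sparse_conn G V sm c' S K c" "S \<subseteq> S'" "\<And>k. finite (V k)"
 shows "sparse_conn G V sm c' S' K c"
proof (rule sparse_connI)
 fix T and ep :: real assume T: "finite T" "T \<subseteq> K" "ep > 0"
 obtain A where A: "finite A" "A \<subseteq> carrier G" and ev: "\<forall>\<^sub>F k in sequentially. sparse_at G (V k) (sm k) c' S T A c ep"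
  by (rule sparse_connE[OF assms(1) T])
 have "\<forall>\<^sub>F k in sequentially. sparse_at G (V k) (sm k) c' S' T A c ep"
  using ev
 proof (rule eventually_mono)
  fix k assume "sparse_at G (V k) (sm k) c' S T A c ep"
  then obtain W D where h: "W \<subseteq> V k" "D \<subseteq> A \<times> V k" "(\<Sum>(s, u)\<in>D. c' s) \<le> c * rcard (V k)"
   "rcard (V k - cover S (sm k) W) \<le> ep * rcard (V k)"
   "\<forall>w\<in>W. \<forall>t\<in>T. sm k t w \<in> W --> reach G (sm k) D A w t"
   by (rule sparse_atE)
  have "card (V k - cover S' (sm k) W) \<le> card (V k - cover S (sm k) W)"
   using assms(2,3) by (intro card_mono) auto
  then have "rcard (V k - cover S' (sm k) W) \<le> ep * rcard (V k)" using h(4) by linarith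
  from sparse_atI[OF h(1-3) this h(5)[rule_format]] show "sparse_at G (V k) (sm k) c' S' T A c ep" .
 qed
 then show "\<exists>A. finite A \<and> A \<subseteq> carrier G \<and> (\<forall>\<^sub>F k in sequentially. sparse_at G (V k) (sm k) c' S' T A c ep)"
  using A by blast
qed

text \<open>Transfinite induction in which neither \<open>S\<close> nor the range of the constants
  changes: successors are handled by \<open>sparse_conn_normal_step\<close> with the same lower
  bound 1, and at a limit the finite set \<open>T\<close> already lies in an earlier stage.\<close>

lemma (in group) sparse_conn_w_normal:
 fixes c' :: "'a => real"
 assumes s: "sofic_approx_seq G V sm" and c': "\<And>g. c' g \<ge> 0"
  and N: "subgroup N G" "infinite N" "finite S" "S \<subseteq> N" and w: "w_normal N G"
  and base: "\<And>c. c > 1 ==> sparse_conn G V sm c' S N c" and c: "c > 1"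
 shows "sparse_conn G V sm c' S (carrier G) c"
proof -
 obtain r :: "nat rel" and Sg :: "nat => 'a set" and z e where
  r0: "Well_order r \<and> z \<in> Field r \<and> e \<in> Field r \<and>
    (\<forall>i\<in>Field r. (z, i) \<in> r \<and> (i, e) \<in> r) \<and>
    (\<forall>i\<in>Field r. subgroup (Sg i) G) \<and>
    Sg z = N \<and> Sg e = carrier G \<and>
    (\<forall>i j. (i, j) \<in> r --> Sg i \<subseteq> Sg j) \<and>
    (\<forall>i j. imm_succ r i j --> Sg i \<lhd> G\<lparr>carrier := Sg j\<rparr>) \<and>
    (\<forall>j\<in>Field r. j \<noteq> z \<and> (\<nexists>i. imm_succ r i j) --> Sg j = (\<Union>i\<in>underS r j. Sg i))"
  using w unfolding w_normal_def by (elim exE)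
 have r: "Well_order r" "z \<in> Field r" "e \<in> Field r" "Sg z = N" "Sg e = carrier G"
  using r0 by simp_all
 have rz: "(z, i) \<in> r" if "i \<in> Field r" for i using r0 that by simp
 have sg: "subgroup (Sg i) G" if "i \<in> Field r" for i using r0 that by simp
 have mono: "Sg i \<subseteq> Sg j" if "(i, j) \<in> r" for i j using r0 that by simp
 have nor: "Sg i \<lhd> G\<lparr>carrier := Sg j\<rparr>" if "imm_succ r i j" for i j using r0 that by simp
 have lim: "Sg j = (\<Union>i\<in>underS r j. Sg i)" if "j \<in> Field r" "j \<noteq> z" "\<nexists>i. imm_succ r i j" for j
  using r0 that by simp
 have wf: "wf (r - Id)" using r(1) unfolding well_order_on_def by (elim conjE)
 have refl: "(i, i) \<in> r" if "i \<in> Field r" for i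
 proof -
  have "refl_on (Field r) r"
   using r(1) unfolding well_order_on_def linear_order_on_def partial_order_on_def preorder_on_def by (elim conjE)
  then show ?thesis using that by (rule refl_onD)
 qed
 have tot: "(i, j) \<in> r \<or> (j, i) \<in> r" if "i \<in> Field r" "j \<in> Field r" for i j
 proof (cases "i = j")
  case False
  have "total_on (Field r) r" using r(1) unfolding well_order_on_def linear_order_on_def by (elim conjE)
  then show ?thesis using that False unfolding total_on_def by simp
 qed (use refl that in simp)
 have "j \<in> Field r ==> (\<forall>c>1. sparse_conn G V sm c' S (Sg j) c)" for j
  using wf
 proof (induction j rule: wf_induct_rule)
  case (less j)
  have NS: "N \<subseteq> Sg i" if "i \<in> Field r" for i using mono[OF rz[OF that]] r(4) by simp
  consider "j = z" | (succ) i where "imm_succ r i j" | (lim) "j \<noteq> z" "\<nexists>i. imm_succ r i j" by blast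
  then show ?case
  proof cases
   case 1
   then show ?thesis using base r(4) by simp
  next
   case (succ i)
   have iF: "i \<in> Field r" using succ unfolding imm_succ_def by blast
   have "i \<in> under r i" using refl[OF iF] unfolding under_def by simp
   then have ij: "i \<in> underS r j" using succ unfolding imm_succ_def by simp
   then have "(i, j) \<in> r - Id" unfolding underS_def by simp
   then have IH: "\<And>c. c > 1 ==> sparse_conn G V sm c' S (Sg i) c" using less.IH iF by blast
   interpret nm: normal "Sg i" "G\<lparr>carrier := Sg j\<rparr>" using nor[OF succ] .
   have "t \<otimes> x \<otimes> inv t \<in> Sg i" if "t \<in> Sg j" "x \<in> Sg i" for t x
    using nm.inv_op_closed2[of t x] that m_inv_consistent[OF sg[OF less.prems] that(1)] by simp
   then show ?thesis
    using sparse_conn_normal_step[OF s c' N sg[OF iF] NS[OF iF] subgroup.subset[OF sg[OF less.prems]] _ IH]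
    by blast
  next
   case lim': lim
   show ?thesis
   proof (intro allI impI)
    fix c :: real assume c: "c > 1"
    show "sparse_conn G V sm c' S (Sg j) c"
    proof (rule sparse_connI)
     fix T and ep :: real assume T: "finite T" "T \<subseteq> Sg j" "ep > 0"
     have "\<exists>i\<in>underS r j. T \<subseteq> Sg i"
      using T(1,2)
     proof (induction T rule: finite_induct)
      case empty
      have "z \<in> underS r j" using rz[OF less.prems] lim'(1) unfolding underS_def by simp
      then show ?case by blast
     next
      case (insert x T)
      then obtain i where i: "i \<in> underS r j" "T \<subseteq> Sg i" by blast
      obtain i' where i': "i' \<in> underS r j" "x \<in> Sg i'" using insert.prems lim[OF less.prems lim'] by blast
      have F: "i \<in> Field r" "i' \<in> Field r" using i i' unfolding underS_def Field_def by blast+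
      show ?case using tot[OF F] mono[of i i'] mono[of i' i] i i' by blast
     qed
     then obtain i where i: "i \<in> underS r j" "T \<subseteq> Sg i" by blast
     then have "(i, j) \<in> r - Id" "i \<in> Field r" unfolding underS_def Field_def by blast+
     then have "sparse_conn G V sm c' S (Sg i) c" using less.IH c by blast
     then show "ev_sparse G V sm c' S T c ep"
      unfolding sparse_conn_def using T i(2) by blast
    qed
   qed
  qed
 qed
 then show ?thesis using r(3,5) c by metis
qed

section \<open>Products of two sofic groups\<close>

text \<open>Pairs are coded because sofic approximation sequences live on finite sets of natural
  numbers; off the coded rectangle the map is the identity, as \<open>permutes\<close>
  demands.\<close>

definition prod_perm :: "nat set => nat set => (nat => nat) => (nat => nat) => nat => nat" where
 "prod_perm X Y f g v = (if v \<in> prod_encode ` (X \<times> Y)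
   then prod_encode (f (fst (prod_decode v)), g (snd (prod_decode v))) else v)"

lemma prod_perm_encode [simp]:
 "a \<in> X ==> b \<in> Y ==> prod_perm X Y f g (prod_encode (a, b)) = prod_encode (f a, g b)"
 unfolding prod_perm_def by auto

lemma prod_perm_permutes:
 assumes "f permutes X" "g permutes Y"
 shows "prod_perm X Y f g permutes prod_encode ` (X \<times> Y)"
proof (rule bij_imp_permutes)
 show "bij_betw (prod_perm X Y f g) (prod_encode ` (X \<times> Y)) (prod_encode ` (X \<times> Y))"
 proof (rule bij_betw_imageI)
  show "inj_on (prod_perm X Y f g) (prod_encode ` (X \<times> Y))"
   using permutes_inj[OF assms(1)] permutes_inj[OF assms(2)]
   by (intro inj_onI) (auto simp: inj_eq)
  show "prod_perm X Y f g ` prod_encode ` (X \<times> Y) = prod_encode ` (X \<times> Y)"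
  proof
   show "prod_perm X Y f g ` prod_encode ` (X \<times> Y) \<subseteq> prod_encode ` (X \<times> Y)"
    using permutes_in_image[OF assms(1)] permutes_in_image[OF assms(2)] by auto
   show "prod_encode ` (X \<times> Y) \<subseteq> prod_perm X Y f g ` prod_encode ` (X \<times> Y)"
   proof clarify
    fix a b assume ab: "a \<in> X" "b \<in> Y"
    obtain a' where a': "a' \<in> X" "a = f a'" using permutes_image[OF assms(1)] ab by blast
    obtain b' where b': "b' \<in> Y" "b = g b'" using permutes_image[OF assms(2)] ab by blast
    have "prod_encode (a, b) = prod_perm X Y f g (prod_encode (a', b'))" using a' b' by simp
    then show "prod_encode (a, b) \<in> prod_perm X Y f g ` prod_encode ` (X \<times> Y)" using a' b' by blast
   qed
  qed
 qed
qed (simp add: prod_perm_def)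

text \<open>Errors of multiplicativity in the two coordinates add up, hence the tolerance dl / 2.
  Distinct elements differ under \<open>pA\<close> or under \<open>pB\<close>, and separation in one
  coordinate suffices.\<close>

lemma sofic_approx_seq_prod:
 fixes G :: "('g, 'c) monoid_scheme" (structure)
 assumes A: "sofic_approx_seq A VA smA" and B: "sofic_approx_seq B VB smB" and G: "group G" and gA: "group A" and gB: "group B"
  and hA: "pA \<in> hom G A" and hB: "pB \<in> hom G B"
  and inj: "\<And>g h. g \<in> carrier G ==> h \<in> carrier G ==> pA g = pA h ==> pB g = pB h ==> g = h"
 shows "sofic_approx_seq G (\<lambda>k. prod_encode ` (VA k \<times> VB k))
  (\<lambda>k g. prod_perm (VA k) (VB k) (smA k (pA g)) (smB k (pB g)))"
 unfolding sofic_approx_seq_def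
proof (intro conjI allI impI)
 fix k
 have sA: "sofic_approx A (VA k) (smA k)" and sB: "sofic_approx B (VB k) (smB k)"
  using A B unfolding sofic_approx_seq_def by blast+
 have "prod_perm (VA k) (VB k) (smA k (pA g)) (smB k (pB g)) permutes prod_encode ` (VA k \<times> VB k)"
  if "g \<in> carrier G" for g
  using sofic_approx_permutes[OF sA hom_in_carrier[OF hA that]] sofic_approx_permutes[OF sB hom_in_carrier[OF hB that]]
  by (rule prod_perm_permutes)
 then show "sofic_approx G (prod_encode ` (VA k \<times> VB k)) (\<lambda>g. prod_perm (VA k) (VB k) (smA k (pA g)) (smB k (pB g)))"
  using sA sB unfolding sofic_approx_def by auto
next
 fix F and dl :: real assume F: "finite F \<and> F \<subseteq> carrier G \<and> dl > 0"
 have "finite (pA ` F)" "pA ` F \<subseteq> carrier A" "finite (pB ` F)" "pB ` F \<subseteq> carrier B" "dl / 2 > 0"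
  using F hA hB by (auto simp: hom_def)
 then have "\<forall>\<^sub>F k in sequentially. good_approx A (pA ` F) (dl / 2) (VA k) (smA k)"
  "\<forall>\<^sub>F k in sequentially. good_approx B (pB ` F) (dl / 2) (VB k) (smB k)"
  using A B unfolding sofic_approx_seq_def by blast+
 then show "\<forall>\<^sub>F k in sequentially. good_approx G F dl (prod_encode ` (VA k \<times> VB k))
   (\<lambda>g. prod_perm (VA k) (VB k) (smA k (pA g)) (smB k (pB g)))"
 proof (eventually_elim)
  case (elim k)
  define X where "X = VA k"
  define Y where "Y = VB k"
  define f where "f = (\<lambda>g. smA k (pA g))"
  define h where "h = (\<lambda>g. smB k (pB g))"
  have sA: "sofic_approx A X (smA k)" and sB: "sofic_approx B Y (smB k)"
   using A B unfolding sofic_approx_seq_def X_def Y_def by blast+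
  have fin: "finite X" "finite Y" "card X > 0" "card Y > 0"
   using sA sB unfolding sofic_approx_def by (auto simp: card_gt_0_iff)
  have cV: "card (prod_encode ` (X \<times> Y)) = card X * card Y"
   by (simp add: card_image[OF inj_prod_encode] card_cartesian_product)
  have inX: "f g a \<in> X" if "g \<in> carrier G" "a \<in> X" for g a
   unfolding f_def using permutes_in_image[OF sofic_approx_permutes[OF sA hom_in_carrier[OF hA that(1)]]] that(2) by blast
  have inY: "h g a \<in> Y" if "g \<in> carrier G" "a \<in> Y" for g a
   unfolding h_def using permutes_in_image[OF sofic_approx_permutes[OF sB hom_in_carrier[OF hB that(1)]]] that(2) by blast
  have mult: "hamming_dist (prod_encode ` (X \<times> Y)) (prod_perm X Y (f (s \<otimes> t)) (h (s \<otimes> t)))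
    (prod_perm X Y (f s) (h s) \<circ> prod_perm X Y (f t) (h t)) \<le> dl" if st: "s \<in> F" "t \<in> F" for s t
  proof -
   have c: "s \<in> carrier G" "t \<in> carrier G" using st F by auto
   let ?D = "{v \<in> prod_encode ` (X \<times> Y). prod_perm X Y (f (s \<otimes> t)) (h (s \<otimes> t)) v \<noteq> (prod_perm X Y (f s) (h s) \<circ> prod_perm X Y (f t) (h t)) v}"
   define EA where "EA = {a \<in> X. f (s \<otimes> t) a \<noteq> (f s \<circ> f t) a}"
   define EB where "EB = {a \<in> Y. h (s \<otimes> t) a \<noteq> (h s \<circ> h t) a}"
   have fE: "finite EA" "finite EB" unfolding EA_def EB_def using fin by auto
   have "hamming_dist X (f (s \<otimes> t)) (f s \<circ> f t) \<le> dl / 2"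
    using elim(1) st c hom_mult[OF hA] unfolding good_approx_def X_def f_def by auto
   then have cEA: "card EA \<le> dl / 2 * card X"
    unfolding hamming_dist_def EA_def using fin by (simp add: pos_divide_le_eq)
   have "hamming_dist Y (h (s \<otimes> t)) (h s \<circ> h t) \<le> dl / 2"
    using elim(2) st c hom_mult[OF hB] unfolding good_approx_def Y_def h_def by auto
   then have cEB: "card EB \<le> dl / 2 * card Y"
    unfolding hamming_dist_def EB_def using fin by (simp add: pos_divide_le_eq)
   have "?D \<subseteq> prod_encode ` (EA \<times> Y \<union> X \<times> EB)"
    using inX[OF c(2)] inY[OF c(2)] unfolding EA_def EB_def by auto
   then have "card ?D \<le> card (prod_encode ` (EA \<times> Y \<union> X \<times> EB))"
    using fin fE by (intro card_mono) auto
   also have "\<dots> \<le> card (EA \<times> Y \<union> X \<times> EB)" using fin fE by (intro card_image_le) auto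
   also have "\<dots> \<le> card EA * card Y + card X * card EB"
    using card_Un_le[of "EA \<times> Y" "X \<times> EB"] by (simp add: card_cartesian_product)
   finally have "rcard ?D \<le> rcard EA * card Y + card X * rcard EB"
    unfolding of_nat_mult[symmetric] of_nat_add[symmetric] of_nat_le_iff .
   also have "\<dots> \<le> (dl / 2 * card X) * card Y + card X * (dl / 2 * card Y)"
    using cEA cEB by (intro add_mono mult_left_mono mult_right_mono) auto
   also have "\<dots> = dl * (card X * card Y)" by simp
   finally show ?thesis unfolding hamming_dist_def cV using fin by (simp add: pos_divide_le_eq)
  qed
  have sep: "1 - dl \<le> hamming_dist (prod_encode ` (X \<times> Y)) (prod_perm X Y (f s) (h s)) (prod_perm X Y (f t) (h t))"
   if st: "s \<in> F" "t \<in> F" "s \<noteq> t" for s t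
  proof -
   have c: "s \<in> carrier G" "t \<in> carrier G" using st F by auto
   define DA where "DA = {a \<in> X. f s a \<noteq> f t a}"
   define DB where "DB = {b \<in> Y. h s b \<noteq> h t b}"
   have big: "(1 - dl) * (card X * card Y) \<le> card (DA \<times> Y \<union> X \<times> DB)"
   proof (cases "pA s = pA t")
    case False
    then have "1 - dl / 2 \<le> hamming_dist X (f s) (f t)"
     using elim(1) st unfolding good_approx_def X_def f_def by auto
    then have "(1 - dl / 2) * card X \<le> card DA"
     unfolding hamming_dist_def DA_def using fin by (simp add: pos_le_divide_eq)
    moreover have "0 \<le> dl / 2 * card X" using F by simp
    ultimately have "(1 - dl) * card X \<le> card DA" by (simp add: algebra_simps)
    then have "(1 - dl) * card X * card Y \<le> card DA * rcard Y" by (rule mult_right_mono) simp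
    also have "\<dots> = card (DA \<times> Y)" by (simp add: card_cartesian_product)
    also have "\<dots> \<le> card (DA \<times> Y \<union> X \<times> DB)"
     using fin unfolding DA_def DB_def of_nat_le_iff by (intro card_mono) auto
    finally show ?thesis by (simp add: mult.assoc)
   next
    case True
    then have "pB s \<noteq> pB t" using inj[OF c] st(3) by blast
    then have "1 - dl / 2 \<le> hamming_dist Y (h s) (h t)"
     using elim(2) st unfolding good_approx_def Y_def h_def by auto
    then have "(1 - dl / 2) * card Y \<le> card DB"
     unfolding hamming_dist_def DB_def using fin by (simp add: pos_le_divide_eq)
    moreover have "0 \<le> dl / 2 * card Y" using F by simp
    ultimately have "(1 - dl) * card Y \<le> card DB" by (simp add: algebra_simps)
    then have "(1 - dl) * card Y * card X \<le> card DB * rcard X" by (rule mult_right_mono) simp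
    also have "\<dots> = card (X \<times> DB)" by (simp add: card_cartesian_product)
    also have "\<dots> \<le> card (DA \<times> Y \<union> X \<times> DB)"
     using fin unfolding DA_def DB_def of_nat_le_iff by (intro card_mono) auto
    finally show ?thesis by (simp add: mult_ac)
   qed
   also have "card (DA \<times> Y \<union> X \<times> DB) = card (prod_encode ` (DA \<times> Y \<union> X \<times> DB))"
    by (simp add: card_image[OF inj_prod_encode])
   also have "\<dots> \<le> card {v \<in> prod_encode ` (X \<times> Y). prod_perm X Y (f s) (h s) v \<noteq> prod_perm X Y (f t) (h t) v}"
    unfolding of_nat_le_iff using fin by (intro card_mono) (auto simp: DA_def DB_def)
   finally show ?thesis unfolding hamming_dist_def cV using fin by (simp add: pos_le_divide_eq)
  qed
  show ?case unfolding good_approx_def using mult sep unfolding X_def Y_def f_def h_def by blast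
 qed
qed

text \<open>To apply t from the kernel of \<open>pA\<close>, a copy of B, one walks in the
  A-direction to a point over the sparse set \<open>WA\<close>, applies t there and walks back; t
  commutes with the walk. The walks use a set \<open>F\<close> that is independent of
  \<open>T\<close>. As \<open>F\<close> generates an infinite group, \<open>QA\<close> can be taken
  as large, and \<open>WA\<close> as sparse, as the cost of \<open>T\<close> requires.\<close>

lemma sparse_conn_product:
 fixes G :: "('g, 'c) monoid_scheme" (structure) and c' :: "'g => real"
 assumes A: "sofic_approx_seq A VA smA" and B: "sofic_approx_seq B VB smB" and G: "group G" and gA: "group A" and gB: "group B"
  and hA: "pA \<in> hom G A" and hB: "pB \<in> hom G B"
  and inj: "\<And>g h. g \<in> carrier G ==> h \<in> carrier G ==> pA g = pA h ==> pB g = pB h ==> g = h"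
  and surj: "\<And>x y. x \<in> carrier A ==> y \<in> carrier B ==> \<exists>g\<in>carrier G. pA g = x \<and> pB g = y"
  and nlf: "\<not> locally_finite_group A" and infB: "infinite (carrier B)" and c': "\<And>g. c' g \<ge> 0"
 shows "\<exists>S. finite S \<and> S \<subseteq> {g \<in> carrier G. pA g = \<one>\<^bsub>A\<^esub>} \<and>
  (\<forall>c>1. sparse_conn G (\<lambda>k. prod_encode ` (VA k \<times> VB k))
   (\<lambda>k g. prod_perm (VA k) (VB k) (smA k (pA g)) (smB k (pB g))) c' S {g \<in> carrier G. pA g = \<one>\<^bsub>A\<^esub>} c)"
proof -
 interpret G: group G by fact
 interpret A: group A by fact
 interpret B: group B by fact
 obtain gg where gg: "\<And>x y. x \<in> carrier A ==> y \<in> carrier B ==> gg x y \<in> carrier G \<and> pA (gg x y) = x \<and> pB (gg x y) = y"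
  using surj by metis
 have pm: "pA (g \<otimes> h) = pA g \<otimes>\<^bsub>A\<^esub> pA h" "pB (g \<otimes> h) = pB g \<otimes>\<^bsub>B\<^esub> pB h"
  if "g \<in> carrier G" "h \<in> carrier G" for g h
  using hA hB that by (auto simp: hom_def)
 have pc: "pA g \<in> carrier A" "pB g \<in> carrier B" if "g \<in> carrier G" for g
  using hA hB that by (auto simp: hom_def)
 have p1: "pA \<one> = \<one>\<^bsub>A\<^esub>" "pB \<one> = \<one>\<^bsub>B\<^esub>"
  using hom_one[OF hA G gA] hom_one[OF hB G gB] by auto
 define N where "N = {g \<in> carrier G. pA g = \<one>\<^bsub>A\<^esub>}"
 define e where "e = (\<lambda>x. gg x \<one>\<^bsub>B\<^esub>)"
 have e: "e x \<in> carrier G" "pA (e x) = x" "pB (e x) = \<one>\<^bsub>B\<^esub>" if "x \<in> carrier A" for x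
  unfolding e_def using gg that by auto
 have e_mult: "e (x \<otimes>\<^bsub>A\<^esub> y) = e x \<otimes> e y" if "x \<in> carrier A" "y \<in> carrier A" for x y
  by (rule inj) (use that e pm in auto)
 have e1: "e \<one>\<^bsub>A\<^esub> = \<one>" by (rule inj) (use e p1 in auto)
 obtain F0 where F0: "F0 \<subseteq> carrier A" "finite F0" "infinite (generate A F0)"
  using nlf unfolding locally_finite_group_def by blast
 define F where "F = insert \<one>\<^bsub>A\<^esub> (F0 \<union> m_inv A ` F0)"
 have F: "finite F" "F \<subseteq> carrier A" "\<one>\<^bsub>A\<^esub> \<in> F" "\<And>f. f \<in> F ==> inv\<^bsub>A\<^esub> f \<in> F"
  unfolding F_def using F0 by auto
 have "generate A F0 \<subseteq> generate A F" by (rule A.mono_generate) (auto simp: F_def)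
 then have infF: "infinite (\<Union>n. spow A F n)"
  using F0(3) A.generate_eq_UN_spow[OF F(2-4)] finite_subset by metis
 define CF where "CF = (\<Sum>f\<in>e ` F. c' f)"
 have CF: "CF \<ge> 0" unfolding CF_def using c' by (simp add: sum_nonneg)
 obtain q0 :: nat where "2 * CF \<le> q0" using real_arch_simple by blast
 define q where "q = Suc q0"
 have q: "2 * CF \<le> q" "q \<ge> 1" using \<open>2 * CF \<le> q0\<close> unfolding q_def by auto
 \<comment> \<open>\<open>QB\<close>, and with it \<open>S\<close>, depends only on the cost of
   \<open>F\<close>; the corresponding set \<open>QA\<close> for the other factor is chosen after
   \<open>T\<close>.\<close>
 obtain QB where QB: "QB \<subseteq> carrier B" "finite QB" "card QB = q"
  using infinite_arbitrarily_large[OF infB] by blast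
 define QB' where "QB' = (\<lambda>(x, y). inv\<^bsub>B\<^esub> x \<otimes>\<^bsub>B\<^esub> y) ` (QB \<times> QB)"
 have QB': "finite QB'" "QB' \<subseteq> carrier B" unfolding QB'_def using QB by (auto simp: subset_iff)
 define S where "S = gg \<one>\<^bsub>A\<^esub> ` QB'"
 have S: "finite S" "S \<subseteq> N" unfolding S_def N_def using QB' gg by auto
 define V where "V = (\<lambda>k. prod_encode ` (VA k \<times> VB k))"
 define sm where "sm = (\<lambda>k g. prod_perm (VA k) (VB k) (smA k (pA g)) (smB k (pB g)))"
 have "sparse_conn G V sm c' S N c" if c: "c > 1" for c
 proof (rule sparse_connI)
  fix T and ep :: real assume T: "finite T" "T \<subseteq> N" and eps: "ep > 0"
  have TC: "T \<subseteq> carrier G" using T unfolding N_def by blast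
  have TA: "pA t = \<one>\<^bsub>A\<^esub>" if "t \<in> T" for t using T that unfolding N_def by blast
  define CT where "CT = (\<Sum>t\<in>T. c' t)"
  have CT: "CT \<ge> 0" unfolding CT_def using c' by (simp add: sum_nonneg)
  obtain p0 :: nat where "2 * CT \<le> p0" using real_arch_simple by blast
  define p where "p = Suc p0"
  have p: "2 * CT \<le> p" "p \<ge> 1" using \<open>2 * CT \<le> p0\<close> unfolding p_def by auto
  obtain QA where QA: "QA \<subseteq> (\<Union>n. spow A F n)" "finite QA" "card QA = p"
   using infinite_arbitrarily_large[OF infF] by blast
  have "\<exists>n. QA \<subseteq> spow A F n"
   using QA(2,1)
  proof (induction QA rule: finite_induct)
   case (insert x Q)
   then obtain n m where "Q \<subseteq> spow A F n" "x \<in> spow A F m" by auto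
   then have "insert x Q \<subseteq> spow A F (max n m)"
    using A.spow_mono[OF F(2,3), of n "max n m"] A.spow_mono[OF F(2,3), of m "max n m"] by auto
   then show ?case by blast
  qed simp
  then obtain n0 where n0: "QA \<subseteq> spow A F n0" by blast
  define n where "n = n0 + n0"
  have spc: "x \<in> carrier A" if "x \<in> spow A F i" for x i using that A.spow_closed[OF F(2)] by blast
  have QAC: "QA \<subseteq> carrier A" using n0 spc by blast
  have QQ: "inv\<^bsub>A\<^esub> y \<otimes>\<^bsub>A\<^esub> x \<in> spow A F n" if "x \<in> QA" "y \<in> QA" for x y
   unfolding n_def using n0 that by (intro A.spow_add_mem[OF F(2)] A.spow_inv[OF F(2,4)]) auto
  define P where "P = spow A F n"
  have P: "finite P" "P \<subseteq> carrier A" unfolding P_def using A.spow_finite[OF F(1)] A.spow_closed[OF F(2)] by auto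
  define AA where "AA = e ` P \<union> T \<union> e ` F \<union> (\<lambda>(x, t, z). e x \<otimes> (t \<otimes> e z)) ` (P \<times> T \<times> P)"
  have AA: "finite AA" "AA \<subseteq> carrier G"
   unfolding AA_def using P T F TC e by (auto simp: subset_iff)
  define GmA where "GmA = insert \<one>\<^bsub>A\<^esub> (QA \<union> m_inv A ` QA \<union> P)"
  have GmA: "finite GmA" "GmA \<subseteq> carrier A" unfolding GmA_def using QA QAC P by auto
  define GmB where "GmB = insert \<one>\<^bsub>B\<^esub> (QB \<union> m_inv B ` QB)"
  have GmB: "finite GmB" "GmB \<subseteq> carrier B" unfolding GmB_def using QB by auto
  have g2: "ep / 2 > 0" using eps by simp
  show "ev_sparse G V sm c' S T c ep"
  proof (rule exI[of _ AA], intro conjI AA,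
    rule eventually_mono[OF eventually_conj[OF A.eventually_good_pts[OF A GmA g2] B.eventually_good_pts[OF B GmB g2]]],
    elim conjE)
   fix k
   define X where "X = VA k"
   define Y where "Y = VB k"
   define al where "al = smA k"
   define be where "be = smB k"
   define GA where "GA = good_pts A X al GmA"
   define GB where "GB = good_pts B Y be GmB"
   define ta where "ta = (\<lambda>g. prod_perm X Y (al (pA g)) (be (pB g)))"
   assume g0: "card (VA k - good_pts A (VA k) (smA k) GmA) \<le> ep / 2 * card (VA k)"
    "card (VB k - good_pts B (VB k) (smB k) GmB) \<le> ep / 2 * card (VB k)"
   then have gA: "card (X - GA) \<le> ep / 2 * card X" and gB: "card (Y - GB) \<le> ep / 2 * card Y"
    unfolding GA_def GB_def X_def Y_def al_def be_def by auto
   have sA: "sofic_approx A X al" and sB: "sofic_approx B Y be"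
    using A B unfolding sofic_approx_seq_def X_def Y_def al_def be_def by blast+
   have fin: "finite X" "finite Y" using sA sB unfolding sofic_approx_def by auto
   have inX: "al x a \<in> X" if "x \<in> carrier A" "a \<in> X" for x a
    using permutes_in_image[OF sofic_approx_permutes[OF sA that(1)]] that(2) by blast
   have inY: "be y b \<in> Y" if "y \<in> carrier B" "b \<in> Y" for y b
    using permutes_in_image[OF sofic_approx_permutes[OF sB that(1)]] that(2) by blast
   have GX: "GA \<subseteq> X" "GB \<subseteq> Y" unfolding GA_def GB_def good_pts_def by blast+
   have oneA: "al \<one>\<^bsub>A\<^esub> a = a" if "a \<in> GA" for a
    using A.good_pts_one[OF sA that[unfolded GA_def]] unfolding GmA_def by blast
   have oneB: "be \<one>\<^bsub>B\<^esub> b = b" if "b \<in> GB" for b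
    using B.good_pts_one[OF sB that[unfolded GB_def]] unfolding GmB_def by blast
   have mulA: "al (x \<otimes>\<^bsub>A\<^esub> y) a = al x (al y a)" if "a \<in> GA" "x \<in> GmA" "y \<in> GmA" for a x y
    using good_pts_mult[OF that(1)[unfolded GA_def] that(2,3)] .
   have mulB: "be (x \<otimes>\<^bsub>B\<^esub> y) b = be x (be y b)" if "b \<in> GB" "x \<in> GmB" "y \<in> GmB" for b x y
    using good_pts_mult[OF that(1)[unfolded GB_def] that(2,3)] .
   have QAne: "QA \<noteq> {}" "QB \<noteq> {}" using QA(3) QB(3) p(2) q(2) by auto
   obtain WA where WA: "WA \<subseteq> GA" "card QA * card WA \<le> card X" "\<forall>d\<in>GA. \<exists>w\<in>WA. \<exists>x\<in>QA. \<exists>y\<in>QA. al x d = al y w"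
    by (rule sparse_net[OF fin(1) GX(1) QAne(1) QA(2), of al])
     (use inX QAC in blast, use good_pts_inj[of _ A X al GmA] in \<open>unfold GA_def GmA_def, blast\<close>)
   obtain WB where WB: "WB \<subseteq> GB" "card QB * card WB \<le> card Y" "\<forall>d\<in>GB. \<exists>w\<in>WB. \<exists>x\<in>QB. \<exists>y\<in>QB. be x d = be y w"
    by (rule sparse_net[OF fin(2) GX(2) QAne(2) QB(2), of be])
     (use inY QB in blast, use good_pts_inj[of _ B Y be GmB] in \<open>unfold GB_def GmB_def, blast\<close>)
   define W where "W = prod_encode ` (GA \<times> WB)"
   \<comment> \<open>Steps by \<open>F\<close> in the A-direction over all of \<open>X\<close>, but
     only at the heights in \<open>WB\<close>, and steps by \<open>T\<close> only over
     \<open>WA\<close>. Each family costs at most half of \<open>card Z\<close>.\<close>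
   define D where "D = e ` F \<times> prod_encode ` (X \<times> WB) \<union> T \<times> prod_encode ` (WA \<times> Y)"
   define Z where "Z = prod_encode ` (X \<times> Y)"
   have cZ: "card Z = card X * card Y"
    unfolding Z_def by (simp add: card_image[OF inj_prod_encode] card_cartesian_product)
   have WZ: "W \<subseteq> Z" unfolding W_def Z_def using GX WB(1) by blast
   have DZ: "D \<subseteq> AA \<times> Z"
    unfolding D_def AA_def Z_def using GX WA(1) WB(1) by blast
   have cost: "(\<Sum>(s, u)\<in>D. c' s) \<le> c * rcard Z"
   proof -
    have fW: "finite WA" "finite WB" using WA(1) WB(1) GX fin finite_subset by metis+
    have "(\<Sum>(s, u)\<in>D. c' s) \<le> CF * card (prod_encode ` (X \<times> WB)) + CT * card (prod_encode ` (WA \<times> Y))"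
     unfolding D_def CF_def CT_def sum_cost_Times[symmetric, of c' "e ` F"]
     by (rule sum_cost_le) (use F(1) T(1) fW fin c' in auto)
    also have "\<dots> = card X * (CF * card WB) + card Y * (CT * card WA)"
     by (simp add: card_image[OF inj_prod_encode] card_cartesian_product algebra_simps)
    also have "\<dots> \<le> card X * (card Y / 2) + card Y * (card X / 2)"
    proof (intro add_mono mult_left_mono)
     have "2 * CF * rcard WB \<le> real q * rcard WB" using q(1) by (rule mult_right_mono) simp
     also have "\<dots> \<le> card Y" unfolding of_nat_mult[symmetric] of_nat_le_iff using WB(2) QB(3) by simp
     finally show "CF * card WB \<le> card Y / 2" by simp
     have "2 * CT * rcard WA \<le> real p * rcard WA" using p(1) by (rule mult_right_mono) simp
     also have "\<dots> \<le> card X" unfolding of_nat_mult[symmetric] of_nat_le_iff using WA(2) QA(3) by simp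
     finally show "CT * card WA \<le> card X / 2" by simp
    qed auto
    also have "\<dots> = 1 * rcard Z" unfolding cZ by simp
    also have "\<dots> \<le> c * rcard Z" using c by (intro mult_right_mono) auto
    finally show ?thesis .
   qed
   have unc: "rcard (Z - cover S ta W) \<le> ep * rcard Z"
   proof -
    let ?E = "(X - GA) \<times> Y \<union> X \<times> (Y - GB)"
    have "Z - cover S ta W \<subseteq> prod_encode ` ?E"
    proof
     fix z assume z: "z \<in> Z - cover S ta W"
     then obtain a b where ab: "a \<in> X" "b \<in> Y" "z = prod_encode (a, b)" unfolding Z_def by auto
     show "z \<in> prod_encode ` ?E"
     proof (rule ccontr)
      assume "z \<notin> prod_encode ` ?E"
      then have g: "a \<in> GA" "b \<in> GB" using ab by blast+
      obtain w x y where w: "w \<in> WB" "x \<in> QB" "y \<in> QB" "be x b = be y w" using WB(3) g(2) by blast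
      have xy: "x \<in> carrier B" "y \<in> carrier B" "inv\<^bsub>B\<^esub> x \<in> GmB" "x \<in> GmB" "y \<in> GmB"
       using w QB unfolding GmB_def by auto
      have wG: "w \<in> GB" using w WB(1) by blast
      have "b = be (inv\<^bsub>B\<^esub> x \<otimes>\<^bsub>B\<^esub> x) b" using oneB[OF g(2)] xy by simp
      also have "\<dots> = be (inv\<^bsub>B\<^esub> x) (be y w)" using mulB[OF g(2) xy(3,4)] w(4) by simp
      also have "\<dots> = be (inv\<^bsub>B\<^esub> x \<otimes>\<^bsub>B\<^esub> y) w" using mulB[OF wG xy(3,5)] by simp
      finally have b: "b = be (inv\<^bsub>B\<^esub> x \<otimes>\<^bsub>B\<^esub> y) w" .
      have m: "inv\<^bsub>B\<^esub> x \<otimes>\<^bsub>B\<^esub> y \<in> QB'" unfolding QB'_def using w by force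
      define s where "s = gg \<one>\<^bsub>A\<^esub> (inv\<^bsub>B\<^esub> x \<otimes>\<^bsub>B\<^esub> y)"
      have s: "s \<in> S" "pA s = \<one>\<^bsub>A\<^esub>" "pB s = inv\<^bsub>B\<^esub> x \<otimes>\<^bsub>B\<^esub> y"
       unfolding s_def S_def using m gg xy by auto
      have "ta s (prod_encode (a, w)) = z"
       unfolding ta_def s ab(3) using ab wG GX oneA[OF g(1)] b by (simp add: subset_iff)
      moreover have "prod_encode (a, w) \<in> W" unfolding W_def using g w by blast
      ultimately show False using z s(1) by blast
     qed
    qed
    then have "card (Z - cover S ta W) \<le> card (prod_encode ` ?E)"
     using fin by (intro card_mono) auto
    also have "\<dots> = card ?E" by (rule card_image[OF inj_prod_encode])
    also have "\<dots> \<le> card (X - GA) * card Y + card X * card (Y - GB)"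
     using card_Un_le[of "(X - GA) \<times> Y" "X \<times> (Y - GB)"] by (simp add: card_cartesian_product)
    finally have "rcard (Z - cover S ta W) \<le> rcard (X - GA) * card Y + card X * rcard (Y - GB)"
     unfolding of_nat_mult[symmetric] of_nat_add[symmetric] of_nat_le_iff .
    also have "\<dots> \<le> (ep / 2 * card X) * card Y + card X * (ep / 2 * card Y)"
     using gA gB by (intro add_mono mult_left_mono mult_right_mono) auto
    also have "\<dots> = ep * rcard Z" unfolding cZ by simp
    finally show ?thesis .
   qed
   have conn: "reach G ta D AA w t" if w: "w \<in> W" "t \<in> T" "ta t w \<in> W" for w t
   proof -
    obtain a b where ab: "a \<in> GA" "b \<in> WB" "w = prod_encode (a, b)" using w(1) unfolding W_def by auto
    have bG: "b \<in> GB" using ab WB(1) by blast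
    have abX: "a \<in> X" "b \<in> Y" using ab bG GX by auto
    have tC: "t \<in> carrier G" "pB t \<in> carrier B" using w(2) TC pc by auto
    have tw: "ta t w = prod_encode (al \<one>\<^bsub>A\<^esub> a, be (pB t) b)"
     unfolding ta_def ab(3) using abX TA[OF w(2)] by simp
    have b1: "be (pB t) b \<in> WB" using w(3) unfolding tw W_def by (auto simp: inj_eq[OF inj_prod_encode])
    obtain a' x y where a': "a' \<in> WA" "x \<in> QA" "y \<in> QA" "al x a = al y a'" using WA(3) ab(1) by blast
    define z where "z = inv\<^bsub>A\<^esub> y \<otimes>\<^bsub>A\<^esub> x"
    have zP: "z \<in> P" unfolding z_def P_def using QQ a' by blast
    have zi: "inv\<^bsub>A\<^esub> z \<in> P" using A.spow_inv[OF F(2,4)] zP unfolding P_def by blast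
    have xyC: "x \<in> carrier A" "y \<in> carrier A" "z \<in> carrier A" "inv\<^bsub>A\<^esub> z \<in> carrier A"
     using a' QAC zP zi P by auto
    have a'G: "a' \<in> GA" using a' WA(1) by blast
    have Gmm: "x \<in> GmA" "y \<in> GmA" "inv\<^bsub>A\<^esub> y \<in> GmA" using a' unfolding GmA_def by auto
    have "al z a = al (inv\<^bsub>A\<^esub> y) (al y a')" unfolding z_def using mulA[OF ab(1) Gmm(3,1)] a'(4) by simp
    also have "\<dots> = al (inv\<^bsub>A\<^esub> y \<otimes>\<^bsub>A\<^esub> y) a'" using mulA[OF a'G Gmm(3,2)] by simp
    finally have za: "al z a = a'" using oneA[OF a'G] xyC by simp
    have walk: "reach G ta D AA w (e x \<otimes> h)"
     if h: "reach G ta D AA w h" "h \<in> carrier G" "be (pB h) b \<in> WB" "x \<in> spow A F i" "i \<le> n"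
      "\<And>x i. x \<in> P ==> e x \<otimes> h \<in> AA" for h x i
     using h(4,5)
    proof (induction i arbitrary: x)
     case 0
     then show ?case using h(1,2) e1 by simp
    next
     case (Suc i)
     obtain f y where f: "f \<in> F" "y \<in> spow A F i" "x = f \<otimes>\<^bsub>A\<^esub> y" using Suc.prems(1) by auto
     have fyC: "f \<in> carrier A" "y \<in> carrier A" using f F spc by auto
     have IH: "reach G ta D AA w (e y \<otimes> h)" using Suc.IH[OF f(2)] Suc.prems(2) by simp
     have pt: "ta (e y \<otimes> h) w = prod_encode (al (y \<otimes>\<^bsub>A\<^esub> pA h) a, be (pB h) b)"
      unfolding ta_def ab(3) using abX pm[OF e(1)[OF fyC(2)] h(2)] e[OF fyC(2)] pc[OF h(2)] by simp
     have "al (y \<otimes>\<^bsub>A\<^esub> pA h) a \<in> X" using inX fyC pc[OF h(2)] abX by auto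
     then have "(e f, ta (e y \<otimes> h) w) \<in> D" unfolding pt D_def using f(1) h(3) by blast
     moreover have eq: "e f \<otimes> (e y \<otimes> h) = e x \<otimes> h"
      unfolding f(3) using e_mult[OF fyC] e(1) fyC h(2) by (simp add: G.m_assoc)
     moreover have "x \<in> P"
      using Suc.prems A.spow_mono[OF F(2,3), of "Suc i" n] unfolding P_def by blast
     then have "e x \<otimes> h \<in> AA" using h(6) by blast
     ultimately show ?case using reach.reach_step[OF IH, of "e f"] by simp
    qed
    have 1: "\<one> \<in> AA" unfolding AA_def using e1 F(3) by (metis UnI1 UnI2 imageI)
    have ez: "reach G ta D AA w (e z \<otimes> \<one>)"
    proof (rule walk[OF reach_one[OF 1] G.one_closed _ zP[unfolded P_def] order_refl])
     show "be (pB \<one>) b \<in> WB" unfolding p1 using oneB[OF bG] ab(2) by simp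
     fix x assume x: "x \<in> P"
     then have "e x \<in> carrier G" using e P by auto
     then show "e x \<otimes> \<one> \<in> AA" unfolding AA_def using x by simp
    qed
    have ezC: "e z \<in> carrier G" using e xyC by auto
    have "ta (e z) w = prod_encode (a', b)"
     unfolding ta_def ab(3) using abX e[OF xyC(3)] za oneB[OF bG] by simp
    then have "(t, ta (e z) w) \<in> D" unfolding D_def using w(2) a'(1) abX by blast
    moreover have tA: "t \<otimes> e z \<in> AA"
    proof -
     have "\<one>\<^bsub>A\<^esub> \<in> P" unfolding P_def using A.spow_mono[OF F(2,3), of 0 n] by auto
     then have "e \<one>\<^bsub>A\<^esub> \<otimes> (t \<otimes> e z) \<in> AA" unfolding AA_def using w(2) zP by force
     then show ?thesis using e1 tC ezC by simp
    qed
    ultimately have rt: "reach G ta D AA w (t \<otimes> e z)"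
     using reach.reach_step[of G ta D AA w "e z" t] ez ezC by simp
    have "reach G ta D AA w (e (inv\<^bsub>A\<^esub> z) \<otimes> (t \<otimes> e z))"
    proof (rule walk[OF rt _ _ zi[unfolded P_def] order_refl])
     show "t \<otimes> e z \<in> carrier G" using tC ezC by simp
     show "be (pB (t \<otimes> e z)) b \<in> WB" using pm[OF tC(1) ezC] e[OF xyC(3)] tC b1 by simp
     fix x assume "x \<in> P"
     then show "e x \<otimes> (t \<otimes> e z) \<in> AA" unfolding AA_def using w(2) zP by force
    qed
    \<comment> \<open>Compared in both coordinates: t is trivial under \<open>pA\<close> and the
      values of \<open>e\<close> are trivial under \<open>pB\<close>, so the two walks
      cancel.\<close>
    moreover have "e (inv\<^bsub>A\<^esub> z) \<otimes> (t \<otimes> e z) = t"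
     by (rule inj) (use xyC tC ezC e pm TA[OF w(2)] in auto)
    ultimately show ?thesis by simp
   qed
   have eqs: "V k = Z" "sm k = ta" unfolding V_def Z_def sm_def ta_def X_def Y_def al_def be_def by auto
   from sparse_atI[OF WZ DZ cost unc conn] show "sparse_at G (V k) (sm k) c' S T AA c ep" unfolding eqs .
  qed
 qed
 then show ?thesis using S unfolding N_def V_def sm_def by blast
qed

text \<open>One sequence has to serve all cost functions, since the cost will be defined from the
  cocycle and from the tolerated loss of entropy.\<close>

abbreviation "has_sparse_seq G \<equiv> \<exists>V sm. sofic_approx_seq G V sm \<and>
 (\<forall>c'. (\<forall>g. c' g \<ge> 0) --> sparse_within G V sm c' (carrier G))"

text \<open>A single normal step leads from the kernel of \<open>pA\<close> to the whole group; the
  kernel is infinite because it maps onto B.\<close>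

lemma sparse_sofic_seq_product:
 assumes G: "group G" and gA: "group A" and gB: "group B" and sA: "sofic A" and sB: "sofic B"
  and hA: "pA \<in> hom G A" and hB: "pB \<in> hom G B"
  and inj: "\<And>g h. g \<in> carrier G ==> h \<in> carrier G ==> pA g = pA h ==> pB g = pB h ==> g = h"
  and surj: "\<And>x y. x \<in> carrier A ==> y \<in> carrier B ==> \<exists>g\<in>carrier G. pA g = x \<and> pB g = y"
  and nlf: "\<not> locally_finite_group A" and infB: "infinite (carrier B)"
 shows "has_sparse_seq G"
proof -
 interpret G: group G by fact
 interpret A: group A by fact
 obtain VA smA where A: "sofic_approx_seq A VA smA" using sA unfolding sofic_def by (elim exE)
 obtain VB smB where B: "sofic_approx_seq B VB smB" using sB unfolding sofic_def by (elim exE)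
 define V where "V = (\<lambda>k. prod_encode ` (VA k \<times> VB k))"
 define sm where "sm = (\<lambda>k g. prod_perm (VA k) (VB k) (smA k (pA g)) (smB k (pB g)))"
 define N where "N = {g \<in> carrier G. pA g = \<one>\<^bsub>A\<^esub>}"
 have seq: "sofic_approx_seq G V sm"
  unfolding V_def sm_def by (rule sofic_approx_seq_prod[OF A B G gA gB hA hB inj])
 have hm: "pA (g \<otimes>\<^bsub>G\<^esub> h) = pA g \<otimes>\<^bsub>A\<^esub> pA h" "pA g \<in> carrier A" if "g \<in> carrier G" "h \<in> carrier G" for g h
  using hA that by (auto simp: hom_def)
 have p1: "pA \<one>\<^bsub>G\<^esub> = \<one>\<^bsub>A\<^esub>" using hom_one[OF hA G gA] .
 have pinv: "pA (inv\<^bsub>G\<^esub> g) = inv\<^bsub>A\<^esub> (pA g)" if "g \<in> carrier G" for g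
  using group_hom.hom_inv[of G A pA g] hA that G gA unfolding group_hom_def group_hom_axioms_def by blast
 have N: "subgroup N G"
  by (rule G.subgroupI) (use hm p1 pinv in \<open>auto simp: N_def\<close>)
 have nor: "t \<otimes>\<^bsub>G\<^esub> x \<otimes>\<^bsub>G\<^esub> inv\<^bsub>G\<^esub> t \<in> N" if "t \<in> carrier G" "x \<in> N" for t x
  using that hm pinv unfolding N_def by auto
 have infN: "infinite N"
 proof
  assume "finite N"
  moreover have "carrier B \<subseteq> pB ` N"
  proof
   fix y assume "y \<in> carrier B"
   then obtain g where "g \<in> carrier G" "pA g = \<one>\<^bsub>A\<^esub>" "pB g = y" using surj[OF A.one_closed] by blast
   then show "y \<in> pB ` N" unfolding N_def by blast
  qed
  ultimately show False using infB finite_surj by blast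
 qed
 have "sparse_within G V sm c' (carrier G)"
  if c': "\<forall>g. c' g \<ge> 0" for c'
 proof -
  have c0: "\<And>g. c' g \<ge> 0" using c' by simp
  have "sparse_within G V sm c' N"
   unfolding N_def V_def sm_def
   by (rule sparse_conn_product[OF A B G gA gB hA hB inj surj nlf infB c0])
  then obtain S where S0: "finite S \<and> S \<subseteq> N \<and> (\<forall>c>1. sparse_conn G V sm c' S N c)" by (elim exE)
  then have S: "finite S" "S \<subseteq> N" "\<And>c. c > 1 ==> sparse_conn G V sm c' S N c" by simp_all
  have "sparse_conn G V sm c' S (carrier G) c" if "c > 1" for c
   by (rule G.sparse_conn_normal_step[OF seq c0 N infN S(1,2) N order_refl order_refl nor S(3) that])
  moreover have "S \<subseteq> carrier G" using S(2) unfolding N_def by blast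
  ultimately show ?thesis using S(1) by blast
 qed
 then show ?thesis using seq by blast
qed

text \<open>In the first class any sofic approximation sequence will do. In the second a product
  sequence is used, with the factors ordered so that the one providing the corridor is not locally
  finite.\<close>

lemma sparse_sofic_seq:
 assumes G: "group G" and so: "sofic G"
  and "has_w_normal_amenable_subgroup G \<or> product_of_infinite_sofic_groups G"
 shows "has_sparse_seq G"
 using assms(3)
proof
 interpret group G by fact
 assume "has_w_normal_amenable_subgroup G"
 then obtain N where N: "subgroup N G" "w_normal N G" "amenable (G\<lparr>carrier := N\<rparr>)"
  "\<not> locally_finite_group (G\<lparr>carrier := N\<rparr>)" "\<not> virtually_cyclic (G\<lparr>carrier := N\<rparr>)"
  unfolding has_w_normal_amenable_subgroup_def by blast
 obtain V sm where seq: "sofic_approx_seq G V sm" using so unfolding sofic_def by (elim exE)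
 have infN: "infinite N"
 proof
  assume f: "finite N"
  interpret GN: group "G\<lparr>carrier := N\<rparr>" using N(1) by (rule subgroup.subgroup_is_group) (rule is_group)
  have "locally_finite_group (G\<lparr>carrier := N\<rparr>)"
   unfolding locally_finite_group_def
  proof (intro allI impI)
   fix S assume "S \<subseteq> carrier (G\<lparr>carrier := N\<rparr>) \<and> finite S"
   then have "generate (G\<lparr>carrier := N\<rparr>) S \<subseteq> N" using GN.generate_incl[of S] by simp
   then show "finite (generate (G\<lparr>carrier := N\<rparr>) S)" using f by (rule finite_subset)
  qed
  then show False using N(4) by blast
 qed
 have "sparse_within G V sm c' (carrier G)"
  if c': "\<forall>g. c' g \<ge> 0" for c'
 proof -
  have c0: "\<And>g. c' g \<ge> 0" using c' by simp
  have "sparse_within G V sm c' N"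
   by (rule sparse_conn_amenable[OF seq c0 N(1,3-5)])
  then obtain S where S0: "finite S \<and> S \<subseteq> N \<and> (\<forall>c>1. sparse_conn G V sm c' S N c)" by (elim exE)
  then have S: "finite S" "S \<subseteq> N" "\<And>c. c > 1 ==> sparse_conn G V sm c' S N c" by simp_all
  have "sparse_conn G V sm c' S (carrier G) c" if "c > 1" for c
   by (rule sparse_conn_w_normal[OF seq c0 N(1) infN S(1,2) N(2) S(3) that])
  moreover have "S \<subseteq> carrier G" using S(2) subgroup.subset[OF N(1)] by blast
  ultimately show ?thesis using S(1) by blast
 qed
 then show ?thesis using seq by blast
next
 assume "product_of_infinite_sofic_groups G"
 then obtain A B :: "nat monoid" where AB: "group A" "group B" "infinite (carrier A)" "infinite (carrier B)"
  "sofic A" "sofic B" "\<not> locally_finite_group A \<or> \<not> locally_finite_group B" "G \<cong> A \<times>\<times> B"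
  unfolding product_of_infinite_sofic_groups_def by blast
 then obtain ps where "ps \<in> iso G (A \<times>\<times> B)" unfolding is_iso_def by blast
 then have psi: "ps \<in> hom G (A \<times>\<times> B)" "bij_betw ps (carrier G) (carrier A \<times> carrier B)"
  unfolding iso_def DirProd_def by auto
 define pA where "pA = (\<lambda>g. fst (ps g))"
 define pB where "pB = (\<lambda>g. snd (ps g))"
 have h: "pA \<in> hom G A" "pB \<in> hom G B"
  using psi(1) unfolding hom_def pA_def pB_def DirProd_def by (auto simp: Pi_iff split_beta mem_Times_iff)
 have inj: "g = h" if "g \<in> carrier G" "h \<in> carrier G" "pA g = pA h" "pB g = pB h" for g h
  using psi(2) that unfolding bij_betw_def inj_on_def pA_def pB_def by (metis prod_eqI)
 have surj: "\<exists>g\<in>carrier G. pA g = x \<and> pB g = y" if xy: "x \<in> carrier A" "y \<in> carrier B" for x y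
 proof -
  have "(x, y) \<in> ps ` carrier G" using psi(2) xy unfolding bij_betw_def by blast
  then obtain g where "g \<in> carrier G" "(x, y) = ps g" by blast
  then show ?thesis unfolding pA_def pB_def by (metis fst_conv snd_conv)
 qed
 from AB(7) show ?thesis
 proof
  assume "\<not> locally_finite_group A"
  then show ?thesis using sparse_sofic_seq_product[OF G AB(1,2,5,6) h inj surj _ AB(4)] by blast
 next
  assume "\<not> locally_finite_group B"
  then show ?thesis
   by (rule sparse_sofic_seq_product[OF G AB(2,1,6,5) h(2,1) _ _ _ AB(3), rotated 2])
    (use inj surj in \<open>blast+\<close>)
 qed
qed

section \<open>Transport of microstates\<close>

text \<open>Two actions on one set with the same orbits. All identities hold at every point,
  exceptional null sets having been removed from \<open>X\<close>; freeness makes \<open>ka\<close>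
  and \<open>lam\<close> unique, and this yields the cocycle identities below.\<close>

locale cocycle_pair = G: group G + H: group H
 for G :: "('g, 'c) monoid_scheme" (structure) and H :: "('h, 'd) monoid_scheme" +
 fixes X :: "'x set" and a :: "'g => 'x => 'x" and b :: "'h => 'x => 'x"
  and ka :: "'g => 'x => 'h" and lam :: "'h => 'x => 'g"
 assumes a_closed: "g \<in> carrier G ==> x \<in> X ==> a g x \<in> X"
  and a_one: "x \<in> X ==> a \<one> x = x"
  and a_mult: "g \<in> carrier G ==> g' \<in> carrier G ==> x \<in> X ==> a (g \<otimes> g') x = a g (a g' x)"
  and a_free: "g \<in> carrier G ==> g' \<in> carrier G ==> x \<in> X ==> a g x = a g' x ==> g = g'"
  and b_closed: "h \<in> carrier H ==> x \<in> X ==> b h x \<in> X"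
  and b_one: "x \<in> X ==> b \<one>\<^bsub>H\<^esub> x = x"
  and b_mult: "h \<in> carrier H ==> h' \<in> carrier H ==> x \<in> X ==> b (h \<otimes>\<^bsub>H\<^esub> h') x = b h (b h' x)"
  and b_free: "h \<in> carrier H ==> h' \<in> carrier H ==> x \<in> X ==> b h x = b h' x ==> h = h'"
  and kap_closed: "g \<in> carrier G ==> x \<in> X ==> ka g x \<in> carrier H"
  and kap_eq: "g \<in> carrier G ==> x \<in> X ==> b (ka g x) x = a g x"
  and lam_closed: "h \<in> carrier H ==> x \<in> X ==> lam h x \<in> carrier G"
  and lam_eq: "h \<in> carrier H ==> x \<in> X ==> a (lam h x) x = b h x"
begin

text \<open>The identity is included as the default value of the cocycle off \<open>X\<close>. The
  logarithm of the number of these values is, up to normalisation, the cost of a step s.\<close>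

abbreviation "kvals s \<equiv> insert \<one>\<^bsub>H\<^esub> (ka s ` X)"

lemma kap_mult:
 assumes "g \<in> carrier G" "g' \<in> carrier G" "x \<in> X"
 shows "ka (g \<otimes> g') x = ka g (a g' x) \<otimes>\<^bsub>H\<^esub> ka g' x"
proof (rule b_free[OF _ _ assms(3)])
 have x': "a g' x \<in> X" using assms a_closed by blast
 show "ka (g \<otimes> g') x \<in> carrier H" "ka g (a g' x) \<otimes>\<^bsub>H\<^esub> ka g' x \<in> carrier H"
  using assms x' kap_closed by auto
 show "b (ka (g \<otimes> g') x) x = b (ka g (a g' x) \<otimes>\<^bsub>H\<^esub> ka g' x) x"
  using assms x' kap_closed by (simp add: kap_eq b_mult a_mult)
qed

lemma lam_mult:
 assumes "h \<in> carrier H" "h' \<in> carrier H" "x \<in> X"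
 shows "lam (h \<otimes>\<^bsub>H\<^esub> h') x = lam h (b h' x) \<otimes> lam h' x"
proof (rule a_free[OF _ _ assms(3)])
 have x': "b h' x \<in> X" using assms b_closed by blast
 show "lam (h \<otimes>\<^bsub>H\<^esub> h') x \<in> carrier G" "lam h (b h' x) \<otimes> lam h' x \<in> carrier G"
  using assms x' lam_closed by auto
 show "a (lam (h \<otimes>\<^bsub>H\<^esub> h') x) x = a (lam h (b h' x) \<otimes> lam h' x) x"
  using assms x' lam_closed by (simp add: lam_eq b_mult a_mult)
qed

lemma kap_lam: "h \<in> carrier H ==> x \<in> X ==> ka (lam h x) x = h"
 by (rule b_free[of _ _ x]) (auto simp: kap_closed lam_closed kap_eq lam_eq)

lemma lam_kap: "g \<in> carrier G ==> x \<in> X ==> lam (ka g x) x = g"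
 by (rule a_free[of _ _ x]) (auto simp: kap_closed lam_closed kap_eq lam_eq)

lemma kap_one: "x \<in> X ==> ka \<one> x = \<one>\<^bsub>H\<^esub>"
 by (rule b_free[of _ _ x]) (auto simp: kap_closed kap_eq b_one a_one)

lemma lam_one: "x \<in> X ==> lam \<one>\<^bsub>H\<^esub> x = \<one>"
 by (rule a_free[of _ _ x]) (auto simp: lam_closed lam_eq b_one a_one)

end

text \<open>A map \<open>xi\<close> from \<open>V\<close> to the space, read as a system of labels of the points of \<open>V\<close>, pulls the orbit
 equivalence back to \<open>V\<close>: \<open>twist xi t\<close> is the resulting action of \<open>t\<close> on \<open>V\<close>.
 A point \<open>v\<close> is written as \<open>st v\<close> applied to \<open>bp v \<in> W\<close>, and \<open>transport xi et v\<close> is the point which has with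
 respect to \<open>et\<close> the same position in the \<open>H\<close>-orbit, relative to \<open>bp v\<close>, as \<open>v\<close> has with respect to \<open>xi\<close>.\<close>

locale microstates = cocycle_pair G H X a b ka lam
 for G :: "('g, 'c) monoid_scheme" (structure) and H :: "('h, 'd) monoid_scheme"
  and X :: "'x set" and a b ka lam +
 fixes V :: "'v set" and sm :: "'g => 'v => 'v" and S :: "'g set" and W :: "'v set" and T :: "'g set"
  and K :: "'h set" and J :: "'g set" and L0 :: "'h set" and Lg :: "'g set" and Gm :: "'g set"
  and q :: "'x => 'l" and st :: "'v => 'g" and bp :: "'v => 'v"
 assumes finV: "finite V" and finS: "finite S" and finJ: "finite J" and finLg: "finite Lg"
  and perm: "g \<in> Gm ==> sm g permutes V"
  and GmC: "Gm \<subseteq> carrier G" and SGm: "S \<subseteq> Gm" and JGm: "J \<subseteq> Gm" and LgGm: "Lg \<subseteq> Gm" and TGm: "T \<subseteq> Gm"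
  and oneGm: "\<one> \<in> Gm" and oneS: "\<one> \<in> S" and LgJ: "m \<in> Lg ==> g \<in> J ==> m \<otimes> g \<in> Gm"
  and KC: "K \<subseteq> carrier H" and L0C: "L0 \<subseteq> carrier H"
  and kapK: "s \<in> S ==> x \<in> X ==> ka s x \<in> K" and lamJ: "h \<in> K ==> x \<in> X ==> lam h x \<in> J"
  and lamLg: "t \<in> L0 ==> x \<in> X ==> lam t x \<in> Lg"
  and T1: "s \<in> S ==> g \<in> J ==> inv s \<otimes> g \<in> T"
  and T2: "s \<in> S ==> s' \<in> S ==> m \<in> Lg ==> inv s' \<otimes> (m \<otimes> s) \<in> T"
  and WV: "W \<subseteq> V" and bpW: "w \<in> W ==> sm \<one> w = w ==> st w = \<one> \<and> bp w = w"
begin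

definition "twist xi t v = sm (lam t (xi v)) v"

definition "transport xi et v = sm (lam (ka (st v) (xi (bp v))) (et (bp v))) (bp v)"

abbreviation "mv et xi v \<equiv> xi (transport et xi v)"

definition "Cov = {v \<in> V. st v \<in> S \<and> bp v \<in> W \<and> sm (st v) (bp v) = v}"

text \<open>All that the construction needs to know about a point: finitely many cocycle values in
  both directions, and the labels \<open>q\<close>, also after a move by \<open>L0\<close>. Points
  are compared through these data only.\<close>

abbreviation "coh x y \<equiv> (\<forall>g\<in>Gm. ka g x = ka g y) \<and> (\<forall>h\<in>K \<union> L0. lam h x = lam h y) \<and>
  (\<forall>t\<in>L0. q (b t x) = q (b t y)) \<and> q x = q y"

definition "mgood xi = {u \<in> good_pts G V sm Gm. xi u \<in> X \<and> (\<forall>g\<in>Gm. xi (sm g u) \<in> X \<and> coh (xi (sm g u)) (a g (xi u)))}"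

definition "agree xi et \<longleftrightarrow> (\<forall>w\<in>W \<inter> mgood xi \<inter> mgood et. \<forall>p\<in>T. sm p w \<in> W --> ka p (xi w) = ka p (et w))"

text \<open>Points where transport can be computed exactly: the base point is equivariant for both
  labellings, and the points reached by transport in either direction or by a twist are covered
  again.\<close>

definition "vgood xi et = {v \<in> Cov. bp v \<in> mgood xi \<and> bp v \<in> mgood et \<and> transport xi et v \<in> Cov \<and> transport et xi v \<in> Cov \<and>
  (\<forall>m\<in>Lg. sm m v \<in> Cov)}"

lemma CovD:
 assumes "v \<in> Cov"
 shows "v \<in> V" "st v \<in> S" "bp v \<in> W" "sm (st v) (bp v) = v"
 using assms by (simp_all add: Cov_def)

lemma vgoodD:
 assumes "v \<in> vgood xi et"
 shows "v \<in> Cov" "bp v \<in> mgood xi" "bp v \<in> mgood et" "transport xi et v \<in> Cov" "m \<in> Lg ==> sm m v \<in> Cov"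
 using assms by (simp_all add: vgood_def)

lemma agree_sym: "agree xi et ==> agree et xi"
 unfolding agree_def by (intro ballI impI) (metis Int_iff)

lemma vgood_sym: "vgood xi et = vgood et xi"
 unfolding vgood_def by blast

lemma injs: "g \<in> Gm ==> sm g u = sm g v ==> u = v"
 using permutes_inj[OF perm, of g] by (simp add: inj_eq)

lemma mgood_mult: "u \<in> mgood xi ==> g \<in> Gm ==> g' \<in> Gm ==> sm (g \<otimes> g') u = sm g (sm g' u)"
 using good_pts_mult[of u G V sm Gm g g'] by (simp add: mgood_def)

lemma mgood_X: "u \<in> mgood xi ==> xi u \<in> X" "u \<in> mgood xi ==> g \<in> Gm ==> xi (sm g u) \<in> X"
 by (simp_all add: mgood_def)

lemma mgood_kap: "u \<in> mgood xi ==> g \<in> Gm ==> s \<in> Gm ==> ka s (xi (sm g u)) = ka s (a g (xi u))"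
 by (simp add: mgood_def)

lemma mgood_lam: "u \<in> mgood xi ==> g \<in> Gm ==> h \<in> K \<or> h \<in> L0 ==> lam h (xi (sm g u)) = lam h (a g (xi u))"
 by (auto simp: mgood_def)

lemma mgood_q: "u \<in> mgood xi ==> g \<in> Gm ==> q (xi (sm g u)) = q (a g (xi u))"
 and mgood_qb: "u \<in> mgood xi ==> g \<in> Gm ==> t \<in> L0 ==> q (b t (xi (sm g u))) = q (b t (a g (xi u)))"
 by (simp_all add: mgood_def)

lemma mgood_one:
 assumes "u \<in> mgood xi" shows "sm \<one> u = u"
proof -
 have "sm \<one> (sm \<one> u) = sm \<one> u" using mgood_mult[OF assms oneGm oneGm] by simp
 then show ?thesis using injs[OF oneGm] by blast
qed

lemma in_carrier:
 "s \<in> S ==> s \<in> carrier G" "g \<in> J ==> g \<in> carrier G" "g \<in> Lg ==> g \<in> carrier G" "g \<in> T ==> g \<in> carrier G"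
 "h \<in> K ==> h \<in> carrier H" "h \<in> L0 ==> h \<in> carrier H"
 by (rule subsetD[OF GmC subsetD[OF SGm]] subsetD[OF GmC subsetD[OF JGm]] subsetD[OF GmC subsetD[OF LgGm]]
  subsetD[OF GmC subsetD[OF TGm]] subsetD[OF KC] subsetD[OF L0C], assumption)+

lemma rebase:
 assumes w: "w \<in> mgood xi" and s': "s' \<in> S" and g: "g \<in> carrier G" and p: "inv s' \<otimes> g \<in> T"
  and eq: "sm s' w' = u" and u: "u = sm g w"
 shows "w' = sm (inv s' \<otimes> g) w"
proof -
 have Gm: "s' \<in> Gm" "inv s' \<otimes> g \<in> Gm" by (rule subsetD[OF SGm s'], rule subsetD[OF TGm p])
 have "sm s' (sm (inv s' \<otimes> g) w) = sm (s' \<otimes> (inv s' \<otimes> g)) w"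
  by (rule mgood_mult[OF w Gm, symmetric])
 also have "s' \<otimes> (inv s' \<otimes> g) = g" using in_carrier(1)[OF s'] g by (simp add: G.m_assoc[symmetric])
 finally have "sm s' w' = sm s' (sm (inv s' \<otimes> g) w)" using eq u by simp
 then show ?thesis by (rule injs[OF Gm(1)])
qed

text \<open>If the point \<open>sm g w\<close> has base point \<open>w' = sm p w\<close>, then its position relative to \<open>w'\<close> is obtained from the one relative to \<open>w\<close>
 by the cocycle identity, and \<open>xi\<close> and \<open>et\<close> agree on the value of the cocycle at \<open>p\<close>.\<close>

lemma transport_step:
 assumes ag: "agree xi et" and w: "w \<in> W" "w \<in> mgood xi" "w \<in> mgood et" and g: "g \<in> carrier G"
  and u: "u \<in> Cov" "u = sm g w" and p: "inv (st u) \<otimes> g \<in> T"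
 shows "transport et xi u = sm (lam (ka g (et w)) (xi w)) w"
proof -
 define s' where "s' = st u"
 define p where "p = inv s' \<otimes> g"
 define w' where "w' = bp u"
 have s': "s' \<in> S" "w' \<in> W" "sm s' w' = u"
  unfolding s'_def w'_def by (rule CovD(2)[OF u(1)], rule CovD(3)[OF u(1)], rule CovD(4)[OF u(1)])
 have pT': "inv s' \<otimes> g \<in> T" unfolding s'_def by (rule p)
 have pT: "p \<in> T" "p \<in> Gm" "p \<in> carrier G"
  unfolding p_def by (rule pT', rule subsetD[OF TGm pT'], rule in_carrier(4)[OF pT'])
 have w'p: "w' = sm p w" unfolding p_def by (rule rebase[OF w(2) s'(1) g pT' s'(3) u(2)])
 have sC: "s' \<in> carrier G" by (rule in_carrier(1)[OF s'(1)])
 have x: "xi w \<in> X" "et w \<in> X" using mgood_X w by blast+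
 have sp: "s' \<otimes> p = g" unfolding p_def using sC g by (simp add: G.m_assoc[symmetric])
 have k: "ka p (xi w) = ka p (et w)" using ag w s'(2) w'p pT(1) unfolding agree_def by blast
 define k where "k = ka p (xi w)"
 have kC: "k \<in> carrier H" unfolding k_def using kap_closed pT x by blast
 define h where "h = ka g (et w)"
 have hC: "h \<in> carrier H" unfolding h_def using kap_closed g x by blast
 define h' where "h' = ka s' (et w')"
 have h'1: "h' = ka s' (a p (et w))" unfolding h'_def w'p using mgood_kap[OF w(3) pT(2) subsetD[OF SGm s'(1)]] .
 have apx: "a p (et w) \<in> X" "a p (xi w) \<in> X" using a_closed pT x by blast+
 have h'K: "h' \<in> K" unfolding h'1 using kapK[OF s'(1) apx(1)] .
 have h'C: "h' \<in> carrier H" by (rule in_carrier(5)[OF h'K])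
 have "h = h' \<otimes>\<^bsub>H\<^esub> k"
  unfolding h_def h'1 k_def \<open>ka p (xi w) = ka p (et w)\<close> sp[symmetric] by (rule kap_mult[OF sC pT(3) x(2)])
 moreover have bk: "b k (xi w) = a p (xi w)" unfolding k_def using kap_eq pT x by blast
 ultimately have "lam h (xi w) = lam h' (a p (xi w)) \<otimes> lam k (xi w)"
  using lam_mult[OF h'C kC x(1)] by simp
 also have "lam k (xi w) = p" unfolding k_def using lam_kap pT x by blast
 also have "lam h' (a p (xi w)) = lam h' (xi w')" unfolding w'p using mgood_lam[OF w(2) pT(2)] h'K by simp
 finally have lh: "lam h (xi w) = lam h' (xi w') \<otimes> p" .
 have "xi w' \<in> X" unfolding w'p using mgood_X(2) w pT by blast
 then have "lam h' (xi w') \<in> Gm" using lamJ[OF h'K] JGm by blast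
 then have "sm (lam h (xi w)) w = sm (lam h' (xi w')) w'" unfolding lh w'p by (rule mgood_mult[OF w(2) _ pT(2)])
 then show ?thesis unfolding transport_def h_def h'_def s'_def w'_def by simp
qed

text \<open>Let w be \<open>bp v\<close> and v = s w. Transport leads to g w, where g has under
  \<open>et\<close> the same H-value h that s has under \<open>xi\<close>. Seen from g w the
  labellings are exchanged, and \<open>lam h (xi w)\<close> is s again.\<close>

lemma transport_inverse:
 assumes ag: "agree xi et" and v: "v \<in> vgood xi et"
 shows "transport et xi (transport xi et v) = v"
proof -
 define w where "w = bp v"
 define s where "s = st v"
 have w: "w \<in> W" "w \<in> mgood xi" "w \<in> mgood et" and s: "s \<in> S" "sm s w = v" and u: "transport xi et v \<in> Cov"
  using vgoodD[OF v] CovD[OF vgoodD(1)[OF v]] unfolding w_def s_def by simp_all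
 have x: "xi w \<in> X" "et w \<in> X" using mgood_X w by blast+
 have sC: "s \<in> carrier G" by (rule in_carrier(1)[OF s(1)])
 define h where "h = ka s (xi w)"
 have hK: "h \<in> K" "h \<in> carrier H"
  unfolding h_def by (rule kapK[OF s(1) x(1)], rule in_carrier(5)[OF kapK[OF s(1) x(1)]])
 define g where "g = lam h (et w)"
 have gJ: "g \<in> J" "g \<in> carrier G"
  unfolding g_def by (rule lamJ[OF hK(1) x(2)], rule in_carrier(2)[OF lamJ[OF hK(1) x(2)]])
 have ug: "transport xi et v = sm g w" unfolding transport_def g_def h_def s_def w_def ..
 have "st (transport xi et v) \<in> S" using u unfolding Cov_def by blast
 then have "inv (st (transport xi et v)) \<otimes> g \<in> T" using T1 gJ by blast
 then have "transport et xi (transport xi et v) = sm (lam (ka g (et w)) (xi w)) w"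
  by (rule transport_step[OF ag w gJ(2) u ug])
 also have "ka g (et w) = h" unfolding g_def using kap_lam hK x by blast
 also have "lam h (xi w) = s" unfolding h_def using lam_kap sC x by blast
 finally show ?thesis using s by simp
qed

text \<open>A twist by t multiplies the H-position relative to \<open>bp v\<close> by t on the left,
  and transport preserves H-positions; so it carries the H-action defined by \<open>et\<close> to
  the one defined by \<open>xi\<close>. The statement on \<open>q\<close> is what makes the
  transported microstate equivariant.\<close>

lemma transport_twist:
 assumes ag: "agree xi et" and v: "v \<in> vgood xi et" and t: "t \<in> L0"
 shows "transport et xi (twist et t v) = twist xi t (transport et xi v)"
  and "q (mv et xi (twist et t v)) = q (b t (mv et xi v))"
  and "mv et xi v \<in> X" and "mv et xi (twist et t v) \<in> X"
proof -
 define w where "w = bp v"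
 define s where "s = st v"
 have w: "w \<in> W" "w \<in> mgood xi" "w \<in> mgood et" and s: "s \<in> S" "sm s w = v" and u: "\<And>m. m \<in> Lg ==> sm m v \<in> Cov"
  using vgoodD[OF v] CovD[OF vgoodD(1)[OF v]] unfolding w_def s_def by simp_all
 have x: "xi w \<in> X" "et w \<in> X" using mgood_X w by blast+
 have sC: "s \<in> carrier G" "s \<in> Gm" by (rule in_carrier(1)[OF s(1)], rule subsetD[OF SGm s(1)])
 have tC: "t \<in> carrier H" by (rule in_carrier(6)[OF t])
 define h where "h = ka s (et w)"
 have hK: "h \<in> K" "h \<in> carrier H"
  unfolding h_def by (rule kapK[OF s(1) x(2)], rule in_carrier(5)[OF kapK[OF s(1) x(2)]])
 define g where "g = lam h (xi w)"
 have gJ: "g \<in> J" "g \<in> carrier G" "g \<in> Gm"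
  unfolding g_def by (rule lamJ[OF hK(1) x(1)], rule in_carrier(2)[OF lamJ[OF hK(1) x(1)]],
   rule subsetD[OF JGm lamJ[OF hK(1) x(1)]])
 have ug: "transport et xi v = sm g w" unfolding transport_def g_def h_def s_def w_def ..
 define m where "m = lam t (et v)"
 have m1: "m = lam t (a s (et w))" unfolding m_def s(2)[symmetric] using mgood_lam[OF w(3) sC(2)] t by simp
 have asx: "a s (et w) \<in> X" using a_closed sC x by blast
 have mL: "m \<in> Lg" "m \<in> carrier G" "m \<in> Gm"
  unfolding m1 by (rule lamLg[OF t asx], rule in_carrier(3)[OF lamLg[OF t asx]], rule subsetD[OF LgGm lamLg[OF t asx]])
 have tw: "twist et t v = sm (m \<otimes> s) w"
  unfolding twist_def m_def[symmetric] using mgood_mult[OF w(2) mL(3) sC(2)] s(2) by simp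
 have uC: "twist et t v \<in> Cov" unfolding twist_def m_def[symmetric] using u mL by blast
 have pT: "inv (st (twist et t v)) \<otimes> (m \<otimes> s) \<in> T" by (rule T2[OF s(1) CovD(2)[OF uC] mL(1)])
 have msC: "m \<otimes> s \<in> carrier G" by (rule G.m_closed[OF mL(2) sC(1)])
 have 1: "transport et xi (twist et t v) = sm (lam (ka (m \<otimes> s) (et w)) (xi w)) w"
  by (rule transport_step[OF ag w msC uC tw pT])
 have "ka (m \<otimes> s) (et w) = ka m (a s (et w)) \<otimes>\<^bsub>H\<^esub> h" unfolding h_def by (rule kap_mult[OF mL(2) sC(1) x(2)])
 also have "ka m (a s (et w)) = t" unfolding m1 using kap_lam[OF tC asx] .
 finally have 2: "ka (m \<otimes> s) (et w) = t \<otimes>\<^bsub>H\<^esub> h" .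
 define m' where "m' = lam t (a g (xi w))"
 have agx: "a g (xi w) \<in> X" using a_closed gJ x by blast
 have bh: "b h (xi w) = a g (xi w)" unfolding g_def using lam_eq[OF hK(2) x(1)] by simp
 have m'L: "m' \<in> Lg" "m' \<in> carrier G" "m' \<in> Gm"
  unfolding m'_def by (rule lamLg[OF t agx], rule in_carrier(3)[OF lamLg[OF t agx]], rule subsetD[OF LgGm lamLg[OF t agx]])
 have 3: "lam (t \<otimes>\<^bsub>H\<^esub> h) (xi w) = m' \<otimes> g"
  using lam_mult[OF tC hK(2) x(1)] unfolding bh m'_def[symmetric] g_def[symmetric] .
 have 4: "transport et xi (twist et t v) = sm (m' \<otimes> g) w" using 1 2 3 by simp
 have "twist xi t (transport et xi v) = sm m' (sm g w)"
  unfolding twist_def ug m'_def using mgood_lam[OF w(2) gJ(3)] t by simp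
 then show "transport et xi (twist et t v) = twist xi t (transport et xi v)"
  using 4 mgood_mult[OF w(2) m'L(3) gJ(3)] by simp
 have mg: "m' \<otimes> g \<in> Gm" using LgJ m'L gJ by blast
 have "q (mv et xi (twist et t v)) = q (a (m' \<otimes> g) (xi w))"
  unfolding 4 by (rule mgood_q[OF w(2) mg])
 also have "a (m' \<otimes> g) (xi w) = b t (a g (xi w))"
  using a_mult[OF m'L(2) gJ(2) x(1)] lam_eq[OF tC agx] unfolding m'_def[symmetric] by simp
 also have "q \<dots> = q (b t (xi (sm g w)))" using mgood_qb[OF w(2) gJ(3) t] by simp
 finally show "q (mv et xi (twist et t v)) = q (b t (mv et xi v))" unfolding ug .
 show "mv et xi v \<in> X" unfolding ug by (rule mgood_X(2)[OF w(2) gJ(3)])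
 show "mv et xi (twist et t v) \<in> X" unfolding 4 by (rule mgood_X(2)[OF w(2) mg])
qed

text \<open>The cocycle identity for \<open>lam\<close>, read at a point where \<open>et\<close> is
  equivariant and \<open>sm\<close> is multiplicative.\<close>

lemma twist_mult:
 assumes u: "u \<in> mgood et" and st: "s \<in> L0" "t \<in> L0" "s \<otimes>\<^bsub>H\<^esub> t \<in> L0"
 shows "twist et (s \<otimes>\<^bsub>H\<^esub> t) u = twist et s (twist et t u)"
proof -
 have x: "et u \<in> X" using mgood_X u by blast
 have c: "s \<in> carrier H" "t \<in> carrier H" by (rule in_carrier(6)[OF st(1)], rule in_carrier(6)[OF st(2)])
 have bx: "b t (et u) \<in> X" using b_closed c x by blast
 define m where "m = lam t (et u)"
 have m: "m \<in> Gm" "m \<in> carrier G" unfolding m_def using lamLg[OF st(2) x] LgGm GmC by blast+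
 have am: "a m (et u) = b t (et u)" unfolding m_def by (rule lam_eq[OF c(2) x])
 have n: "lam s (b t (et u)) \<in> Gm" using lamLg[OF st(1) bx] LgGm by blast
 have "twist et s (twist et t u) = sm (lam s (et (sm m u))) (sm m u)" unfolding twist_def m_def ..
 also have "lam s (et (sm m u)) = lam s (b t (et u))" using mgood_lam[OF u m(1)] st am by simp
 also have "sm (lam s (b t (et u))) (sm m u) = sm (lam s (b t (et u)) \<otimes> m) u"
  using mgood_mult[OF u n m(1)] by simp
 also have "lam s (b t (et u)) \<otimes> m = lam (s \<otimes>\<^bsub>H\<^esub> t) (et u)"
  unfolding m_def by (rule lam_mult[OF c x, symmetric])
 finally show ?thesis unfolding twist_def by simp
qed

lemma twist_separates:
 assumes u: "u \<in> mgood et" and st: "s \<in> L0" "t \<in> L0" and eq: "twist et s u = twist et t u"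
 shows "s = t"
proof -
 have x: "et u \<in> X" using mgood_X u by blast
 have c: "s \<in> carrier H" "t \<in> carrier H" by (rule in_carrier(6)[OF st(1)], rule in_carrier(6)[OF st(2)])
 have "lam s (et u) \<in> Gm" "lam t (et u) \<in> Gm"
  by (rule subsetD[OF LgGm lamLg[OF st(1) x]], rule subsetD[OF LgGm lamLg[OF st(2) x]])
 then have "lam s (et u) = lam t (et u)"
  using good_pts_inj[of u G V sm Gm] u eq unfolding twist_def mgood_def by blast
 then have "b s (et u) = b t (et u)" using lam_eq c x by metis
 then show ?thesis using b_free c x by blast
qed

lemma twist_one: "u \<in> mgood et ==> twist et \<one>\<^bsub>H\<^esub> u = u"
 unfolding twist_def using mgood_one mgood_X(1) lam_one by metis

lemma twist_in:
 assumes "u \<in> mgood et" "t \<in> L0"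
 shows "twist et t u \<in> V"
proof -
 have "u \<in> V" using assms(1) by (simp add: mgood_def good_pts_def)
 moreover have "lam t (et u) \<in> Gm" by (rule subsetD[OF LgGm lamLg[OF assms(2) mgood_X(1)[OF assms(1)]]])
 ultimately show ?thesis unfolding twist_def using permutes_in_image[OF perm] by blast
qed

text \<open>By the normalisation \<open>bpW\<close> a point of \<open>W\<close> is its own base
  point with position the identity. Fixing these points makes cocycle values there readable after
  transport.\<close>

lemma transport_base:
 assumes w: "w \<in> W" "w \<in> mgood xi" "w \<in> mgood et"
 shows "transport et xi w = w"
proof -
 have "st w = \<one>" "bp w = w" using bpW[OF w(1) mgood_one[OF w(2)]] by auto
 then show ?thesis
  unfolding transport_def using mgood_X(1) w kap_one lam_one mgood_one by metis
qed

text \<open>\<open>transport xi et v\<close> depends on \<open>xi\<close> only through the cocycle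
  value \<open>ka (st v)\<close> at the base point. Transport fixes the base point, so this value is
  visible in the transported labels; hence both microstates send v to the same point u, and the
  transported label at u is the label of v.\<close>

lemma transport_recover:
 assumes ag: "agree xi et" "agree xi' et" and v: "v \<in> vgood xi et" "v \<in> vgood xi' et"
  and same: "\<And>u s. u \<in> V ==> s \<in> S ==> mv et xi u \<in> X ==> mv et xi' u \<in> X ==>
   ka s (mv et xi u) = ka s (mv et xi' u) \<and> P (mv et xi u) = P (mv et xi' u)"
 shows "P (xi v) = P (xi' v)"
proof -
 define w where "w = bp v"
 define s where "s = st v"
 have w: "w \<in> W" "w \<in> mgood xi" "w \<in> mgood xi'" "w \<in> mgood et" and s: "s \<in> S" "sm s w = v"
  using vgoodD[OF v(1)] vgoodD[OF v(2)] CovD[OF vgoodD(1)[OF v(1)]] unfolding w_def s_def by simp_all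
 have "xi w \<in> X" "xi' w \<in> X" using mgood_X(1) w by blast+
 then have "ka s (xi w) = ka s (xi' w)"
  using same[of w s] transport_base[OF w(1,2,4)] transport_base[OF w(1,3,4)] s(1) w(1) WV by auto
 then have u: "transport xi et v = transport xi' et v" unfolding transport_def s_def w_def by simp
 define u where "u = transport xi et v"
 have "u \<in> V" unfolding u_def by (rule CovD(1)[OF vgoodD(4)[OF v(1)]])
 have 1: "transport et xi u = v" unfolding u_def by (rule transport_inverse[OF ag(1) v(1)])
 have 2: "transport et xi' u = v" unfolding u_def u by (rule transport_inverse[OF ag(2) v(2)])
 have "xi v \<in> X" "xi' v \<in> X" using mgood_X(2) w s SGm by blast+
 then show ?thesis using same[OF \<open>u \<in> V\<close> s(1)] 1 2 by auto
qed

text \<open>A covered point fails for one of three reasons: its base point is not equivariant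
  (\<open>B1\<close>), a transport in one of the directions leaves the covered points
  (\<open>B2\<close>), or a twist does (\<open>B3\<close>). Each of these sets comes from a small
  one by boundedly many permutations or their inverses.\<close>

lemma card_vgood:
 "card (V - vgood xi et) \<le> (1 + 2 * (card S * card J) + card Lg) * card (V - Cov)
   + card S * (card (V - mgood xi) + card (V - mgood et))"
proof -
 define B1 where "B1 = (\<Union>s\<in>S. sm s ` (V - (mgood xi \<inter> mgood et)))"
 define B2 where "B2 = (\<Union>(s, g)\<in>S \<times> J. sm s ` {w \<in> V. sm g w \<in> V - Cov})"
 define B3 where "B3 = (\<Union>m\<in>Lg. {v \<in> V. sm m v \<in> V - Cov})"
 have inV: "sm g v \<in> V" if "g \<in> Gm" "v \<in> V" for g v using permutes_in_image[OF perm[OF that(1)]] that(2) by blast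
 have CV: "Cov \<subseteq> V" unfolding Cov_def by blast
 have tr: "v \<in> B2" if v: "v \<in> Cov" "bp v \<in> mgood xi" "bp v \<in> mgood et" "transport xi et v \<notin> Cov" for v xi et
 proof -
  have w: "st v \<in> S" "bp v \<in> W" "sm (st v) (bp v) = v" using v(1) unfolding Cov_def by auto
  have g: "lam (ka (st v) (xi (bp v))) (et (bp v)) \<in> J"
   using lamJ[OF kapK[OF w(1) mgood_X(1)[OF v(2)]] mgood_X(1)[OF v(3)]] .
  define g where "g = lam (ka (st v) (xi (bp v))) (et (bp v))"
  have gJ: "g \<in> J" "g \<in> Gm" using g JGm unfolding g_def by blast+
  have "bp v \<in> {w \<in> V. sm g w \<in> V - Cov}"
   using v(4) w(2) WV inV gJ(2) unfolding transport_def g_def[symmetric] by blast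
  then have "v \<in> sm (st v) ` {w \<in> V. sm g w \<in> V - Cov}" using w(3) by force
  then show ?thesis unfolding B2_def using w(1) gJ(1) by blast
 qed
 have "V - vgood xi et \<subseteq> (V - Cov) \<union> (B1 \<union> (B2 \<union> B3))"
 proof
  fix v assume v: "v \<in> V - vgood xi et"
  show "v \<in> (V - Cov) \<union> (B1 \<union> (B2 \<union> B3))"
  proof (rule ccontr)
   assume no: "v \<notin> (V - Cov) \<union> (B1 \<union> (B2 \<union> B3))"
   then have c: "v \<in> Cov" using v by blast
   then have w: "st v \<in> S" "bp v \<in> W" "sm (st v) (bp v) = v" unfolding Cov_def by auto
   have m: "bp v \<in> mgood xi" "bp v \<in> mgood et"
   proof -
    have "bp v \<notin> V - (mgood xi \<inter> mgood et)" using no w unfolding B1_def by (metis UN_I UnCI imageI)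
    then show "bp v \<in> mgood xi" "bp v \<in> mgood et" using w(2) WV by blast+
   qed
   have "transport xi et v \<in> Cov" "transport et xi v \<in> Cov" using tr[OF c m] tr[OF c m(2,1)] no by blast+
   moreover have "sm m v \<in> Cov" if "m \<in> Lg" for m
    using no that v inV[of m v] LgGm unfolding B3_def by blast
   ultimately show False using v c m unfolding vgood_def by blast
  qed
 qed
 moreover have fin: "finite B1" "finite B2" "finite B3"
  unfolding B1_def B2_def B3_def using finV finS finJ finLg by auto
 ultimately have "card (V - vgood xi et) \<le> card ((V - Cov) \<union> (B1 \<union> (B2 \<union> B3)))"
  using finV by (intro card_mono) auto
 also have "\<dots> \<le> card (V - Cov) + (card B1 + (card B2 + card B3))"
  using card_Un_le[of "V - Cov" "B1 \<union> (B2 \<union> B3)"] card_Un_le[of B1 "B2 \<union> B3"] card_Un_le[of B2 B3] by linarith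
 also have "card B1 \<le> card S * (card (V - mgood xi) + card (V - mgood et))"
 proof -
  have "card B1 \<le> (\<Sum>s\<in>S. card (sm s ` (V - (mgood xi \<inter> mgood et))))" unfolding B1_def by (rule card_UN_le[OF finS])
  also have "\<dots> \<le> (\<Sum>s\<in>S. card (V - (mgood xi \<inter> mgood et)))" using finV by (intro sum_mono card_image_le) auto
  also have "\<dots> = card S * card (V - (mgood xi \<inter> mgood et))" by simp
  also have "\<dots> \<le> card S * (card (V - mgood xi) + card (V - mgood et))"
   using card_Un_le[of "V - mgood xi" "V - mgood et"] by (intro mult_left_mono) (auto simp: Diff_Int)
  finally show ?thesis .
 qed
 also have "card B2 \<le> card S * card J * card (V - Cov)"
 proof -
  have "card B2 \<le> (\<Sum>p\<in>S \<times> J. card (case p of (s, g) => sm s ` {w \<in> V. sm g w \<in> V - Cov}))"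
   unfolding B2_def using finS finJ by (intro card_UN_le) auto
  also have "\<dots> \<le> (\<Sum>p\<in>S \<times> J. card (V - Cov))"
  proof (rule sum_mono, clarify)
   fix s g assume sg: "s \<in> S" "g \<in> J"
   have "card (sm s ` {w \<in> V. sm g w \<in> V - Cov}) \<le> card {w \<in> V. sm g w \<in> V - Cov}"
    using finV by (intro card_image_le) auto
   also have "\<dots> = card (V - Cov)" using sg JGm by (intro card_vimage_permutes perm finV) auto
   finally show "card (sm s ` {w \<in> V. sm g w \<in> V - Cov}) \<le> card (V - Cov)" .
  qed
  finally show ?thesis by (simp add: card_cartesian_product)
 qed
 also have "card B3 \<le> card Lg * card (V - Cov)"
  unfolding B3_def using LgGm by (intro card_UN_vimage_permutes finLg finV perm) auto
 finally show ?thesis by (simp add: algebra_simps)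
qed

end

section \<open>Entropy in terms of labels\<close>

text \<open>A finite partition is given by a simple function \<open>f\<close>, whose values label its cells, and a homomorphism \<open>\<phi>\<close> in \<open>Hom_mu\<close>
 by a map \<open>xi\<close> from \<open>V\<close> to the space with \<open>\<phi> A = {v \<in> V. xi v \<in> A}\<close>. The condition on all sets \<open>Z\<close> of labels in \<open>micro\<close>
 bounds the distance in total variation up to a factor \<open>2\<close>.\<close>

definition lab_part :: "'x measure => ('x => 'l) => 'x set set" where
 "lab_part M f = (\<lambda>x. {y \<in> space M. f y = f x}) ` space M"

text \<open>A point x lies in g A exactly if inv g x lies in A, so the level sets are the cells of
  the join of the translates by \<open>F\<close>.\<close>

definition jlab :: "('g, 'c) monoid_scheme => ('g => 'x => 'x) => 'g set => ('x => 'l) => 'x => 'g => 'l" where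
 "jlab G al F f x = (\<lambda>g\<in>F. f (al (inv\<^bsub>G\<^esub> g) x))"

abbreviation "deviation M j V xi Z \<equiv> \<bar>rcard {v \<in> V. j (xi v) \<in> Z} - rcard V * measure M {x \<in> space M. j x \<in> Z}\<bar>"

abbreviation "emp_err M V xi A \<equiv> \<bar>rcard {v \<in> V. xi v \<in> A} / rcard V - measure M A\<bar>"

abbreviation "defect G al f V sm xi g \<equiv> {u \<in> V. f (al (inv\<^bsub>G\<^esub> g) (xi (sm g u))) \<noteq> f (xi u)}"

abbreviation "cells M j Z \<equiv> {A \<in> lab_part M j. \<exists>x\<in>A. j x \<in> Z}"

definition micro :: "('g, 'c) monoid_scheme => 'x measure => ('g => 'x => 'x) => ('x => 'l) => 'g set => real =>
  'v set => ('g => 'v => 'v) => ('v => 'x) set" where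
 "micro G M al f F dl V sm = {xi \<in> V \<rightarrow> space M.
   (\<forall>g\<in>F. rcard (defect G al f V sm xi g) \<le> dl * rcard V) \<and>
   (\<forall>Z. deviation M (jlab G al F f) V xi Z \<le> dl * rcard V)}"

definition patterns :: "('x => 'l) => ('v => 'x) set => 'v set => ('v => 'l) set" where
 "patterns p Xi V = (\<lambda>xi. restrict (\<lambda>v. p (xi v)) V) ` Xi"

abbreviation "many r p Xi V \<equiv> exp (r * rcard V) \<le> rcard (patterns p Xi V)"

abbreviation "hom_rate M al C F dl V sm P \<equiv>
 log_count (num_restrictions (Hom_mu M al C F dl V sm) P) / ereal (rcard V)"

lemma finite_patterns:
 assumes "simple_function M p" "finite V"
 shows "finite (patterns p (micro G M al f F dl V sm) V)"
proof (rule finite_subset)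
 show "patterns p (micro G M al f F dl V sm) V \<subseteq> V \<rightarrow>\<^sub>E p ` space M" unfolding patterns_def micro_def by auto
 show "finite (V \<rightarrow>\<^sub>E p ` space M)" using assms unfolding simple_function_def by (intro finite_PiE) auto
qed

section \<open>Partitions given by labels, and total variation\<close>

lemma lab_part_eq: "lab_part M f = (\<lambda>l. f -` {l} \<inter> space M) ` f ` space M"
 unfolding lab_part_def image_image by (rule image_cong) auto

lemma finite_partition_lab_part: "simple_function M f ==> finite_partition M (lab_part M f)"
 unfolding finite_partition_def lab_part_eq simple_function_def
 by (auto simp: partition_on_def disjoint_def)

lemma partition_on_lab_part: "partition_on (space M) (lab_part M f)"
 unfolding lab_part_eq by (auto simp: partition_on_def disjoint_def)

lemma disj_lab_part: "A \<in> lab_part M f ==> B \<in> lab_part M f ==> A \<noteq> B ==> A \<inter> B = {}"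
 unfolding lab_part_eq by auto

text \<open>The cell itself serves as the label of its points, so every finite partition comes from
  a label function.\<close>

lemma lab_part_class:
 assumes P: "finite_partition M P" and p: "p = (\<lambda>x. THE A. A \<in> P \<and> x \<in> A)"
 shows "simple_function M p" "lab_part M p = P"
proof -
 have Un: "\<Union>P = space M" and ne: "{} \<notin> P" and fin: "finite P" "P \<subseteq> sets M"
  using P unfolding finite_partition_def partition_on_def by auto
 have dis: "A = B" if "A \<in> P" "B \<in> P" "x \<in> A" "x \<in> B" for A B x
 proof (rule ccontr)
  assume "A \<noteq> B"
  then have "A \<inter> B = {}" using P that(1,2) unfolding finite_partition_def partition_on_def by (auto dest: disjointD)
  then show False using that by blast
 qed
 have ex1: "\<exists>!A. A \<in> P \<and> x \<in> A" if x: "x \<in> space M" for x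
 proof -
  obtain A where A: "A \<in> P" "x \<in> A" using x Un by blast
  show ?thesis by (rule ex1I[of _ A]) (use A dis in blast)+
 qed
 have pI: "p x \<in> P" "x \<in> p x" if "x \<in> space M" for x
  using theI'[OF ex1[OF that]] unfolding p by blast+
 have uniq: "p x = A" if "A \<in> P" "x \<in> A" for x A
 proof -
  have "x \<in> space M" using that Un by blast
  then show ?thesis using dis[OF _ that(1) _ that(2)] pI by blast
 qed
 have vim: "p -` {A} \<inter> space M = A" if "A \<in> P" for A
 proof -
  have A: "A \<subseteq> space M" using that Un by blast
  show ?thesis
  proof
   show "p -` {A} \<inter> space M \<subseteq> A" using pI(2) by auto
   show "A \<subseteq> p -` {A} \<inter> space M" using A uniq[OF that] by auto
  qed
 qed
 have im: "p ` space M = P"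
 proof
  show "p ` space M \<subseteq> P" using pI(1) by (rule image_subsetI)
  show "P \<subseteq> p ` space M"
  proof
   fix A assume A: "A \<in> P"
   obtain x where x: "x \<in> A" using A ne by (metis ex_in_conv)
   then have "x \<in> space M" using A Un by blast
   then show "A \<in> p ` space M" using uniq[OF A x] by (metis imageI)
  qed
 qed
 show "simple_function M p"
  unfolding simple_function_def im using fin vim by auto
 show "lab_part M p = P" unfolding lab_part_eq im using vim by simp
qed

lemma refines_lab_part:
 "(\<And>x y. x \<in> space M ==> y \<in> space M ==> f x = f y ==> p x = p y) ==>
  refines (space M) (lab_part M f) (lab_part M p)"
 unfolding refines_def
proof (intro conjI ballI partition_on_lab_part)
 fix A assume fp: "\<And>x y. x \<in> space M ==> y \<in> space M ==> f x = f y ==> p x = p y" and "A \<in> lab_part M f"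
 then obtain x where x: "x \<in> space M" "A = {y \<in> space M. f y = f x}" unfolding lab_part_def by auto
 have "A \<subseteq> {y \<in> space M. p y = p x}" unfolding x(2)
 proof (intro subsetI)
  fix y assume "y \<in> {y \<in> space M. f y = f x}"
  then show "y \<in> {y \<in> space M. p y = p x}" using fp[of y x] x(1) by blast
 qed
 moreover have "{y \<in> space M. p y = p x} \<in> lab_part M p" unfolding lab_part_def by (rule imageI[OF x(1)])
 ultimately show "\<exists>B\<in>lab_part M p. A \<subseteq> B" by (rule bexI)
qed

lemma refines_lab_partD:
 assumes "refines (space M) (lab_part M f) (lab_part M p)" "x \<in> space M" "y \<in> space M" "f x = f y"
 shows "p x = p y"
proof -
 have "{z \<in> space M. f z = f x} \<in> lab_part M f" using assms(2) unfolding lab_part_def by (rule imageI)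
 then obtain Y where Y: "Y \<in> lab_part M p" "{z \<in> space M. f z = f x} \<subseteq> Y" using assms(1) unfolding refines_def by blast
 then have "x \<in> Y" "y \<in> Y" using assms by auto
 then show ?thesis using Y(1) unfolding lab_part_def by auto
qed

context group_action
begin

lemma inv_act: "g \<in> carrier G ==> x \<in> E ==> \<phi> (inv g) (\<phi> g x) = x"
 by (rule orbit_sym_aux) auto

lemma act_inv: "g \<in> carrier G ==> x \<in> E ==> \<phi> g (\<phi> (inv g) x) = x"
proof -
 interpret group G using group_hom group_hom.axioms(1) by blast
 assume g: "g \<in> carrier G" and x: "x \<in> E"
 show ?thesis using orbit_sym_aux[of "inv g" x] g x by simp
qed

lemma inv_closed_act: "g \<in> carrier G ==> x \<in> E ==> \<phi> (inv g) x \<in> E"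
proof -
 interpret group G using group_hom group_hom.axioms(1) by blast
 assume g: "g \<in> carrier G" and x: "x \<in> E"
 show ?thesis using element_image[of "inv g" x] g x by simp
qed

lemma act_closed: "g \<in> carrier G ==> x \<in> E ==> \<phi> g x \<in> E"
 by (rule element_image) auto

lemma act_image: "g \<in> carrier G ==> A \<subseteq> E ==> \<phi> g ` A = {y \<in> E. \<phi> (inv g) y \<in> A}"
 using act_inv inv_act act_closed by (auto simp: image_iff) (metis subsetD)+

end

text \<open>Cells of the common refinement are nonempty intersections of one cell from each
  translate; a choice whose intersection contains x must consist of the cells of x.\<close>

lemma translated_join_lab_part:
 fixes G :: "('g, 'c) monoid_scheme" (structure)
 assumes act: "group_action G (space M) al" and F: "F \<subseteq> carrier G" "F \<noteq> {}"
 shows "translated_join al F (lab_part M f) = lab_part M (jlab G al F f)"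
proof -
 interpret group_action G "space M" al by (rule act)
 have im: "al s ` {y \<in> space M. f y = l} = {y \<in> space M. f (al (inv s) y) = l}" if s: "s \<in> F" for s l
 proof -
  have sC: "s \<in> carrier G" using s F by blast
  have "al s ` {y \<in> space M. f y = l} = {y \<in> space M. al (inv s) y \<in> {y \<in> space M. f y = l}}"
   by (rule act_image[OF sC]) simp
  then show ?thesis using inv_closed_act[OF sC] by auto
 qed
 have blk: "R = {y \<in> space M. f (al (inv s) y) = f (al (inv s) x)}"
  if s: "s \<in> F" and R: "R \<in> (`) (al s) ` lab_part M f" and x: "x \<in> R" for s R x
 proof -
  obtain z where z: "R = al s ` {y \<in> space M. f y = f z}" using R unfolding lab_part_def by auto
  show ?thesis using x unfolding z im[OF s] by simp
 qed
 have ex: "\<exists>R. R \<in> (`) (al s) ` lab_part M f \<and> x \<in> R" if s: "s \<in> F" and x: "x \<in> space M" for s x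
 proof (rule exI[of _ "al s ` {y \<in> space M. f y = f (al (inv s) x)}"], rule conjI)
  have sC: "s \<in> carrier G" using s F by blast
  show "x \<in> al s ` {y \<in> space M. f y = f (al (inv s) x)}" unfolding im[OF s] using x by simp
  show "al s ` {y \<in> space M. f y = f (al (inv s) x)} \<in> (`) (al s) ` lab_part M f"
   unfolding lab_part_def using inv_closed_act[OF sC x] by (intro imageI)
 qed
 define PP where "PP = (\<lambda>s. (`) (al s) ` lab_part M f) ` F"
 have cell: "\<Inter> (h ` PP) = {y \<in> space M. jlab G al F f y = jlab G al F f x}"
  if h: "h \<in> (\<Pi> P\<in>PP. P)" and x: "x \<in> \<Inter> (h ` PP)" for h x
 proof -
  have hs: "h ((`) (al s) ` lab_part M f) = {y \<in> space M. f (al (inv s) y) = f (al (inv s) x)}" if "s \<in> F" for s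
   by (rule blk[OF that]) (use h x that in \<open>auto simp: PP_def\<close>)
  have "\<Inter> (h ` PP) = (\<Inter>s\<in>F. {y \<in> space M. f (al (inv s) y) = f (al (inv s) x)})"
   unfolding PP_def image_image using hs by simp
  also have "\<dots> = {y \<in> space M. jlab G al F f y = jlab G al F f x}"
   using F(2) unfolding jlab_def by (auto simp: fun_eq_iff restrict_def)
  finally show ?thesis .
 qed
 show ?thesis
  unfolding translated_join_def common_refinement PP_def[symmetric]
 proof
  show "(\<Union>h\<in>\<Pi> P\<in>PP. P. {\<Inter> (h ` PP)}) - {{}} \<subseteq> lab_part M (jlab G al F f)"
  proof
   fix A assume "A \<in> (\<Union>h\<in>\<Pi> P\<in>PP. P. {\<Inter> (h ` PP)}) - {{}}"
   then obtain h where h: "h \<in> (\<Pi> P\<in>PP. P)" "A = \<Inter> (h ` PP)" and "A \<noteq> {}" by auto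
   then obtain x where h3: "x \<in> A" by blast
   have A: "A = {y \<in> space M. jlab G al F f y = jlab G al F f x}" unfolding h(2) by (rule cell[OF h(1)]) (use h(2) h3 in simp)
   then have "x \<in> space M" using h3 by simp
   then show "A \<in> lab_part M (jlab G al F f)" unfolding lab_part_def A by (rule imageI)
  qed
  show "lab_part M (jlab G al F f) \<subseteq> (\<Union>h\<in>\<Pi> P\<in>PP. P. {\<Inter> (h ` PP)}) - {{}}"
  proof
   fix A assume "A \<in> lab_part M (jlab G al F f)"
   then obtain x where x: "x \<in> space M" "A = {y \<in> space M. jlab G al F f y = jlab G al F f x}" unfolding lab_part_def by auto
   define h where "h = (\<lambda>P. SOME R. R \<in> P \<and> x \<in> R)"
   have hP: "h P \<in> P \<and> x \<in> h P" if "P \<in> PP" for P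
    unfolding h_def by (rule someI_ex) (use that ex x(1) in \<open>auto simp: PP_def\<close>)
   have h: "h \<in> (\<Pi> P\<in>PP. P)" using hP by blast
   have "A = \<Inter> (h ` PP)" unfolding x(2) by (rule cell[OF h, symmetric]) (use hP in blast)
   moreover have "x \<in> A" using x by simp
   ultimately show "A \<in> (\<Union>h\<in>\<Pi> P\<in>PP. P. {\<Inter> (h ` PP)}) - {{}}" using h by (intro DiffI UN_I[OF h]) auto
  qed
 qed
qed

lemma simple_function_restrict:
 assumes F: "finite F" and sf: "\<And>g. g \<in> F ==> simple_function M (f g)"
 shows "simple_function M (\<lambda>x. \<lambda>g\<in>F. f g x)"
proof -
 define j where "j = (\<lambda>x. \<lambda>g\<in>F. f g x)"
 have "finite (j ` space M)"
 proof (rule finite_subset)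
  show "j ` space M \<subseteq> (\<Pi>\<^sub>E g\<in>F. f g ` space M)"
   unfolding j_def by auto
  show "finite (\<Pi>\<^sub>E g\<in>F. f g ` space M)"
   using F(1) sf unfolding simple_function_def by (intro finite_PiE) auto
 qed
 moreover have "j -` {j x} \<inter> space M \<in> sets M" if x: "x \<in> space M" for x
 proof (cases "F = {}")
  case True
  then have "j -` {j x} \<inter> space M = space M" unfolding j_def restrict_def by auto
  then show ?thesis by simp
 next
  case False
  have iff: "j y = j x \<longleftrightarrow> (\<forall>g\<in>F. f g y = f g x)" for y
  proof
   assume e: "j y = j x"
   show "\<forall>g\<in>F. f g y = f g x"
   proof
    fix g assume g: "g \<in> F"
    have "j y g = j x g" by (rule fun_cong[OF e])
    then show "f g y = f g x" unfolding j_def using g by simp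
   qed
  qed (auto simp: j_def restrict_def)
  have "j -` {j x} \<inter> space M = (\<Inter>g\<in>F. f g -` {f g x} \<inter> space M)"
  proof (rule Set.set_eqI)
   fix y
   have "y \<in> j -` {j x} \<inter> space M \<longleftrightarrow> (\<forall>g\<in>F. f g y = f g x) \<and> y \<in> space M" using iff[of y] by simp
   then show "y \<in> j -` {j x} \<inter> space M \<longleftrightarrow> y \<in> (\<Inter>g\<in>F. f g -` {f g x} \<inter> space M)" using False by auto
  qed
  also have "\<dots> \<in> sets M"
   by (rule sets.finite_INT[OF F False]) (rule simple_functionD(2)[OF sf])
  finally show ?thesis .
 qed
 ultimately have "simple_function M j" unfolding simple_function_def by blast
 then show ?thesis unfolding j_def .
qed

lemma simple_jlab:
 fixes G :: "('g, 'c) monoid_scheme" (structure)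
 assumes act: "pmp_action G M al" and F: "finite F" "F \<subseteq> carrier G" and f: "simple_function M f"
 shows "simple_function M (jlab G al F f)"
proof -
 have A: "group_action G (space M) al" using act unfolding pmp_action_def by blast
 interpret group_action G "space M" al by (rule A)
 interpret group G using group_hom group_hom.axioms(1) by blast
 have "simple_function M (\<lambda>x. f (al (inv g) x))" if "g \<in> F" for g
 proof (rule simple_function_comp[OF _ f])
  have "inv g \<in> carrier G" by (rule inv_closed[OF subsetD[OF F(2) that]])
  then show "al (inv g) \<in> M \<rightarrow>\<^sub>M M" using act unfolding pmp_action_def by blast
 qed
 then have "simple_function M (\<lambda>x. \<lambda>g\<in>F. f (al (inv g) x))" by (rule simple_function_restrict[OF F(1)])
 moreover have "jlab G al F f = (\<lambda>x. \<lambda>g\<in>F. f (al (inv g) x))" by (rule ext) (rule jlab_def)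
 ultimately show ?thesis by simp
qed

lemma finite_sum_abs_le:
 fixes e :: "'l => real"
 assumes "finite J" and "\<And>Z. Z \<subseteq> J ==> \<bar>\<Sum>l\<in>Z. e l\<bar> \<le> dl"
 shows "(\<Sum>l\<in>J. \<bar>e l\<bar>) \<le> 2 * dl"
proof -
 have "(\<Sum>l\<in>J. \<bar>e l\<bar>) = (\<Sum>l\<in>{l\<in>J. e l \<ge> 0}. \<bar>e l\<bar>) + (\<Sum>l\<in>{l\<in>J. \<not> e l \<ge> 0}. \<bar>e l\<bar>)"
  using sum.If_cases[OF assms(1), of "\<lambda>l. e l \<ge> 0" "\<lambda>l. \<bar>e l\<bar>" "\<lambda>l. \<bar>e l\<bar>"] by (simp add: Int_def conj_commute)
 also have "(\<Sum>l\<in>{l\<in>J. e l \<ge> 0}. \<bar>e l\<bar>) = (\<Sum>l\<in>{l\<in>J. e l \<ge> 0}. e l)" by (rule sum.cong) auto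
 also have "(\<Sum>l\<in>{l\<in>J. \<not> e l \<ge> 0}. \<bar>e l\<bar>) = - (\<Sum>l\<in>{l\<in>J. \<not> e l \<ge> 0}. e l)"
  unfolding sum_negf[symmetric] by (rule sum.cong) auto
 finally show ?thesis using assms(2)[of "{l\<in>J. e l \<ge> 0}"] assms(2)[of "{l\<in>J. \<not> e l \<ge> 0}"] by auto
qed

lemma (in finite_measure) measure_simple_sum:
 assumes j: "simple_function M j"
 shows "measure M {x \<in> space M. j x \<in> Z} = (\<Sum>A\<in>cells M j Z. measure M A)"
proof -
 have fin: "finite (lab_part M j)" and meas: "lab_part M j \<subseteq> sets M"
  using finite_partition_lab_part[OF j] unfolding finite_partition_def by auto
 have "{x \<in> space M. j x \<in> Z} = \<Union> (cells M j Z)" unfolding lab_part_def by auto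
 also have "measure M \<dots> = (\<Sum>A\<in>cells M j Z. measure M A)"
 proof -
  have "measure M (\<Union> (id ` (cells M j Z))) = (\<Sum>A\<in>cells M j Z. measure M (id A))"
  proof (rule finite_measure_finite_Union)
   show "disjoint_family_on id (cells M j Z)"
    unfolding disjoint_family_on_def
   proof (intro ballI impI)
    fix A B assume "A \<in> cells M j Z" "B \<in> cells M j Z" "A \<noteq> B"
    then show "id A \<inter> id B = {}" using disj_lab_part[of A M j B] by simp
   qed
  qed (use fin meas in auto)
  then show ?thesis by simp
 qed
 finally show ?thesis .
qed

lemma card_simple_sum:
 assumes j: "simple_function M j" and V: "finite V" "xi \<in> V \<rightarrow> space M"
 shows "card {v \<in> V. j (xi v) \<in> Z} = (\<Sum>A\<in>cells M j Z. card {v \<in> V. xi v \<in> A})"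
proof -
 have fin: "finite (lab_part M j)" using finite_partition_lab_part[OF j] unfolding finite_partition_def by auto
 have "{v \<in> V. j (xi v) \<in> Z} = (\<Union>A\<in>cells M j Z. {v \<in> V. xi v \<in> A})"
  using V(2) unfolding lab_part_def by auto
 also have "card \<dots> = (\<Sum>A\<in>cells M j Z. card {v \<in> V. xi v \<in> A})"
 proof (rule card_UN_disjoint)
  show "\<forall>A\<in>cells M j Z. \<forall>B\<in>(cells M j Z).
    A \<noteq> B --> {v \<in> V. xi v \<in> A} \<inter> {v \<in> V. xi v \<in> B} = {}"
  proof (intro ballI impI)
   fix A B assume "A \<in> cells M j Z" "B \<in> cells M j Z" "A \<noteq> B"
   then have "A \<inter> B = {}" using disj_lab_part[of A M j B] by simp
   then show "{v \<in> V. xi v \<in> A} \<inter> {v \<in> V. xi v \<in> B} = {}" by blast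
  qed
 qed (use fin V(1) in auto)
 finally show ?thesis .
qed

text \<open>One direction is the triangle inequality over the cells with labels in Z. For the other,
  every family of cells arises from a set of labels, and splitting by sign in
  \<open>finite_sum_abs_le\<close> costs the factor 2.\<close>

lemma (in finite_measure) total_variation:
 assumes j: "simple_function M j" and V: "finite V" "V \<noteq> {}" "xi \<in> V \<rightarrow> space M"
 shows "(\<Sum>A\<in>lab_part M j. emp_err M V xi A) \<le> dl ==>
   deviation M j V xi Z \<le> dl * rcard V"
  and "(\<And>Z. deviation M j V xi Z \<le> dl * rcard V) ==>
   (\<Sum>A\<in>lab_part M j. emp_err M V xi A) \<le> 2 * dl"
proof -
 have fin: "finite (lab_part M j)" using finite_partition_lab_part[OF j] unfolding finite_partition_def by auto
 define e where "e = (\<lambda>A. rcard {v \<in> V. xi v \<in> A} / rcard V - measure M A)"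
 have n: "rcard V > 0" using V by (simp add: card_gt_0_iff)
 have eq: "rcard {v \<in> V. j (xi v) \<in> Z} - rcard V * measure M {x \<in> space M. j x \<in> Z}
   = rcard V * (\<Sum>A\<in>cells M j Z. e A)" for Z
  unfolding measure_simple_sum[OF j] card_simple_sum[OF j V(1,3)] e_def
  using n by (simp add: sum_subtractf sum_distrib_left right_diff_distrib)
 {
  assume le: "(\<Sum>A\<in>lab_part M j. emp_err M V xi A) \<le> dl"
  have "\<bar>\<Sum>A\<in>cells M j Z. e A\<bar> \<le> (\<Sum>A\<in>cells M j Z. \<bar>e A\<bar>)" by (rule sum_abs)
  also have "\<dots> \<le> (\<Sum>A\<in>lab_part M j. \<bar>e A\<bar>)" by (rule sum_mono2) (use fin in auto)
  also have "\<dots> \<le> dl" using le unfolding e_def .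
  finally show "deviation M j V xi Z \<le> dl * rcard V"
   unfolding eq abs_mult using n by (simp add: mult.commute mult_left_mono)
 }
 {
  assume le: "\<And>Z. deviation M j V xi Z \<le> dl * rcard V"
  have "(\<Sum>A\<in>lab_part M j. \<bar>e A\<bar>) \<le> 2 * dl"
  proof (rule finite_sum_abs_le[OF fin])
   fix Q assume Q: "Q \<subseteq> lab_part M j"
   have "(cells M j (j ` \<Union>Q)) = Q"
   proof (intro equalityI subsetI)
    fix A assume A: "A \<in> cells M j (j ` \<Union>Q)"
    then obtain x y B where xy: "x \<in> A" "B \<in> Q" "y \<in> B" "j x = j y" by auto
    obtain a where a: "A = {y \<in> space M. j y = j a}" using A unfolding lab_part_def by blast
    obtain b where b: "B = {y \<in> space M. j y = j b}" using subsetD[OF Q xy(2)] unfolding lab_part_def by (elim imageE)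
    have "j a = j b" using xy unfolding a b by simp
    then have "A = B" unfolding a b by simp
    then show "A \<in> Q" using xy by simp
   next
    fix A assume A: "A \<in> Q"
    then have "A \<in> lab_part M j" using Q by blast
    then obtain x where x: "x \<in> A" unfolding lab_part_def by blast
    have "j x \<in> j ` \<Union>Q" by (rule imageI) (use A x in blast)
    then show "A \<in> cells M j (j ` \<Union>Q)" using x \<open>A \<in> lab_part M j\<close> by (intro CollectI conjI bexI[of _ x])
   qed
   then have "rcard V * \<bar>\<Sum>A\<in>Q. e A\<bar> \<le> rcard V * dl"
    using le[of "j ` \<Union>Q"] unfolding eq abs_mult by (simp add: mult.commute)
   then show "\<bar>\<Sum>A\<in>Q. e A\<bar> \<le> dl" using n by simp
  qed
  then show "(\<Sum>A\<in>lab_part M j. emp_err M V xi A) \<le> 2 * dl"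
   unfolding e_def .
 }
qed

section \<open>Homomorphisms of finite algebras and microstates\<close>

lemma algebra_alg: "P \<subseteq> Pow (space M) ==> algebra (space M) (alg M P)"
 unfolding alg_def hull_def algebra_iff_Un
proof (intro conjI)
 assume "P \<subseteq> Pow (space M)"
 then show "\<Inter> {t. (t \<subseteq> Pow (space M) \<and> {} \<in> t \<and> (\<forall>a\<in>t. space M - a \<in> t) \<and> (\<forall>a\<in>t. \<forall>b\<in>t. a \<union> b \<in> t)) \<and> P \<subseteq> t} \<subseteq> Pow (space M)"
  by (intro Inter_lower) auto
qed auto

lemma alg_induct [consumes 2, case_names basic empty compl union]:
 assumes "A \<in> alg M P" and P: "P \<subseteq> Pow (space M)"
  and "\<And>A. A \<in> P ==> Q A" and "Q {}" and "\<And>A. A \<in> alg M P ==> Q A ==> Q (space M - A)"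
  and "\<And>A B. A \<in> alg M P ==> B \<in> alg M P ==> Q A ==> Q B ==> Q (A \<union> B)"
 shows "Q A"
proof -
 interpret algebra "space M" "alg M P" by (rule algebra_alg[OF P])
 have "algebra (space M) {A \<in> alg M P. Q A}"
  unfolding algebra_iff_Un using assms space_closed by auto
 moreover have "P \<subseteq> {A \<in> alg M P. Q A}" using assms(3) hull_subset[of P] unfolding alg_def by blast
 ultimately have "alg M P \<subseteq> {A \<in> alg M P. Q A}" unfolding alg_def by (intro hull_minimal)
 then show ?thesis using assms(1) by blast
qed

lemma in_alg_lab_part:
 assumes j: "finite (j ` space M)" and A: "A \<subseteq> space M"
  and cong: "\<And>x y. x \<in> A ==> y \<in> space M ==> j x = j y ==> y \<in> A"
 shows "A \<in> alg M (lab_part M j)"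
proof -
 have sub: "lab_part M j \<subseteq> Pow (space M)" unfolding lab_part_def by auto
 interpret algebra "space M" "alg M (lab_part M j)" by (rule algebra_alg[OF sub])
 have "A = \<Union> {B \<in> lab_part M j. B \<subseteq> A}"
 proof (intro equalityI subsetI)
  fix x assume x: "x \<in> A"
  have "{y \<in> space M. j y = j x} \<in> lab_part M j" using x A unfolding lab_part_def by (intro imageI) blast
  moreover have "{y \<in> space M. j y = j x} \<subseteq> A"
  proof
   fix y assume "y \<in> {y \<in> space M. j y = j x}"
   then show "y \<in> A" using cong[OF x, of y] by simp
  qed
  moreover have "x \<in> {y \<in> space M. j y = j x}" using x A by blast
  ultimately show "x \<in> \<Union> {B \<in> lab_part M j. B \<subseteq> A}" by blast
 qed blast
 also have "\<dots> \<in> alg M (lab_part M j)"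
 proof (rule finite_Union)
  show "finite {B \<in> lab_part M j. B \<subseteq> A}" using j unfolding lab_part_eq by simp
  show "{B \<in> lab_part M j. B \<subseteq> A} \<subseteq> alg M (lab_part M j)"
   using hull_subset[of "lab_part M j"] unfolding alg_def by blast
 qed
 finally show ?thesis .
qed

text \<open>A point with two different labels is counted for exactly two values of l, one for each
  label; a point with equal labels is not counted.\<close>

lemma sum_card_sym_diff:
 assumes V: "finite V" and pe: "pe permutes V" and R: "finite R" "\<And>v. v \<in> V ==> a v \<in> R" "\<And>v. v \<in> V ==> b v \<in> R"
 shows "(\<Sum>l\<in>R. card (sym_diff (pe ` {u \<in> V. a u = l}) {v \<in> V. b v = l})) = 2 * card {u \<in> V. b (pe u) \<noteq> a u}"
proof -
 let ?P = "\<lambda>u l. (a u = l) \<noteq> (b (pe u) = l)" and ?S = "\<lambda>l. sym_diff (pe ` {u \<in> V. a u = l}) {v \<in> V. b v = l}"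
 have inV: "pe u \<in> V \<longleftrightarrow> u \<in> V" for u using permutes_in_image[OF pe] .
 have eq: "?S l = pe ` {u \<in> V. ?P u l}" for l
 proof -
  have "{v \<in> V. b v = l} = pe ` {u \<in> V. b (pe u) = l}"
  proof (intro equalityI subsetI)
   fix v assume v: "v \<in> {v \<in> V. b v = l}"
   then obtain u where "u \<in> V" "v = pe u" using permutes_image[OF pe] by blast
   then show "v \<in> pe ` {u \<in> V. b (pe u) = l}" using v by blast
  qed (use inV in auto)
  then have "?S l
    = pe ` (sym_diff {u \<in> V. a u = l} {u \<in> V. b (pe u) = l})"
   using image_set_diff[OF permutes_inj[OF pe]] by (simp add: image_Un)
  also have "sym_diff {u \<in> V. a u = l} {u \<in> V. b (pe u) = l} = {u \<in> V. ?P u l}" by blast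
  finally show ?thesis .
 qed
 have "(\<Sum>l\<in>R. card (?S l))
   = (\<Sum>l\<in>R. card {u \<in> V. ?P u l})"
  unfolding eq using card_image[OF inj_on_subset[OF permutes_inj[OF pe] subset_UNIV]] by simp
 also have "\<dots> = (\<Sum>l\<in>R. \<Sum>u\<in>V. if ?P u l then 1 else 0)"
  using V by (simp add: sum.If_cases Int_def)
 also have "\<dots> = (\<Sum>u\<in>V. \<Sum>l\<in>R. if ?P u l then 1 else 0)" by (rule sum.swap)
 also have "\<dots> = (\<Sum>u\<in>V. if b (pe u) \<noteq> a u then 2 else 0)"
 proof (rule sum.cong[OF refl])
  fix u assume u: "u \<in> V"
  have "(\<Sum>l\<in>R. if ?P u l then 1 else 0) = card {l \<in> R. ?P u l}"
   using R(1) by (simp add: sum.If_cases Int_def)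
  also have "{l \<in> R. ?P u l} = (if b (pe u) \<noteq> a u then {a u, b (pe u)} else {})"
   using R(2,3) u inV by auto
  also have "card \<dots> = (if b (pe u) \<noteq> a u then 2 else 0)" by auto
  finally show "(\<Sum>l\<in>R. if ?P u l then 1 else 0) = (if b (pe u) \<noteq> a u then 2 else (0::nat))" .
 qed
 also have "\<dots> = 2 * card {u \<in> V. b (pe u) \<noteq> a u}" using V by (simp add: sum.If_cases Int_def)
 finally show ?thesis .
qed

locale entropy_data =
 fixes G :: "('g, 'c) monoid_scheme" (structure) and M :: "'x measure" and al :: "'g => 'x => 'x"
  and f :: "'x => 'l" and F :: "'g set" and V :: "'v set" and sm :: "'g => 'v => 'v"
 assumes act: "pmp_action G M al" and f: "simple_function M f"
  and F: "finite F" "F \<subseteq> carrier G" "F \<noteq> {}"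
  and V: "finite V" "V \<noteq> {}" and perm: "g \<in> F ==> sm g permutes V"
begin

sublocale A: group_action G "space M" al using act unfolding pmp_action_def by blast
sublocale prob_space M using act unfolding pmp_action_def by blast

abbreviation "jF \<equiv> jlab G al F f"

abbreviation "hom_dist \<phi> g \<equiv>
 \<Sum>A\<in>lab_part M f. measure (uniform_count_measure V) (sym_diff (sm g ` \<phi> A) (\<phi> (al g ` A)))"

lemma join: "translated_join al F (lab_part M f) = lab_part M jF"
 by (rule translated_join_lab_part[OF A.group_action_axioms F(2,3)])

lemma jlab: "simple_function M jF" by (rule simple_jlab[OF act F(1,2) f])

lemma jlab_eqD: "jF x = jF y ==> g \<in> F ==> f (al (inv g) x) = f (al (inv g) y)"
 unfolding jlab_def by (drule fun_cong[of _ _ g]) simp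

lemma translate_in_alg:
 assumes g: "g \<in> F" and A: "A \<in> lab_part M f"
 shows "al g ` A \<in> alg M (lab_part M jF)" "A \<subseteq> space M"
  "al g ` A = {y \<in> space M. al (inv g) y \<in> A}"
proof -
 have gC: "g \<in> carrier G" using g F by blast
 obtain x where x: "A = {y \<in> space M. f y = f x}" using A unfolding lab_part_def by blast
 then show AM: "A \<subseteq> space M" by blast
 show im: "al g ` A = {y \<in> space M. al (inv g) y \<in> A}" by (rule A.act_image[OF gC AM])
 show "al g ` A \<in> alg M (lab_part M jF)"
 proof (rule in_alg_lab_part)
  show "finite (jF ` space M)" using jlab unfolding simple_function_def by blast
  show "al g ` A \<subseteq> space M" unfolding im by blast
  fix y z assume y: "y \<in> al g ` A" and z: "z \<in> space M" and e: "jF y = jF z"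
  show "z \<in> al g ` A"
  proof -
   have "al (inv g) y \<in> A" using y unfolding im by blast
   then have "f (al (inv g) y) = f x" unfolding x by blast
   then have "al (inv g) z \<in> A" using jlab_eqD[OF e g] A.inv_closed_act[OF gC z] unfolding x by simp
   then show ?thesis unfolding im using z by blast
  qed
 qed
qed

lemma hom_conditions:
 assumes xi: "xi \<in> V \<rightarrow> space M" and \<phi>: "\<And>A. A \<in> alg M (lab_part M jF) ==> \<phi> A = {v \<in> V. xi v \<in> A}"
  and g: "g \<in> F" and oneF: "\<one> \<in> F"
 shows "hom_dist \<phi> g
  = 2 * rcard (defect G al f V sm xi g) / rcard V"
proof -
 let ?B = "\<lambda>l. {u \<in> V. f (xi u) = l}" and ?C = "\<lambda>l. {v \<in> V. f (al (inv g) (xi v)) = l}"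
 let ?D = "\<lambda>l. sym_diff (sm g ` ?B l) (?C l)"
 define c where "c = (\<lambda>l. f -` {l} \<inter> space M)"
 have lp: "lab_part M f = c ` f ` space M" unfolding c_def by (rule lab_part_eq)
 have inj: "inj_on c (f ` space M)" unfolding c_def inj_on_def by auto
 have gC: "g \<in> carrier G" using g F by blast
 have one: "al \<one> x = x" if "x \<in> space M" for x using A.id_eq_one that by (metis restrict_apply')
 have cA: "c l \<in> lab_part M f" if "l \<in> f ` space M" for l using that unfolding lp by blast
 have calg: "c l \<in> alg M (lab_part M jF)" if "l \<in> f ` space M" for l
 proof -
  have "al \<one> ` c l = c l" using one unfolding c_def by (auto simp: image_iff)
  then show ?thesis using translate_in_alg(1)[OF oneF cA[OF that]] by simp
 qed
 have m: "measure (uniform_count_measure V) (sym_diff (sm g ` \<phi> (c l)) (\<phi> (al g ` c l)))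
  = rcard (?D l) / rcard V"
  if l: "l \<in> f ` space M" for l
 proof -
  have 1: "\<phi> (c l) = ?B l" unfolding \<phi>[OF calg[OF l]] using xi unfolding c_def by auto
  have "\<phi> (al g ` c l) = {v \<in> V. xi v \<in> al g ` c l}"
   by (rule \<phi>[OF translate_in_alg(1)[OF g cA[OF l]]])
  also have "\<dots> = {v \<in> V. xi v \<in> space M \<and> al (inv g) (xi v) \<in> c l}"
   unfolding translate_in_alg(3)[OF g cA[OF l]] by simp
  also have "\<dots> = ?C l" using xi A.inv_closed_act[OF gC] unfolding c_def by auto
  finally have 2: "\<phi> (al g ` c l) = ?C l" .
  have "?D l \<subseteq> V"
   using permutes_in_image[OF perm[OF g]] by auto
  then show ?thesis unfolding 1 2 by (rule measure_uniform_count_measure[OF V(1)])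
 qed
 have "hom_dist \<phi> g
  = (\<Sum>l\<in>f ` space M. rcard (?D l) / rcard V)"
  unfolding lp sum.reindex[OF inj] using m by (intro sum.cong refl) simp
 also have "\<dots> = real (\<Sum>l\<in>f ` space M. card (?D l)) / rcard V"
  by (simp add: sum_divide_distrib)
 also have "(\<Sum>l\<in>f ` space M. card (?D l))
   = 2 * card (defect G al f V sm xi g)"
 proof (rule sum_card_sym_diff[OF V(1) perm[OF g]])
  show "finite (f ` space M)" using f unfolding simple_function_def by blast
  show "f (xi v) \<in> f ` space M" if "v \<in> V" for v by (rule imageI) (use xi that in auto)
  show "f (al (inv g) (xi v)) \<in> f ` space M" if "v \<in> V" for v
  proof (rule imageI, rule A.inv_closed_act[OF gC])
   show "xi v \<in> space M" using xi that by auto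
  qed
 qed
 finally show ?thesis by simp
qed

text \<open>Both conditions of \<open>Hom_mu\<close> lose a factor 2: the symmetric differences
  count each defect twice, and total variation is only bounded by twice the deviation.\<close>

lemma hom_of_micro:
 assumes xi: "xi \<in> micro G M al f F dl V sm" and dl: "2 * dl < dl'" and oneF: "\<one> \<in> F"
 shows "(\<lambda>A\<in>alg M (translated_join al F (lab_part M f)). {v \<in> V. xi v \<in> A}) \<in> Hom_mu M al (lab_part M f) F dl' V sm"
proof -
 define \<A> where "\<A> = alg M (lab_part M jF)"
 define \<phi> where "\<phi> = (\<lambda>A\<in>\<A>. {v \<in> V. xi v \<in> A})"
 have \<phi>A: "\<phi> A = {v \<in> V. xi v \<in> A}" if "A \<in> \<A>" for A unfolding \<phi>_def using that by simp
 have sub: "lab_part M jF \<subseteq> Pow (space M)" unfolding lab_part_def by auto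
 interpret R: algebra "space M" \<A> unfolding \<A>_def by (rule algebra_alg[OF sub])
 have xiV: "xi \<in> V \<rightarrow> space M" using xi unfolding micro_def by blast
 have n: "rcard V > 0" using V by (simp add: card_gt_0_iff)
 have "boolean_hom (space M) \<A> V \<phi>"
  unfolding boolean_hom_def
 proof (intro conjI ballI)
  show "\<phi> \<in> \<A> \<rightarrow>\<^sub>E Pow V" unfolding \<phi>_def by auto
  show "\<phi> {} = {}" by (simp add: \<phi>A)
  show "\<phi> (space M) = V" using xiV by (auto simp: \<phi>A)
  fix A assume A: "A \<in> \<A>"
  show "\<phi> (space M - A) = V - \<phi> A" using xiV by (auto simp: \<phi>A[OF A] \<phi>A[OF R.compl_sets[OF A]])
  fix B assume B: "B \<in> \<A>"
  show "\<phi> (A \<union> B) = \<phi> A \<union> \<phi> B" "\<phi> (A \<inter> B) = \<phi> A \<inter> \<phi> B"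
   unfolding \<phi>A[OF A] \<phi>A[OF B] \<phi>A[OF R.Un[OF A B]] \<phi>A[OF R.Int[OF A B]] by blast+
 qed
 moreover have "hom_dist \<phi> g < dl'" if g: "g \<in> F" for g
 proof -
  have "2 * rcard (defect G al f V sm xi g) / rcard V \<le> 2 * dl"
   using xi g n unfolding micro_def by (simp add: field_simps)
  then show ?thesis using hom_conditions[OF xiV \<phi>A[unfolded \<A>_def] g oneF] dl by simp
 qed
 moreover have "(\<Sum>A\<in>lab_part M jF. \<bar>measure (uniform_count_measure V) (\<phi> A) - measure M A\<bar>) < dl'"
 proof -
  have "(\<Sum>A\<in>lab_part M jF. \<bar>measure (uniform_count_measure V) (\<phi> A) - measure M A\<bar>)
   = (\<Sum>A\<in>lab_part M jF. emp_err M V xi A)"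
  proof (rule sum.cong[OF refl])
   fix A assume "A \<in> lab_part M jF"
   then have "A \<in> \<A>" unfolding \<A>_def alg_def by (rule hull_inc)
   then have "measure (uniform_count_measure V) (\<phi> A) = rcard {v \<in> V. xi v \<in> A} / rcard V"
    unfolding \<phi>A[OF \<open>A \<in> \<A>\<close>] by (intro measure_uniform_count_measure[OF V(1)]) blast
   then show "\<bar>measure (uniform_count_measure V) (\<phi> A) - measure M A\<bar> = emp_err M V xi A" by simp
  qed
  also have "\<dots> \<le> 2 * dl"
   by (rule total_variation(2)[OF jlab V xiV]) (use xi in \<open>auto simp: micro_def\<close>)
  finally show ?thesis using dl by linarith
 qed
 ultimately show ?thesis unfolding Hom_mu_def join \<A>_def \<phi>_def by blast
qed

text \<open>The images of the atoms of the join partition \<open>V\<close>, so any choice of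
  \<open>xi v\<close> in the atom whose image contains v realises the homomorphism on the algebra
  generated by the atoms.\<close>

lemma micro_of_hom:
 assumes \<phi>: "\<phi> \<in> Hom_mu M al (lab_part M f) F dl V sm" and oneF: "\<one> \<in> F"
 shows "\<exists>xi\<in>micro G M al f F dl V sm. \<forall>A\<in>alg M (translated_join al F (lab_part M f)). \<phi> A = {v \<in> V. xi v \<in> A}"
proof -
 define J where "J = lab_part M jF"
 have sub: "J \<subseteq> Pow (space M)" unfolding J_def lab_part_def by auto
 interpret R: algebra "space M" "alg M J" by (rule algebra_alg[OF sub])
 have h: "\<phi> \<in> alg M J \<rightarrow>\<^sub>E Pow V" "\<phi> {} = {}" "\<phi> (space M) = V" "\<And>A. A \<in> alg M J ==> \<phi> (space M - A) = V - \<phi> A"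
  "\<And>A B. A \<in> alg M J ==> B \<in> alg M J ==> \<phi> (A \<union> B) = \<phi> A \<union> \<phi> B"
  "\<And>A B. A \<in> alg M J ==> B \<in> alg M J ==> \<phi> (A \<inter> B) = \<phi> A \<inter> \<phi> B"
  using \<phi>[unfolded Hom_mu_def mem_Collect_eq join J_def[symmetric], THEN conjunct1]
  unfolding boolean_hom_def by simp_all
 have Jalg: "A \<in> alg M J" if "A \<in> J" for A using that unfolding alg_def by (rule hull_inc)
 have finJ: "finite J" using finite_partition_lab_part[OF jlab] unfolding finite_partition_def J_def by blast
 have un: "\<phi> (\<Union>Q) = (\<Union>A\<in>Q. \<phi> A) \<and> \<Union>Q \<in> alg M J" if "finite Q" "Q \<subseteq> J" for Q using that
 proof (induction Q)
  case (insert A Q)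
  then have "A \<in> alg M J" using Jalg by blast
  then show ?case using insert h(5)[of A "\<Union>Q"] by auto
 qed (use h in auto)
 have "\<Union>J = space M" using partition_on_lab_part[of M "jF"] unfolding partition_on_def J_def by blast
 then have cover: "(\<Union>A\<in>J. \<phi> A) = V" using un[OF finJ subset_refl] h(3) by simp
 have ex: "\<exists>x. \<exists>A\<in>J. v \<in> \<phi> A \<and> x \<in> A" if vV: "v \<in> V" for v
 proof -
  obtain A where A: "A \<in> J" "v \<in> \<phi> A" using vV cover by blast
  then have "A \<noteq> {}" using h(2) by auto
  then show ?thesis using A by blast
 qed
 define xi where "xi = (\<lambda>v. SOME x. \<exists>A\<in>J. v \<in> \<phi> A \<and> x \<in> A)"
 have xi: "\<exists>A\<in>J. v \<in> \<phi> A \<and> xi v \<in> A" if "v \<in> V" for v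
  unfolding xi_def by (rule someI_ex[OF ex[OF that]])
 have xiV: "xi \<in> V \<rightarrow> space M" using xi sub by blast
 have \<phi>V: "\<phi> A \<subseteq> V" if "A \<in> alg M J" for A using h(1) that by blast
 have eq: "\<phi> A = {v \<in> V. xi v \<in> A}" if "A \<in> alg M J" for A using that sub
 proof (induction rule: alg_induct)
  case (basic A)
  have "v \<in> \<phi> A \<longleftrightarrow> xi v \<in> A" if v: "v \<in> V" for v
  proof -
   obtain B where B: "B \<in> J" "v \<in> \<phi> B" "xi v \<in> B" using xi[OF v] by blast
   have "A = B" if "v \<in> \<phi> A \<or> xi v \<in> A"
   proof (rule ccontr)
    assume "A \<noteq> B"
    then have e: "A \<inter> B = {}" using disj_lab_part[of A M "jF" B] basic B(1) unfolding J_def by blast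
    then have "\<phi> A \<inter> \<phi> B = {}" using h(6)[OF Jalg[OF basic] Jalg[OF B(1)]] h(2) by simp
    then show False using e B that by blast
   qed
   then show ?thesis using B by blast
  qed
  then show ?case using \<phi>V[OF Jalg[OF basic]] by blast
 next
  case empty
  then show ?case using h(2) by simp
 next
  case (compl A)
  then show ?case using h(4) xiV by auto
 next
  case (union A B)
  then show ?case using h(5) by auto
 qed
 have n: "rcard V > 0" using V by (simp add: card_gt_0_iff)
 have "xi \<in> micro G M al f F dl V sm"
  unfolding micro_def
 proof (intro CollectI conjI ballI allI)
  show "xi \<in> V \<rightarrow> space M" by (rule xiV)
  fix g assume g: "g \<in> F"
  have "hom_dist \<phi> g < dl"
   using \<phi> g unfolding Hom_mu_def by blast
  then have "2 * rcard (defect G al f V sm xi g) / rcard V < dl"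
   using hom_conditions[OF xiV eq[unfolded J_def] g oneF] by simp
  then have "2 * rcard (defect G al f V sm xi g) < dl * rcard V"
   using n by (simp add: pos_divide_less_eq)
  then show "rcard (defect G al f V sm xi g) \<le> dl * rcard V" by linarith
 next
  fix Z
  have "(\<Sum>A\<in>J. emp_err M V xi A)
   = (\<Sum>A\<in>J. \<bar>measure (uniform_count_measure V) (\<phi> A) - measure M A\<bar>)"
  proof (rule sum.cong[OF refl])
   fix A assume "A \<in> J"
   then have "A \<in> alg M J" by (rule Jalg)
   then have "measure (uniform_count_measure V) (\<phi> A) = rcard {v \<in> V. xi v \<in> A} / rcard V"
    unfolding eq[OF \<open>A \<in> alg M J\<close>] by (intro measure_uniform_count_measure[OF V(1)]) blast
   then show "emp_err M V xi A = \<bar>measure (uniform_count_measure V) (\<phi> A) - measure M A\<bar>" by simp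
  qed
  also have "\<dots> \<le> dl" using \<phi> unfolding Hom_mu_def join J_def by auto
  finally show "deviation M jF V xi Z \<le> dl * rcard V"
   unfolding J_def by (rule total_variation(1)[OF jlab V xiV])
 qed
 then show ?thesis using eq unfolding join J_def by blast
qed

context
 fixes p :: "'x => 'p"
 assumes p: "\<And>x y. x \<in> space M ==> y \<in> space M ==> f x = f y ==> p x = p y" and oneF: "\<one> \<in> F"
begin

lemma p_one: "al \<one> x = x" "al (inv \<one>) x = x" if "x \<in> space M"
proof -
 interpret group G using A.group_hom group_hom.axioms(1) by blast
 show "al \<one> x = x" using A.id_eq_one that by (metis restrict_apply')
 then show "al (inv \<one>) x = x" by simp
qed

lemma finite_p: "finite (p ` space M)"
proof -
 have "p ` space M \<subseteq> (\<lambda>l. p (SOME x. x \<in> space M \<and> f x = l)) ` f ` space M"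
 proof
  fix y assume "y \<in> p ` space M"
  then obtain x where x: "x \<in> space M" "y = p x" by blast
  define z where "z = (SOME z. z \<in> space M \<and> f z = f x)"
  have z: "z \<in> space M \<and> f z = f x" unfolding z_def by (rule someI[of _ x]) (use x in simp)
  then have "y = p z" using p[of z x] x by simp
  then show "y \<in> (\<lambda>l. p (SOME x. x \<in> space M \<and> f x = l)) ` f ` space M" using x unfolding z_def by blast
 qed
 then show ?thesis using f unfolding simple_function_def by (meson finite_imageI finite_subset)
qed

lemma p_in_alg: "A \<in> lab_part M p ==> A \<in> alg M (translated_join al F (lab_part M f))"
proof -
 assume A: "A \<in> lab_part M p"
 obtain z where z: "A = {y \<in> space M. p y = p z}" using A unfolding lab_part_def by blast
 show ?thesis unfolding join
 proof (rule in_alg_lab_part)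
  show "finite (jF ` space M)" using jlab unfolding simple_function_def by blast
  show "A \<subseteq> space M" unfolding z by blast
  fix x y assume x: "x \<in> A" and y: "y \<in> space M" and e: "jF x = jF y"
  have xM: "x \<in> space M" using x unfolding z by blast
  have "f x = f y" using jlab_eqD[OF e oneF] p_one(2)[OF xM] p_one(2)[OF y] by simp
  then show "y \<in> A" using p[OF xM y] x y unfolding z by simp
 qed
qed

text \<open>The restriction of the homomorphism to the cells of \<open>p\<close> tells which cell
  contains \<open>xi v\<close>, hence the label; \<open>Th\<close> reads it off.\<close>

lemma card_patterns_le:
 assumes dl: "2 * dl < dl'"
 shows "card (patterns p (micro G M al f F dl V sm) V) \<le> num_restrictions (Hom_mu M al (lab_part M f) F dl' V sm) (lab_part M p)"
proof -
 define R where "R = (\<lambda>\<phi>. restrict \<phi> (lab_part M p)) ` Hom_mu M al (lab_part M f) F dl' V sm"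
 define Th where "Th = (\<lambda>ps. restrict (\<lambda>v. p (SOME x. \<exists>A\<in>lab_part M p. v \<in> ps A \<and> x \<in> A)) V)"
 have "R \<subseteq> lab_part M p \<rightarrow>\<^sub>E Pow V"
 proof
  fix r assume "r \<in> R"
  then obtain \<phi> where \<phi>: "\<phi> \<in> Hom_mu M al (lab_part M f) F dl' V sm" "r = restrict \<phi> (lab_part M p)" unfolding R_def by blast
  have "\<phi> \<in> alg M (translated_join al F (lab_part M f)) \<rightarrow>\<^sub>E Pow V" using \<phi>(1) unfolding Hom_mu_def boolean_hom_def by blast
  then have "\<phi> A \<in> Pow V" if "A \<in> lab_part M p" for A using p_in_alg[OF that] by (rule PiE_mem)
  then show "r \<in> lab_part M p \<rightarrow>\<^sub>E Pow V" unfolding \<phi>(2) by (rule restrict_PiE_iff[THEN iffD2, rule_format])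
 qed
 moreover have "finite (lab_part M p \<rightarrow>\<^sub>E Pow V)"
  using finite_p V(1) unfolding lab_part_eq by (intro finite_PiE) auto
 ultimately have fin: "finite R" by (rule finite_subset)
 have "patterns p (micro G M al f F dl V sm) V \<subseteq> Th ` R"
 proof
  fix pe assume "pe \<in> patterns p (micro G M al f F dl V sm) V"
  then obtain xi where xi: "xi \<in> micro G M al f F dl V sm" "pe = restrict (\<lambda>v. p (xi v)) V" unfolding patterns_def by blast
  define \<phi> where "\<phi> = (\<lambda>A\<in>alg M (translated_join al F (lab_part M f)). {v \<in> V. xi v \<in> A})"
  have \<phi>: "\<phi> \<in> Hom_mu M al (lab_part M f) F dl' V sm" unfolding \<phi>_def by (rule hom_of_micro[OF xi(1) dl oneF])
  have "Th (restrict \<phi> (lab_part M p)) = pe"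
   unfolding Th_def xi(2)
  proof (rule restrict_ext)
   fix v assume v: "v \<in> V"
   then have xiv: "xi v \<in> space M" using xi(1) unfolding micro_def by blast
   have in_iff: "v \<in> restrict \<phi> (lab_part M p) A \<longleftrightarrow> xi v \<in> A" if "A \<in> lab_part M p" for A
    using p_in_alg[OF that] that v unfolding \<phi>_def by simp
   have "\<exists>A\<in>lab_part M p. v \<in> restrict \<phi> (lab_part M p) A \<and> (SOME x. \<exists>A\<in>lab_part M p. v \<in> restrict \<phi> (lab_part M p) A \<and> x \<in> A) \<in> A"
   proof (rule someI[of _ "xi v"])
    have "{y \<in> space M. p y = p (xi v)} \<in> lab_part M p" unfolding lab_part_def by (rule imageI[OF xiv])
    moreover have "xi v \<in> {y \<in> space M. p y = p (xi v)}" using xiv by blast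
    ultimately show "\<exists>A\<in>lab_part M p. v \<in> restrict \<phi> (lab_part M p) A \<and> xi v \<in> A" using in_iff by blast
   qed
   then obtain A where A: "A \<in> lab_part M p" "xi v \<in> A" "(SOME x. \<exists>A\<in>lab_part M p. v \<in> restrict \<phi> (lab_part M p) A \<and> x \<in> A) \<in> A"
    using in_iff by blast
   then obtain z where "A = {y \<in> space M. p y = p z}" unfolding lab_part_def by blast
   then show "p (SOME x. \<exists>A\<in>lab_part M p. v \<in> restrict \<phi> (lab_part M p) A \<and> x \<in> A) = p (xi v)" using A(2,3) by simp
  qed
  then show "pe \<in> Th ` R" using \<phi> unfolding R_def by blast
 qed
 then have "card (patterns p (micro G M al f F dl V sm) V) \<le> card (Th ` R)" using fin by (intro card_mono) auto
 also have "\<dots> \<le> card R" by (rule card_image_le[OF fin])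
 finally show ?thesis unfolding num_restrictions_def R_def .
qed

lemma num_restrictions_le:
 "num_restrictions (Hom_mu M al (lab_part M f) F dl V sm) (lab_part M p) \<le> card (patterns p (micro G M al f F dl V sm) V)"
proof -
 define R where "R = (\<lambda>\<phi>. restrict \<phi> (lab_part M p)) ` Hom_mu M al (lab_part M f) F dl V sm"
 define Th where "Th = (\<lambda>pe. \<lambda>A\<in>lab_part M p. {v \<in> V. \<exists>x\<in>A. pe v = p x})"
 define Q where "Q = patterns p (micro G M al f F dl V sm) V"
 have "Q \<subseteq> V \<rightarrow>\<^sub>E p ` space M" unfolding Q_def patterns_def micro_def by auto
 then have fin: "finite Q" using finite_PiE[OF V(1), of "\<lambda>_. p ` space M"] finite_p by (auto intro: finite_subset)
 have "R \<subseteq> Th ` Q"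
 proof
  fix r assume "r \<in> R"
  then obtain \<phi> where \<phi>: "\<phi> \<in> Hom_mu M al (lab_part M f) F dl V sm" "r = restrict \<phi> (lab_part M p)" unfolding R_def by blast
  obtain xi where xi: "xi \<in> micro G M al f F dl V sm" "\<forall>A\<in>alg M (translated_join al F (lab_part M f)). \<phi> A = {v \<in> V. xi v \<in> A}"
   using micro_of_hom[OF \<phi>(1) oneF] by blast
  have xiV: "xi \<in> V \<rightarrow> space M" using xi(1) unfolding micro_def by blast
  have "r = Th (restrict (\<lambda>v. p (xi v)) V)"
   unfolding \<phi>(2) Th_def
  proof (rule restrict_ext)
   fix A assume A: "A \<in> lab_part M p"
   then obtain z where z: "A = {y \<in> space M. p y = p z}" "z \<in> space M" unfolding lab_part_def by blast
   have "\<phi> A = {v \<in> V. xi v \<in> A}" using xi(2) p_in_alg[OF A] by blast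
   also have "\<dots> = {v \<in> V. \<exists>x\<in>A. restrict (\<lambda>v. p (xi v)) V v = p x}" using xiV z unfolding z(1) by auto
   finally show "\<phi> A = {v \<in> V. \<exists>x\<in>A. restrict (\<lambda>v. p (xi v)) V v = p x}" .
  qed
  moreover have "restrict (\<lambda>v. p (xi v)) V \<in> Q" unfolding Q_def patterns_def using xi(1) by blast
  ultimately show "r \<in> Th ` Q" by blast
 qed
 then have "card R \<le> card (Th ` Q)" using fin by (intro card_mono) auto
 also have "\<dots> \<le> card Q" by (rule card_image_le[OF fin])
 finally show ?thesis unfolding num_restrictions_def R_def Q_def .
qed

end

end

section \<open>Entropy as exponential growth rate of patterns\<close>

lemma log_count_le_iff:
 assumes "N > 0"
 shows "log_count n / ereal N \<le> ereal r \<longleftrightarrow> real n \<le> exp (r * N)"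
proof (cases "n = 0")
 case True
 then show ?thesis using assms by (simp add: log_count_def)
next
 case False
 then have "log_count n / ereal N \<le> ereal r \<longleftrightarrow> ln (real n) \<le> r * N"
  using assms by (simp add: log_count_def field_simps)
 also have "\<dots> \<longleftrightarrow> real n \<le> exp (r * N)" using False ln_le_cancel_iff[of "real n" "exp (r * N)"] by simp
 finally show ?thesis .
qed

lemma log_count_ge:
 assumes "N > 0" "exp (r * N) \<le> real n"
 shows "ereal r \<le> log_count n / ereal N"
proof -
 have n: "n \<noteq> 0" using assms(2) exp_gt_zero[of "r * N"] by (intro notI) (simp del: exp_gt_zero)
 have "r * N \<le> ln (real n)" using ln_le_cancel_iff[of "exp (r * N)" "real n"] assms(2) n by simp
 then show ?thesis using assms(1) n by (simp add: log_count_def field_simps)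
qed

text \<open>The label type of \<open>f\<close> stays free, since the labels used later are tuples
  containing cocycle values. The limsup turns into a statement on infinitely many k.\<close>

lemma sofic_entropy_gtE:
 assumes act: "pmp_action G M al" and S: "\<And>k. sofic_approx G (V k) (sm k)" and r: "ereal r < sofic_entropy G M al V sm"
 obtains p :: "'x => 'x set" where "simple_function M p"
  and "\<And>(f :: 'x => 'l) F dl. simple_function M f ==> (\<And>x y. x \<in> space M ==> y \<in> space M ==> f x = f y ==> p x = p y) ==>
    finite F ==> F \<subseteq> carrier G ==> \<one>\<^bsub>G\<^esub> \<in> F ==> dl > 0 ==>
    \<exists>\<^sub>F k in sequentially. many r p (micro G M al f F dl (V k) (sm k)) (V k)"
proof -
 obtain P where P: "finite_partition M P" and r1: "ereal r < (INF C\<in>{C. finite_partition M C \<and> refines (space M) C P}.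
   INF F\<in>{F. finite F \<and> F \<subseteq> carrier G \<and> \<one>\<^bsub>G\<^esub> \<in> F}. INF dl\<in>{0<..}.
    limsup (\<lambda>k. hom_rate M al C F dl (V k) (sm k) P))"
  using r unfolding sofic_entropy_def less_SUP_iff by blast
 define p where "p = (\<lambda>x. THE A. A \<in> P \<and> x \<in> A)"
 note p = lab_part_class[OF P p_def]
 show ?thesis
 proof (rule that[OF p(1)])
  fix f :: "'x => 'l" and F dl
  assume f: "simple_function M f" and fp: "\<And>x y. x \<in> space M ==> y \<in> space M ==> f x = f y ==> p x = p y"
   and F: "finite F" "F \<subseteq> carrier G" "\<one>\<^bsub>G\<^esub> \<in> F" and dl: "(dl::real) > 0"
  have C: "lab_part M f \<in> {C. finite_partition M C \<and> refines (space M) C P}"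
  proof -
   have "refines (space M) (lab_part M f) (lab_part M p)" by (rule refines_lab_part) (rule fp)
   then show ?thesis using finite_partition_lab_part[OF f] p(2) by simp
  qed
  have r2: "ereal r < limsup (\<lambda>k. hom_rate M al (lab_part M f) F dl (V k) (sm k) P)"
   using less_INF_D[OF less_INF_D[OF less_INF_D[OF r1 C], of F], of dl] F dl by simp
  show "\<exists>\<^sub>F k in sequentially. many r p (micro G M al f F dl (V k) (sm k)) (V k)"
  proof (rule ccontr)
   assume "\<not> ?thesis"
   then have ev: "\<forall>\<^sub>F k in sequentially. \<not> many r p (micro G M al f F dl (V k) (sm k)) (V k)"
    unfolding frequently_def by simp
   have "\<forall>\<^sub>F k in sequentially. hom_rate M al (lab_part M f) F dl (V k) (sm k) P \<le> ereal r"
    using ev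
   proof (rule eventually_mono)
    fix k assume k: "\<not> many r p (micro G M al f F dl (V k) (sm k)) (V k)"
    have V: "finite (V k)" "V k \<noteq> {}" "\<And>g. g \<in> F ==> sm k g permutes V k" using S[of k] F unfolding sofic_approx_def by blast+
    note oneF = F(3)
    interpret entropy_data G M al f F "V k" "sm k" using act f F V by unfold_locales auto
    have "num_restrictions (Hom_mu M al (lab_part M f) F dl (V k) (sm k)) P \<le> card (patterns p (micro G M al f F dl (V k) (sm k)) (V k))"
     unfolding p(2)[symmetric] by (rule num_restrictions_le[OF _ oneF]) (rule fp)
    moreover have "rcard (V k) > 0" using V by (simp add: card_gt_0_iff)
    ultimately show "hom_rate M al (lab_part M f) F dl (V k) (sm k) P \<le> ereal r"
     using k log_count_le_iff by fastforce
   qed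
   then have "limsup (\<lambda>k. hom_rate M al (lab_part M f) F dl (V k) (sm k) P) \<le> ereal r"
    by (rule Limsup_bounded)
   then show False using r2 by simp
  qed
 qed
qed

text \<open>Cells serve as labels of the finer partition. The tolerance is divided by 3 because
  \<open>card_patterns_le\<close> needs twice the smaller tolerance to be strictly below the
  larger.\<close>

lemma sofic_entropy_geI:
 fixes p :: "'x => 'p"
 assumes act: "pmp_action G M al" and S: "\<And>k. sofic_approx G (V k) (sm k)" and p: "simple_function M p"
  and freq: "\<And>(f :: 'x => 'x set) F dl. simple_function M f ==> (\<And>x y. x \<in> space M ==> y \<in> space M ==> f x = f y ==> p x = p y) ==>
    finite F ==> F \<subseteq> carrier G ==> \<one>\<^bsub>G\<^esub> \<in> F ==> dl > 0 ==>
    \<exists>\<^sub>F k in sequentially. many r p (micro G M al f F dl (V k) (sm k)) (V k)"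
 shows "ereal r \<le> sofic_entropy G M al V sm"
 unfolding sofic_entropy_def
proof (rule SUP_upper2[of "lab_part M p"])
 show "lab_part M p \<in> {P. finite_partition M P}" using finite_partition_lab_part[OF p] by simp
 show "ereal r \<le> (INF C\<in>{C. finite_partition M C \<and> refines (space M) C (lab_part M p)}.
   INF F\<in>{F. finite F \<and> F \<subseteq> carrier G \<and> \<one>\<^bsub>G\<^esub> \<in> F}. INF dl\<in>{0<..}.
    limsup (\<lambda>k. hom_rate M al C F dl (V k) (sm k) (lab_part M p)))"
 proof (intro INF_greatest)
  fix C F dl assume "C \<in> {C. finite_partition M C \<and> refines (space M) C (lab_part M p)}"
   and "F \<in> {F. finite F \<and> F \<subseteq> carrier G \<and> \<one>\<^bsub>G\<^esub> \<in> F}" and "dl \<in> {0::real<..}"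
  then have C: "finite_partition M C" "refines (space M) C (lab_part M p)"
   and F: "finite F" "F \<subseteq> carrier G" "\<one>\<^bsub>G\<^esub> \<in> F" and dl: "dl / 3 > 0" by auto
  define f where "f = (\<lambda>x. THE A. A \<in> C \<and> x \<in> A)"
  note cf = lab_part_class[OF C(1) f_def]
  have fp: "p x = p y" if "x \<in> space M" "y \<in> space M" "f x = f y" for x y
   by (rule refines_lab_partD[OF C(2)[folded cf(2)] that])
  show "ereal r \<le> limsup (\<lambda>k. hom_rate M al C F dl (V k) (sm k) (lab_part M p))"
  proof (rule ccontr)
   assume "\<not> ?thesis"
   then have "limsup (\<lambda>k. hom_rate M al C F dl (V k) (sm k) (lab_part M p)) < ereal r"
    by simp
   then have ev: "\<forall>\<^sub>F k in sequentially. hom_rate M al C F dl (V k) (sm k) (lab_part M p) < ereal r"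
    by (rule Limsup_lessD)
   have "\<forall>\<^sub>F k in sequentially. \<not> many r p (micro G M al f F (dl / 3) (V k) (sm k)) (V k)"
    using ev
   proof (rule eventually_mono)
    fix k assume k: "hom_rate M al C F dl (V k) (sm k) (lab_part M p) < ereal r"
    have V: "finite (V k)" "V k \<noteq> {}" "\<And>g. g \<in> F ==> sm k g permutes V k" using S[of k] F unfolding sofic_approx_def by blast+
    note oneF = F(3)
    interpret entropy_data G M al f F "V k" "sm k" using act cf(1) F V by unfold_locales auto
    have n: "rcard (V k) > 0" using V by (simp add: card_gt_0_iff)
    have le: "card (patterns p (micro G M al f F (dl / 3) (V k) (sm k)) (V k)) \<le> num_restrictions (Hom_mu M al C F dl (V k) (sm k)) (lab_part M p)"
     unfolding cf(2)[symmetric] by (rule card_patterns_le[OF _ oneF]) (rule fp, assumption+, use dl in simp)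
    show "\<not> many r p (micro G M al f F (dl / 3) (V k) (sm k)) (V k)"
    proof
     assume "many r p (micro G M al f F (dl / 3) (V k) (sm k)) (V k)"
     then have "exp (r * rcard (V k)) \<le> real (num_restrictions (Hom_mu M al C F dl (V k) (sm k)) (lab_part M p))"
      using le by linarith
     from log_count_ge[OF n this] k show False by simp
    qed
   qed
   moreover have "\<exists>\<^sub>F k in sequentially. many r p (micro G M al f F (dl / 3) (V k) (sm k)) (V k)"
    by (rule freq[OF cf(1) _ F dl]) (rule fp)
   ultimately show False unfolding frequently_def by simp
  qed
 qed
qed

lemma card_Collect_diff_le:
 assumes V: "finite V" and C: "\<And>v. v \<in> V ==> P v \<noteq> Q v ==> R v"
 shows "\<bar>rcard {v \<in> V. P v} - rcard {v \<in> V. Q v}\<bar> \<le> rcard {v \<in> V. R v}"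
proof -
 have "card {v \<in> V. P v} \<le> card ({v \<in> V. Q v} \<union> {v \<in> V. R v})" "card {v \<in> V. Q v} \<le> card ({v \<in> V. P v} \<union> {v \<in> V. R v})"
  using V C by (auto intro!: card_mono)
 then show ?thesis
  using card_Un_le[of "{v \<in> V. Q v}" "{v \<in> V. R v}"] card_Un_le[of "{v \<in> V. P v}" "{v \<in> V. R v}"] by linarith
qed

lemma (in finite_measure) measure_Collect_diff_le:
 assumes A: "A \<in> sets M" and B: "B \<in> sets M" and E: "E \<in> sets M" and C: "\<And>v. v \<in> A \<union> B ==> (v \<in> A) \<noteq> (v \<in> B) ==> v \<in> E"
 shows "\<bar>measure M A - measure M B\<bar> \<le> measure M E"
proof -
 have "measure M A \<le> measure M (B \<union> E)" "measure M B \<le> measure M (A \<union> E)"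
  using A B E C by (auto intro!: finite_measure_mono)
 then show ?thesis using measure_Un_le[OF B E] measure_Un_le[OF A E] by linarith
qed

lemma pmp_measure_vimage:
 assumes act: "pmp_action H N be" and g: "g \<in> carrier H" and E: "E \<in> sets N"
 shows "{y \<in> space N. be g y \<in> E} \<in> sets N" "measure N {y \<in> space N. be g y \<in> E} = measure N E"
proof -
 have m: "be g \<in> N \<rightarrow>\<^sub>M N" "distr N N (be g) = N" using act g unfolding pmp_action_def by blast+
 have eq: "{y \<in> space N. be g y \<in> E} = be g -` E \<inter> space N" by blast
 show "{y \<in> space N. be g y \<in> E} \<in> sets N" unfolding eq by (rule measurable_sets[OF m(1) E])
 show "measure N {y \<in> space N. be g y \<in> E} = measure N E"
  unfolding eq using measure_distr[OF m(1) E] m(2) by simp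
qed

text \<open>Points are moved within the atoms of the finer label, away from the small set where the two labels are not compatible.\<close>

lemma micro_replace:
 fixes H :: "('h, 'd) monoid_scheme" (structure)
 assumes act: "pmp_action H N be" and e: "simple_function N e" and f: "simple_function N f"
  and err: "measure N {y \<in> space N. dd (e y) \<noteq> f y} \<le> ep"
  and L: "finite L" "L \<subseteq> carrier H" "F \<subseteq> L" "\<one> \<in> F"
  and V: "finite V" "\<And>t. t \<in> F ==> ta t permutes V" and xi: "xi \<in> micro H N be e L dl1 V ta"
  and dl: "3 * dl1 + 2 * (rcard F * ep) \<le> dl" and ep: "dl1 \<ge> 0"
 shows "\<exists>xi'\<in>micro H N be f F dl V ta. \<forall>v\<in>V. e (xi' v) = e (xi v)"
proof -
 have A: "group_action H (space N) be" and pr: "prob_space N" using act unfolding pmp_action_def by blast+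
 interpret A: group_action H "space N" be by (rule A)
 interpret prob_space N by (rule pr)
 interpret group H using A.group_hom group_hom.axioms(1) by blast
 define J where "J = jlab H be L e"
 have finF: "finite F" and FC: "F \<subseteq> carrier H" using L finite_subset by blast+
 have sJ: "simple_function N J" unfolding J_def by (rule simple_jlab[OF act L(1,2) e])
 have sF: "simple_function N (jlab H be F f)" by (rule simple_jlab[OF act finF FC f])
 define E where "E = {y \<in> space N. dd (e y) \<noteq> f y}"
 have E: "E \<in> sets N"
 proof -
  have "simple_function N (\<lambda>y. dd (e y) \<noteq> f y)" by (rule simple_function_compose2[OF e f])
  then have "(\<lambda>y. dd (e y) \<noteq> f y) -` {True} \<inter> space N \<in> sets N" by (rule simple_functionD)
  moreover have "(\<lambda>y. dd (e y) \<noteq> f y) -` {True} \<inter> space N = E" unfolding E_def by auto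
  ultimately show ?thesis by simp
 qed
 define BF where "BF = (\<Union>g\<in>F. {y \<in> space N. be (inv g) y \<in> E})"
 have inF: "inv g \<in> carrier H" if "g \<in> F" for g using that FC by blast
 have BFs: "BF \<in> sets N" unfolding BF_def using pmp_measure_vimage(1)[OF act inF E] finF by blast
 have "measure N BF \<le> (\<Sum>g\<in>F. measure N {y \<in> space N. be (inv g) y \<in> E})"
  unfolding BF_def using pmp_measure_vimage(1)[OF act inF E] finF by (intro finite_measure_subadditive_finite) auto
 also have "\<dots> = (\<Sum>g\<in>F. measure N E)" using pmp_measure_vimage(2)[OF act inF E] by (intro sum.cong) auto
 also have "\<dots> \<le> rcard F * ep" using err unfolding E_def by (simp add: mult_left_mono)
 finally have mBF: "measure N BF \<le> rcard F * ep" .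
 \<comment> \<open>The joint labels carried only by bad points; every other label has a good
   representative. The statistics of \<open>xi\<close> are tested on this very set of labels, which
   bounds the number of bad v.\<close>
 define Zb where "Zb = {z. \<forall>y\<in>space N. J y = z --> y \<in> BF}"
 define bad where "bad = (\<lambda>v. J (xi v) \<in> Zb)"
 have xiV: "xi v \<in> space N" if "v \<in> V" for v using xi that unfolding micro_def by blast
 have xis: "deviation N J V xi Z \<le> dl1 * rcard V" for Z
  using xi unfolding micro_def J_def by blast
 have xie: "rcard (defect H be e V ta xi g) \<le> dl1 * rcard V" if "g \<in> F" for g
  using xi that L(3) unfolding micro_def by blast
 have cb: "rcard {v \<in> V. bad v} \<le> (rcard F * ep + dl1) * rcard V"
 proof -
  have "measure N {x \<in> space N. J x \<in> Zb} \<le> measure N BF"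
   by (rule finite_measure_mono[OF _ BFs]) (auto simp: Zb_def)
  then have "rcard V * measure N {x \<in> space N. J x \<in> Zb} \<le> rcard V * (rcard F * ep)"
   using mBF by (intro mult_left_mono) auto
  then show ?thesis using xis[of Zb] unfolding bad_def by (simp add: algebra_simps abs_le_iff)
 qed
 define xi' where "xi' = (\<lambda>v. if bad v then xi v else (SOME y. y \<in> space N \<and> J y = J (xi v) \<and> y \<notin> BF))"
 have good: "xi' v \<in> space N \<and> J (xi' v) = J (xi v) \<and> xi' v \<notin> BF" if "\<not> bad v" for v
 proof -
  have "\<exists>y. y \<in> space N \<and> J y = J (xi v) \<and> y \<notin> BF" using that unfolding bad_def Zb_def by blast
  from someI_ex[OF this] show ?thesis unfolding xi'_def using that by simp
 qed
 have xi'V: "xi' v \<in> space N" if "v \<in> V" for v using good[of v] xiV[OF that] unfolding xi'_def by (cases "bad v") auto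
 have J': "J (xi' v) = J (xi v)" for v using good[of v] unfolding xi'_def by (cases "bad v") auto
 have Jg: "J y g = e (be (inv g) y)" if "g \<in> F" for g y
  unfolding J_def jlab_def using that L(3) by auto
 have fF: "f (be (inv g) y) = dd (J y g)" if "y \<in> space N" "y \<notin> BF" "g \<in> F" for y g
  using that A.inv_closed_act[of g y] FC unfolding BF_def E_def Jg[OF that(3)] by auto
 have one: "be (inv \<one>) y = y" if "y \<in> space N" for y
  using A.id_eq_one that by (metis inv_one restrict_apply')
 have f1: "f (xi' v) = dd (J (xi v) \<one>)" if "\<not> bad v" for v
  using fF[of "xi' v" "\<one>"] good[OF that] L(4) one[of "xi' v"] by simp
 have e1: "e y = J y \<one>" if "y \<in> space N" for y using Jg[OF L(4), of y] one[OF that] by simp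
 have "xi' \<in> micro H N be f F dl V ta"
  unfolding micro_def
 proof (intro CollectI conjI ballI allI)
  show "xi' \<in> V \<rightarrow> space N" using xi'V by blast
  fix g assume g: "g \<in> F"
  have inV: "ta g u \<in> V" if "u \<in> V" for u using permutes_in_image[OF V(2)[OF g]] that by blast
  have "defect H be f V ta xi' g \<subseteq>
    {u \<in> V. bad (ta g u)} \<union> ({u \<in> V. bad u} \<union> (defect H be e V ta xi g))"
  proof
   fix u assume u: "u \<in> (defect H be f V ta xi' g)"
   show "u \<in> {u \<in> V. bad (ta g u)} \<union> ({u \<in> V. bad u} \<union> (defect H be e V ta xi g))"
   proof (rule ccontr)
    assume no: "\<not> ?thesis"
    then have nb: "\<not> bad (ta g u)" "\<not> bad u" and eq: "e (be (inv g) (xi (ta g u))) = e (xi u)" using u by auto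
    have "f (be (inv g) (xi' (ta g u))) = dd (J (xi (ta g u)) g)" using fF[OF _ _ g] good[OF nb(1)] by metis
    also have "J (xi (ta g u)) g = J (xi u) \<one>" using eq Jg[OF g] e1[OF xiV[of u]] u by simp
    finally show False using f1[OF nb(2)] u by simp
   qed
  qed
  then have "card (defect H be f V ta xi' g) \<le>
    card ({u \<in> V. bad (ta g u)} \<union> ({u \<in> V. bad u} \<union> (defect H be e V ta xi g)))"
   using V(1) by (intro card_mono) auto
  also have "\<dots> \<le> card {u \<in> V. bad (ta g u)} + (card {u \<in> V. bad u} + card (defect H be e V ta xi g))"
   by (intro order_trans[OF card_Un_le] add_mono order_refl card_Un_le)
  also have "card {u \<in> V. bad (ta g u)} = card {u \<in> V. bad u}"
  proof -
   have "{u \<in> V. bad (ta g u)} = {v \<in> V. ta g v \<in> {u \<in> V. bad u}}" using inV by auto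
   also have "card \<dots> = card {u \<in> V. bad u}" by (rule card_vimage_permutes[OF V(2)[OF g] V(1)]) blast
   finally show ?thesis .
  qed
  finally have "rcard (defect H be f V ta xi' g)
    \<le> (2 * (rcard F * ep + dl1) + dl1) * rcard V" using cb xie[OF g] by (simp add: algebra_simps)
  also have "\<dots> \<le> dl * rcard V" using dl by (intro mult_right_mono) (auto simp: algebra_simps)
  finally show "rcard (defect H be f V ta xi' g) \<le> dl * rcard V" .
 next
  fix Z
  \<comment> \<open>Away from \<open>BF\<close> the joint label of f is a function of
    \<open>J\<close>, so the statistics of \<open>xi\<close> on the label set \<open>W\<close> can
    be used.\<close>
  define W where "W = {z. (\<lambda>g\<in>F. dd (z g)) \<in> Z}"
  have jW: "jlab H be F f y \<in> Z \<longleftrightarrow> J y \<in> W" if "y \<in> space N" "y \<notin> BF" for y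
  proof -
   have "jlab H be F f y = (\<lambda>g\<in>F. dd (J y g))" unfolding jlab_def by (rule restrict_ext) (rule fF[OF that])
   then show ?thesis unfolding W_def by simp
  qed
  have 1: "\<bar>rcard {v \<in> V. jlab H be F f (xi' v) \<in> Z} - rcard {v \<in> V. J (xi v) \<in> W}\<bar> \<le> rcard {v \<in> V. bad v}"
  proof (rule card_Collect_diff_le[OF V(1)])
   fix v assume "v \<in> V" "(jlab H be F f (xi' v) \<in> Z) \<noteq> (J (xi v) \<in> W)"
   then show "bad v" using jW[of "xi' v"] good[of v] by fastforce
  qed
  have "{x \<in> space N. J x \<in> W} = J -` W \<inter> space N" "{x \<in> space N. jlab H be F f x \<in> Z} = jlab H be F f -` Z \<inter> space N" by blast+
  then have ms: "{x \<in> space N. J x \<in> W} \<in> sets N" "{x \<in> space N. jlab H be F f x \<in> Z} \<in> sets N"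
   using simple_functionD(2)[OF sJ] simple_functionD(2)[OF sF] by simp_all
  have "\<bar>measure N {x \<in> space N. J x \<in> W} - measure N {x \<in> space N. jlab H be F f x \<in> Z}\<bar> \<le> measure N BF"
   by (rule measure_Collect_diff_le[OF ms BFs]) (use jW in blast)
  then have "rcard V * \<bar>measure N {x \<in> space N. J x \<in> W} - measure N {x \<in> space N. jlab H be F f x \<in> Z}\<bar> \<le> rcard V * (rcard F * ep)"
   using mBF by (intro mult_left_mono) auto
  then have 2: "\<bar>rcard V * measure N {x \<in> space N. J x \<in> W} - rcard V * measure N {x \<in> space N. jlab H be F f x \<in> Z}\<bar> \<le> rcard F * ep * rcard V"
   unfolding right_diff_distrib[symmetric] abs_mult by (simp add: mult.commute)
  have "(3 * dl1 + 2 * (rcard F * ep)) * rcard V \<le> dl * rcard V" using dl by (intro mult_right_mono) auto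
  moreover have "0 \<le> dl1 * rcard V" using ep by simp
  ultimately show "deviation N (jlab H be F f) V xi' Z \<le> dl * rcard V"
   using 1 2 cb xis[of W] unfolding distrib_right by linarith
 qed
 moreover have "e (xi' v) = e (xi v)" if "v \<in> V" for v
  using e1[OF xi'V[OF that]] e1[OF xiV[OF that]] J' by simp
 ultimately show ?thesis by blast
qed

lemma good_approx_mono: "good_approx G F dl V sm ==> F' \<subseteq> F ==> dl \<le> dl' ==> good_approx G F' dl' V sm"
 unfolding good_approx_def by (meson order_trans diff_left_mono subsetD)

text \<open>The value False from n on gives a single label type for all n and makes each label a
  truncation of the later ones.\<close>

definition bits :: "(nat => 'y set) => nat => 'y => nat => bool" where
 "bits A n y = (\<lambda>i. i < n \<and> y \<in> A i)"

abbreviation "bit_err M A B n Z \<equiv> {y \<in> space M. (y \<in> B) \<noteq> (bits A n y \<in> Z)}"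

lemma bits_bits: "n \<le> m ==> (\<lambda>i. i < n \<and> bits A m y i) = bits A n y"
 unfolding bits_def by auto

lemma simple_bits:
 assumes A: "\<And>i. A i \<in> sets N"
 shows "simple_function N (bits A n)"
proof (induction n)
 case 0
 have "bits A 0 = (\<lambda>y i. False)" unfolding bits_def by auto
 then show ?case by simp
next
 case (Suc n)
 have "simple_function N (\<lambda>y. y \<in> A n)"
  unfolding simple_function_eq_measurable
 proof
  show "finite ((\<lambda>y. y \<in> A n) ` space N)" by (rule finite_subset[of _ UNIV]) auto
  show "(\<lambda>y. y \<in> A n) \<in> N \<rightarrow>\<^sub>M count_space UNIV" using A[of n] by measurable
 qed
 with Suc have "simple_function N (\<lambda>y. (bits A n y)(n := (y \<in> A n)))"
  by (rule simple_function_compose2)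
 moreover have "(\<lambda>y. (bits A n y)(n := (y \<in> A n))) = bits A (Suc n)"
  unfolding bits_def by (auto simp: fun_eq_iff less_Suc_eq)
 ultimately show ?case by simp
qed

text \<open>Sets that are approximated in measure by finitely many bits form a sigma-algebra: a
  complement is handled by complementing the label set, and a countable union is first replaced by a
  finite one.\<close>

lemma (in finite_measure) approximation_by_bits:
 assumes A: "\<And>i. A i \<in> sets M" and gen: "sets M = sigma_sets (space M) (range A)" and B: "B \<in> sets M" and ep: "ep > 0"
 shows "\<exists>n Z. measure M (bit_err M A B n Z) < ep"
proof -
 have vim: "{y \<in> space M. bits A n y \<in> Z} \<in> sets M" for n Z
 proof -
  have "{y \<in> space M. bits A n y \<in> Z} = bits A n -` Z \<inter> space M" by blast
  then show ?thesis using simple_functionD(2)[OF simple_bits[OF A]] by simp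
 qed
 have meas: "bit_err M A B n Z \<in> sets M" if B: "B \<in> sets M" for B n Z
 proof -
  have "bit_err M A B n Z = sym_diff B {y \<in> space M. bits A n y \<in> Z}"
   using sets.sets_into_space[OF B] by auto
  then show ?thesis using vim[of n Z] B by auto
 qed
 have "B \<in> sigma_sets (space M) (range A)" using B gen by simp
 then have "\<forall>ep>0. \<exists>n Z. measure M (bit_err M A B n Z) < ep"
 proof (induction rule: sigma_sets.induct)
  case (Basic a)
  then obtain i where i: "a = A i" by blast
  have eq: "{y \<in> space M. (y \<in> a) \<noteq> (bits A (Suc i) y \<in> {z. z i})} = {}" unfolding i bits_def by auto
  show ?case
  proof (intro allI impI)
   fix ep :: real assume "ep > 0"
   then have "measure M {y \<in> space M. (y \<in> a) \<noteq> (bits A (Suc i) y \<in> {z. z i})} < ep" unfolding eq by simp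
   then show "\<exists>n Z. measure M {y \<in> space M. (y \<in> a) \<noteq> (bits A n y \<in> Z)} < ep" by (rule exI[of _ "Suc i", OF exI])
  qed
 next
  case Empty
  show ?case
  proof (intro allI impI)
   fix ep :: real assume "ep > 0"
   then have "measure M {y \<in> space M. (y \<in> {}) \<noteq> (bits A 0 y \<in> {})} < ep" by simp
   then show "\<exists>n Z. measure M {y \<in> space M. (y \<in> {}) \<noteq> (bits A n y \<in> Z)} < ep" by (rule exI[of _ 0, OF exI])
  qed
 next
  case (Compl a)
  show ?case
  proof (intro allI impI)
   fix ep :: real assume "ep > 0"
   then obtain n Z where nZ: "measure M {y \<in> space M. (y \<in> a) \<noteq> (bits A n y \<in> Z)} < ep" using Compl by blast
   have eq: "{y \<in> space M. (y \<in> space M - a) \<noteq> (bits A n y \<in> - Z)} = {y \<in> space M. (y \<in> a) \<noteq> (bits A n y \<in> Z)}" by auto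
   have "measure M {y \<in> space M. (y \<in> space M - a) \<noteq> (bits A n y \<in> - Z)} < ep" unfolding eq by (rule nZ)
   then show "\<exists>n Z. measure M {y \<in> space M. (y \<in> space M - a) \<noteq> (bits A n y \<in> Z)} < ep" by (rule exI[of _ n, OF exI])
  qed
 next
  case (Union a)
  show ?case
  proof (intro allI impI)
   fix ep :: real assume ep: "ep > 0"
   have as: "a i \<in> sets M" for i using Union(1) gen by simp
   have "(\<lambda>k. measure M (\<Union>i<k. a i)) \<longlonglongrightarrow> measure M (\<Union>k. \<Union>i<k. a i)"
    proof (rule finite_Lim_measure_incseq)
    show "range (\<lambda>k. \<Union>i<k. a i) \<subseteq> sets M" using as by auto
    show "incseq (\<lambda>k. \<Union>i<k. a i)" unfolding incseq_def by (intro allI impI UN_mono) auto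
   qed
   moreover have "(\<Union>k. \<Union>i<k. a i) = (\<Union>i. a i)" by (auto intro: lessI)
   ultimately have lim: "(\<lambda>k. measure M (\<Union>i<k. a i)) \<longlonglongrightarrow> measure M (\<Union>i. a i)" by simp
   obtain k where k: "measure M (\<Union>i. a i) - measure M (\<Union>i<k. a i) < ep / 2"
   proof -
    have "\<forall>\<^sub>F k in sequentially. measure M (\<Union>i. a i) - ep / 2 < measure M (\<Union>i<k. a i)"
     using order_tendstoD(1)[OF lim] ep by simp
    then obtain k where "measure M (\<Union>i. a i) - ep / 2 < measure M (\<Union>i<k. a i)"
     by (meson eventually_sequentially order_refl)
    then show ?thesis using that[of k] by linarith
   qed
   define ep' where "ep' = ep / (2 * real (Suc k))"
   have ep': "ep' > 0" unfolding ep'_def using ep by simp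
   have "\<forall>i. \<exists>n Z. measure M (bit_err M A (a i) n Z) < ep'" using Union(2) ep' by blast
   then obtain n Z where nZ: "\<And>i. measure M (bit_err M A (a i) (n i) (Z i)) < ep'" by metis
   define m where "m = Max (n ` {..k})"
   have nm: "n i \<le> m" if "i < k" for i unfolding m_def using that by (intro Max_ge) auto
   define Z' where "Z' = {z. \<exists>i<k. (\<lambda>j. j < n i \<and> z j) \<in> Z i}"
   have Z': "bits A m y \<in> Z' \<longleftrightarrow> (\<exists>i<k. bits A (n i) y \<in> Z i)" for y
    unfolding Z'_def mem_Collect_eq by (intro ex_cong1 conj_cong refl) (simp only: bits_bits[OF nm])
   have "{y \<in> space M. (y \<in> (\<Union>i. a i)) \<noteq> (bits A m y \<in> Z')} \<subseteq>
     ((\<Union>i. a i) - (\<Union>i<k. a i)) \<union> (\<Union>i\<in>{..<k}. bit_err M A (a i) (n i) (Z i))"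
    unfolding Z' by auto
   then have "measure M {y \<in> space M. (y \<in> (\<Union>i. a i)) \<noteq> (bits A m y \<in> Z')} \<le>
     measure M (((\<Union>i. a i) - (\<Union>i<k. a i)) \<union> (\<Union>i\<in>{..<k}. bit_err M A (a i) (n i) (Z i)))"
    using as meas[OF as] by (intro finite_measure_mono) auto
   also have "\<dots> \<le> measure M ((\<Union>i. a i) - (\<Union>i<k. a i)) + measure M (\<Union>i\<in>{..<k}. bit_err M A (a i) (n i) (Z i))"
    using as meas[OF as] by (intro measure_Un_le) auto
   also have "measure M ((\<Union>i. a i) - (\<Union>i<k. a i)) = measure M (\<Union>i. a i) - measure M (\<Union>i<k. a i)"
    using as by (intro finite_measure_Diff) auto
   also have "measure M (\<Union>i\<in>{..<k}. bit_err M A (a i) (n i) (Z i))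
     \<le> (\<Sum>i\<in>{..<k}. measure M (bit_err M A (a i) (n i) (Z i)))"
    using meas[OF as] by (intro finite_measure_subadditive_finite) auto
   also have "\<dots> \<le> (\<Sum>i\<in>{..<k}. ep')" using nZ by (intro sum_mono less_imp_le)
   also have "\<dots> = real k * ep'" by simp
   also have "\<dots> < ep / 2" unfolding ep'_def using ep by (simp add: field_simps)
   finally have "measure M {y \<in> space M. (y \<in> (\<Union>i. a i)) \<noteq> (bits A m y \<in> Z')} < ep" using k by linarith
   then show "\<exists>n Z. measure M {y \<in> space M. (y \<in> (\<Union>i. a i)) \<noteq> (bits A n y \<in> Z)} < ep" by blast
  qed
 qed
 then show ?thesis using ep by blast
qed

text \<open>The decoder \<open>D\<close> picks a value whose approximating label set contains the
  truncated bits, and it errs only where one of these sets does. As it truncates first, the same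
  decoder works for all larger m.\<close>

lemma (in finite_measure) approximation_by_bits_simple:
 assumes A: "\<And>i. A i \<in> sets M" and gen: "sets M = sigma_sets (space M) (range A)" and f: "simple_function M f" and ep: "ep > 0"
 shows "\<exists>n D. \<forall>m\<ge>n. measure M {y \<in> space M. D (bits A m y) \<noteq> f y} \<le> ep"
proof -
 define R where "R = f ` space M"
 have fR: "finite R" and fl: "\<And>l. f -` {l} \<inter> space M \<in> sets M" unfolding R_def using simple_functionD[OF f] by auto
 define ep' where "ep' = ep / real (Suc (card R))"
 have ep': "ep' > 0" unfolding ep'_def using ep by simp
 have "\<forall>l. \<exists>n Z. measure M {y \<in> space M. (y \<in> f -` {l} \<inter> space M) \<noteq> (bits A n y \<in> Z)} < ep'"
  using approximation_by_bits[OF A gen fl ep'] by blast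
 from choice[OF this] obtain n where "\<forall>l. \<exists>Z. measure M {y \<in> space M. (y \<in> f -` {l} \<inter> space M) \<noteq> (bits A (n l) y \<in> Z)} < ep'" ..
 from choice[OF this] obtain Z where nZ0: "\<forall>l. measure M {y \<in> space M. (y \<in> f -` {l} \<inter> space M) \<noteq> (bits A (n l) y \<in> Z l)} < ep'" ..
 note nZ = nZ0[rule_format]
 define n0 where "n0 = Max (insert 0 (n ` R))"
 have nn: "n l \<le> n0" if "l \<in> R" for l unfolding n0_def using that fR by (intro Max_ge) auto
 define D where "D = (\<lambda>z. SOME l. l \<in> R \<and> (\<lambda>i. i < n l \<and> z i) \<in> Z l)"
 let ?D = "\<lambda>m. {y \<in> space M. D (bits A m y) \<noteq> f y}"
 have "measure M (?D m) \<le> ep" if m: "m \<ge> n0" for m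
 proof -
  define E where "E = (\<lambda>l. {y \<in> space M. (y \<in> f -` {l} \<inter> space M) \<noteq> (bits A (n l) y \<in> Z l)})"
  have Es: "E l \<in> sets M" for l
  proof -
   have "E l = sym_diff (f -` {l} \<inter> space M) (bits A (n l) -` Z l \<inter> space M)" unfolding E_def by auto
   then show ?thesis using fl[of l] simple_functionD(2)[where X = "Z l", OF simple_bits[where n = "n l", OF A]] by auto
  qed
  have "?D m \<subseteq> (\<Union>l\<in>R. E l)"
  proof
   fix y assume y: "y \<in> ?D m"
   show "y \<in> (\<Union>l\<in>R. E l)"
   proof (rule ccontr)
    assume "y \<notin> (\<Union>l\<in>R. E l)"
    then have iff: "f y = l \<longleftrightarrow> bits A (n l) y \<in> Z l" if "l \<in> R" for l using that y unfolding E_def by auto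
    have bb: "(\<lambda>i. i < n l \<and> bits A m y i) = bits A (n l) y" if "l \<in> R" for l
     using bits_bits[of "n l" m A y] nn[OF that] m by simp
    have fy: "f y \<in> R" unfolding R_def using y by blast
    have "D (bits A m y) \<in> R \<and> (\<lambda>i. i < n (D (bits A m y)) \<and> bits A m y i) \<in> Z (D (bits A m y))"
     unfolding D_def by (rule someI[of _ "f y"]) (use fy iff[OF fy] bb[OF fy] in simp)
    then have "f y = D (bits A m y)" by (metis iff bb)
    then show False using y by simp
   qed
  qed
  then have "measure M (?D m) \<le> measure M (\<Union>l\<in>R. E l)"
   using Es fR by (intro finite_measure_mono) auto
  also have "\<dots> \<le> (\<Sum>l\<in>R. measure M (E l))" using Es fR by (intro finite_measure_subadditive_finite) auto
  also have "\<dots> \<le> (\<Sum>l\<in>R. ep')" using nZ unfolding E_def by (intro sum_mono less_imp_le)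
  also have "\<dots> = rcard R * ep'" by simp
  also have "\<dots> \<le> ep" unfolding ep'_def using ep by (simp add: field_simps)
  finally show ?thesis .
 qed
 then show ?thesis by blast
qed

abbreviation "separating_generator N A \<equiv> (\<forall>i. A i \<in> sets N) \<and> sets N = sigma_sets (space N) (range A) \<and>
 (\<forall>x\<in>space N. \<forall>y\<in>space N. x \<noteq> y --> (\<exists>i. x \<in> A i \<and> y \<notin> A i))"

text \<open>A countable base of the topology, with the empty set added so that an enumeration always
  exists; separation of points follows from the Hausdorff property.\<close>

lemma standard_borel_generator:
 assumes "standard_borel N"
 shows "\<exists>A :: nat => 'y set. separating_generator N A"
proof -
 obtain T where T: "topspace T = space N" "completely_metrizable_space T" "second_countable T"
  "sets N = sigma_sets (space N) {U. openin T U}" using assms unfolding standard_borel_def by blast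
 obtain \<B> where \<B>: "countable \<B>" "\<And>V. V \<in> \<B> ==> openin T V" "\<And>U x. openin T U ==> x \<in> U ==> \<exists>V\<in>\<B>. x \<in> V \<and> V \<subseteq> U"
  using T(3) unfolding second_countable_def by metis
 define A where "A = from_nat_into (insert {} \<B>)"
 have rA: "range A = insert {} \<B>" unfolding A_def using \<B>(1) by (intro range_from_nat_into) auto
 have opA: "openin T (A i)" for i
 proof -
  have "A i \<in> insert {} \<B>" unfolding rA[symmetric] by (rule rangeI)
  then show ?thesis using \<B>(2)[of "A i"] openin_empty[of T] by (cases "A i = {}") auto
 qed
 have sub: "A i \<subseteq> space N" for i using openin_subset[OF opA] T(1) by simp
 have As: "A i \<in> sets N" for i unfolding T(4) by (rule sigma_sets.Basic) (use opA in simp)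
 have "sigma_sets (space N) {U. openin T U} = sigma_sets (space N) (range A)"
 proof (rule sigma_sets_eqI)
  fix U assume "U \<in> {U. openin T U}"
  then have U: "openin T U" by simp
  have "U = \<Union> {V \<in> \<B>. V \<subseteq> U}" using \<B>(3)[OF U] by blast
  moreover have "\<Union> {V \<in> \<B>. V \<subseteq> U} \<in> sigma_sets (space N) (range A)"
   by (rule sigma_sets_UNION) (use \<B>(1) rA in \<open>auto intro: sigma_sets.Basic countable_subset\<close>)
  ultimately show "U \<in> sigma_sets (space N) (range A)" by simp
 next
  fix U assume "U \<in> range A"
  then show "U \<in> sigma_sets (space N) {U. openin T U}" using opA by (auto intro: sigma_sets.Basic)
 qed
 moreover have "\<exists>i. x \<in> A i \<and> y \<notin> A i" if xy: "x \<in> space N" "y \<in> space N" "x \<noteq> y" for x y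
 proof -
  have "Hausdorff_space T" using T(2) completely_metrizable_imp_metrizable_space metrizable_imp_Hausdorff_space by blast
  then obtain U W where U: "openin T U" "openin T W" "x \<in> U" "y \<in> W" "disjnt U W"
   using xy T(1) unfolding Hausdorff_space_def by metis
  obtain V where V: "V \<in> \<B>" "x \<in> V" "V \<subseteq> U" using \<B>(3)[OF U(1,3)] by blast
  have "V \<in> range A" using V(1) rA by blast
  then show ?thesis using V U(4,5) unfolding disjnt_def by blast
 qed
 ultimately show ?thesis using As T(4) by (intro exI[of _ A]) auto
qed

text \<open>The n-th model is requested for \<open>p\<close> together with the first n bits, the
  finite set \<open>L n\<close> and tolerance 1 / (n + 1). Any finer partition is nearly a function
  of the bits, and \<open>micro_replace\<close> passes to it without altering the patterns, since
  \<open>p\<close> is a component of the label \<open>e n\<close>.\<close>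

lemma sofic_entropy_ge_of_models:
 fixes p :: "'y => 'p"
 assumes grp: "group H" and cnt: "countable (carrier H)" and act: "pmp_action H N be" and p: "simple_function N p"
  and models: "\<And>(f :: 'y => 'p \<times> (nat => bool)) L dl. simple_function N f ==> (\<And>x. fst (f x) = p x) ==>
    finite L ==> L \<subseteq> carrier H ==> \<one>\<^bsub>H\<^esub> \<in> L ==> dl > 0 ==>
    \<exists>V ta. sofic_approx H V ta \<and> good_approx H L dl V ta \<and>
     many r p (micro H N be f L dl V ta) (V :: nat set)"
 shows "\<exists>V ta. sofic_approx_seq H V ta \<and> ereal r \<le> sofic_entropy H N be V ta"
proof -
 interpret group H by (rule grp)
 have sb: "standard_borel N" and pr: "prob_space N" using act unfolding pmp_action_def by blast+
 interpret prob_space N by (rule pr)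
 obtain A :: "nat => 'y set" where A0: "separating_generator N A"
  using standard_borel_generator[OF sb] ..
 note A = A0[THEN conjunct1, rule_format] A0[THEN conjunct2, THEN conjunct1]
 define e where "e = (\<lambda>n y. (p y, bits A n y))"
 define L where "L = (\<lambda>n. insert \<one>\<^bsub>H\<^esub> (from_nat_into (carrier H) ` {..<n}))"
 define dl where "dl = (\<lambda>n. 1 / real (Suc n))"
 have e: "simple_function N (e n)" for n unfolding e_def using p simple_bits[OF A(1)] by (rule simple_function_Pair)
 have ne: "carrier H \<noteq> {}" by blast
 have L: "finite (L n)" "L n \<subseteq> carrier H" "\<one>\<^bsub>H\<^esub> \<in> L n" for n
  unfolding L_def using from_nat_into[OF ne] by auto
 have Lmono: "L n \<subseteq> L m" if "n \<le> m" for n m unfolding L_def using that by auto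
 have Lex: "\<exists>n. F \<subseteq> L n" if F: "finite F" "F \<subseteq> carrier H" for F using F
 proof (induction F)
  case (insert t F)
  then obtain n where n: "F \<subseteq> L n" by auto
  have "t \<in> range (from_nat_into (carrier H))" using insert range_from_nat_into[OF ne cnt] by auto
  then obtain i where "t = from_nat_into (carrier H) i" by blast
  then have "t \<in> L (Suc i)" unfolding L_def by auto
  then have "insert t F \<subseteq> L (max n (Suc i))" using n Lmono[of n "max n (Suc i)"] Lmono[of "Suc i" "max n (Suc i)"] by auto
  then show ?case ..
 qed simp
 have dl: "dl n > 0" for n unfolding dl_def by simp
 have dllim: "\<forall>\<^sub>F n in sequentially. dl n < ep" if "ep > 0" for ep
  unfolding dl_def using order_tendstoD(2)[OF LIMSEQ_inverse_real_of_nat that] by (simp add: inverse_eq_divide)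
 have "\<forall>n. \<exists>V ta. sofic_approx H V ta \<and> good_approx H (L n) (dl n) V ta \<and>
     many r p (micro H N be (e n) (L n) (dl n) V ta) (V :: nat set)"
  using models[OF e _ L dl] by (simp add: e_def)
 from choice[OF this] obtain V :: "nat => nat set" where "\<forall>n. \<exists>ta. sofic_approx H (V n) ta \<and> good_approx H (L n) (dl n) (V n) ta \<and>
     many r p (micro H N be (e n) (L n) (dl n) (V n) ta) (V n)" ..
 from choice[OF this] obtain ta where V0: "\<forall>n. sofic_approx H (V n) (ta n) \<and> good_approx H (L n) (dl n) (V n) (ta n) \<and>
     many r p (micro H N be (e n) (L n) (dl n) (V n) (ta n)) (V n)" ..
 have V: "sofic_approx H (V n) (ta n)" "good_approx H (L n) (dl n) (V n) (ta n)"
  "many r p (micro H N be (e n) (L n) (dl n) (V n) (ta n)) (V n)" for n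
  using V0 by blast+
 have seq: "sofic_approx_seq H V ta"
  unfolding sofic_approx_seq_def
 proof (intro conjI allI impI)
  show "sofic_approx H (V k) (ta k)" for k by (rule V)
  fix F ep assume a: "finite F \<and> F \<subseteq> carrier H \<and> (ep::real) > 0"
  then obtain n where n: "F \<subseteq> L n" using Lex by blast
  have "\<forall>\<^sub>F k in sequentially. dl k < ep" using a by (intro dllim) simp
  moreover have "\<forall>\<^sub>F k in sequentially. n \<le> k" by (rule eventually_ge_at_top)
  ultimately show "\<forall>\<^sub>F k in sequentially. good_approx H F ep (V k) (ta k)"
  proof (eventually_elim)
   case (elim k)
   then show ?case using good_approx_mono[OF V(2)[of k], of F ep] n Lmono[of n k] by auto
  qed
 qed
 have "ereal r \<le> sofic_entropy H N be V ta"
 proof (rule sofic_entropy_geI[OF act V(1) p])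
  fix f :: "'y => 'y set" and F ep
  assume f: "simple_function N f" and F: "finite F" "F \<subseteq> carrier H" "\<one>\<^bsub>H\<^esub> \<in> F" and ep: "(ep::real) > 0"
  obtain n where n: "F \<subseteq> L n" using Lex[OF F(1,2)] by blast
  \<comment> \<open>Splits the tolerance \<open>ep\<close> into one half for the approximation by
    bits and one half for three times \<open>dl k\<close>.\<close>
  define ep' where "ep' = ep / (4 * real (Suc (card F)))"
  have ep': "ep' > 0" unfolding ep'_def using ep by simp
  obtain n' D where D: "\<And>m. m \<ge> n' ==> measure N {y \<in> space N. D (bits A m y) \<noteq> f y} \<le> ep'"
   using approximation_by_bits_simple[OF A f ep'] by blast
  have "\<forall>\<^sub>F k in sequentially. dl k < ep / 6" using ep by (intro dllim) simp
  moreover have "\<forall>\<^sub>F k in sequentially. n \<le> k" "\<forall>\<^sub>F k in sequentially. n' \<le> k" by (rule eventually_ge_at_top)+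
  ultimately have "\<forall>\<^sub>F k in sequentially. many r p (micro H N be f F ep (V k) (ta k)) (V k)"
  proof eventually_elim
   case (elim k)
   let ?E = "micro H N be (e k) (L k) (dl k) (V k) (ta k)" and ?F = "micro H N be f F ep (V k) (ta k)"
   have Vk: "finite (V k)" "\<And>t. t \<in> F ==> ta k t permutes V k" using V(1)[of k] F unfolding sofic_approx_def by blast+
   have FL: "F \<subseteq> L k" using n Lmono[OF elim(2)] by blast
   have err: "measure N {y \<in> space N. D (snd (e k y)) \<noteq> f y} \<le> ep'" unfolding e_def snd_conv by (rule D[OF elim(3)])
   have "2 * (rcard F * ep') \<le> ep / 2" unfolding ep'_def using ep by (simp add: field_simps)
   then have small: "3 * dl k + 2 * (rcard F * ep') \<le> ep" using elim(1) by linarith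
   have "patterns p ?E (V k) \<subseteq> patterns p ?F (V k)"
   proof
    fix pe assume "pe \<in> patterns p ?E (V k)"
    then obtain xi where xi: "xi \<in> ?E" "pe = restrict (\<lambda>v. p (xi v)) (V k)"
     unfolding patterns_def by blast
    obtain xi' where xi': "xi' \<in> ?F" "\<forall>v\<in>V k. e k (xi' v) = e k (xi v)"
     using micro_replace[where dd = "\<lambda>z. D (snd z)", OF act e f err L(1,2) FL F(3) Vk xi(1) small less_imp_le[OF dl]] by blast
    have "pe = restrict (\<lambda>v. p (xi' v)) (V k)" unfolding xi(2) by (rule restrict_ext) (use xi'(2) in \<open>simp add: e_def\<close>)
    then show "pe \<in> patterns p ?F (V k)" unfolding patterns_def using xi'(1) by blast
   qed
   moreover have "finite (patterns p ?F (V k))" by (rule finite_patterns[OF p Vk(1)])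
   ultimately have "card (patterns p ?E (V k)) \<le> card (patterns p ?F (V k))"
    by (intro card_mono)
   then show ?case using V(3)[of k] by linarith
  qed
  then show "\<exists>\<^sub>F k in sequentially. many r p (micro H N be f F ep (V k) (ta k)) (V k)"
   by (rule eventually_frequently[OF sequentially_bot])
 qed
 then show ?thesis using seq by blast
qed

section \<open>Counting transported microstates\<close>

lemma extend_to_permutation:
 assumes V: "finite V" and B: "B \<subseteq> V" and inj: "inj_on f B" and im: "f ` B \<subseteq> V"
 shows "\<exists>pe. pe permutes V \<and> (\<forall>v\<in>B. pe v = f v)"
proof -
 have fin: "finite B" "finite (f ` B)" using V B im finite_subset by blast+
 have "card (V - B) = card (V - f ` B)"
  using card_Diff_subset[OF fin(1) B] card_Diff_subset[OF fin(2) im] card_image[OF inj] by simp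
 then obtain h where h: "bij_betw h (V - B) (V - f ` B)"
  using finite_same_card_bij[of "V - B" "V - f ` B"] V by blast
 define pe where "pe = (\<lambda>v. if v \<in> B then f v else if v \<in> V then h v else v)"
 have "bij_betw pe B (f ` B)" using inj by (auto simp: pe_def bij_betw_def inj_on_def)
 moreover have "bij_betw pe (V - B) (V - f ` B)"
  using h by (rule bij_betw_cong[THEN iffD1, rotated]) (simp add: pe_def)
 ultimately have "bij_betw pe (B \<union> (V - B)) (f ` B \<union> (V - f ` B))" by (rule bij_betw_combine) blast
 moreover have "B \<union> (V - B) = V" "f ` B \<union> (V - f ` B) = V" using B im by blast+
 ultimately have "bij_betw pe V V" by simp
 then have "pe permutes V" by (rule bij_imp_permutes) (use B in \<open>auto simp: pe_def\<close>)
 then show ?thesis by (intro exI[of _ pe]) (auto simp: pe_def)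
qed

abbreviation "differ V f g \<equiv> {v \<in> V. f v \<noteq> g v}"

text \<open>Each disagreement with \<open>pe0\<close> receives the weight x. A function in the ball
  has weight at least x to the power m, while the total weight of all functions is a product over
  \<open>V\<close> whose factors are at most 1 + \<open>rcard R * x\<close>.\<close>

lemma card_hamming_ball:
 fixes x m :: real
 assumes V: "finite V" and R: "finite R" and x: "0 < x" "x \<le> 1"
 shows "rcard {pe \<in> V \<rightarrow>\<^sub>E R. rcard (differ V pe pe0) \<le> m} \<le> exp (rcard R * x * rcard V - m * ln x)"
proof -
 define B where "B = {pe \<in> V \<rightarrow>\<^sub>E R. rcard (differ V pe pe0) \<le> m}"
 have fin: "finite (V \<rightarrow>\<^sub>E R)" using V R by (intro finite_PiE)
 have "rcard B * exp (m * ln x) = (\<Sum>pe\<in>B. exp (m * ln x))" by simp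
 also have "\<dots> \<le> (\<Sum>pe\<in>B. \<Prod>v\<in>V. if pe v \<noteq> pe0 v then x else 1)"
 proof (rule sum_mono)
  fix pe assume "pe \<in> B"
  then have "rcard (differ V pe pe0) \<le> m" unfolding B_def by simp
  then have "m * ln x \<le> rcard (differ V pe pe0) * ln x" using x by (intro mult_right_mono_neg) auto
  then have "exp (m * ln x) \<le> exp (rcard (differ V pe pe0) * ln x)" by simp
  also have "\<dots> = x ^ card (differ V pe pe0)" using x by (simp add: exp_of_nat_mult)
  also have "\<dots> = (\<Prod>v\<in>V. if pe v \<noteq> pe0 v then x else 1)" using V by (simp add: prod.If_cases Int_def)
  finally show "exp (m * ln x) \<le> (\<Prod>v\<in>V. if pe v \<noteq> pe0 v then x else 1)" .
 qed
 also have "\<dots> \<le> (\<Sum>pe\<in>V \<rightarrow>\<^sub>E R. \<Prod>v\<in>V. if pe v \<noteq> pe0 v then x else 1)"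
  by (rule sum_mono2[OF fin]) (use x in \<open>auto simp: B_def intro!: prod_nonneg\<close>)
 also have "\<dots> = (\<Prod>v\<in>V. \<Sum>l\<in>R. if l \<noteq> pe0 v then x else 1)"
  by (rule prod_sum_PiE[symmetric]) (use V R in auto)
 also have "\<dots> \<le> (\<Prod>v\<in>V. exp (rcard R * x))"
 proof (rule prod_mono, rule conjI)
  fix v assume "v \<in> V"
  show "0 \<le> (\<Sum>l\<in>R. if l \<noteq> pe0 v then x else 1)" using x by (intro sum_nonneg) auto
  have "(\<Sum>l\<in>R. if l \<noteq> pe0 v then x else 1) \<le> (\<Sum>l\<in>R. x + (if l = pe0 v then 1 else 0))" using x by (intro sum_mono) auto
  also have "\<dots> \<le> rcard R * x + 1" using R by (simp add: sum.distrib)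
  also have "\<dots> \<le> exp (rcard R * x)" using exp_ge_add_one_self[of "rcard R * x"] by (simp only: add.commute)
  finally show "(\<Sum>l\<in>R. if l \<noteq> pe0 v then x else 1) \<le> exp (rcard R * x)" .
 qed
 also have "\<dots> = exp (rcard R * x * rcard V)" by (simp add: exp_of_nat_mult[symmetric] mult.commute)
 finally show ?thesis unfolding B_def by (simp add: exp_diff pos_le_divide_eq)
qed

abbreviation "fibre h Xi d \<equiv> {xi \<in> Xi. h xi = d}"

lemma patterns_fibres:
 assumes "finite (h ` Xi)"
 shows "card (patterns P Xi V) \<le> (\<Sum>d\<in>h ` Xi. card (patterns P (fibre h Xi d) V))"
proof -
 have "patterns P Xi V = (\<Union>d\<in>h ` Xi. patterns P (fibre h Xi d) V)" unfolding patterns_def by auto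
 then show ?thesis using card_UN_le[OF assms, of "\<lambda>d. patterns P (fibre h Xi d) V"] by simp
qed

text \<open>The number of systems of values along \<open>D\<close> is at most the product of the
  \<open>N s\<close>, hence at most exp B; so one of them is shared by microstates with at least exp
  r patterns.\<close>

lemma pigeonhole_patterns:
 fixes N :: "'s => nat"
 assumes fin: "finite D" and ka: "\<And>s u xi. (s, u) \<in> D ==> xi \<in> Xi ==> k s (xi u) \<in> R s" and R: "\<And>s u. (s, u) \<in> D ==> finite (R s)"
  and N: "\<And>s u. (s, u) \<in> D ==> card (R s) \<le> N s \<and> N s > 0" and le: "(\<Sum>(s, u)\<in>D. ln (real (N s))) \<le> B"
  and big: "exp (r + B) \<le> rcard (patterns P Xi V)"
 shows "\<exists>et\<in>Xi. exp r \<le> rcard (patterns P {xi \<in> Xi. \<forall>(s, u)\<in>D. k s (xi u) = k s (et u)} V)"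
proof (rule ccontr)
 assume "\<not> ?thesis"
 then have no: "rcard (patterns P {xi \<in> Xi. \<forall>(s, u)\<in>D. k s (xi u) = k s (et u)} V) < exp r" if "et \<in> Xi" for et
  using that by (meson not_le)
 define dat where "dat = (\<lambda>xi. \<lambda>(s, u)\<in>D. k s (xi u))"
 have fP: "finite (\<Pi>\<^sub>E (s, u)\<in>D. R s)" using fin R by (intro finite_PiE) auto
 have sub: "dat ` Xi \<subseteq> (\<Pi>\<^sub>E (s, u)\<in>D. R s)" unfolding dat_def using ka by auto
 then have fd: "finite (dat ` Xi)" using fP by (rule finite_subset)
 have "card (dat ` Xi) \<le> card (\<Pi>\<^sub>E (s, u)\<in>D. R s)" by (rule card_mono[OF fP sub])
 also have "\<dots> = (\<Prod>p\<in>D. card (R (fst p)))" by (simp add: card_PiE[OF fin] split_def)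
 finally have "rcard (dat ` Xi) \<le> real (\<Prod>p\<in>D. card (R (fst p)))" unfolding of_nat_le_iff .
 also have "\<dots> \<le> (\<Prod>p\<in>D. real (N (fst p)))" unfolding of_nat_prod using N by (intro prod_mono) fastforce
 also have "\<dots> = (\<Prod>p\<in>D. exp (ln (real (N (fst p)))))" using N by (intro prod.cong refl) fastforce
 also have "\<dots> = exp (\<Sum>p\<in>D. ln (real (N (fst p))))" by (rule exp_sum[OF fin, symmetric])
 also have "\<dots> \<le> exp B" using le by (simp add: split_def)
 finally have cd: "rcard (dat ` Xi) \<le> exp B" .
 have each: "rcard (patterns P (fibre dat Xi d) V) < exp r" if d: "d \<in> dat ` Xi" for d
 proof -
  obtain et where et: "et \<in> Xi" "d = dat et" using d by blast
  have "dat xi = dat et \<longleftrightarrow> (\<forall>(s, u)\<in>D. k s (xi u) = k s (et u))" for xi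
  proof
   assume e: "dat xi = dat et"
   show "\<forall>(s, u)\<in>D. k s (xi u) = k s (et u)"
   proof clarify
    fix s u assume "(s, u) \<in> D"
    then show "k s (xi u) = k s (et u)" using fun_cong[OF e, of "(s, u)"] unfolding dat_def by simp
   qed
  next
   assume e: "\<forall>(s, u)\<in>D. k s (xi u) = k s (et u)"
   show "dat xi = dat et" unfolding dat_def by (rule restrict_ext) (use e in auto)
  qed
  then show ?thesis using no[OF et(1)] unfolding et(2) by simp
 qed
 have ne: "Xi \<noteq> {}"
 proof
  assume "Xi = {}"
  then have "exp (r + B) \<le> 0" using big unfolding patterns_def by simp
  then show False using exp_gt_zero[of "r + B"] by linarith
 qed
 have "rcard (patterns P Xi V) \<le> real (\<Sum>d\<in>dat ` Xi. card (patterns P (fibre dat Xi d) V))"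
  unfolding of_nat_le_iff by (rule patterns_fibres[OF fd])
 also have "\<dots> = (\<Sum>d\<in>dat ` Xi. rcard (patterns P (fibre dat Xi d) V))" by simp
 also have "\<dots> < (\<Sum>d\<in>dat ` Xi. exp r)" using ne fd each by (intro sum_strict_mono) auto
 also have "\<dots> = rcard (dat ` Xi) * exp r" by simp
 also have "\<dots> \<le> exp B * exp r" using cd by (intro mult_right_mono) auto
 finally show False using big by (simp add: exp_add mult.commute)
qed

context microstates
begin

text \<open>Along a path the cocycle is a product of its values at the single steps, and these are
  prescribed by the data on \<open>D\<close>.\<close>

lemma agree_of_data:
 assumes A: "A \<subseteq> Gm" and D: "D \<subseteq> A \<times> V" and reach: "\<And>w t. w \<in> W ==> t \<in> T ==> sm t w \<in> W ==> reach G sm D A w t"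
  and data: "\<And>s u. (s, u) \<in> D ==> xi u \<in> X ==> et u \<in> X ==> ka s (xi u) = ka s (et u)"
 shows "agree xi et"
 unfolding agree_def
proof (intro ballI impI)
 fix w p assume w: "w \<in> W \<inter> mgood xi \<inter> mgood et" and p: "p \<in> T" and pw: "sm p w \<in> W"
 have m: "w \<in> mgood xi" "w \<in> mgood et" "w \<in> W" using w by blast+
 have x: "xi w \<in> X" "et w \<in> X" by (rule mgood_X(1)[OF m(1)], rule mgood_X(1)[OF m(2)])
 have "reach G sm D A w p" by (rule reach[OF m(3) p pw])
 then show "ka p (xi w) = ka p (et w)"
 proof (induction rule: reach.induct)
  case reach_one
  then show ?case using kap_one x by simp
 next
  case (reach_step t s)
  have t: "t \<in> Gm" "s \<in> Gm" using subsetD[OF A reach_mem[OF reach_step(1)]] subsetD[OF D reach_step(2)] A by auto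
  have tC: "t \<in> carrier G" "s \<in> carrier G" by (rule subsetD[OF GmC t(1)], rule subsetD[OF GmC t(2)])
  have "ka s (a t (xi w)) = ka s (xi (sm t w))" by (rule mgood_kap[OF m(1) t, symmetric])
  also have "\<dots> = ka s (et (sm t w))" by (rule data[OF reach_step(2) mgood_X(2)[OF m(1) t(1)] mgood_X(2)[OF m(2) t(1)]])
  also have "\<dots> = ka s (a t (et w))" by (rule mgood_kap[OF m(2) t])
  finally show ?case using kap_mult[OF tC(2,1) x(1)] kap_mult[OF tC(2,1) x(2)] reach_step.IH by simp
 qed
qed

lemma transport_inj:
 assumes ag: "agree xi et"
 shows "inj_on (transport et xi) (vgood xi et)" "transport et xi ` vgood xi et \<subseteq> V"
proof -
 have "transport xi et (transport et xi v) = v" if "v \<in> vgood xi et" for v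
  by (rule transport_inverse[OF agree_sym[OF ag]]) (use that vgood_sym in simp)
 then show "inj_on (transport et xi) (vgood xi et)" by (rule inj_on_inverseI)
 show "transport et xi ` vgood xi et \<subseteq> V"
 proof (rule image_subsetI)
  fix v assume "v \<in> vgood xi et"
  then have "v \<in> vgood et xi" using vgood_sym by simp
  from CovD(1)[OF vgoodD(4)[OF this]] show "transport et xi v \<in> V" .
 qed
qed

text \<open>Injectivity of the transport on \<open>vgood\<close> gives one inequality; the other is
  the same inequality for the complementary property.\<close>

lemma card_transport:
 assumes ag: "agree xi et"
 shows "\<bar>rcard {v \<in> V. R (mv et xi v)} - rcard {u \<in> V. R (xi u)}\<bar> \<le> rcard (V - vgood xi et)"
proof -
 have vV: "vgood xi et \<subseteq> V" unfolding vgood_def Cov_def by blast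
 have half: "card {v \<in> V. R (mv et xi v)} \<le> card {u \<in> V. R (xi u)} + card (V - vgood xi et)" for R
 proof -
  have "card {v \<in> V. R (mv et xi v)} \<le> card ({v \<in> vgood xi et. R (mv et xi v)} \<union> (V - vgood xi et))"
   using finV vV by (intro card_mono) (auto intro: finite_subset)
  also have "\<dots> \<le> card {v \<in> vgood xi et. R (mv et xi v)} + card (V - vgood xi et)" by (rule card_Un_le)
  also have "card {v \<in> vgood xi et. R (mv et xi v)} \<le> card {u \<in> V. R (xi u)}"
  proof (rule card_inj_on_le[of "transport et xi"])
   show "inj_on (transport et xi) {v \<in> vgood xi et. R (mv et xi v)}"
    by (rule inj_on_subset[OF transport_inj(1)[OF ag]]) blast
   show "transport et xi ` {v \<in> vgood xi et. R (mv et xi v)} \<subseteq> {u \<in> V. R (xi u)}"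
    using transport_inj(2)[OF ag] by blast
   show "finite {u \<in> V. R (xi u)}" using finV by simp
  qed
  finally show ?thesis by simp
 qed
 have comp: "card {v \<in> V. \<not> Q v} = card V - card {v \<in> V. Q v}" "card {v \<in> V. Q v} \<le> card V" for Q
 proof -
  have "{v \<in> V. \<not> Q v} = V - {v \<in> V. Q v}" by blast
  then show "card {v \<in> V. \<not> Q v} = card V - card {v \<in> V. Q v}" using finV by (simp add: card_Diff_subset)
  show "card {v \<in> V. Q v} \<le> card V" using finV by (intro card_mono) auto
 qed
 show ?thesis
  using half[of R] half[of "\<lambda>x. \<not> R x"] comp[of "\<lambda>v. R (mv et xi v)"] comp[of "\<lambda>u. R (xi u)"] by linarith
qed

text \<open>On the equivariant points of \<open>et\<close> a twist is undone by the twist with the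
  inverse, so it is injective and extends to a permutation of \<open>V\<close>. The cocycle identity
  gives multiplicativity and freeness gives separation.\<close>

lemma twisted_sofic:
 fixes dl :: real
 assumes L1: "L1 \<subseteq> L0" and invL: "\<And>t. t \<in> L1 ==> inv\<^bsub>H\<^esub> t \<in> L0" and oneL: "\<one>\<^bsub>H\<^esub> \<in> L0" and Vne: "V \<noteq> {}"
  and L: "L \<subseteq> L1" "\<And>s t. s \<in> L ==> t \<in> L ==> s \<otimes>\<^bsub>H\<^esub> t \<in> L1"
  and bad: "2 * rcard (V - mgood et) \<le> dl * rcard V"
 shows "\<exists>ta. sofic_approx H V ta \<and> good_approx H L dl V ta \<and> (\<forall>t\<in>L1. \<forall>v\<in>mgood et. ta t v = twist et t v)"
proof -
 have mV: "mgood et \<subseteq> V" unfolding mgood_def good_pts_def by blast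
 have ex: "\<exists>pe. pe permutes V \<and> (\<forall>v\<in>mgood et. pe v = twist et t v)" if t: "t \<in> L1" for t
 proof (rule extend_to_permutation[OF finV mV])
  have t0: "t \<in> L0" "t \<in> carrier H" using t L1 L0C by blast+
  have "twist et (inv\<^bsub>H\<^esub> t) (twist et t u) = u" if u: "u \<in> mgood et" for u
   using twist_mult[OF u invL[OF t] t0(1)] twist_one[OF u] oneL t0(2) by simp
  then show "inj_on (twist et t) (mgood et)" by (rule inj_on_inverseI)
  show "twist et t ` mgood et \<subseteq> V" using twist_in t0 by blast
 qed
 define ta where "ta = (\<lambda>t. if t \<in> L1 then (SOME pe. pe permutes V \<and> (\<forall>v\<in>mgood et. pe v = twist et t v)) else id)"
 have ta: "ta t permutes V \<and> (\<forall>v\<in>mgood et. ta t v = twist et t v)" if "t \<in> L1" for t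
  unfolding ta_def using someI_ex[OF ex[OF that]] that by simp
 have permta: "ta t permutes V" for t using ta[of t] permutes_id by (cases "t \<in> L1") (auto simp: ta_def id_def)
 have tw: "ta t v = twist et t v" if "t \<in> L1" "v \<in> mgood et" for t v using ta that by blast
 have n: "rcard V > 0" using finV Vne by (simp add: card_gt_0_iff)
 have "good_approx H L dl V ta"
  unfolding good_approx_def
 proof (intro conjI ballI impI)
  fix s t assume st: "s \<in> L" "t \<in> L"
  let ?D = "{v \<in> V. ta (s \<otimes>\<^bsub>H\<^esub> t) v \<noteq> (ta s \<circ> ta t) v}" and ?C = "{v \<in> V. ta t v \<in> V - mgood et}"
  have st1: "s \<in> L1" "t \<in> L1" "s \<otimes>\<^bsub>H\<^esub> t \<in> L1" using st L by blast+
  have "?D \<subseteq> (V - mgood et) \<union> ?C"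
  proof
   fix v assume v: "v \<in> ?D"
   show "v \<in> (V - mgood et) \<union> ?C"
   proof (rule ccontr)
    assume no: "\<not> ?thesis"
    have m: "v \<in> mgood et" "ta t v \<in> mgood et" using no v permutes_in_image[OF permta, of t v] by auto
    have "ta (s \<otimes>\<^bsub>H\<^esub> t) v = twist et s (twist et t v)"
     using tw[OF st1(3) m(1)] twist_mult[OF m(1), of s t] st1 L1 by (simp add: subset_iff)
    also have "\<dots> = (ta s \<circ> ta t) v" using tw[OF st1(1) m(2)] tw[OF st1(2) m(1)] by simp
    finally show False using v by simp
   qed
  qed
  then have "card ?D \<le> card ((V - mgood et) \<union> ?C)"
   using finV by (intro card_mono) auto
  also have "\<dots> \<le> card (V - mgood et) + card ?C" by (rule card_Un_le)
  also have "card ?C = card (V - mgood et)"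
   by (rule card_vimage_permutes[OF permta finV]) blast
  finally have "rcard ?D \<le> dl * rcard V" using bad by linarith
  then show "hamming_dist V (ta (s \<otimes>\<^bsub>H\<^esub> t)) (ta s \<circ> ta t) \<le> dl" unfolding hamming_dist_def using n by (simp add: pos_divide_le_eq)
 next
  fix s t assume st: "s \<in> L" "t \<in> L" "s \<noteq> t"
  have "mgood et \<subseteq> differ V (ta s) (ta t)"
  proof
   fix v assume v: "v \<in> mgood et"
   have "twist et s v \<noteq> twist et t v" using twist_separates[OF v, of s t] st L L1 by blast
   then show "v \<in> differ V (ta s) (ta t)"
    using tw[OF subsetD[OF L(1) st(1)] v] tw[OF subsetD[OF L(1) st(2)] v] subsetD[OF mV v] by simp
  qed
  then have "card (mgood et) \<le> card (differ V (ta s) (ta t))" using finV by (intro card_mono) auto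
  moreover have "card V = card (mgood et) + card (V - mgood et)"
   using card_Diff_subset[OF finite_subset[OF mV finV] mV] card_mono[OF finV mV] by simp
  ultimately have "(1 - dl) * rcard V \<le> rcard (differ V (ta s) (ta t))" using bad by (simp add: left_diff_distrib)
  then show "1 - dl \<le> hamming_dist V (ta s) (ta t)" unfolding hamming_dist_def using n by (simp add: pos_le_divide_eq)
 qed
 moreover have "sofic_approx H V ta" unfolding sofic_approx_def using finV Vne permta by blast
 ultimately show ?thesis using tw by blast
qed

text \<open>The defect for \<open>inv g\<close>, evaluated at the point \<open>sm g u\<close>,
  compares the label of \<open>xi (sm g u)\<close> with that of \<open>a g (xi u)\<close>, which is
  what \<open>mgood\<close> asks for. This is why \<open>F\<close> contains the inverses.\<close>

lemma card_mgood:
 fixes d :: real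
 assumes F: "F \<subseteq> carrier G" "Gm \<subseteq> F" "\<And>g. g \<in> Gm ==> inv g \<in> F" and finGm: "finite Gm"
  and xi: "\<And>v. v \<in> V ==> xi v \<in> Y"
  and coh: "\<And>x y. x \<in> Y ==> y \<in> X ==> c x = c y ==> x \<in> X \<and> coh x y"
  and e: "\<And>g. g \<in> F ==> rcard {u \<in> V. c (a (inv g) (xi (sm g u))) \<noteq> c (xi u)} \<le> d"
  and nX: "rcard {u \<in> V. xi u \<notin> X} \<le> d"
 shows "rcard (V - mgood xi) \<le> rcard (V - good_pts G V sm F) + (rcard Gm + 1) * d"
proof -
 define B where "B = (\<lambda>g. {u \<in> V. c (a g (xi (sm (inv g) u))) \<noteq> c (xi u)})"
 let ?P = "\<lambda>g. {u \<in> V. sm g u \<in> B g}" and ?N = "{u \<in> V. xi u \<notin> X}"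
 let ?U = "(V - good_pts G V sm F) \<union> (?N \<union> (\<Union>g\<in>Gm. ?P g))"
 have sub: "V - mgood xi \<subseteq> ?U"
 proof
  fix u assume u: "u \<in> V - mgood xi"
  show "u \<in> ?U"
  proof (rule ccontr)
   assume no: "\<not> ?thesis"
   then have gp: "u \<in> good_pts G V sm F" and xu: "xi u \<in> X" and nB: "\<And>g. g \<in> Gm ==> sm g u \<notin> B g" using u by auto
   have "sm \<one> (sm \<one> u) = sm \<one> u" using good_pts_mult[OF gp subsetD[OF F(2) oneGm] subsetD[OF F(2) oneGm]] by simp
   then have u1: "sm \<one> u = u" by (rule injs[OF oneGm])
   have main: "xi (sm g u) \<in> X \<and> coh (xi (sm g u)) (a g (xi u))" if g: "g \<in> Gm" for g
   proof (rule coh)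
    have gC: "g \<in> carrier G" by (rule subsetD[OF GmC g])
    have gV: "sm g u \<in> V" using permutes_in_image[OF perm[OF g]] u by blast
    show "xi (sm g u) \<in> Y" by (rule xi[OF gV])
    show "a g (xi u) \<in> X" by (rule a_closed[OF gC xu])
    have "sm (inv g) (sm g u) = u" using good_pts_mult[OF gp F(3)[OF g] subsetD[OF F(2) g]] u1 gC by simp
    then show "c (xi (sm g u)) = c (a g (xi u))" using nB[OF g] gV unfolding B_def by simp
   qed
   have "u \<in> good_pts G V sm Gm" using gp F(2) unfolding good_pts_def by blast
   then have "u \<in> mgood xi" using main xu unfolding mgood_def by blast
   then show False using u by blast
  qed
 qed
 have "card (V - mgood xi) \<le> card ?U"
  using finV finGm by (intro card_mono[OF _ sub]) auto
 also have "\<dots> \<le> card (V - good_pts G V sm F) + (card ?N + (\<Sum>g\<in>Gm. card (?P g)))"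
  by (intro order_trans[OF card_Un_le] add_mono order_refl card_UN_le finGm)
 finally have "rcard (V - mgood xi) \<le> rcard (V - good_pts G V sm F) + (rcard ?N + (\<Sum>g\<in>Gm. rcard (?P g)))"
  unfolding of_nat_sum[symmetric] of_nat_add[symmetric] of_nat_le_iff .
 also have "(\<Sum>g\<in>Gm. rcard (?P g)) \<le> (\<Sum>g\<in>Gm. d)"
 proof (rule sum_mono)
  fix g assume g: "g \<in> Gm"
  have gC: "g \<in> carrier G" by (rule subsetD[OF GmC g])
  have "card (?P g) = card (B g)" by (rule card_vimage_permutes[OF perm[OF g] finV]) (auto simp: B_def)
  then show "rcard (?P g) \<le> d" using e[OF F(3)[OF g]] gC unfolding B_def by simp
 qed
 finally show ?thesis using nX by (simp add: algebra_simps)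
qed

text \<open>Two microstates with equal transported labels have, by \<open>transport_recover\<close>,
  equal labels \<open>P\<close> at all points good for both. So each fibre lies in a Hamming ball of
  radius \<open>2 * tt * rcard V\<close>, whose size is subexponential up to
  \<open>ep\<close>.\<close>

lemma patterns_transfer:
 fixes tt x ep :: real
 assumes ag: "\<And>xi. xi \<in> Xi ==> agree xi et" and bad: "\<And>xi. xi \<in> Xi ==> rcard (V - vgood xi et) \<le> tt * rcard V"
  and R: "finite R" "\<And>xi v. xi \<in> Xi ==> v \<in> V ==> P (xi v) \<in> R" and R': "finite R'" "\<And>x. p' x \<in> R'"
  and p': "\<And>x y s. x \<in> X ==> y \<in> X ==> s \<in> S ==> p' x = p' y ==> ka s x = ka s y \<and> P x = P y"
  and x: "0 < x" "x \<le> 1" "rcard R * x \<le> ep / 2" "2 * tt * (- ln x) \<le> ep / 2"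
 shows "rcard (patterns P Xi V) \<le> rcard ((\<lambda>xi. restrict (\<lambda>v. p' (mv et xi v)) V) ` Xi) * exp (ep * rcard V)"
proof -
 define h where "h = (\<lambda>xi. restrict (\<lambda>v. p' (mv et xi v)) V)"
 have "h ` Xi \<subseteq> V \<rightarrow>\<^sub>E R'" unfolding h_def using R' by auto
 then have fh: "finite (h ` Xi)" using finite_PiE[OF finV, of "\<lambda>_. R'"] R'(1) by (auto intro: finite_subset)
 have fib: "rcard (patterns P (fibre h Xi d) V) \<le> exp (ep * rcard V)" if d: "d \<in> h ` Xi" for d
 proof -
  obtain xi0 where xi0: "xi0 \<in> Xi" "d = h xi0" using d by blast
  define Ball where "Ball = {pe \<in> V \<rightarrow>\<^sub>E R. rcard (differ V pe (\<lambda>v. P (xi0 v))) \<le> 2 * tt * rcard V}"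
  have "patterns P (fibre h Xi d) V \<subseteq> Ball"
  proof
   fix pe assume "pe \<in> patterns P (fibre h Xi d) V"
   then obtain xi where xi: "xi \<in> Xi" "h xi = h xi0" "pe = restrict (\<lambda>v. P (xi v)) V" unfolding patterns_def xi0(2) by blast
   have hh: "p' (mv et xi u) = p' (mv et xi0 u)" if "u \<in> V" for u
    using fun_cong[OF xi(2), of u] that unfolding h_def by simp
   have "differ V pe (\<lambda>v. P (xi0 v)) \<subseteq> (V - vgood xi et) \<union> (V - vgood xi0 et)"
   proof (rule ccontr)
    assume "\<not> ?thesis"
    then obtain v where v: "v \<in> V" "pe v \<noteq> P (xi0 v)" "v \<in> vgood xi et" "v \<in> vgood xi0 et" by blast
    have "P (xi v) = P (xi0 v)"
     by (rule transport_recover[OF ag[OF xi(1)] ag[OF xi0(1)] v(3,4)]) (rule p', assumption+, rule hh)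
    then show False using v(1,2) xi(3) by simp
   qed
   then have "card (differ V pe (\<lambda>v. P (xi0 v))) \<le> card ((V - vgood xi et) \<union> (V - vgood xi0 et))" using finV by (intro card_mono) auto
   also have "\<dots> \<le> card (V - vgood xi et) + card (V - vgood xi0 et)" by (rule card_Un_le)
   finally have "rcard (differ V pe (\<lambda>v. P (xi0 v))) \<le> 2 * tt * rcard V" using bad[OF xi(1)] bad[OF xi0(1)] by linarith
   moreover have "pe \<in> V \<rightarrow>\<^sub>E R" unfolding xi(3) using R(2)[OF xi(1)] by auto
   ultimately show "pe \<in> Ball" unfolding Ball_def by blast
  qed
  moreover have "finite Ball" unfolding Ball_def using finite_PiE[OF finV, of "\<lambda>_. R"] R(1) by auto
  ultimately have "card (patterns P (fibre h Xi d) V) \<le> card Ball" by (intro card_mono)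
  then have "rcard (patterns P (fibre h Xi d) V) \<le> rcard Ball" by simp
  also have "\<dots> \<le> exp (rcard R * x * rcard V - 2 * tt * rcard V * ln x)"
   unfolding Ball_def by (rule card_hamming_ball[OF finV R(1) x(1,2)])
  also have "\<dots> \<le> exp (ep * rcard V)"
  proof -
   have "rcard R * x * rcard V + 2 * tt * (- ln x) * rcard V \<le> (ep / 2) * rcard V + (ep / 2) * rcard V"
    using x(3,4) by (intro add_mono mult_right_mono) auto
   then show ?thesis by (simp add: algebra_simps)
  qed
  finally show ?thesis .
 qed
 have "rcard (patterns P Xi V) \<le> real (\<Sum>d\<in>h ` Xi. card (patterns P (fibre h Xi d) V))"
  unfolding of_nat_le_iff by (rule patterns_fibres[OF fh])
 also have "\<dots> = (\<Sum>d\<in>h ` Xi. rcard (patterns P (fibre h Xi d) V))" by simp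
 also have "\<dots> \<le> (\<Sum>d\<in>h ` Xi. exp (ep * rcard V))" by (rule sum_mono) (rule fib)
 also have "\<dots> = rcard (h ` Xi) * exp (ep * rcard V)" by simp
 finally show ?thesis unfolding h_def .
qed

end

section \<open>Bounded orbit equivalence\<close>

text \<open>\<open>Ps\<close> and \<open>Ph\<close> are total and measurable, so that they can be
  composed with microstates, whose values may lie anywhere; the algebraic relations are required on
  the conull set \<open>X\<close> only.\<close>

locale bounded_oe = cocycle_pair G H X al b ka lam
 for G :: "('g, 'c) monoid_scheme" (structure) and H :: "('h, 'd) monoid_scheme" and X :: "'x set" and al b ka lam +
 fixes M :: "'x measure" and N :: "'y measure" and be :: "'h => 'y => 'y" and Ps :: "'x => 'y" and Ph :: "'y => 'x"
 assumes actM: "pmp_action G M al" and actN: "pmp_action H N be"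
  and X: "X \<in> sets M" "AE x in M. x \<in> X"
  and Ps: "Ps \<in> M \<rightarrow>\<^sub>M N" "distr M N Ps = N" "Ps x \<in> space N" and Ph: "Ph \<in> N \<rightarrow>\<^sub>M M" "x \<in> X ==> Ph (Ps x) = x"
  and Ps_b: "t \<in> carrier H ==> x \<in> X ==> Ps (b t x) = be t (Ps x)"
  and finite_kap: "g \<in> carrier G ==> finite (ka g ` X)" and finite_lam: "t \<in> carrier H ==> finite (lam t ` X)"
  and meas_kap: "g \<in> carrier G ==> {x \<in> X. ka g x = h} \<in> sets M"

section \<open>Pulling the action of H back along the orbit equivalence\<close>

text \<open>Different values are told apart by one of countably many measurable sets.\<close>

lemma measurable_eq_set:
 assumes sb: "standard_borel N" and f: "f \<in> M \<rightarrow>\<^sub>M N" and g: "g \<in> M \<rightarrow>\<^sub>M N"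
 shows "{x \<in> space M. f x = g x} \<in> sets M"
proof -
 obtain A :: "nat => _ set" where A0: "separating_generator N A"
  using standard_borel_generator[OF sb] ..
 have A: "A i \<in> sets N" and sep: "x \<in> space N ==> y \<in> space N ==> x \<noteq> y ==> \<exists>i. x \<in> A i \<and> y \<notin> A i" for i x y
  using A0 by blast+
 have fs: "f x \<in> space N" "g x \<in> space N" if "x \<in> space M" for x
  using measurable_space[OF f that] measurable_space[OF g that] .
 have "{x \<in> space M. f x = g x} = space M - (\<Union>i. sym_diff (f -` A i \<inter> space M) (g -` A i \<inter> space M))"
 proof (intro equalityI subsetI)
  fix x assume x: "x \<in> space M - (\<Union>i. sym_diff (f -` A i \<inter> space M) (g -` A i \<inter> space M))"
  then have "f x \<in> A i \<longleftrightarrow> g x \<in> A i" for i by blast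
  then show "x \<in> {x \<in> space M. f x = g x}" using sep[OF fs[of x]] x by blast
 qed auto
 also have "\<dots> \<in> sets M" using measurable_sets[OF f A] measurable_sets[OF g A] by auto
 finally show ?thesis .
qed

definition free_part :: "('g, 'c) monoid_scheme => 'x measure => ('g => 'x => 'x) => 'x set" where
 "free_part G M al = {x \<in> space M. \<forall>s\<in>carrier G - {\<one>\<^bsub>G\<^esub>}. al s x \<noteq> x}"

lemma free_part:
 fixes G :: "('g, 'c) monoid_scheme" (structure)
 assumes act: "pmp_action G M al" and cnt: "countable (carrier G)" and free: "free_action G M al"
 shows "free_part G M al \<in> sets M" "AE x in M. x \<in> free_part G M al"
  "x \<in> free_part G M al ==> g \<in> carrier G ==> al g x \<in> free_part G M al"
  "x \<in> free_part G M al ==> g \<in> carrier G ==> g' \<in> carrier G ==> al g x = al g' x ==> g = g'"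
proof -
 have A: "group_action G (space M) al" and sb: "standard_borel M" and m: "\<And>g. g \<in> carrier G ==> al g \<in> M \<rightarrow>\<^sub>M M"
  using act unfolding pmp_action_def by blast+
 interpret A: group_action G "space M" al by (rule A)
 interpret group G using A.group_hom group_hom.axioms(1) by blast
 have eq: "{x \<in> space M. al s x = x} \<in> sets M" if "s \<in> carrier G" for s
  by (rule measurable_eq_set[OF sb m[OF that]]) (rule measurable_ident_sets, rule refl)
 have "free_part G M al = space M - (\<Union>s\<in>carrier G - {\<one>}. {x \<in> space M. al s x = x})" unfolding free_part_def by blast
 also have "\<dots> \<in> sets M"
 proof -
  have "(\<Union>s\<in>carrier G - {\<one>}. {x \<in> space M. al s x = x}) \<in> sets M"
   by (rule sets.countable_UN'') (use cnt eq in auto)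
  then show ?thesis by auto
 qed
 finally show "free_part G M al \<in> sets M" .
 show "AE x in M. x \<in> free_part G M al"
  using free AE_space unfolding free_action_def free_part_def by eventually_elim auto
 have inj: "g = g'" if x: "x \<in> free_part G M al" and g: "g \<in> carrier G" "g' \<in> carrier G" and e: "al g x = al g' x" for x g g'
 proof -
  have xM: "x \<in> space M" using x unfolding free_part_def by blast
  have "al (inv g' \<otimes> g) x = al (inv g') (al g x)" using A.composition_rule[OF xM] g by simp
  also have "\<dots> = x" unfolding e by (rule A.inv_act[OF g(2) xM])
  finally have "inv g' \<otimes> g = \<one>" using x g unfolding free_part_def by blast
  then have "g' \<otimes> (inv g' \<otimes> g) = g'" using g by simp
  then show ?thesis using g by (simp add: m_assoc[symmetric])
 qed
 then show "x \<in> free_part G M al ==> g \<in> carrier G ==> g' \<in> carrier G ==> al g x = al g' x ==> g = g'" by blast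
 show "al g x \<in> free_part G M al" if x: "x \<in> free_part G M al" and g: "g \<in> carrier G"
 proof -
  have xM: "x \<in> space M" using x unfolding free_part_def by blast
  have "s = \<one>" if s: "s \<in> carrier G" "al s (al g x) = al g x" for s
  proof -
   have "al (s \<otimes> g) x = al g x" using A.composition_rule[OF xM s(1) g] s(2) by simp
   then have "s \<otimes> g = g" using inj[OF x _ g] s g by blast
   then show ?thesis using right_cancel[of g s "\<one>"] s(1) g by simp
  qed
  then show ?thesis unfolding free_part_def using A.act_closed[OF g xM] by blast
 qed
qed

lemma measurable_extend:
 assumes A: "A \<in> sets M" and f: "f \<in> restrict_space M A \<rightarrow>\<^sub>M N" and c: "c \<in> space N"
 shows "(\<lambda>x. if x \<in> A then f x else c) \<in> M \<rightarrow>\<^sub>M N"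
proof (rule measurableI)
 have AM: "A \<subseteq> space M" by (rule sets.sets_into_space[OF A])
 have sp: "space (restrict_space M A) = A" using AM by (auto simp: space_restrict_space)
 show "(if x \<in> A then f x else c) \<in> space N" for x using measurable_space[OF f] c sp by auto
 fix B assume B: "B \<in> sets N"
 have "f -` B \<inter> A \<in> sets (restrict_space M A)" using measurable_sets[OF f B] sp by simp
 then have "f -` B \<inter> A \<in> sets M" using A sets_restrict_space_iff[of A M] AM by auto
 moreover have "(\<lambda>x. if x \<in> A then f x else c) -` B \<inter> space M = (f -` B \<inter> A) \<union> (if c \<in> B then space M - A else {})"
  using AM by (auto split: if_splits)
 ultimately show "(\<lambda>x. if x \<in> A then f x else c) -` B \<inter> space M \<in> sets M" using A by auto
qed

text \<open>\<open>X\<close> consists of the points free for G whose image is free for H, and H acts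
  on it through \<open>Ps\<close>. Freeness determines the cocycle there, so its level sets are sets
  where two measurable maps coincide, within \<open>X\<close>.\<close>

lemma bounded_oe_exists:
 assumes gG: "group G" and cG: "countable (carrier G)" and gH: "group H" and cH: "countable (carrier H)"
  and aM: "pmp_action G M al" and fM: "free_action G M al" and aN: "pmp_action H N be" and fN: "free_action H N be"
  and oe: "boundedly_orbit_equivalent G M al H N be"
 shows "\<exists>X b ka lam Ps Ph. bounded_oe G H X al b ka lam M N be Ps Ph"
proof -
 obtain X0 Y0 Ps0 ka ka' where oe0: "orbit_equivalence G M al H N be X0 Y0 Ps0 \<and> cocycle_of G al H be X0 Ps0 ka \<and>
   cocycle_of H be G al Y0 (inv_into X0 Ps0) ka' \<and> (\<forall>g\<in>carrier G. finite (ka g ` X0)) \<and> (\<forall>t\<in>carrier H. finite (ka' t ` Y0))"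
  using oe unfolding boundedly_orbit_equivalent_def by (elim exE)
 have iX: "X0 \<in> sets M" "AE x in M. x \<in> X0" "\<And>g. g \<in> carrier G ==> al g ` X0 = X0"
  and iY: "Y0 \<in> sets N" "AE y in N. y \<in> Y0" "\<And>t. t \<in> carrier H ==> be t ` Y0 = Y0"
  and iso: "measure_isomorphism (restrict_space M X0) (restrict_space N Y0) Ps0"
  using oe0[THEN conjunct1] unfolding orbit_equivalence_def invariant_conull_def by simp_all
 have k: "ka g x \<in> carrier H" "Ps0 (al g x) = be (ka g x) (Ps0 x)" if "g \<in> carrier G" "x \<in> X0" for g x
  using oe0[THEN conjunct2, THEN conjunct1] that unfolding cocycle_of_def by simp_all
 have k': "ka' t y \<in> carrier G" "inv_into X0 Ps0 (be t y) = al (ka' t y) (inv_into X0 Ps0 y)" if "t \<in> carrier H" "y \<in> Y0" for t y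
  using oe0[THEN conjunct2, THEN conjunct2, THEN conjunct1] that unfolding cocycle_of_def by simp_all
 have fk: "g \<in> carrier G ==> finite (ka g ` X0)" "t \<in> carrier H ==> finite (ka' t ` Y0)" for g t
  using oe0 by blast+
 have AM: "group_action G (space M) al" and pM: "prob_space M" and AN: "group_action H (space N) be" and pN: "prob_space N"
  and sbN: "standard_borel N" and mM: "\<And>g. g \<in> carrier G ==> al g \<in> M \<rightarrow>\<^sub>M M" and mN: "\<And>t. t \<in> carrier H ==> be t \<in> N \<rightarrow>\<^sub>M N"
  using aM aN unfolding pmp_action_def by blast+
 interpret AM: group_action G "space M" al by (rule AM)
 interpret AN: group_action H "space N" be by (rule AN)
 interpret G: group G by (rule gG)
 interpret H: group H by (rule gH)
 interpret pM: prob_space M by (rule pM)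
 interpret pN: prob_space N by (rule pN)
 have X0M: "X0 \<subseteq> space M" and Y0N: "Y0 \<subseteq> space N" using sets.sets_into_space[OF iX(1)] sets.sets_into_space[OF iY(1)] .
 have spX: "space (restrict_space M X0) = X0" and spY: "space (restrict_space N Y0) = Y0"
  using X0M Y0N by (auto simp: space_restrict_space)
 have bij: "bij_betw Ps0 X0 Y0" and mPs0: "Ps0 \<in> restrict_space M X0 \<rightarrow>\<^sub>M restrict_space N Y0"
  and mPh0: "inv_into X0 Ps0 \<in> restrict_space N Y0 \<rightarrow>\<^sub>M restrict_space M X0"
  and dPs0: "distr (restrict_space M X0) (restrict_space N Y0) Ps0 = restrict_space N Y0"
  using iso unfolding measure_isomorphism_def spX spY by blast+
 obtain x0 y0 where x0: "x0 \<in> space M" and y0: "y0 \<in> space N" using pM.not_empty pN.not_empty by blast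
 define Ps where "Ps = (\<lambda>x. if x \<in> X0 then Ps0 x else y0)"
 define Ph where "Ph = (\<lambda>y. if y \<in> Y0 then inv_into X0 Ps0 y else x0)"
 have "Ps0 \<in> restrict_space M X0 \<rightarrow>\<^sub>M N" using mPs0 measurable_restrict_space2_iff[of Ps0 "restrict_space M X0" N Y0] by blast
 then have mPs: "Ps \<in> M \<rightarrow>\<^sub>M N" unfolding Ps_def by (rule measurable_extend[OF iX(1) _ y0])
 have "inv_into X0 Ps0 \<in> restrict_space N Y0 \<rightarrow>\<^sub>M M"
  using mPh0 measurable_restrict_space2_iff[of "inv_into X0 Ps0" "restrict_space N Y0" M X0] by blast
 then have mPh: "Ph \<in> N \<rightarrow>\<^sub>M M" unfolding Ph_def by (rule measurable_extend[OF iY(1) _ x0])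
 have PsY: "Ps x \<in> Y0" "Ps x = Ps0 x" if "x \<in> X0" for x using bij that unfolding Ps_def bij_betw_def by auto
 have PhPs: "Ph (Ps x) = x" if "x \<in> X0" for x
  using PsY[OF that] bij that unfolding Ph_def bij_betw_def by simp
 have PsPh: "Ph y \<in> X0" "Ps (Ph y) = y" if "y \<in> Y0" for y
 proof -
  have "y \<in> Ps0 ` X0" using bij that unfolding bij_betw_def by simp
  then have "inv_into X0 Ps0 y \<in> X0" "Ps0 (inv_into X0 Ps0 y) = y" by (rule inv_into_into, rule f_inv_into_f)
  then show "Ph y \<in> X0" "Ps (Ph y) = y" using that unfolding Ph_def Ps_def by auto
 qed
 have PsN: "Ps x \<in> space N" for x using PsY(1)[of x] Y0N y0 unfolding Ps_def by auto
 have dPs: "distr M N Ps = N"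
 proof (rule measure_eqI)
  show "sets (distr M N Ps) = sets N" by simp
  fix B assume "B \<in> sets (distr M N Ps)"
  then have B: "B \<in> sets N" by simp
  have BY: "B \<inter> Y0 \<in> sets N" using B iY(1) by blast
  have "emeasure (distr M N Ps) B = emeasure M (Ps -` B \<inter> space M)" by (rule emeasure_distr[OF mPs B])
  also have "\<dots> = emeasure M (Ps0 -` (B \<inter> Y0) \<inter> X0)"
  proof (rule emeasure_eq_AE)
   show "AE x in M. x \<in> Ps -` B \<inter> space M \<longleftrightarrow> x \<in> Ps0 -` (B \<inter> Y0) \<inter> X0"
    using iX(2)
   proof eventually_elim
    case (elim x)
    then show ?case using PsY[OF elim] X0M by auto
   qed
   show "Ps -` B \<inter> space M \<in> sets M" by (rule measurable_sets[OF mPs B])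
   have "Ps -` (B \<inter> Y0) \<inter> space M \<inter> X0 \<in> sets M" using measurable_sets[OF mPs BY] iX(1) by blast
   moreover have "Ps -` (B \<inter> Y0) \<inter> space M \<inter> X0 = Ps0 -` (B \<inter> Y0) \<inter> X0" using X0M PsY(2) by auto
   ultimately show "Ps0 -` (B \<inter> Y0) \<inter> X0 \<in> sets M" by simp
  qed
  also have "\<dots> = emeasure (restrict_space M X0) (Ps0 -` (B \<inter> Y0) \<inter> space (restrict_space M X0))"
   unfolding spX using iX(1) by (intro emeasure_restrict_space[symmetric]) auto
  also have "\<dots> = emeasure (distr (restrict_space M X0) (restrict_space N Y0) Ps0) (B \<inter> Y0)"
   using BY iY(1) Y0N by (intro emeasure_distr[symmetric] mPs0) (auto simp: sets_restrict_space_iff)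
  also have "\<dots> = emeasure N (B \<inter> Y0)" unfolding dPs0 using iY(1) by (intro emeasure_restrict_space) auto
  also have "\<dots> = emeasure N B"
  proof (rule emeasure_eq_AE[OF _ BY B])
   show "AE x in N. x \<in> B \<inter> Y0 \<longleftrightarrow> x \<in> B" using iY(2) by eventually_elim auto
  qed
  finally show "emeasure (distr M N Ps) B = emeasure N B" .
 qed
 note FM = free_part[OF aM cG fM] and FN = free_part[OF aN cH fN]
 define X where "X = X0 \<inter> free_part G M al \<inter> (Ps -` free_part H N be \<inter> space M)"
 have XX: "x \<in> X0" "x \<in> free_part G M al" "Ps x \<in> free_part H N be" "x \<in> space M" if "x \<in> X" for x
  using that unfolding X_def by blast+
 have Xs: "X \<in> sets M" unfolding X_def using iX(1) FM(1) measurable_sets[OF mPs FN(1)] by blast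
 have XAE: "AE x in M. x \<in> X"
 proof -
  have "AE y in distr M N Ps. y \<in> free_part H N be" unfolding dPs by (rule FN(2))
  then have "AE x in M. Ps x \<in> free_part H N be" by (rule AE_distrD[OF mPs])
  with iX(2) FM(2) AE_space show ?thesis by eventually_elim (simp add: X_def)
 qed
 have aX0: "al g x \<in> X0" if "g \<in> carrier G" "x \<in> X0" for g x using iX(3)[OF that(1)] that(2) by blast
 have bY0: "be t y \<in> Y0" if "t \<in> carrier H" "y \<in> Y0" for t y using iY(3)[OF that(1)] that(2) by blast
 have Psa: "Ps (al g x) = be (ka g x) (Ps x)" if "g \<in> carrier G" "x \<in> X0" for g x
  using k(2)[OF that] PsY(2) aX0[OF that] that(2) by simp
 have aX: "al g x \<in> X" if g: "g \<in> carrier G" and x: "x \<in> X" for g x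
 proof -
  have "Ps (al g x) \<in> free_part H N be" unfolding Psa[OF g XX(1)[OF x]] by (rule FN(3)[OF XX(3)[OF x] k(1)[OF g XX(1)[OF x]]])
  then show ?thesis unfolding X_def using aX0[OF g XX(1)[OF x]] FM(3)[OF XX(2)[OF x] g] X0M by blast
 qed
 define b where "b = (\<lambda>t x. Ph (be t (Ps x)))"
 define lam where "lam = (\<lambda>t x. ka' t (Ps x))"
 have Psb: "Ps (b t x) = be t (Ps x)" if "t \<in> carrier H" "x \<in> X" for t x
  unfolding b_def using PsPh(2)[OF bY0[OF that(1) PsY(1)[OF XX(1)[OF that(2)]]]] .
 have lamb: "lam t x \<in> carrier G" "b t x = al (lam t x) x" if t: "t \<in> carrier H" and x: "x \<in> X" for t x
 proof -
  have y: "Ps x \<in> Y0" by (rule PsY(1)[OF XX(1)[OF x]])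
  show "lam t x \<in> carrier G" unfolding lam_def by (rule k'(1)[OF t y])
  have "b t x = inv_into X0 Ps0 (be t (Ps x))" unfolding b_def Ph_def using bY0[OF t y] by simp
  also have "\<dots> = al (lam t x) (inv_into X0 Ps0 (Ps x))" unfolding lam_def by (rule k'(2)[OF t y])
  also have "inv_into X0 Ps0 (Ps x) = x" using PhPs[OF XX(1)[OF x]] y unfolding Ph_def by simp
  finally show "b t x = al (lam t x) x" .
 qed
 have bX: "b t x \<in> X" if "t \<in> carrier H" "x \<in> X" for t x
  unfolding lamb(2)[OF that] by (rule aX[OF lamb(1)[OF that] that(2)])
 have cp: "cocycle_pair G H X al b ka lam"
 proof (intro cocycle_pair.intro cocycle_pair_axioms.intro gG gH)
  show "al \<one>\<^bsub>G\<^esub> x = x" if "x \<in> X" for x using AM.id_eq_one XX(4)[OF that] by (metis restrict_apply')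
  show "al (g \<otimes>\<^bsub>G\<^esub> g') x = al g (al g' x)" if "g \<in> carrier G" "g' \<in> carrier G" "x \<in> X" for g g' x
   by (rule AM.composition_rule[OF XX(4)[OF that(3)] that(1,2)])
  show "g = g'" if "g \<in> carrier G" "g' \<in> carrier G" "x \<in> X" "al g x = al g' x" for g g' x
   by (rule FM(4)[OF XX(2)[OF that(3)] that(1,2,4)])
  show "b \<one>\<^bsub>H\<^esub> x = x" if x: "x \<in> X" for x
  proof -
   have "be \<one>\<^bsub>H\<^esub> (Ps x) = Ps x" using AN.id_eq_one PsN[of x] by (metis restrict_apply')
   then show ?thesis unfolding b_def using PhPs[OF XX(1)[OF x]] by simp
  qed
  show "b (h \<otimes>\<^bsub>H\<^esub> h') x = b h (b h' x)" if h: "h \<in> carrier H" "h' \<in> carrier H" and x: "x \<in> X" for h h' x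
  proof -
   have "b h (b h' x) = Ph (be h (be h' (Ps x)))" unfolding Psb[OF h(2) x, symmetric] by (simp add: b_def)
   then show ?thesis using AN.composition_rule[OF PsN[of x] h] by (simp add: b_def)
  qed
  show "h = h'" if h: "h \<in> carrier H" "h' \<in> carrier H" and x: "x \<in> X" and e: "b h x = b h' x" for h h' x
   by (rule FN(4)[OF XX(3)[OF x] h]) (metis Psb h x e)
  show "b (ka g x) x = al g x" if g: "g \<in> carrier G" and x: "x \<in> X" for g x
   unfolding b_def Psa[OF g XX(1)[OF x], symmetric] by (rule PhPs[OF aX0[OF g XX(1)[OF x]]])
  show "ka g x \<in> carrier H" if "g \<in> carrier G" "x \<in> X" for g x by (rule k(1)[OF that(1) XX(1)[OF that(2)]])
  show "al (lam h x) x = b h x" if "h \<in> carrier H" "x \<in> X" for h x by (rule lamb(2)[OF that, symmetric])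
 qed (fact aX bX lamb(1))+
 have "bounded_oe G H X al b ka lam M N be Ps Ph"
 proof (rule bounded_oe.intro[OF cp], unfold_locales)
  show "Ph (Ps x) = x" if "x \<in> X" for x by (rule PhPs[OF XX(1)[OF that]])
  show "finite (ka g ` X)" if "g \<in> carrier G" for g
   by (rule finite_subset[OF _ fk(1)[OF that]]) (use XX(1) in blast)
  show "finite (lam t ` X)" if "t \<in> carrier H" for t
   by (rule finite_subset[OF _ fk(2)[OF that]]) (use XX(1) PsY(1) in \<open>auto simp: lam_def\<close>)
  show "{x \<in> X. ka g x = h} \<in> sets M" if g: "g \<in> carrier G" for g h
  proof (cases "h \<in> carrier H")
   case False
   then have "{x \<in> X. ka g x = h} = {}" using k(1)[OF g] XX(1) by blast
   then show ?thesis by (metis sets.empty_sets)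
  next
   case True
   have "{x \<in> space M. Ps (al g x) = be h (Ps x)} \<in> sets M"
    by (rule measurable_eq_set[OF sbN measurable_compose[OF mM[OF g] mPs] measurable_compose[OF mPs mN[OF True]]])
   moreover have "{x \<in> X. ka g x = h} = X \<inter> {x \<in> space M. Ps (al g x) = be h (Ps x)}"
   proof (intro equalityI subsetI)
    fix x assume "x \<in> {x \<in> X. ka g x = h}"
    then show "x \<in> X \<inter> {x \<in> space M. Ps (al g x) = be h (Ps x)}" using Psa[OF g] XX by auto
   next
    fix x assume x: "x \<in> X \<inter> {x \<in> space M. Ps (al g x) = be h (Ps x)}"
    then have xX: "x \<in> X" by blast
    have "ka g x = h"
     by (rule FN(4)[OF XX(3)[OF xX] k(1)[OF g XX(1)[OF xX]] True]) (use x Psa[OF g XX(1)[OF xX]] in simp)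
    then show "x \<in> {x \<in> X. ka g x = h}" using xX by blast
   qed
   ultimately show ?thesis using Xs by auto
  qed
 qed (fact aM aN Xs XAE mPs dPs PsN mPh Psb)+
 then show ?thesis by (intro exI)
qed

section \<open>From microstates of G to microstates of H\<close>

locale oe_microstates = bounded_oe G H X al b ka lam M N be Ps Ph +
  microstates G H X al b ka lam V sm S W T K J L0 Lg Gm "\<lambda>x. jlab H be L f (Ps x)" st bp
 for G :: "('g, 'c) monoid_scheme" (structure) and H :: "('h, 'd) monoid_scheme" and X :: "'x set" and al b ka lam
  and M :: "'x measure" and N :: "'y measure" and be Ps Ph
  and V :: "'v set" and sm S W T K J L0 Lg Gm and f :: "'y => 'l" and L st bp +
 assumes f: "simple_function N f" and L: "finite L" "L \<subseteq> L0"
begin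

abbreviation "jL \<equiv> jlab H be L f"

text \<open>The defect at t vanishes wherever transport intertwines the twists, because the action
  of \<open>inv t\<close> on labels undoes t. Statistics change by at most the number of points
  without good transport, and \<open>Ps\<close> preserves the measure.\<close>

lemma micro_transfer:
 assumes ag: "agree xi et" and bad: "rcard (V - vgood xi et) \<le> tt * rcard V" "rcard (V - mgood et) \<le> m * rcard V"
  and ta: "\<And>t v. t \<in> L ==> v \<in> mgood et ==> ta t v = twist et t v"
  and stat: "\<And>Z. deviation M (\<lambda>x. jL (Ps x)) V xi Z \<le> dl * rcard V"
  and le: "tt + m \<le> dl'" "tt + dl \<le> dl'"
 shows "(\<lambda>v. Ps (mv et xi v)) \<in> micro H N be f L dl' V ta"
 unfolding micro_def
proof (intro CollectI conjI ballI allI)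
 have LC: "L \<subseteq> carrier H" using L(2) L0C by blast
 interpret A: group_action H "space N" be using actN unfolding pmp_action_def by blast
 show "(\<lambda>v. Ps (mv et xi v)) \<in> V \<rightarrow> space N" using Ps(3) by blast
 fix t assume t: "t \<in> L"
 have t0: "t \<in> L0" "t \<in> carrier H" using t L LC by blast+
 let ?D = "defect H be f V ta (\<lambda>v. Ps (mv et xi v)) t"
 have "?D \<subseteq> (V - vgood xi et) \<union> (V - mgood et)"
 proof (rule ccontr)
  assume "\<not> ?thesis"
  then obtain u where u: "f (be (inv\<^bsub>H\<^esub> t) (Ps (mv et xi (ta t u)))) \<noteq> f (Ps (mv et xi u))"
   "u \<in> vgood xi et" "u \<in> mgood et" by blast
  define x where "x = mv et xi u"
  have xX: "x \<in> X" unfolding x_def by (rule transport_twist(3)[OF ag u(2) t0(1)])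
  have "jL (Ps (mv et xi (ta t u))) = jL (Ps (b t x))"
   unfolding ta[OF t u(3)] x_def by (rule transport_twist(2)[OF ag u(2) t0(1)])
  from fun_cong[OF this, of t] have "f (be (inv\<^bsub>H\<^esub> t) (Ps (mv et xi (ta t u)))) = f (be (inv\<^bsub>H\<^esub> t) (Ps (b t x)))"
   unfolding jlab_def using t by simp
  also have "be (inv\<^bsub>H\<^esub> t) (Ps (b t x)) = Ps x" unfolding Ps_b[OF t0(2) xX] by (rule A.inv_act[OF t0(2) Ps(3)])
  finally show False using u(1) unfolding x_def by simp
 qed
 then have "card ?D \<le> card ((V - vgood xi et) \<union> (V - mgood et))"
  using finV by (intro card_mono) auto
 also have "\<dots> \<le> card (V - vgood xi et) + card (V - mgood et)" by (rule card_Un_le)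
 finally have "rcard ?D \<le> (tt + m) * rcard V"
  using bad by (simp add: distrib_right)
 also have "\<dots> \<le> dl' * rcard V" using le by (intro mult_right_mono) auto
 finally show "rcard ?D \<le> dl' * rcard V" .
next
 fix Z
 have LC: "L \<subseteq> carrier H" using L(2) L0C by blast
 have sj: "simple_function N (jL)" by (rule simple_jlab[OF actN L(1) LC f])
 have "{y \<in> space N. jL y \<in> Z} = jL -` Z \<inter> space N" by blast
 then have ms: "{y \<in> space N. jL y \<in> Z} \<in> sets N" using simple_functionD(2)[OF sj] by simp
 have "measure N {y \<in> space N. jL y \<in> Z} = measure (distr M N Ps) {y \<in> space N. jL y \<in> Z}" using Ps(2) by simp
 also have "\<dots> = measure M (Ps -` {y \<in> space N. jL y \<in> Z} \<inter> space M)" by (rule measure_distr[OF Ps(1) ms])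
 also have "Ps -` {y \<in> space N. jL y \<in> Z} \<inter> space M = {x \<in> space M. jL (Ps x) \<in> Z}" using Ps(3) by auto
 finally have eq: "measure N {y \<in> space N. jL y \<in> Z} = measure M {x \<in> space M. jL (Ps x) \<in> Z}" .
 have 1: "\<bar>rcard {v \<in> V. jL (Ps (mv et xi v)) \<in> Z} - rcard {u \<in> V. jL (Ps (xi u)) \<in> Z}\<bar> \<le> tt * rcard V"
  using card_transport[OF ag, of "\<lambda>x. jL (Ps x) \<in> Z"] bad(1) by linarith
 have "tt * rcard V + dl * rcard V \<le> dl' * rcard V"
  unfolding distrib_right[symmetric] using le by (intro mult_right_mono) auto
 then show "\<bar>rcard {v \<in> V. jL (Ps (mv et xi v)) \<in> Z}
   - rcard V * measure N {y \<in> space N. jL y \<in> Z}\<bar> \<le> dl' * rcard V"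
  unfolding eq using 1 stat[of Z] by linarith
qed

end

context bounded_oe
begin

definition "khat g x = (if x \<in> X then ka g x else \<one>\<^bsub>H\<^esub>)"
definition "lhat t x = (if x \<in> X then lam t x else \<one>)"

lemma lam_iff: "g \<in> carrier G ==> t \<in> carrier H ==> x \<in> X ==> lam t x = g \<longleftrightarrow> ka g x = t"
 using kap_lam lam_kap by metis

lemma simple_extend:
 assumes fin: "finite (j ` X)" and meas: "\<And>l. {x \<in> X. j x = l} \<in> sets M"
 shows "simple_function M (\<lambda>x. if x \<in> X then j x else c)"
 unfolding simple_function_def
proof
 show "finite ((\<lambda>x. if x \<in> X then j x else c) ` space M)"
  by (rule finite_subset[of _ "insert c (j ` X)"]) (use fin in auto)
 have XM: "X \<subseteq> space M" by (rule sets.sets_into_space[OF X(1)])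
 show "\<forall>l\<in>(\<lambda>x. if x \<in> X then j x else c) ` space M. (\<lambda>x. if x \<in> X then j x else c) -` {l} \<inter> space M \<in> sets M"
 proof
  fix l
  have "(\<lambda>x. if x \<in> X then j x else c) -` {l} \<inter> space M = {x \<in> X. j x = l} \<union> (if c = l then space M - X else {})"
   using XM by (auto split: if_splits)
  then show "(\<lambda>x. if x \<in> X then j x else c) -` {l} \<inter> space M \<in> sets M" using meas X(1) by auto
 qed
qed

lemma simple_khat: "g \<in> carrier G ==> simple_function M (khat g)"
 unfolding khat_def[abs_def] by (rule simple_extend[OF finite_kap meas_kap])

lemma simple_lhat:
 assumes t: "t \<in> carrier H" shows "simple_function M (lhat t)"
proof -
 have "{x \<in> X. lam t x = l} \<in> sets M" for l
 proof (cases "l \<in> carrier G")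
  case True
  have "{x \<in> X. lam t x = l} = {x \<in> X. ka l x = t}" using lam_iff[OF True t] by blast
  then show ?thesis using meas_kap[OF True] by simp
 next
  case False
  then have "{x \<in> X. lam t x = l} = {}" using lam_closed[OF t] by blast
  then show ?thesis by (metis sets.empty_sets)
 qed
 then have "simple_function M (\<lambda>x. if x \<in> X then lam t x else \<one>)" by (rule simple_extend[OF finite_lam[OF t]])
 then show ?thesis unfolding lhat_def[abs_def] .
qed

lemma simple_in_X: "simple_function M (\<lambda>x. x \<in> X)"
proof -
 have "simple_function M (\<lambda>x. if x \<in> X then True else False)"
 proof (rule simple_extend)
  show "{x \<in> X. True = l} \<in> sets M" for l using X(1) by (cases l) auto
 qed auto
 moreover have "(\<lambda>x. if x \<in> X then True else False) = (\<lambda>x. x \<in> X)" by auto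
 ultimately show ?thesis by (simp only:)
qed

text \<open>The label that carries the entropy on the side of H: besides \<open>p\<close> it keeps
  the cocycle values on \<open>S\<close> that \<open>transport_recover\<close> requires.\<close>

definition "plab S p y = (p (Ph y), \<lambda>s\<in>S. khat s (Ph y))"

lemma simple_plab:
 assumes "simple_function M p" "finite S" "S \<subseteq> carrier G"
 shows "simple_function N (plab S p)"
proof -
 have "simple_function M (\<lambda>x. (p x, \<lambda>s\<in>S. khat s x))"
  using assms simple_khat by (intro simple_function_Pair simple_function_restrict) auto
 from simple_function_comp[OF Ph(1) this] show ?thesis unfolding plab_def[abs_def] .
qed

lemma plab_Ps: "x \<in> X ==> plab S p (Ps x) = (p x, \<lambda>s\<in>S. ka s x)"
 unfolding plab_def by (simp add: Ph(2) khat_def cong: restrict_cong)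

end

lemma jlab_one:
 assumes "group_action G (space M) al" "\<one>\<^bsub>G\<^esub> \<in> F" "x \<in> space M"
 shows "jlab G al F c x \<one>\<^bsub>G\<^esub> = c x"
proof -
 interpret group_action G "space M" al by fact
 interpret group G using group_hom group_hom.axioms(1) by blast
 have "al \<one>\<^bsub>G\<^esub> x = x" using id_eq_one assms(3) by (metis restrict_apply')
 then show ?thesis unfolding jlab_def using assms(2) by simp
qed

lemma micro_stat:
 assumes A: "group_action G (space M) al" and F: "\<one>\<^bsub>G\<^esub> \<in> F" and xi: "xi \<in> micro G M al c F dl V sm"
 shows "\<bar>rcard {v \<in> V. Q (c (xi v))} - rcard V * measure M {x \<in> space M. Q (c x)}\<bar> \<le> dl * rcard V"
proof -
 have xiV: "xi v \<in> space M" if "v \<in> V" for v using xi that unfolding micro_def by blast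
 have 1: "{v \<in> V. Q (c (xi v))} = {v \<in> V. jlab G al F c (xi v) \<in> {z. Q (z \<one>\<^bsub>G\<^esub>)}}"
  using jlab_one[where c = c, OF A F xiV] by auto
 have 2: "{x \<in> space M. Q (c x)} = {x \<in> space M. jlab G al F c x \<in> {z. Q (z \<one>\<^bsub>G\<^esub>)}}"
  using jlab_one[where c = c, OF A F] by auto
 have "\<forall>Z. deviation M (jlab G al F c) V xi Z \<le> dl * rcard V"
  using xi unfolding micro_def mem_Collect_eq by (elim conjE)
 then show ?thesis unfolding 1 2 by (rule spec)
qed

text \<open>The parameters are chosen in the order of their dependence: \<open>K\<close>,
  \<open>J\<close>, \<open>Lg\<close> and \<open>T\<close> from \<open>S\<close> and
  \<open>L\<close>, then the tolerances, \<open>A\<close> from sparse connectivity, then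
  \<open>Gm\<close>, \<open>F\<close> and at last \<open>dl\<close>. One half of the loss
  \<open>2 * ep\<close> is due to the pigeonhole principle, the other to microstates that transport
  no longer distinguishes.\<close>

lemma (in bounded_oe) models:
 fixes p :: "'x => 'p" and f :: "'y => 'l" and V :: "nat => nat set" and r ep dl' :: real
 assumes seq: "sofic_approx_seq G V sm" and S: "finite S" "S \<subseteq> carrier G" "\<one> \<in> S"
  and sc: "sparse_conn G V sm (\<lambda>s. 2 * ln (rcard (kvals s)) / ep) S (carrier G) 2"
  and p: "simple_function M p" and ep: "ep > 0"
  and freq: "\<And>(c :: 'x => 'p \<times> bool \<times> ('g => 'h) \<times> ('h => 'g) \<times> ('h => 'l) \<times> ('h => 'h => 'l)) F dl. simple_function M c ==>
    (\<And>x. fst (c x) = p x) ==> finite F ==> F \<subseteq> carrier G ==> \<one> \<in> F ==> dl > 0 ==>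
    \<exists>\<^sub>F k in sequentially. many r p (micro G M al c F dl (V k) (sm k)) (V k)"
  and f: "simple_function N f" and L: "finite L" "L \<subseteq> carrier H" "\<one>\<^bsub>H\<^esub> \<in> L" and dl': "dl' > 0"
 shows "\<exists>W ta. sofic_approx H W ta \<and> good_approx H L dl' W ta \<and>
  many (r - 2 * ep) (plab S p) (micro H N be f L dl' W ta) (W :: nat set)"
proof -
 have AM: "group_action G (space M) al" and prM: "prob_space M" using actM unfolding pmp_action_def by blast+
 interpret AM: group_action G "space M" al by (rule AM)
 interpret prob_space M by (rule prM)
 have XM: "X \<subseteq> space M" by (rule sets.sets_into_space[OF X(1)])
 \<comment> \<open>Products of elements of \<open>L\<close> are needed for the multiplicativity of
   the twists, and the inverses added in \<open>L0\<close> for their injectivity.\<close>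
 define L1 where "L1 = L \<union> (\<lambda>(s, t). s \<otimes>\<^bsub>H\<^esub> t) ` (L \<times> L)"
 define L0 where "L0 = L1 \<union> (\<lambda>t. inv\<^bsub>H\<^esub> t) ` L1"
 have L1C: "L1 \<subseteq> carrier H" unfolding L1_def using L(2) by auto
 have L0C: "L0 \<subseteq> carrier H" unfolding L0_def using L1C by auto
 have finL0: "finite L0" unfolding L0_def L1_def using L(1) by auto
 define K where "K = (\<Union>s\<in>S. ka s ` X)"
 have finK: "finite K" unfolding K_def using S(1,2) finite_kap by auto
 have KC: "K \<subseteq> carrier H" unfolding K_def using S(2) kap_closed by auto
 define J where "J = (\<Union>h\<in>K. lam h ` X)"
 have finJ: "finite J" unfolding J_def using finK KC finite_lam by auto
 have JC: "J \<subseteq> carrier G" unfolding J_def using KC lam_closed by auto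
 define Lg where "Lg = (\<Union>t\<in>L0. lam t ` X)"
 have finLg: "finite Lg" unfolding Lg_def using finL0 L0C finite_lam by auto
 have LgC: "Lg \<subseteq> carrier G" unfolding Lg_def using L0C lam_closed by auto
 define T where "T = (\<lambda>(s, g). inv s \<otimes> g) ` (S \<times> J) \<union> (\<lambda>(s, s', m). inv s' \<otimes> (m \<otimes> s)) ` (S \<times> S \<times> Lg)"
 have finT: "finite T" unfolding T_def using S(1) finJ finLg by auto
 have TC: "T \<subseteq> carrier G" unfolding T_def using S(2) JC LgC by (auto simp: subset_iff)
 define R where "R = p ` space M"
 have finR: "finite R" unfolding R_def using p unfolding simple_function_def by blast
 \<comment> \<open>Makes the term \<open>rcard R * x\<close> of the Hamming bound at most ep / 2;
   \<open>tt\<close> below does the same for the term with the logarithm of x.\<close>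
 define x where "x = min 1 (ep / (2 * (rcard R + 1)))"
 have x: "0 < x" "x \<le> 1" unfolding x_def using ep by (auto simp: add_nonneg_pos)
 have Rx: "rcard R * x \<le> ep / 2"
 proof -
  have "rcard R * x \<le> rcard R * (ep / (2 * (rcard R + 1)))" unfolding x_def by (intro mult_left_mono) auto
  also have "\<dots> \<le> ep / 2" using ep by (simp add: field_simps)
  finally show ?thesis .
 qed
 have lnx: "- ln x \<ge> 0" using x by simp
 define tt where "tt = min (ep / (4 * (1 - ln x))) (dl' / 4)"
 have tt: "tt > 0" unfolding tt_def using ep dl' lnx by (simp add: add_pos_nonneg)
 have ttx: "2 * tt * (- ln x) \<le> ep / 2"
 proof -
  have "2 * tt * (- ln x) \<le> 2 * (ep / (4 * (1 - ln x))) * (- ln x)"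
   using lnx unfolding tt_def by (intro mult_right_mono) auto
  also have "\<dots> \<le> ep / 2" using ep lnx by (simp add: field_simps)
  finally show ?thesis .
 qed
 have ttdl: "tt \<le> dl' / 4" unfolding tt_def by (rule min.cobounded2)
 define C where "C = real (1 + 2 * (card S * card J) + card Lg)"
 have C: "C \<ge> 1" unfolding C_def by simp
 \<comment> \<open>\<open>C * ep2\<close> and, with m below, \<open>rcard S * (2 * m)\<close> are at
   most tt / 2; these are the two contributions in \<open>card_vgood\<close>.\<close>
 define ep2 where "ep2 = tt / (2 * C)"
 have ep2: "ep2 > 0" unfolding ep2_def using tt C by simp
 define m where "m = tt / (4 * (rcard S + 1))"
 have m: "m > 0" "m \<le> tt / 4" unfolding m_def using tt by (auto simp: field_simps)
 have Sm: "rcard S * (2 * m) \<le> tt / 2" unfolding m_def using tt by (simp add: field_simps)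
 obtain A where A: "finite A" "A \<subseteq> carrier G"
  and evW: "\<forall>\<^sub>F k in sequentially. sparse_at G (V k) (sm k) (\<lambda>s. 2 * ln (rcard (kvals s)) / ep) S T A 2 ep2"
  by (rule sparse_connE[OF sc finT TC ep2])
 define Gm where "Gm = insert \<one> (S \<union> J \<union> Lg \<union> T \<union> A \<union> (\<lambda>(m, g). m \<otimes> g) ` (Lg \<times> J))"
 have finGm: "finite Gm" unfolding Gm_def using S(1) finJ finLg finT A(1) by simp
 have GmC: "Gm \<subseteq> carrier G" unfolding Gm_def using S(2) JC LgC TC A(2) by (auto simp: subset_iff)
 define F where "F = Gm \<union> (\<lambda>g. inv g) ` Gm"
 have F: "finite F" "F \<subseteq> carrier G" "\<one> \<in> F" unfolding F_def using finGm GmC by (auto simp: Gm_def)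
 have invF: "inv g \<in> F" if "g \<in> Gm" for g unfolding F_def using that by blast
 define dl where "dl = m / (2 * (rcard Gm + 1))"
 have dl: "dl > 0" "dl \<le> m" "(rcard Gm + 1) * dl = m / 2" unfolding dl_def using m by (auto simp: field_simps)
 define j where "j = jlab H be L f"
 have sj: "simple_function N j" unfolding j_def by (rule simple_jlab[OF actN L(1,2) f])
 \<comment> \<open>The label for which microstates of G are taken: \<open>p\<close> as its first
   component, from which patterns are read, followed by membership in \<open>X\<close> and all data
   compared by \<open>coh\<close>.\<close>
 define c where "c = (\<lambda>x. (p x, x \<in> X, (\<lambda>g\<in>Gm. khat g x), (\<lambda>h\<in>K \<union> L0. lhat h x), j (Ps x), (\<lambda>t\<in>L0. j (be t (Ps x)))))"
 have sjt: "simple_function M (\<lambda>x. j (be t (Ps x)))" if "t \<in> L0" for t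
 proof -
  have "be t \<in> N \<rightarrow>\<^sub>M N" using actN subsetD[OF L0C that] unfolding pmp_action_def by blast
  then show ?thesis by (rule simple_function_comp[OF measurable_compose[OF Ps(1)] sj])
 qed
 have c: "simple_function M c"
  unfolding c_def
 proof (intro simple_function_Pair p simple_in_X simple_function_restrict finGm sjt finL0)
  show "simple_function M (khat g)" if "g \<in> Gm" for g by (rule simple_khat[OF subsetD[OF GmC that]])
  show "finite (K \<union> L0)" using finK finL0 by simp
  show "simple_function M (lhat h)" if "h \<in> K \<union> L0" for h by (rule simple_lhat) (use that KC L0C in blast)
  show "simple_function M (\<lambda>x. j (Ps x))" by (rule simple_function_comp[OF Ps(1) sj])
 qed
 have fr: "\<exists>\<^sub>F k in sequentially. many r p (micro G M al c F dl (V k) (sm k)) (V k)"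
  by (rule freq[OF c _ F dl(1)]) (simp add: c_def)
 have ev: "\<forall>\<^sub>F k in sequentially. card (V k - good_pts G (V k) (sm k) F) \<le> m / 2 * card (V k)"
  by (rule G.eventually_good_pts[OF seq F(1,2)]) (use m in simp)
 obtain k where k0: "(many r p (micro G M al c F dl (V k) (sm k)) (V k) \<and>
  card (V k - good_pts G (V k) (sm k) F) \<le> m / 2 * card (V k)) \<and>
  sparse_at G (V k) (sm k) (\<lambda>s. 2 * ln (rcard (kvals s)) / ep) S T A 2 ep2"
  using frequently_ex[OF frequently_eventually_frequently[OF frequently_eventually_frequently[OF fr ev] evW]] ..
 note k = k0[THEN conjunct1, THEN conjunct1] k0[THEN conjunct1, THEN conjunct2]
 obtain W D where WD: "W \<subseteq> V k" "D \<subseteq> A \<times> V k"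
   "(\<Sum>(s, u)\<in>D. 2 * ln (rcard (kvals s)) / ep) \<le> 2 * rcard (V k)"
   "rcard (V k - cover S (sm k) W) \<le> ep2 * rcard (V k)"
   "\<forall>w\<in>W. \<forall>t\<in>T. sm k t w \<in> W --> reach G (sm k) D A w t"
  by (rule sparse_atE[OF k0[THEN conjunct2]])
 define n where "n = rcard (V k)"
 have sa: "sofic_approx G (V k) (sm k)" using seq unfolding sofic_approx_seq_def by blast
 have finV: "finite (V k)" and Vne: "V k \<noteq> {}" using sa unfolding sofic_approx_def by blast+
 \<comment> \<open>One fixed choice of position and base point for all microstates; points of
   \<open>W\<close> fixed by the identity are their own base points, as \<open>bpW\<close>
   requires.\<close>
 define sb where "sb = (\<lambda>v. if v \<in> W \<and> sm k \<one> v = v then (\<one>, v) else (SOME y. fst y \<in> S \<and> snd y \<in> W \<and> sm k (fst y) (snd y) = v))"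
 define st where "st = (\<lambda>v. fst (sb v))"
 define bp where "bp = (\<lambda>v. snd (sb v))"
 have sb: "st v \<in> S \<and> bp v \<in> W \<and> sm k (st v) (bp v) = v" if v: "v \<in> cover S (sm k) W" for v
 proof (cases "v \<in> W \<and> sm k \<one> v = v")
  case True
  then show ?thesis unfolding st_def bp_def sb_def using S(3) by simp
 next
  case False
  obtain s w where "s \<in> S" "w \<in> W" "v = sm k s w" using v by blast
  then have ex: "\<exists>y. fst y \<in> S \<and> snd y \<in> W \<and> sm k (fst y) (snd y) = v" by (intro exI[of _ "(s, w)"]) simp
  have "sb v = (SOME y. fst y \<in> S \<and> snd y \<in> W \<and> sm k (fst y) (snd y) = v)" unfolding sb_def by (rule if_not_P[OF False])
  then show ?thesis using someI_ex[OF ex] unfolding st_def bp_def by simp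
 qed
 interpret ms: oe_microstates G H X al b ka lam M N be Ps Ph "V k" "sm k" S W T K J L0 Lg Gm f L st bp
 proof unfold_locales
  show "finite (V k)" "finite S" "finite J" "finite Lg" by (fact finV S(1) finJ finLg)+
  show "sm k g permutes V k" if "g \<in> Gm" for g by (rule sofic_approx_permutes[OF sa subsetD[OF GmC that]])
  show "Gm \<subseteq> carrier G" by (rule GmC)
  show "S \<subseteq> Gm" "J \<subseteq> Gm" "Lg \<subseteq> Gm" "T \<subseteq> Gm" "\<one> \<in> Gm" unfolding Gm_def by blast+
  show "\<one> \<in> S" by (rule S(3))
  show "m \<otimes> g \<in> Gm" if "m \<in> Lg" "g \<in> J" for m g
  proof -
   have "(m, g) \<in> Lg \<times> J" using that by blast
   from imageI[OF this, of "\<lambda>(m, g). m \<otimes> g"] show ?thesis unfolding Gm_def by simp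
  qed
  show "K \<subseteq> carrier H" "L0 \<subseteq> carrier H" by (fact KC L0C)+
  show "ka s x \<in> K" if "s \<in> S" "x \<in> X" for s x unfolding K_def using that by blast
  show "lam h x \<in> J" if "h \<in> K" "x \<in> X" for h x unfolding J_def using that by blast
  show "lam t x \<in> Lg" if "t \<in> L0" "x \<in> X" for t x unfolding Lg_def using that by blast
  show "inv s \<otimes> g \<in> T" if "s \<in> S" "g \<in> J" for s g
  proof -
   have "(s, g) \<in> S \<times> J" using that by blast
   from imageI[OF this, of "\<lambda>(s, g). inv s \<otimes> g"] show ?thesis unfolding T_def by simp
  qed
  show "inv s' \<otimes> (m \<otimes> s) \<in> T" if "s \<in> S" "s' \<in> S" "m \<in> Lg" for s s' m
  proof -
   have "(s, s', m) \<in> S \<times> S \<times> Lg" using that by blast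
   from imageI[OF this, of "\<lambda>(s, s', m). inv s' \<otimes> (m \<otimes> s)"] show ?thesis unfolding T_def by simp
  qed
  show "W \<subseteq> V k" by (rule WD(1))
  show "st w = \<one> \<and> bp w = w" if "w \<in> W" "sm k \<one> w = w" for w
   unfolding st_def bp_def sb_def using that by simp
  show "simple_function N f" "finite L" by (fact f L(1))+
  show "L \<subseteq> L0" unfolding L0_def L1_def by blast
 qed
 define Xi where "Xi = micro G M al c F dl (V k) (sm k)"
 have XiV: "xi v \<in> space M" if "xi \<in> Xi" "v \<in> V k" for xi v using that unfolding Xi_def micro_def by blast
 have stat: "\<bar>rcard {v \<in> V k. Q (c (xi v))} - n * measure M {x \<in> space M. Q (c x)}\<bar> \<le> dl * n" if "xi \<in> Xi" for xi Q
  using micro_stat[OF AM F(3) that[unfolded Xi_def]] unfolding n_def .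
 have coh: "x \<in> X \<and> (\<forall>g'\<in>Gm. ka g' x = ka g' y) \<and> (\<forall>h\<in>K \<union> L0. lam h x = lam h y) \<and>
   (\<forall>t\<in>L0. jlab H be L f (Ps (b t x)) = jlab H be L f (Ps (b t y))) \<and> jlab H be L f (Ps x) = jlab H be L f (Ps y)"
  if y: "y \<in> X" and e: "c x = c y" for x y
 proof -
  have e1: "(x \<in> X) = (y \<in> X)" "(\<lambda>g\<in>Gm. khat g x) = (\<lambda>g\<in>Gm. khat g y)" "(\<lambda>h\<in>K \<union> L0. lhat h x) = (\<lambda>h\<in>K \<union> L0. lhat h y)"
   "j (Ps x) = j (Ps y)" "(\<lambda>t\<in>L0. j (be t (Ps x))) = (\<lambda>t\<in>L0. j (be t (Ps y)))"
   using e unfolding c_def prod.inject by blast+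
  have xX: "x \<in> X" using e1(1) y by blast
  have "ka g' x = ka g' y" if "g' \<in> Gm" for g' using fun_cong[OF e1(2), of g'] that xX y by (simp add: khat_def)
  moreover have "lam h x = lam h y" if "h \<in> K \<union> L0" for h using fun_cong[OF e1(3), of h] that xX y by (simp add: lhat_def)
  moreover have "j (Ps (b t x)) = j (Ps (b t y))" if t: "t \<in> L0" for t
   using fun_cong[OF e1(5), of t] t Ps_b[OF subsetD[OF L0C t] xX] Ps_b[OF subsetD[OF L0C t] y] by simp
  ultimately show ?thesis using xX e1(4) unfolding j_def by blast
 qed
 have mg: "rcard (V k - ms.mgood xi) \<le> m * n" if xi: "xi \<in> Xi" for xi
 proof -
  have "rcard (V k - ms.mgood xi) \<le> rcard (V k - good_pts G (V k) (sm k) F) + (rcard Gm + 1) * (dl * n)"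
  proof (rule ms.card_mgood[where Y = "space M" and c = c, OF F(2) _ invF finGm XiV[OF xi]])
   show "Gm \<subseteq> F" unfolding F_def by blast
   show "rcard (defect G al c (V k) (sm k) xi g) \<le> dl * n" if "g \<in> F" for g
    using xi that unfolding Xi_def micro_def n_def by blast
   have "AE x in M. \<not> x \<notin> X" using X(2) by simp
   then have "emeasure M {x \<in> space M. x \<notin> X} = 0" by (rule emeasure_eq_0_AE)
   then have "measure M {x \<in> space M. x \<notin> X} = 0" by (simp add: measure_def)
   then show "rcard {u \<in> V k. xi u \<notin> X} \<le> dl * n"
    using stat[OF xi, of "\<lambda>z. \<not> fst (snd z)"] by (simp add: c_def)
  qed (use coh in blast)+
  also have "(rcard Gm + 1) * (dl * n) = m / 2 * n" unfolding mult.assoc[symmetric] dl(3) ..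
  also have "rcard (V k - good_pts G (V k) (sm k) F) + m / 2 * n \<le> m / 2 * n + m / 2 * n" using k(2) unfolding n_def by simp
  also have "\<dots> = m * n" by simp
  finally show ?thesis .
 qed
 have cov: "rcard (V k - ms.Cov) \<le> ep2 * n"
 proof -
  have "V k - ms.Cov \<subseteq> V k - cover S (sm k) W" unfolding ms.Cov_def using sb by blast
  then have "card (V k - ms.Cov) \<le> card (V k - cover S (sm k) W)" using finV by (intro card_mono) auto
  then show ?thesis using WD(4) unfolding n_def by linarith
 qed
 have n0: "n \<ge> 0" unfolding n_def by simp
 have vg: "rcard (V k - ms.vgood xi et) \<le> tt * n" if xi: "xi \<in> Xi" and et: "et \<in> Xi" for xi et
 proof -
  have "rcard (V k - ms.vgood xi et) \<le> real ((1 + 2 * (card S * card J) + card Lg) * card (V k - ms.Cov)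
   + card S * (card (V k - ms.mgood xi) + card (V k - ms.mgood et)))" unfolding of_nat_le_iff by (rule ms.card_vgood)
  also have "\<dots> = C * rcard (V k - ms.Cov) + rcard S * (rcard (V k - ms.mgood xi) + rcard (V k - ms.mgood et))"
   unfolding C_def by (simp add: algebra_simps)
  also have "\<dots> \<le> C * (ep2 * n) + rcard S * (m * n + m * n)"
   using cov mg[OF xi] mg[OF et] C by (intro add_mono mult_left_mono) auto
  also have "\<dots> = (C * ep2 + rcard S * (2 * m)) * n" by (simp add: algebra_simps)
  also have "\<dots> \<le> (tt / 2 + tt / 2) * n" using Sm n0 C unfolding ep2_def by (intro mult_right_mono add_mono) auto
  finally show ?thesis by simp
 qed
 have finD: "finite D" using finite_subset[OF WD(2)] A(1) finV by blast
 have DC: "s \<in> carrier G" if "(s, u) \<in> D" for s u using that WD(2) A(2) by blast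
 let ?X = "\<lambda>et. {xi \<in> Xi. \<forall>(s, u)\<in>D. khat s (xi u) = khat s (et u)}"
 have XI: "\<exists>et\<in>Xi. exp ((r - ep) * n) \<le> rcard (patterns p (?X et) (V k))"
 proof (rule pigeonhole_patterns[where R = "\<lambda>s. kvals s" and N = "\<lambda>s. card (kvals s)" and B = "ep * n", OF finD])
  show "khat s (xi u) \<in> kvals s" for s u and xi :: "nat => 'x" unfolding khat_def by simp
  show fR: "finite (kvals s)" if "(s, u) \<in> D" for s u using finite_kap[OF DC[OF that]] by simp
  show "card (kvals s) \<le> card (kvals s) \<and> card (kvals s) > 0" if "(s, u) \<in> D" for s u
   using fR[OF that] by (simp add: card_gt_0_iff)
  \<comment> \<open>The factor 2 / \<open>ep\<close> in the cost function and the constant 2 in the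
    sparse connectivity combine to the bound \<open>ep * n\<close> on the logarithm of the number of
    data.\<close>
  have "(2 / ep) * (\<Sum>(s, u)\<in>D. ln (rcard (kvals s))) = (\<Sum>(s, u)\<in>D. 2 * ln (rcard (kvals s)) / ep)"
   unfolding sum_distrib_left by (intro sum.cong) auto
  also have "\<dots> \<le> 2 * n" using WD(3) unfolding n_def .
  finally show "(\<Sum>(s, u)\<in>D. ln (rcard (kvals s))) \<le> ep * n" using ep by (simp add: field_simps)
  show "exp ((r - ep) * n + ep * n) \<le> rcard (patterns p Xi (V k))"
   using k(1) unfolding n_def Xi_def by (simp add: left_diff_distrib)
 qed
 then obtain et where et: "et \<in> Xi" and big: "exp ((r - ep) * n) \<le> rcard (patterns p (?X et) (V k))"
  by (elim bexE)
 define Xi' where "Xi' = ?X et"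
 have ag: "ms.agree xi et" if xi: "xi \<in> Xi'" for xi
 proof (rule ms.agree_of_data[OF _ WD(2) WD(5)[rule_format]])
  show "A \<subseteq> Gm" unfolding Gm_def by blast
  show "ka s (xi u) = ka s (et u)" if "(s, u) \<in> D" "xi u \<in> X" "et u \<in> X" for s u
  proof -
   have "khat s (xi u) = khat s (et u)" using xi that(1) unfolding Xi'_def by blast
   then show ?thesis using that(2,3) unfolding khat_def by simp
  qed
 qed
 have Xi'D: "xi \<in> Xi" if "xi \<in> Xi'" for xi using that unfolding Xi'_def by blast
 have "2 * rcard (V k - ms.mgood et) \<le> dl' * rcard (V k)"
 proof -
  have "2 * (m * n) \<le> dl' * n" unfolding mult.assoc[symmetric] using m(2) tt ttdl n0 by (intro mult_right_mono) auto
  then show ?thesis using mg[OF et] unfolding n_def by linarith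
 qed
 then have "\<exists>ta. sofic_approx H (V k) ta \<and> good_approx H L dl' (V k) ta \<and> (\<forall>t\<in>L1. \<forall>v\<in>ms.mgood et. ta t v = ms.twist et t v)"
  by (intro ms.twisted_sofic[of L1 L, OF _ _ _ Vne]) (use L(3) in \<open>auto simp: L0_def L1_def\<close>)
 then obtain ta where ta0: "sofic_approx H (V k) ta" "good_approx H L dl' (V k) ta"
   "\<forall>t\<in>L1. \<forall>v\<in>ms.mgood et. ta t v = ms.twist et t v"
  by (elim exE conjE)
 have ta: "ta t v = ms.twist et t v" if "t \<in> L" "v \<in> ms.mgood et" for t v
  using ta0(3) that unfolding L1_def by blast
 define Img where "Img = (\<lambda>xi. restrict (\<lambda>v. plab S p (Ps (ms.mv et xi v))) (V k)) ` Xi'"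
 have sp: "simple_function N (plab S p)" by (rule simple_plab[OF p S(1,2)])
 have cnt: "rcard (patterns p Xi' (V k)) \<le> rcard Img * exp (ep * n)"
  unfolding Img_def n_def
 proof (rule ms.patterns_transfer[where R = R and R' = "plab S p ` space N" and tt = tt and x = x, OF ag _ finR _ _ _ _ x Rx ttx])
  show "rcard (V k - ms.vgood xi et) \<le> tt * rcard (V k)" if "xi \<in> Xi'" for xi
   using vg[OF Xi'D[OF that] et] unfolding n_def .
  show "p (xi v) \<in> R" if "xi \<in> Xi'" "v \<in> V k" for xi v
   unfolding R_def by (rule imageI[OF XiV[OF Xi'D[OF that(1)] that(2)]])
  show "finite (plab S p ` space N)" using sp unfolding simple_function_def by blast
  show "plab S p (Ps x) \<in> plab S p ` space N" for x by (rule imageI[OF Ps(3)])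
  show "ka s x = ka s y \<and> p x = p y" if xy: "x \<in> X" "y \<in> X" "s \<in> S" "plab S p (Ps x) = plab S p (Ps y)" for x y s
  proof -
   have e: "p x = p y" "(\<lambda>s\<in>S. ka s x) = (\<lambda>s\<in>S. ka s y)" using xy(4) unfolding plab_Ps[OF xy(1)] plab_Ps[OF xy(2)] by simp_all
   show ?thesis using fun_cong[OF e(2), of s] xy(3) e(1) by simp
  qed
 qed
 let ?M = "micro H N be f L dl' (V k) ta"
 have "Img \<subseteq> patterns (plab S p) ?M (V k)"
 proof
  fix pe assume "pe \<in> Img"
  then obtain xi where xi: "xi \<in> Xi'" "pe = restrict (\<lambda>v. plab S p (Ps (ms.mv et xi v))) (V k)" unfolding Img_def by blast
  have "(\<lambda>v. Ps (ms.mv et xi v)) \<in> ?M"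
  proof (rule ms.micro_transfer[where tt = tt and m = m and dl = dl, OF ag[OF xi(1)] vg[OF Xi'D[OF xi(1)] et, unfolded n_def] mg[OF et, unfolded n_def] ta])
   show "tt + m \<le> dl'" "tt + dl \<le> dl'" using m ttdl dl tt dl' by linarith+
   show "deviation M (\<lambda>x. jlab H be L f (Ps x)) (V k) xi Z \<le> dl * rcard (V k)" for Z
    using stat[OF Xi'D[OF xi(1)], of "\<lambda>z. fst (snd (snd (snd (snd z)))) \<in> Z"] unfolding c_def j_def n_def by simp
  qed
  then show "pe \<in> patterns (plab S p) ?M (V k)" unfolding patterns_def xi(2) by (rule imageI)
 qed
 moreover have "finite (patterns (plab S p) ?M (V k))" by (rule finite_patterns[OF sp finV])
 ultimately have "card Img \<le> card (patterns (plab S p) ?M (V k))" by (intro card_mono)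
 moreover have "exp ((r - 2 * ep) * n) \<le> rcard Img"
 proof -
  have "exp ((r - 2 * ep) * n) * exp (ep * n) = exp ((r - ep) * n)" by (simp add: exp_add[symmetric] algebra_simps)
  also have "\<dots> \<le> rcard Img * exp (ep * n)" using big cnt unfolding Xi'_def by linarith
  finally show ?thesis by simp
 qed
 ultimately have "many (r - 2 * ep) (plab S p) ?M (V k)"
  unfolding n_def by linarith
 then show ?thesis using ta0 by (intro exI[of _ "V k"] exI[of _ ta]) blast
qed

lemma orbit_subset: "invariant_conull G M al X0 ==> x \<in> X0 ==> orbit G al x \<subseteq> X0"
 unfolding orbit_def invariant_conull_def by blast

text \<open>Inverting the isomorphism twice returns \<open>Ps\<close> only on \<open>X0\<close>, but
  the cocycle condition sees nothing else, as \<open>X0\<close> is invariant.\<close>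

lemma boundedly_orbit_equivalent_sym:
 assumes "boundedly_orbit_equivalent G M al H N be"
 shows "boundedly_orbit_equivalent H N be G M al"
proof -
 obtain X0 Y0 Ps ka ka' where oe0: "orbit_equivalence G M al H N be X0 Y0 Ps \<and> cocycle_of G al H be X0 Ps ka \<and>
   cocycle_of H be G al Y0 (inv_into X0 Ps) ka' \<and> (\<forall>g\<in>carrier G. finite (ka g ` X0)) \<and> (\<forall>t\<in>carrier H. finite (ka' t ` Y0))"
  using assms unfolding boundedly_orbit_equivalent_def by (elim exE)
 have iX: "invariant_conull G M al X0" and iY: "invariant_conull H N be Y0"
  and iso: "measure_isomorphism (restrict_space M X0) (restrict_space N Y0) Ps"
  and orb: "\<And>x. x \<in> X0 ==> Ps ` orbit G al x = orbit H be (Ps x)"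
  using oe0[THEN conjunct1] unfolding orbit_equivalence_def by simp_all
 define Ph where "Ph = inv_into X0 Ps"
 define M' where "M' = restrict_space M X0"
 define N' where "N' = restrict_space N Y0"
 have X0M: "X0 \<subseteq> space M" and Y0N: "Y0 \<subseteq> space N"
  using iX iY sets.sets_into_space unfolding invariant_conull_def by blast+
 have spX: "space M' = X0" and spY: "space N' = Y0" unfolding M'_def N'_def using X0M Y0N by (auto simp: space_restrict_space)
 have bij: "bij_betw Ps X0 Y0" and mPs: "Ps \<in> M' \<rightarrow>\<^sub>M N'" and mPh: "Ph \<in> N' \<rightarrow>\<^sub>M M'" and d: "distr M' N' Ps = N'"
  using iso unfolding measure_isomorphism_def M'_def[symmetric] N'_def[symmetric] spX spY Ph_def by blast+
 have bijPh: "bij_betw Ph Y0 X0" unfolding Ph_def by (rule bij_betw_inv_into[OF bij])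
 have PhPs: "Ph (Ps x) = x" "Ps x \<in> Y0" if "x \<in> X0" for x
  using bij that unfolding Ph_def bij_betw_def by auto
 have PsPh: "Ps (Ph y) = y" "Ph y \<in> X0" if "y \<in> Y0" for y
  using bij that unfolding Ph_def bij_betw_def by (auto intro: f_inv_into_f inv_into_into)
 have inv: "inv_into Y0 Ph x = Ps x" if x: "x \<in> X0" for x
  using inv_into_f_f[of Ph Y0 "Ps x"] bijPh PhPs[OF x] unfolding bij_betw_def by simp
 have "measure_isomorphism N' M' Ph"
  unfolding measure_isomorphism_def spX spY
 proof (intro conjI)
  show "bij_betw Ph Y0 X0" by (rule bijPh)
  show "Ph \<in> N' \<rightarrow>\<^sub>M M'" by (rule mPh)
  show "inv_into Y0 Ph \<in> M' \<rightarrow>\<^sub>M N'" using measurable_cong[of M' "inv_into Y0 Ph" Ps N'] inv spX mPs by simp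
  have "distr N' M' Ph = distr (distr M' N' Ps) M' Ph" using d by simp
  also have "\<dots> = distr M' M' (Ph \<circ> Ps)" by (rule distr_distr[OF mPh mPs])
  also have "\<dots> = distr M' M' (\<lambda>x. x)" by (rule distr_cong) (use spX PhPs in auto)
  also have "\<dots> = M'" by (rule distr_id)
  finally show "distr N' M' Ph = M'" .
 qed
 moreover have "Ph ` orbit H be y = orbit G al (Ph y)" if y: "y \<in> Y0" for y
 proof -
  have "orbit H be y = Ps ` orbit G al (Ph y)" using orb[OF PsPh(2)[OF y]] PsPh(1)[OF y] by simp
  then have "Ph ` orbit H be y = (\<lambda>x. Ph (Ps x)) ` orbit G al (Ph y)" by (simp add: image_image)
  also have "\<dots> = (\<lambda>x. x) ` orbit G al (Ph y)"
   by (rule image_cong[OF refl PhPs(1)]) (use orbit_subset[OF iX PsPh(2)[OF y]] in blast)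
  finally show ?thesis by simp
 qed
 ultimately have "orbit_equivalence H N be G M al Y0 X0 Ph"
  unfolding orbit_equivalence_def M'_def N'_def using iX iY by blast
 moreover have "cocycle_of G al H be X0 (inv_into Y0 Ph) ka"
 proof -
  have "cocycle_of G al H be X0 Ps ka" using oe0 by blast
  moreover have "al g x \<in> X0" if "g \<in> carrier G" "x \<in> X0" for g x using iX that unfolding invariant_conull_def by blast
  ultimately show ?thesis unfolding cocycle_of_def using inv by simp
 qed
 ultimately show ?thesis unfolding boundedly_orbit_equivalent_def using oe0 unfolding Ph_def[symmetric] by blast
qed

lemma max_sofic_entropy_le:
 fixes G :: "('g, 'c) monoid_scheme" and H :: "('h, 'd) monoid_scheme"
  and M :: "'x measure" and N :: "'y measure"
 assumes gG: "group G" and cG: "countable (carrier G)" and sG: "sofic G" and gH: "group H" and cH: "countable (carrier H)"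
  and cls: "has_w_normal_amenable_subgroup G \<or> product_of_infinite_sofic_groups G"
  and aM: "pmp_action G M al" and fM: "free_action G M al" and reg: "entropy_regular G M al"
  and aN: "pmp_action H N be" and fN: "free_action H N be"
  and oe: "boundedly_orbit_equivalent G M al H N be"
 shows "max_sofic_entropy G M al \<le> max_sofic_entropy H N be"
proof (rule dense_le)
 fix z assume z: "z < max_sofic_entropy G M al"
 show "z \<le> max_sofic_entropy H N be"
 proof (cases z)
  case (real r0)
  obtain r where r: "z < ereal r" "ereal r < max_sofic_entropy G M al" using ereal_dense2[OF z] by blast
  define ep where "ep = (r - r0) / 2"
  have ep: "ep > 0" unfolding ep_def using r(1) real by simp
  obtain V sm where V0: "sofic_approx_seq G V sm \<and> (\<forall>c'. (\<forall>g. c' g \<ge> 0) -->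
   sparse_within G V sm c' (carrier G))"
   using sparse_sofic_seq[OF gG sG cls] by (elim exE)
  note seq = V0[THEN conjunct1]
  have sa: "sofic_approx G (V k) (sm k)" for k using seq unfolding sofic_approx_seq_def by blast
  have "max_sofic_entropy G M al \<le> sofic_entropy G M al V sm"
   using reg unfolding entropy_regular_def inf_sofic_entropy_def by (auto intro!: INF_lower2[of "(V, sm)"] seq)
  then have rV: "ereal r < sofic_entropy G M al V sm" using r(2) by (rule less_le_trans[rotated])
  obtain p :: "'x => 'x set" where p: "simple_function M p"
   and freq: "\<And>(f :: 'x => 'x set \<times> bool \<times> ('g => 'h) \<times> ('h => 'g) \<times> ('h => ('x set \<times> ('g => 'h)) \<times> (nat => bool)) \<times>
      ('h => 'h => ('x set \<times> ('g => 'h)) \<times> (nat => bool))) F dl.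
    simple_function M f ==> (\<And>x y. x \<in> space M ==> y \<in> space M ==> f x = f y ==> p x = p y) ==>
    finite F ==> F \<subseteq> carrier G ==> \<one>\<^bsub>G\<^esub> \<in> F ==> dl > 0 ==>
    \<exists>\<^sub>F k in sequentially. many r p (micro G M al f F dl (V k) (sm k)) (V k)"
  proof (rule sofic_entropy_gtE[OF aM sa rV, where 'l = "'x set \<times> bool \<times> ('g => 'h) \<times> ('h => 'g) \<times> ('h => ('x set \<times> ('g => 'h)) \<times> (nat => bool)) \<times>
      ('h => 'h => ('x set \<times> ('g => 'h)) \<times> (nat => bool))"], goal_cases)
   case (1 p)
   show ?case by (rule that) (fact 1)+
  qed
  obtain X b ka lam Ps Ph where "bounded_oe G H X al b ka lam M N be Ps Ph"
   using bounded_oe_exists[OF gG cG gH cH aM fM aN fN oe] by (elim exE)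
  then interpret bounded_oe G H X al b ka lam M N be Ps Ph .
  define c' where "c' = (\<lambda>s. 2 * ln (rcard (kvals s)) / ep)"
  have "c' g \<ge> 0" for g
  proof -
   have "ln (real n) \<ge> 0" for n :: nat by (cases "n = 0") auto
   then show ?thesis unfolding c'_def using ep by simp
  qed
  then obtain S0 where S0: "finite S0 \<and> S0 \<subseteq> carrier G \<and> (\<forall>c>1. sparse_conn G V sm c' S0 (carrier G) c)" using V0 by blast
  define S where "S = insert \<one>\<^bsub>G\<^esub> S0"
  have S: "finite S" "S \<subseteq> carrier G" "\<one>\<^bsub>G\<^esub> \<in> S" unfolding S_def using S0 by auto
  have sc: "sparse_conn G V sm c' S (carrier G) 2"
   by (rule sparse_conn_mono_left[of G V sm c' S0]) (use S0 sa in \<open>auto simp: S_def sofic_approx_def\<close>)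
  have "\<exists>W ta. sofic_approx_seq H W ta \<and> ereal r0 \<le> sofic_entropy H N be W ta"
  proof (rule sofic_entropy_ge_of_models[OF gH cH aN simple_plab[OF p S(1,2)]])
   fix f :: "'y => ('x set \<times> ('g => 'h)) \<times> (nat => bool)" and L dl
   assume f: "simple_function N f" and L: "finite L" "L \<subseteq> carrier H" "\<one>\<^bsub>H\<^esub> \<in> L" and dl: "(dl::real) > 0"
   have "\<exists>W ta. sofic_approx H W ta \<and> good_approx H L dl W ta \<and>
    many (r - 2 * ep) (plab S p) (micro H N be f L dl W ta) (W :: nat set)"
   proof (rule models[OF seq S sc[unfolded c'_def] p ep _ f L dl])
    fix c :: "'x => 'x set \<times> bool \<times> ('g => 'h) \<times> ('h => 'g) \<times> ('h => ('x set \<times> ('g => 'h)) \<times> (nat => bool)) \<times>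
      ('h => 'h => ('x set \<times> ('g => 'h)) \<times> (nat => bool))" and F gm
    assume c: "simple_function M c" "\<And>x. fst (c x) = p x" and F: "finite F" "F \<subseteq> carrier G" "\<one>\<^bsub>G\<^esub> \<in> F" and gm: "(gm::real) > 0"
    show "\<exists>\<^sub>F k in sequentially. many r p (micro G M al c F gm (V k) (sm k)) (V k)"
    proof (rule freq[OF c(1) _ F gm])
     show "p x = p y" if "c x = c y" for x y unfolding c(2)[symmetric] that ..
    qed
   qed
   moreover have "r - 2 * ep = r0" unfolding ep_def by (simp add: field_simps)
   ultimately show "\<exists>W ta. sofic_approx H W ta \<and> good_approx H L dl W ta \<and>
    many r0 (plab S p) (micro H N be f L dl W ta) (W :: nat set)" by simp
  qed
  then obtain W ta where W: "sofic_approx_seq H W ta" "ereal r0 \<le> sofic_entropy H N be W ta" by blast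
  have "sofic_entropy H N be W ta \<le> max_sofic_entropy H N be"
   unfolding max_sofic_entropy_def using W(1) by (intro SUP_upper2[of "(W, ta)"]) auto
  then show ?thesis using W(2) real by (auto intro: order_trans)
 next
  case PInf
  then show ?thesis using z by simp
 next
  case MInf
  then show ?thesis by simp
 qed
qed

theorem theorem2:
  fixes G :: "('g, 'c) monoid_scheme" and H :: "('h, 'd) monoid_scheme"
    and M :: "'x measure" and N :: "'y measure"
    and \<alpha> :: "'g \<Rightarrow> 'x \<Rightarrow> 'x" and \<beta> :: "'h \<Rightarrow> 'y \<Rightarrow> 'y"
  assumes "group G" and "countable (carrier G)" and "sofic G"
    and "group H" and "countable (carrier H)" and "sofic H"
    and "has_w_normal_amenable_subgroup G \<or> product_of_infinite_sofic_groups G"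
    and "has_w_normal_amenable_subgroup H \<or> product_of_infinite_sofic_groups H"
    and "pmp_action G M \<alpha>" and "free_action G M \<alpha>"
    and "uniquely_ergodic G M \<alpha>" and "entropy_regular G M \<alpha>"
    and "pmp_action H N \<beta>" and "free_action H N \<beta>"
    and "uniquely_ergodic H N \<beta>" and "entropy_regular H N \<beta>"
    and "boundedly_orbit_equivalent G M \<alpha> H N \<beta>"
  shows "max_sofic_entropy H N \<beta> = max_sofic_entropy G M \<alpha>"
proof (rule antisym)
 show "max_sofic_entropy G M \<alpha> \<le> max_sofic_entropy H N \<beta>"
  by (rule max_sofic_entropy_le) (fact assms)+
 show "max_sofic_entropy H N \<beta> \<le> max_sofic_entropy G M \<alpha>"
  by (rule max_sofic_entropy_le) (fact assms boundedly_orbit_equivalent_sym[OF assms(17)])+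
qed

end
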